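(* Let $(M,g)$ be an $n$-dimensional ($n\ge3$) Riemannian manifold of constant sectional curvature $K=c$ with a spin structure. Then the following identities of operators from $\Gamma(S_j)$ to $\Gamma(S_j)$ hold: $$\begin{aligned}\Delta_j=&\nabla^{*}\nabla+\tfrac{1}{2}R_j=\nabla^{*}\nabla+\left(j(n+j-1)+\tfrac{n(n-1)}{8}\right)c\\ =&D_j^2+(T_j^-)^{*}T_j^-+\left(j(n+j-2)-\tfrac{n(n-1)}{8}\right)c\\ =&(T_j^+)^{*}T_j^++\frac{(n+2j-2)^2}{(n+2j)^2}D_j^2+\left((j+1)(n+j-1)-\tfrac{n(n-1)}{8}\right)c.\end{aligned}$$ The operators among $\Gamma(S_{j-1})$ and $\Gamma(S_j)$ are related by $$T_j^-D_j=\frac{n+2j-4}{n+2j-2}D_{j-1}T_j^-,\qquad D_jT_{j-1}^+=\frac{n+2j-4}{n+2j-2}T_{j-1}^+D_{j-1},\qquad T_{j-1}^+=(T_j^-)^{*}.$$ Moreover the operators commute with the standard Laplacian: $$D_j\Delta_j=\Delta_jD_j,\qquad T_j^-\Delta_j=\Delta_{j-1}T_j^-,\qquad T_{j-1}^+\Delta_{j-1}=\Delta_jT_{j-1}^+.$$ (Here $j\ge0$, and $j\ge 1$ in identities involving $S_{j-1}$.)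
   Context: Notation: $(x)_k$ means $x$ repeated $k$ times; irreducible representations are labelled by highest weights. $\mathrm{Spin}(M)$ is the spin structure. Bundles. For $n=2m$, $W_j=W_j^+\oplus W_j^-$ where $W_j^{\pm}$ is the irreducible unitary $\mathrm{Spin}(n)$-module of highest weight $(j+1/2,(1/2)_{m-2},\pm 1/2)$; for $n=2m-1$, $W_j$ is the irreducible module of highest weight $(j+1/2,(1/2)_{m-2})$. $S_j:=\mathrm{Spin}(M)\times_{\mathrm{Spin}(n)}W_j$ with its Hermitian metric ($S_0$ is the spinor bundle). $\Gamma$ denotes smooth sections, $\nabla$ the covariant derivative induced by the Levi-Civita connection, $*$ the formal adjoint. Operators. Let $\mathrm{Sym}^j_0$ be the bundle of trace-free complex symmetric $j$-tensors. Orthogonally $S_0\otimes \mathrm{Sym}^j_0=S_j\oplus S_{j-1}$ ($S_{-1}=0$), where $S_j$ is the kernel of the Clifford contraction $\gamma:S_0\otimes\mathrm{Sym}_0^j\to S_0\otimes \mathrm{Sym}_0^{j-1}$, $\psi\otimes v^j\mapsto v\cdot\psi\otimes v^{j-1}$ ($v$ null), and its complement is identified isometrically with $S_{j-1}\subset S_0\otimes\mathrm{Sym}_0^{j-1}$ by a positive multiple of $\gamma$. The twisted Dirac operator is $D(j)=\sum_k (e_k\cdot\otimes \mathrm{id})\circ\nabla_{e_k}$ on $S_0\otimes\mathrm{Sym}_0^j$ ($e_k\cdot e_k\cdot=-1$); write $$D(j)=\begin{pmatrix} D_j & T_{j-1}^+\\ T_j^- & D_{j-1}'\end{pmatrix}\quad\text{on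 }\Gamma(S_j\oplus S_{j-1}).$$ This defines $D_j:\Gamma(S_j)\to\Gamma(S_j)$, $T_{j-1}^+:\Gamma(S_{j-1})\to\Gamma(S_j)$, $T_j^-:\Gamma(S_j)\to\Gamma(S_{j-1})$ for all $j$, with $T_0^-=0$. Standard Laplacian: on a bundle associated to a representation $\pi_\rho$, $\Delta_\rho:=\nabla^*\nabla+\frac12R_\rho$, $R_\rho=\frac12\sum R_{ijkl}\,\pi_\rho(e_{ij}e_{kl})$, $R_{ijkl}=g(R(e_i,e_j)e_k,e_l)$, $e_{ij}=e_i\wedge e_j\in\mathfrak{so}(TM)$, with sign convention such that in constant curvature $c$ one has $R_\rho=c\,\pi_\rho(c_2)$, $c_2=\sum_{i,j}e_{ij}e_{ji}$ (non-negative on irreducibles). $\Delta_j,R_j$ are these for $S_j$. *)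

theory Defs
  imports "HOL-Analysis.Analysis"
begin

section \<open>Smooth functions between Euclidean spaces\<close>

primrec Ck_on :: "nat \<Rightarrow> ('a::euclidean_space \<Rightarrow> 'b::real_normed_vector) \<Rightarrow> 'a set \<Rightarrow> bool" where
  "Ck_on 0 f S \<longleftrightarrow> continuous_on S f"
| "Ck_on (Suc k) f S \<longleftrightarrow>
     f differentiable_on S \<and> (\<forall>v. Ck_on k (\<lambda>x. frechet_derivative f (at x) v) S)"

text \<open>Only used for open \<open>S\<close>.\<close>

definition smooth_on :: "('a::euclidean_space \<Rightarrow> 'b::real_normed_vector) \<Rightarrow> 'a set \<Rightarrow> bool" where
  "smooth_on f S \<longleftrightarrow> (\<forall>k. Ck_on k f S)"


section \<open>Riemannian manifolds\<close>

text \<open>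
  The manifold is the whole type \<open>'m\<close>, with an atlas indexed by \<open>'i\<close>; its dimension is
  \<open>CARD('n)\<close>. Tangent vectors at a point of \<open>patch M i\<close> are given by their components in
  the coordinate basis of \<open>chart M i\<close>, and \<open>gmet M i x\<close> is the Gram matrix of the metric in
  that basis.
\<close>

record ('i, 'm, 'n::finite) riem_manifold =
  patch :: "'i \<Rightarrow> 'm set"
  chart :: "'i \<Rightarrow> 'm \<Rightarrow> real ^ 'n"
  gmet :: "'i \<Rightarrow> 'm \<Rightarrow> real ^ 'n ^ 'n"

definition parm :: "('i, 'm, 'n::finite, 'z) riem_manifold_scheme \<Rightarrow> 'i \<Rightarrow> real ^ 'n \<Rightarrow> 'm" where
  "parm M i = inv_into (patch M i) (chart M i)"

definition smooth_fun_on ::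
  "('i, 'm, 'n::finite, 'z) riem_manifold_scheme \<Rightarrow> 'i \<Rightarrow> ('m \<Rightarrow> 'b::real_normed_vector) \<Rightarrow> 'm set \<Rightarrow> bool" where
  "smooth_fun_on M i f S \<longleftrightarrow> smooth_on (f \<circ> parm M i) (chart M i ` S)"

text \<open>Derivative of \<open>f\<close> at \<open>x\<close> along the tangent vector with components \<open>v\<close> in chart \<open>i\<close>.\<close>

definition dir_deriv ::
  "('i, 'm, 'n::finite, 'z) riem_manifold_scheme \<Rightarrow> 'i \<Rightarrow> ('m \<Rightarrow> 'b::real_normed_vector) \<Rightarrow> 'm \<Rightarrow> real ^ 'n \<Rightarrow> 'b" where
  "dir_deriv M i f x v = frechet_derivative (f \<circ> parm M i) (at (chart M i x)) v"

text \<open>Jacobian of the coordinate change from chart \<open>i\<close> to chart \<open>j\<close>.\<close>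

definition jac ::
  "('i, 'm, 'n::finite, 'z) riem_manifold_scheme \<Rightarrow> 'i \<Rightarrow> 'i \<Rightarrow> 'm \<Rightarrow> real ^ 'n ^ 'n" where
  "jac M i j x = matrix (dir_deriv M i (chart M j) x)"

definition smooth_manifold ::
  "('i, 'm::topological_space, 'n::finite, 'z) riem_manifold_scheme \<Rightarrow> bool" where
  "smooth_manifold M \<longleftrightarrow>
     (\<Union>i. patch M i) = UNIV \<and>
     (\<forall>i. open (patch M i) \<and> open (chart M i ` patch M i) \<and>
          homeomorphism (patch M i) (chart M i ` patch M i) (chart M i) (parm M i)) \<and>
     (\<forall>i j. smooth_fun_on M i (chart M j) (patch M i \<inter> patch M j))"

definition riemannian_metric :: "('i, 'm, 'n::finite, 'z) riem_manifold_scheme \<Rightarrow> bool" where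
  "riemannian_metric M \<longleftrightarrow>
     (\<forall>i. smooth_fun_on M i (gmet M i) (patch M i)) \<and>
     (\<forall>i. \<forall>x\<in>patch M i. transpose (gmet M i x) = gmet M i x \<and>
                         (\<forall>v. v \<noteq> 0 \<longrightarrow> v \<bullet> (gmet M i x *v v) > 0)) \<and>
     (\<forall>i j. \<forall>x\<in>patch M i \<inter> patch M j.
          gmet M i x = transpose (jac M i j x) ** gmet M j x ** jac M i j x)"

definition ginner ::
  "('i, 'm, 'n::finite, 'z) riem_manifold_scheme \<Rightarrow> 'i \<Rightarrow> 'm \<Rightarrow> real ^ 'n \<Rightarrow> real ^ 'n \<Rightarrow> real" where
  "ginner M i x u v = u \<bullet> (gmet M i x *v v)"

definition coord_deriv ::
  "('i, 'm, 'n::finite, 'z) riem_manifold_scheme \<Rightarrow> 'i \<Rightarrow> 'n \<Rightarrow> ('m \<Rightarrow> real) \<Rightarrow> 'm \<Rightarrow> real" where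
  "coord_deriv M i a f x = dir_deriv M i f x (axis a 1)"

text \<open>\<open>christoffel M i x k a b\<close> is \<open>\<Gamma>\<^sup>k\<^bsub>ab\<^esub>\<close>, that is, the Levi-Civita connection satisfies
  \<open>\<nabla>\<^sub>a \<partial>\<^sub>b = (\<Sum>k. \<Gamma>\<^sup>k\<^bsub>ab\<^esub> \<partial>\<^sub>k)\<close>.\<close>

definition christoffel ::
  "('i, 'm, 'n::finite, 'z) riem_manifold_scheme \<Rightarrow> 'i \<Rightarrow> 'm \<Rightarrow> 'n \<Rightarrow> 'n \<Rightarrow> 'n \<Rightarrow> real" where
  "christoffel M i x k a b =
     (\<Sum>l\<in>UNIV. matrix_inv (gmet M i x) $ k $ l *
        (coord_deriv M i a (\<lambda>y. gmet M i y $ b $ l) x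
         + coord_deriv M i b (\<lambda>y. gmet M i y $ a $ l) x
         - coord_deriv M i l (\<lambda>y. gmet M i y $ a $ b) x)) / 2"

text \<open>\<open>R(u, v)w\<close> with \<open>R(X, Y) = [\<nabla>\<^sub>X, \<nabla>\<^sub>Y] - \<nabla>\<^bsub>[X, Y]\<^esub>\<close>.\<close>

definition curv ::
  "('i, 'm, 'n::finite, 'z) riem_manifold_scheme \<Rightarrow> 'i \<Rightarrow> 'm \<Rightarrow> real ^ 'n \<Rightarrow> real ^ 'n \<Rightarrow> real ^ 'n \<Rightarrow> real ^ 'n" where
  "curv M i x u v w = (\<chi> l. \<Sum>a\<in>UNIV. \<Sum>b\<in>UNIV. \<Sum>k\<in>UNIV. u $ a * v $ b * w $ k *
     (coord_deriv M i a (\<lambda>y. christoffel M i y l b k) x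
      - coord_deriv M i b (\<lambda>y. christoffel M i y l a k) x
      + (\<Sum>m\<in>UNIV. christoffel M i x l a m * christoffel M i x m b k
                   - christoffel M i x l b m * christoffel M i x m a k)))"

definition sectional_curvature ::
  "('i, 'm, 'n::finite, 'z) riem_manifold_scheme \<Rightarrow> 'i \<Rightarrow> 'm \<Rightarrow> real ^ 'n \<Rightarrow> real ^ 'n \<Rightarrow> real" where
  "sectional_curvature M i x u v =
     ginner M i x (curv M i x u v v) u /
     (ginner M i x u u * ginner M i x v v - (ginner M i x u v)\<^sup>2)"

definition constant_curvature ::
  "('i, 'm, 'n::finite, 'z) riem_manifold_scheme \<Rightarrow> real \<Rightarrow> bool" where
  "constant_curvature M c \<longleftrightarrow>
     (\<forall>i. \<forall>x\<in>patch M i. \<forall>u v. u \<noteq> v \<and> independent {u, v} \<longrightarrow> sectional_curvature M i x u v = c)"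

text \<open>This determines the Borel measure \<open>\<mu>\<close> uniquely when \<open>'m\<close> is second countable.\<close>

definition riemannian_volume ::
  "('i, 'm::topological_space, 'n::finite, 'z) riem_manifold_scheme \<Rightarrow> 'm measure \<Rightarrow> bool" where
  "riemannian_volume M \<mu> \<longleftrightarrow> sets \<mu> = sets borel \<and>
     (\<forall>i. \<forall>A\<in>sets borel. A \<subseteq> patch M i \<longrightarrow>
        emeasure \<mu> A =
          (\<integral>\<^sup>+ y. indicator (chart M i ` A) y * ennreal (sqrt (det (gmet M i (parm M i y)))) \<partial>lborel))"


section \<open>Clifford modules and the spin group\<close>

text \<open>
  The Clifford module is \<open>complex ^ 's\<close> with its standard Hermitian form, \<open>cl k\<close> being Clifford
  multiplication by the \<open>k\<close>-th vector of an orthonormal basis. The irreducible Clifford module is,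
  as a module over the spin group, the sum of the two half-spin modules for \<open>CARD('n)\<close> even, and
  the spin module for \<open>CARD('n)\<close> odd.
\<close>

definition spinor_module :: "('n::finite \<Rightarrow> complex ^ 's ^ 's::finite) \<Rightarrow> bool" where
  "spinor_module cl \<longleftrightarrow>
     (\<forall>k l. cl k ** cl l + cl l ** cl k = (if k = l then mat (- 2) else 0)) \<and>
     (\<forall>k. (\<chi> a b. cnj (cl k $ b $ a)) = - cl k) \<and>
     (\<forall>V. vec.subspace V \<and> (\<forall>k. \<forall>u\<in>V. cl k *v u \<in> V) \<longrightarrow> V = {0} \<or> V = UNIV)"

definition cvec :: "('n::finite \<Rightarrow> complex ^ 's ^ 's::finite) \<Rightarrow> real ^ 'n \<Rightarrow> complex ^ 's ^ 's" where
  "cvec cl v = (\<Sum>k\<in>UNIV. v $ k *\<^sub>R cl k)"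

text \<open>
  The spin group is generated, inside the even part of the Clifford algebra, by the products of two
  unit vectors. The even part acts faithfully on the spinor module, so the group can be taken to
  consist of matrices.
\<close>

inductive_set spin_group :: "('n::finite \<Rightarrow> complex ^ 's ^ 's::finite) \<Rightarrow> (complex ^ 's ^ 's) set"
  for cl where
  one: "mat 1 \<in> spin_group cl"
| mult: "s \<in> spin_group cl \<Longrightarrow> norm v = 1 \<Longrightarrow> norm w = 1 \<Longrightarrow> s ** cvec cl v ** cvec cl w \<in> spin_group cl"

text \<open>The double covering of the special orthogonal group, \<open>s v s\<^sup>-\<^sup>1 = (spin_cover cl s) v\<close>.\<close>

definition spin_cover ::
  "('n::finite \<Rightarrow> complex ^ 's ^ 's::finite) \<Rightarrow> complex ^ 's ^ 's \<Rightarrow> real ^ 'n ^ 'n" where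
  "spin_cover cl s = (THE A. \<forall>v. s ** cvec cl v = cvec cl (A *v v) ** s)"


section \<open>Spinor-valued tensors\<close>

text \<open>
  A spinor-valued \<open>j\<close>-tensor is given by its components, indexed by lists of length \<open>j\<close>; it
  vanishes on lists of other lengths.
\<close>

type_synonym ('n, 's) sptensor = "'n list \<Rightarrow> complex ^ 's"

definition tensors :: "nat \<Rightarrow> ('n::finite, 's::finite) sptensor set" where
  "tensors j = {u. \<forall>I. length I \<noteq> j \<longrightarrow> u I = 0}"

definition sym0 :: "nat \<Rightarrow> ('n::finite, 's::finite) sptensor set" where
  "sym0 j = {u \<in> tensors j. (\<forall>I J. mset I = mset J \<longrightarrow> u I = u J) \<and>
                            (\<forall>I. (\<Sum>k\<in>UNIV. u (k # k # I)) = 0)}"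

definition herm :: "nat \<Rightarrow> ('n::finite, 's::finite) sptensor \<Rightarrow> ('n, 's) sptensor \<Rightarrow> complex" where
  "herm j u v = (\<Sum>I | length I = j. \<Sum>a\<in>UNIV. u I $ a * cnj (v I $ a))"

text \<open>The representation of the spin group on spinor-valued tensors, and its differential;
  a skew matrix \<open>A\<close> acts on spinors by \<open>(\<Sum>b. e\<^sub>b \<cdot> (A e\<^sub>b) \<cdot>) / 4\<close>.\<close>

definition rho ::
  "('n::finite \<Rightarrow> complex ^ 's ^ 's::finite) \<Rightarrow> complex ^ 's ^ 's \<Rightarrow> ('n, 's) sptensor \<Rightarrow> ('n, 's) sptensor" where
  "rho cl s u = (\<lambda>I. \<Sum>J | length J = length I.
     (\<Prod>r<length I. spin_cover cl s $ (I ! r) $ (J ! r)) *\<^sub>R (s *v u J))"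

definition drho ::
  "('n::finite \<Rightarrow> complex ^ 's ^ 's::finite) \<Rightarrow> real ^ 'n ^ 'n \<Rightarrow> ('n, 's) sptensor \<Rightarrow> ('n, 's) sptensor" where
  "drho cl A u = (\<lambda>I.
     (1 / 4) *\<^sub>R (\<Sum>a\<in>UNIV. \<Sum>b\<in>UNIV. A $ a $ b *\<^sub>R (cl b *v (cl a *v u I)))
     + (\<Sum>r<length I. \<Sum>b\<in>UNIV. A $ (I ! r) $ b *\<^sub>R u (I[r := b])))"

text \<open>The Clifford contraction: on \<open>\<psi> \<otimes> v \<otimes> \<dots> \<otimes> v\<close> it yields \<open>v \<cdot> \<psi> \<otimes> v \<otimes> \<dots> \<otimes> v\<close>
  with one factor \<open>v\<close> less.\<close>

definition cliff ::
  "('n::finite \<Rightarrow> complex ^ 's ^ 's::finite) \<Rightarrow> ('n, 's) sptensor \<Rightarrow> ('n, 's) sptensor" where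
  "cliff cl u = (\<lambda>I. \<Sum>k\<in>UNIV. cl k *v u (k # I))"

text \<open>
  The fibre \<open>W\<^sub>j\<close>, realised as the kernel of the Clifford contraction; for \<open>j = 0\<close> it is the whole
  spinor module. As a module over the spin group it is the one of highest weight
  \<open>(j + 1/2, 1/2, \<dots>, 1/2)\<close>, for \<open>CARD('n)\<close> even the sum of those of highest weights
  \<open>(j + 1/2, 1/2, \<dots>, 1/2, \<plusminus>1/2)\<close>.
\<close>

definition Wfib :: "('n::finite \<Rightarrow> complex ^ 's ^ 's::finite) \<Rightarrow> nat \<Rightarrow> ('n, 's) sptensor set" where
  "Wfib cl j = {u \<in> sym0 j. cliff cl u = (\<lambda>I. 0)}"

definition Wcompl :: "('n::finite \<Rightarrow> complex ^ 's ^ 's::finite) \<Rightarrow> nat \<Rightarrow> ('n, 's) sptensor set" where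
  "Wcompl cl j = {u \<in> sym0 j. \<forall>w\<in>Wfib cl j. herm j u w = 0}"

definition prW ::
  "('n::finite \<Rightarrow> complex ^ 's ^ 's::finite) \<Rightarrow> nat \<Rightarrow> ('n, 's) sptensor \<Rightarrow> ('n, 's) sptensor" where
  "prW cl j u = (THE v. v \<in> Wfib cl j \<and> (\<forall>w\<in>Wfib cl j. herm j (\<lambda>I. u I - v I) w = 0))"

text \<open>For \<open>j \<ge> 1\<close>, the isometric identification of \<open>Wcompl cl j\<close> with \<open>Wfib cl (j - 1)\<close> by a
  positive multiple of the Clifford contraction.\<close>

definition ident_const :: "('n::finite \<Rightarrow> complex ^ 's ^ 's::finite) \<Rightarrow> nat \<Rightarrow> real" where
  "ident_const cl j = (THE a. a > 0 \<and> (\<forall>u\<in>Wcompl cl j.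
     herm (j - 1) (\<lambda>I. a *\<^sub>R cliff cl u I) (\<lambda>I. a *\<^sub>R cliff cl u I) = herm j u u))"

definition ident ::
  "('n::finite \<Rightarrow> complex ^ 's ^ 's::finite) \<Rightarrow> nat \<Rightarrow> ('n, 's) sptensor \<Rightarrow> ('n, 's) sptensor" where
  "ident cl j u = (\<lambda>I. ident_const cl j *\<^sub>R cliff cl u I)"

definition ident_inv ::
  "('n::finite \<Rightarrow> complex ^ 's ^ 's::finite) \<Rightarrow> nat \<Rightarrow> ('n, 's) sptensor \<Rightarrow> ('n, 's) sptensor" where
  "ident_inv cl j = inv_into (Wcompl cl j) (ident cl j)"


section \<open>Spin structures and sections of associated bundles\<close>

text \<open>
  A spin structure, that is, a principal bundle for the spin group doubly covering the bundle of
  oriented orthonormal frames, is given by transition functions with respect to local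
  trivialisations: over \<open>patch M i\<close> the columns of \<open>frame M i\<close> are the components in
  \<open>chart M i\<close> of an orthonormal frame, and the transition functions of these frames are lifted to
  a cocycle with values in the spin group. Using the same index set for charts and
  trivialisations is no restriction, as one may pass to a common refinement.
\<close>

record ('i, 'm, 'n::finite, 's::finite) spin_manifold = "('i, 'm, 'n) riem_manifold" +
  frame :: "'i \<Rightarrow> 'm \<Rightarrow> real ^ 'n ^ 'n"
  lift :: "'i \<Rightarrow> 'i \<Rightarrow> 'm \<Rightarrow> complex ^ 's ^ 's"
  clif :: "'n \<Rightarrow> complex ^ 's ^ 's"

definition frame_vec ::
  "('i, 'm, 'n::finite, 's::finite) spin_manifold \<Rightarrow> 'i \<Rightarrow> 'm \<Rightarrow> 'n \<Rightarrow> real ^ 'n" where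
  "frame_vec M i x k = column k (frame M i x)"

text \<open>\<open>frame_change M j i x\<close> maps components with respect to the \<open>i\<close>-th frame to components with
  respect to the \<open>j\<close>-th frame.\<close>

definition frame_change ::
  "('i, 'm, 'n::finite, 's::finite) spin_manifold \<Rightarrow> 'i \<Rightarrow> 'i \<Rightarrow> 'm \<Rightarrow> real ^ 'n ^ 'n" where
  "frame_change M j i x = matrix_inv (frame M j x) ** jac M i j x ** frame M i x"

definition spin_structure :: "('i, 'm, 'n::finite, 's::finite) spin_manifold \<Rightarrow> bool" where
  "spin_structure M \<longleftrightarrow>
     spinor_module (clif M) \<and>
     (\<forall>i. smooth_fun_on M i (frame M i) (patch M i)) \<and>
     (\<forall>i. \<forall>x\<in>patch M i. transpose (frame M i x) ** gmet M i x ** frame M i x = mat 1) \<and>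
     (\<forall>i j. smooth_fun_on M i (lift M j i) (patch M i \<inter> patch M j)) \<and>
     (\<forall>i j. \<forall>x\<in>patch M i \<inter> patch M j.
        lift M j i x \<in> spin_group (clif M) \<and>
        spin_cover (clif M) (lift M j i x) = frame_change M j i x) \<and>
     (\<forall>i j k. \<forall>x\<in>patch M i \<inter> patch M j \<inter> patch M k.
        lift M k i x = lift M k j x ** lift M j i x)"

definition riemannian_spin_manifold ::
  "('i, 'm::topological_space, 'n::finite, 's::finite) spin_manifold \<Rightarrow> bool" where
  "riemannian_spin_manifold M \<longleftrightarrow> smooth_manifold M \<and> riemannian_metric M \<and> spin_structure M"

text \<open>
  Sections are given by their local representatives with respect to the trivialisations. The
  vector bundles under consideration are those associated with spin-invariant spaces \<open>V\<close> of
  spinor-valued tensors. Representatives are set to \<open>0\<close> outside of their patches.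
\<close>

type_synonym ('i, 'm, 'n, 's) field = "'i \<Rightarrow> 'm \<Rightarrow> ('n, 's) sptensor"

definition sections ::
  "('i, 'm, 'n::finite, 's::finite) spin_manifold \<Rightarrow> ('n, 's) sptensor set \<Rightarrow> ('i, 'm, 'n, 's) field set" where
  "sections M V = {\<psi>.
     (\<forall>i x. x \<notin> patch M i \<longrightarrow> \<psi> i x = (\<lambda>I. 0)) \<and>
     (\<forall>i. \<forall>x\<in>patch M i. \<psi> i x \<in> V) \<and>
     (\<forall>i I. smooth_fun_on M i (\<lambda>x. \<psi> i x I) (patch M i)) \<and>
     (\<forall>i j. \<forall>x\<in>patch M i \<inter> patch M j. \<psi> j x = rho (clif M) (lift M j i x) (\<psi> i x))}"

definition compact_support :: "('i, 'm::topological_space, 'n::finite, 's::finite) field \<Rightarrow> bool" where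
  "compact_support \<psi> \<longleftrightarrow> (\<exists>K. compact K \<and> (\<forall>x. x \<notin> K \<longrightarrow> (\<forall>i. \<psi> i x = (\<lambda>I. 0))))"

definition Gam ::
  "('i, 'm, 'n::finite, 's::finite) spin_manifold \<Rightarrow> nat \<Rightarrow> ('i, 'm, 'n, 's) field set" where
  "Gam M j = sections M (Wfib (clif M) j)"

definition pt_herm ::
  "('i, 'm, 'n::finite, 's::finite) spin_manifold \<Rightarrow> nat \<Rightarrow> ('i, 'm, 'n, 's) field \<Rightarrow>
     ('i, 'm, 'n, 's) field \<Rightarrow> 'm \<Rightarrow> complex" where
  "pt_herm M p \<psi> \<phi> x = (let i = (SOME i. x \<in> patch M i) in herm p (\<psi> i x) (\<phi> i x))"

definition L2_herm ::
  "('i, 'm, 'n::finite, 's::finite) spin_manifold \<Rightarrow> 'm measure \<Rightarrow> nat \<Rightarrow> ('i, 'm, 'n, 's) field \<Rightarrow>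
     ('i, 'm, 'n, 's) field \<Rightarrow> complex" where
  "L2_herm M \<mu> p \<psi> \<phi> = (\<integral>x. pt_herm M p \<psi> \<phi> x \<partial>\<mu>)"

text \<open>Formal adjoint, with respect to the volume measure \<open>\<mu>\<close>, of an operator \<open>T\<close> from sections of
  \<open>S\<^sub>j\<close> to fields of spinor-valued \<open>q\<close>-tensors.\<close>

definition formal_adjoint ::
  "('i, 'm::topological_space, 'n::finite, 's::finite) spin_manifold \<Rightarrow> 'm measure \<Rightarrow> nat \<Rightarrow> nat \<Rightarrow>
     (('i, 'm, 'n, 's) field \<Rightarrow> ('i, 'm, 'n, 's) field) \<Rightarrow>
     ('i, 'm, 'n, 's) field \<Rightarrow> ('i, 'm, 'n, 's) field" where
  "formal_adjoint M \<mu> j q T \<phi> = (THE \<xi>. \<xi> \<in> Gam M j \<and>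
     (\<forall>\<psi>\<in>Gam M j. compact_support \<psi> \<longrightarrow> L2_herm M \<mu> q (T \<psi>) \<phi> = L2_herm M \<mu> j \<psi> \<xi>))"


section \<open>Covariant derivative and curvature\<close>

text \<open>Chart components of \<open>\<nabla>\<^sub>v e\<^sub>b\<close>.\<close>

definition nabla_frame ::
  "('i, 'm, 'n::finite, 's::finite) spin_manifold \<Rightarrow> 'i \<Rightarrow> 'm \<Rightarrow> real ^ 'n \<Rightarrow> 'n \<Rightarrow> real ^ 'n" where
  "nabla_frame M i x v b = dir_deriv M i (\<lambda>y. frame_vec M i y b) x v
     + (\<chi> k. \<Sum>a\<in>UNIV. \<Sum>d\<in>UNIV. christoffel M i x k a d * v $ a * frame_vec M i x b $ d)"

text \<open>The connection form \<open>\<omega>\<close> evaluated on \<open>e\<^sub>k\<close>: a skew matrix with \<open>\<nabla>\<^bsub>e\<^sub>k\<^esub> e\<^sub>b = (\<Sum>a. \<omega>\<^bsub>ab\<^esub> e\<^sub>a)\<close>.\<close>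

definition conn_form ::
  "('i, 'm, 'n::finite, 's::finite) spin_manifold \<Rightarrow> 'i \<Rightarrow> 'm \<Rightarrow> 'n \<Rightarrow> real ^ 'n ^ 'n" where
  "conn_form M i x k =
     (\<chi> a b. ginner M i x (nabla_frame M i x (frame_vec M i x k) b) (frame_vec M i x a))"

text \<open>The covariant derivative of a \<open>j\<close>-tensor is a \<open>(j + 1)\<close>-tensor, the first index being that of
  the cotangent factor: \<open>(\<nabla>\<psi>) (k # I) = (\<nabla>\<^bsub>e\<^sub>k\<^esub> \<psi>) I\<close>.\<close>

definition nabla ::
  "('i, 'm, 'n::finite, 's::finite) spin_manifold \<Rightarrow> ('i, 'm, 'n, 's) field \<Rightarrow> ('i, 'm, 'n, 's) field" where
  "nabla M \<psi> = (\<lambda>i x J. case J of [] \<Rightarrow> 0 | k # I \<Rightarrow>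
     if x \<in> patch M i
     then dir_deriv M i (\<lambda>y. \<psi> i y I) x (frame_vec M i x k) + drho (clif M) (conn_form M i x k) (\<psi> i x) I
     else 0)"

definition rough_laplacian ::
  "('i, 'm::topological_space, 'n::finite, 's::finite) spin_manifold \<Rightarrow> 'm measure \<Rightarrow> nat \<Rightarrow>
     ('i, 'm, 'n, 's) field \<Rightarrow> ('i, 'm, 'n, 's) field" where
  "rough_laplacian M \<mu> j \<psi> = formal_adjoint M \<mu> j (Suc j) (nabla M) (nabla M \<psi>)"

text \<open>The element \<open>e\<^sub>a \<and> e\<^sub>b\<close>, acting by \<open>v \<mapsto> \<langle>e\<^sub>a, v\<rangle> e\<^sub>b - \<langle>e\<^sub>b, v\<rangle> e\<^sub>a\<close>.\<close>

definition wedge :: "'n::finite \<Rightarrow> 'n \<Rightarrow> real ^ 'n ^ 'n" where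
  "wedge a b = (\<chi> p q. (if p = b \<and> q = a then 1 else 0) - (if p = a \<and> q = b then 1 else 0))"

definition frame_curv ::
  "('i, 'm, 'n::finite, 's::finite) spin_manifold \<Rightarrow> 'i \<Rightarrow> 'm \<Rightarrow> 'n \<Rightarrow> 'n \<Rightarrow> 'n \<Rightarrow> 'n \<Rightarrow> real" where
  "frame_curv M i x a b k l =
     ginner M i x (curv M i x (frame_vec M i x a) (frame_vec M i x b) (frame_vec M i x k)) (frame_vec M i x l)"

definition curv_endo ::
  "('i, 'm, 'n::finite, 's::finite) spin_manifold \<Rightarrow> ('i, 'm, 'n, 's) field \<Rightarrow> ('i, 'm, 'n, 's) field" where
  "curv_endo M \<psi> = (\<lambda>i x I. (1 / 2) *\<^sub>R
     (\<Sum>a\<in>UNIV. \<Sum>b\<in>UNIV. \<Sum>k\<in>UNIV. \<Sum>l\<in>UNIV. frame_curv M i x a b k l *\<^sub>R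
        drho (clif M) (wedge a b) (drho (clif M) (wedge k l) (\<psi> i x)) I))"

definition std_laplacian ::
  "('i, 'm::topological_space, 'n::finite, 's::finite) spin_manifold \<Rightarrow> 'm measure \<Rightarrow> nat \<Rightarrow>
     ('i, 'm, 'n, 's) field \<Rightarrow> ('i, 'm, 'n, 's) field" where
  "std_laplacian M \<mu> j \<psi> =
     (\<lambda>i x I. rough_laplacian M \<mu> j \<psi> i x I + (1 / 2) *\<^sub>R curv_endo M \<psi> i x I)"


section \<open>The twisted Dirac operator and its blocks\<close>

definition twisted_dirac ::
  "('i, 'm, 'n::finite, 's::finite) spin_manifold \<Rightarrow> ('i, 'm, 'n, 's) field \<Rightarrow> ('i, 'm, 'n, 's) field" where
  "twisted_dirac M \<psi> = (\<lambda>i x I. \<Sum>k\<in>UNIV. clif M k *v nabla M \<psi> i x (k # I))"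

definition Dj ::
  "('i, 'm, 'n::finite, 's::finite) spin_manifold \<Rightarrow> nat \<Rightarrow> ('i, 'm, 'n, 's) field \<Rightarrow> ('i, 'm, 'n, 's) field" where
  "Dj M j \<psi> = (\<lambda>i x. prW (clif M) j (twisted_dirac M \<psi> i x))"

text \<open>\<open>Tminus M j\<close> is \<open>T\<^sub>j\<^sup>-\<close>, from \<open>S\<^sub>j\<close> to \<open>S\<^bsub>j-1\<^esub>\<close> (and \<open>0\<close> for \<open>j = 0\<close>);
  \<open>Tplus M j\<close> is \<open>T\<^sub>j\<^sup>+\<close>, from \<open>S\<^sub>j\<close> to \<open>S\<^bsub>j+1\<^esub>\<close>.\<close>

definition Tminus ::
  "('i, 'm, 'n::finite, 's::finite) spin_manifold \<Rightarrow> nat \<Rightarrow> ('i, 'm, 'n, 's) field \<Rightarrow> ('i, 'm, 'n, 's) field" where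
  "Tminus M j \<psi> = (\<lambda>i x. if j = 0 then (\<lambda>I. 0)
     else ident (clif M) j (\<lambda>I. twisted_dirac M \<psi> i x I - prW (clif M) j (twisted_dirac M \<psi> i x) I))"

definition Tplus ::
  "('i, 'm, 'n::finite, 's::finite) spin_manifold \<Rightarrow> nat \<Rightarrow> ('i, 'm, 'n, 's) field \<Rightarrow> ('i, 'm, 'n, 's) field" where
  "Tplus M j \<psi> = (\<lambda>i x. prW (clif M) (Suc j)
     (twisted_dirac M (\<lambda>i x. ident_inv (clif M) (Suc j) (\<psi> i x)) i x))"

text \<open>The operators \<open>(T\<^sub>j\<^sup>-)\<^sup>*\<close> and \<open>(T\<^sub>j\<^sup>+)\<^sup>*\<close>. For \<open>j = 0\<close> the former is the adjoint of the zero
  operator, so the truncated \<open>j - 1\<close> is immaterial.\<close>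

definition Tminus_adj ::
  "('i, 'm::topological_space, 'n::finite, 's::finite) spin_manifold \<Rightarrow> 'm measure \<Rightarrow> nat \<Rightarrow>
     ('i, 'm, 'n, 's) field \<Rightarrow> ('i, 'm, 'n, 's) field" where
  "Tminus_adj M \<mu> j = formal_adjoint M \<mu> j (j - 1) (Tminus M j)"

definition Tplus_adj ::
  "('i, 'm::topological_space, 'n::finite, 's::finite) spin_manifold \<Rightarrow> 'm measure \<Rightarrow> nat \<Rightarrow>
     ('i, 'm, 'n, 's) field \<Rightarrow> ('i, 'm, 'n, 's) field" where
  "Tplus_adj M \<mu> j = formal_adjoint M \<mu> j (Suc j) (Tplus M j)"

end

(*
  Let cliff be the Clifford contraction on spinor-valued trace-free symmetric tensors and clsym the
  symmetrised Clifford multiplication, which is its adjoint up to a factor. The complement of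
  W_j = ker cliff is clsym W_(j-1), and cliff clsym is the scalar -(n + 2j - 2) on W_(j-1), so that
  the projections, the identification of the complement with W_(j-1) and its normalising constant
  are explicit. In constant curvature c the Lichnerowicz formula reads
    D(j)^2 = nabla^* nabla + c (n(n-1)/4 + j) + c clsym cliff,
  and the right-hand side preserves both summands. Squaring the block matrix of D(j), whose entry
  D'_(j-1) is -(n + 2j - 4)/(n + 2j - 2) D_(j-1), and comparing the four blocks gives the formulas
  for the Laplacian and the intertwining relations; these imply the commutation relations.

  For the adjoints, nabla^* is minus the divergence. A cutoff reduces this to compact support in
  one chart, where it is the vanishing of the integral of a derivative. On W_j-valued
  sections T^- is a multiple of the divergence, and T^+ is minus that multiple of nabla followed by
  the projection to W_(j+1). Cutoffs also show that a formal adjoint is unique.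
*)

theory Submission
  imports Defs
begin

section \<open>Calculus of iterated directional derivatives on open sets\<close>

section \<open>Smooth functions\<close>

text \<open>The covariant derivative is defined frame by frame, so its covariance requires the
  derivative of the spin lift, which the cocycle controls only through the double covering.
  Differentiating \<open>s v = (A v) s\<close> determines \<open>ds\<close> up to an operator
  commuting with Clifford multiplication. Unitarity makes this operator skew, Schur's lemma makes it
  an imaginary scalar, and reality of traces of even Clifford products excludes the scalar.

  Constant curvature is assumed for sectional curvatures only; the full tensor is recovered by
  polarisation. The zeroth-order term of the Laplacian is a Casimir eigenvalue, found by removing
  one tensor index at a time.

  The numerator \<open>n + 2 j - 4\<close> is the scalar of \<open>cliff\<close> after
  \<open>clsym\<close>, lowered by \<open>2\<close> when \<open>cliff\<close> passes the Clifford
  factor of the Dirac operator. The Laplacian of \<open>S_j\<close> occurs twice, in the upper block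
  of the square of \<open>D(j)\<close> and in the lower block of the square of
  \<open>D(j+1)\<close>; comparing the two occurrences is what makes \<open>T^-\<close> and
  \<open>T^+\<close> commute with it.\<close>

lemma frechet_derivative_eq: "(f has_derivative f') (at x) \<Longrightarrow> frechet_derivative f (at x) = f'"
  using frechet_derivative_at by metis

lemma has_derivative_cong_open:
  assumes "open S" "x \<in> S" "\<And>y. y \<in> S \<Longrightarrow> f y = g y"
  shows "(f has_derivative d) (at x) \<longleftrightarrow> (g has_derivative d) (at x)"
  using assms has_derivative_transform_within_open by metis

lemma frechet_derivative_cong_open:
  assumes "open S" "x \<in> S" "\<And>y. y \<in> S \<Longrightarrow> f y = g y"
  shows "frechet_derivative f (at x) = frechet_derivative g (at x)"
  unfolding frechet_derivative_def by (simp add: has_derivative_cong_open[OF assms])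

text \<open>The derivatives inside \<open>Ck_on\<close> are taken in the whole space, so agreement
  on \<open>S\<close> determines them because every point of \<open>S\<close> is interior.\<close>

lemma Ck_on_cong:
  assumes "open S"
  shows "(\<And>x. x \<in> S \<Longrightarrow> f x = g x) \<Longrightarrow> Ck_on k f S \<longleftrightarrow> Ck_on k g S"
proof (induction k arbitrary: f g)
  case 0
  then show ?case using continuous_on_cong by force
next
  case (Suc k)
  have "f differentiable_on S \<longleftrightarrow> g differentiable_on S"
    unfolding differentiable_on_eq_differentiable_at[OF assms]
    using has_derivative_cong_open[OF assms _ Suc.prems] by (simp add: differentiable_def)
  moreover have "Ck_on k (\<lambda>x. frechet_derivative f (at x) v) S \<longleftrightarrow>
      Ck_on k (\<lambda>x. frechet_derivative g (at x) v) S" for v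
    by (rule Suc.IH) (simp add: frechet_derivative_cong_open[OF assms _ Suc.prems])
  ultimately show ?case by simp
qed

lemma Ck_on_imp_continuous_on: "Ck_on k f S \<Longrightarrow> continuous_on S f"
  by (cases k) (auto intro: differentiable_imp_continuous_on)

lemma Ck_on_SucD: "Ck_on (Suc k) f S \<Longrightarrow> Ck_on k f S"
  by (induction k arbitrary: f) (auto intro: differentiable_imp_continuous_on)

lemma Ck_on_subset: "Ck_on k f S \<Longrightarrow> T \<subseteq> S \<Longrightarrow> Ck_on k f T"
  by (induction k arbitrary: f) (auto intro: continuous_on_subset differentiable_on_subset)

lemma Ck_on_Union:
  assumes "\<And>S. S \<in> F \<Longrightarrow> open S"
  shows "(\<And>S. S \<in> F \<Longrightarrow> Ck_on k f S) \<Longrightarrow> Ck_on k f (\<Union>F)"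
proof (induction k arbitrary: f)
  case 0
  then show ?case using assms continuous_on_open_Union by auto
next
  case (Suc k)
  then show ?case
    using assms by (auto simp: differentiable_on_eq_differentiable_at open_Union)
qed

lemma Ck_on_const: "Ck_on k (\<lambda>x. c) S"
  by (induction k arbitrary: c) (auto simp: frechet_derivative_const)

lemma Ck_on_add:
  assumes "open S"
  shows "Ck_on k f S \<Longrightarrow> Ck_on k g S \<Longrightarrow> Ck_on k (\<lambda>x. f x + g x) S"
proof (induction k arbitrary: f g)
  case 0
  then show ?case by (auto intro: continuous_on_add)
next
  case (Suc k)
  have d: "((\<lambda>x. f x + g x) has_derivative
      (\<lambda>v. frechet_derivative f (at x) v + frechet_derivative g (at x) v)) (at x)" if "x \<in> S" for x
    by (rule has_derivative_add)
      (use Suc.prems that assms in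
        \<open>auto simp: differentiable_on_eq_differentiable_at frechet_derivative_works[symmetric]\<close>)
  have "Ck_on k (\<lambda>x. frechet_derivative (\<lambda>x. f x + g x) (at x) v) S" for v
    by (subst Ck_on_cong[OF assms, where g="\<lambda>x. frechet_derivative f (at x) v + frechet_derivative g (at x) v"])
      (use Suc in \<open>auto simp: frechet_derivative_eq[OF d]\<close>)
  then show ?case
    using d assms by (auto simp: differentiable_on_eq_differentiable_at differentiable_def)
qed

lemma Ck_on_bounded_linear:
  assumes "open S" "bounded_linear L"
  shows "Ck_on k f S \<Longrightarrow> Ck_on k (\<lambda>x. L (f x)) S"
proof (induction k arbitrary: f)
  case 0
  then show ?case using assms(2) by (auto intro: bounded_linear.continuous_on)
next
  case (Suc k)
  have d: "((\<lambda>x. L (f x)) has_derivative (\<lambda>v. L (frechet_derivative f (at x) v))) (at x)" if "x \<in> S" for x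
    by (rule bounded_linear.has_derivative[OF assms(2)])
      (use Suc.prems that assms in
        \<open>auto simp: differentiable_on_eq_differentiable_at frechet_derivative_works[symmetric]\<close>)
  have "Ck_on k (\<lambda>x. frechet_derivative (\<lambda>x. L (f x)) (at x) v) S" for v
    by (subst Ck_on_cong[OF assms(1), where g="\<lambda>x. L (frechet_derivative f (at x) v)"])
      (use Suc in \<open>auto simp: frechet_derivative_eq[OF d]\<close>)
  then show ?case
    using d assms by (auto simp: differentiable_on_eq_differentiable_at differentiable_def)
qed

text \<open>The Leibniz rule pairs an undifferentiated factor with a derivative, so the induction
  also uses that both factors themselves are of the lower class \<open>k\<close>.\<close>

lemma Ck_on_bounded_bilinear:
  assumes "open S" "bounded_bilinear p"
  shows "Ck_on k f S \<Longrightarrow> Ck_on k g S \<Longrightarrow> Ck_on k (\<lambda>x. p (f x) (g x)) S"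
proof (induction k arbitrary: f g)
  case 0
  then show ?case using assms(2) by (auto intro: bounded_bilinear.continuous_on)
next
  case (Suc k)
  have d: "((\<lambda>x. p (f x) (g x)) has_derivative
      (\<lambda>v. p (f x) (frechet_derivative g (at x) v) + p (frechet_derivative f (at x) v) (g x))) (at x)"
    if "x \<in> S" for x
    by (rule bounded_bilinear.FDERIV[OF assms(2)])
      (use Suc.prems that assms in
        \<open>auto simp: differentiable_on_eq_differentiable_at frechet_derivative_works[symmetric]\<close>)
  have c: "Ck_on k f S" "Ck_on k g S" "Ck_on k (\<lambda>x. frechet_derivative f (at x) v) S"
    "Ck_on k (\<lambda>x. frechet_derivative g (at x) v) S" for v
    using Suc.prems Ck_on_SucD[OF Suc.prems(1)] Ck_on_SucD[OF Suc.prems(2)] by auto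
  have "Ck_on k (\<lambda>x. frechet_derivative (\<lambda>x. p (f x) (g x)) (at x) v) S" for v
    by (subst Ck_on_cong[OF assms(1), where g="\<lambda>x. p (f x) (frechet_derivative g (at x) v)
          + p (frechet_derivative f (at x) v) (g x)"])
      (auto simp: frechet_derivative_eq[OF d] intro!: Ck_on_add[OF assms(1)] Suc.IH c)
  then show ?case
    using d assms by (auto simp: differentiable_on_eq_differentiable_at differentiable_def)
qed

lemma Ck_on_sum:
  assumes "open S"
  shows "(\<And>a. a \<in> A \<Longrightarrow> Ck_on k (f a) S) \<Longrightarrow> Ck_on k (\<lambda>x. \<Sum>a\<in>A. f a x) S"
  by (induction A rule: infinite_finite_induct) (auto intro: Ck_on_add[OF assms] Ck_on_const)

text \<open>In the chain rule the outer derivative is applied to a direction that varies with the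
  point. Expanding this direction in \<open>Basis\<close> gives a finite sum of scalar coefficients
  times partial derivatives of \<open>f\<close> composed with \<open>g\<close>, to which the
  induction hypothesis, general in \<open>f\<close>, applies.\<close>

lemma Ck_on_compose:
  fixes g :: "'a::euclidean_space \<Rightarrow> 'b::euclidean_space" and f :: "'b \<Rightarrow> 'c::real_normed_vector"
  assumes "open S" "open T" "\<And>x. x \<in> S \<Longrightarrow> g x \<in> T"
  shows "Ck_on k f T \<Longrightarrow> Ck_on k g S \<Longrightarrow> Ck_on k (\<lambda>x. f (g x)) S"
proof (induction k arbitrary: f)
  case 0
  then show ?case
    using assms by (auto intro: continuous_on_compose2)
next
  case (Suc k)
  have d: "((\<lambda>x. f (g x)) has_derivative
      (\<lambda>v. frechet_derivative f (at (g x)) (frechet_derivative g (at x) v))) (at x)"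
    "(f has_derivative frechet_derivative f (at (g x))) (at (g x))"
    if "x \<in> S" for x
    by (rule has_derivative_compose)
      (use Suc.prems that assms in
        \<open>auto simp: differentiable_on_eq_differentiable_at frechet_derivative_works[symmetric]\<close>)
  have e: "frechet_derivative f (at (g x)) w = (\<Sum>b\<in>Basis. (w \<bullet> b) *\<^sub>R frechet_derivative f (at (g x)) b)"
    if "x \<in> S" for x w
    using d(2)[OF that] by (subst euclidean_representation[of w, symmetric])
      (simp add: linear_sum linear_scale has_derivative_linear)
  have "Ck_on k (\<lambda>x. frechet_derivative (\<lambda>x. f (g x)) (at x) v) S" for v
  proof (subst Ck_on_cong[OF assms(1), where
        g="\<lambda>x. \<Sum>b\<in>Basis. (frechet_derivative g (at x) v \<bullet> b) *\<^sub>R frechet_derivative f (at (g x)) b"])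
    fix x assume "x \<in> S"
    then show "frechet_derivative (\<lambda>x. f (g x)) (at x) v =
      (\<Sum>b\<in>Basis. (frechet_derivative g (at x) v \<bullet> b) *\<^sub>R frechet_derivative f (at (g x)) b)"
      by (subst frechet_derivative_eq[OF d(1)], assumption) (rule e)
  next
    show "Ck_on k (\<lambda>x. \<Sum>b\<in>Basis. (frechet_derivative g (at x) v \<bullet> b) *\<^sub>R frechet_derivative f (at (g x)) b) S"
    proof (rule Ck_on_sum[OF assms(1)])
      fix b :: 'b
      have "Ck_on k (\<lambda>x. frechet_derivative g (at x) v \<bullet> b) S"
        using Suc.prems(2) by (intro Ck_on_bounded_linear[OF assms(1) bounded_linear_inner_left]) auto
      moreover have "Ck_on k (\<lambda>x. frechet_derivative f (at (g x)) b) S"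
        using Suc.prems Ck_on_SucD[OF Suc.prems(2)] by (intro Suc.IH) auto
      ultimately show "Ck_on k (\<lambda>x. (frechet_derivative g (at x) v \<bullet> b) *\<^sub>R frechet_derivative f (at (g x)) b) S"
        by (rule Ck_on_bounded_bilinear[OF assms(1) bounded_bilinear_scaleR])
    qed
  qed
  then show ?case
    using d(1) assms by (auto simp: differentiable_on_eq_differentiable_at differentiable_def)
qed

text \<open>The derivative \<open>- (1/f) f' (1/f)\<close> contains the reciprocal only
  undifferentiated, hence the induction on the order closes.\<close>

lemma Ck_on_inverse:
  fixes f :: "'a::euclidean_space \<Rightarrow> real"
  assumes "open S" "\<And>x. x \<in> S \<Longrightarrow> f x \<noteq> 0"
  shows "Ck_on k f S \<Longrightarrow> Ck_on k (\<lambda>x. inverse (f x)) S"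
proof (induction k)
  case 0
  then show ?case using assms by (auto intro: continuous_on_inverse)
next
  case (Suc k)
  have d: "((\<lambda>x. inverse (f x)) has_derivative
      (\<lambda>v. - (inverse (f x) * frechet_derivative f (at x) v * inverse (f x)))) (at x)" if "x \<in> S" for x
    by (rule Deriv.has_derivative_inverse)
      (use Suc.prems that assms in
        \<open>auto simp: differentiable_on_eq_differentiable_at frechet_derivative_works[symmetric]\<close>)
  have i: "Ck_on k (\<lambda>x. inverse (f x)) S"
    using Suc.IH Ck_on_SucD[OF Suc.prems] by blast
  have "Ck_on k (\<lambda>x. frechet_derivative (\<lambda>x. inverse (f x)) (at x) v) S" for v
    by (subst Ck_on_cong[OF assms(1), where
          g="\<lambda>x. - (inverse (f x) * frechet_derivative f (at x) v * inverse (f x))"])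
      (use Suc.prems in \<open>auto simp: frechet_derivative_eq[OF d] intro!: i
          Ck_on_bounded_bilinear[OF assms(1) bounded_bilinear_mult]
          Ck_on_bounded_linear[OF assms(1) bounded_linear_minus[OF bounded_linear_ident]]\<close>)
  then show ?case
    using d assms by (auto simp: differentiable_on_eq_differentiable_at differentiable_def)
qed

lemma smooth_on_cong:
  assumes "open S" "\<And>x. x \<in> S \<Longrightarrow> f x = g x" "smooth_on f S"
  shows "smooth_on g S"
  using assms Ck_on_cong[of S f g] unfolding smooth_on_def by blast

lemma smooth_on_imp_continuous_on: "smooth_on f S \<Longrightarrow> continuous_on S f"
  unfolding smooth_on_def using Ck_on_imp_continuous_on by blast

lemma smooth_on_imp_differentiable_at: "smooth_on f S \<Longrightarrow> open S \<Longrightarrow> x \<in> S \<Longrightarrow> f differentiable at x"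
  unfolding smooth_on_def using Ck_on.simps(2)[of 0 f S] differentiable_on_eq_differentiable_at by blast

lemma smooth_on_frechet_derivative: "smooth_on f S \<Longrightarrow> smooth_on (\<lambda>x. frechet_derivative f (at x) v) S"
  unfolding smooth_on_def using Ck_on.simps(2)[of _ f S] by blast

lemma smooth_on_subset: "smooth_on f S \<Longrightarrow> T \<subseteq> S \<Longrightarrow> smooth_on f T"
  unfolding smooth_on_def using Ck_on_subset by blast

lemma smooth_on_Un: "open S \<Longrightarrow> open T \<Longrightarrow> smooth_on f S \<Longrightarrow> smooth_on f T \<Longrightarrow> smooth_on f (S \<union> T)"
  unfolding smooth_on_def using Ck_on_Union[of "{S, T}" _ f] by auto

lemma smooth_on_const: "smooth_on (\<lambda>x. c) S"
  unfolding smooth_on_def using Ck_on_const by blast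

lemma smooth_on_bounded_linear: "open S \<Longrightarrow> bounded_linear L \<Longrightarrow> smooth_on f S \<Longrightarrow> smooth_on (\<lambda>x. L (f x)) S"
  unfolding smooth_on_def using Ck_on_bounded_linear by blast

lemma smooth_on_ident: "open S \<Longrightarrow> smooth_on (\<lambda>x. x) S"
proof -
  have "Ck_on k (\<lambda>x. x) S" for k
    by (cases k) (auto intro!: continuous_on_id Ck_on_const simp: frechet_derivative_ident differentiable_on_def)
  then show ?thesis unfolding smooth_on_def by blast
qed

lemma smooth_on_bounded_bilinear:
  "open S \<Longrightarrow> bounded_bilinear p \<Longrightarrow> smooth_on f S \<Longrightarrow> smooth_on g S \<Longrightarrow> smooth_on (\<lambda>x. p (f x) (g x)) S"
  unfolding smooth_on_def using Ck_on_bounded_bilinear by blast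

lemma smooth_on_add: "open S \<Longrightarrow> smooth_on f S \<Longrightarrow> smooth_on g S \<Longrightarrow> smooth_on (\<lambda>x. f x + g x) S"
  unfolding smooth_on_def using Ck_on_add by blast

lemma smooth_on_sum: "open S \<Longrightarrow> (\<And>a. a \<in> A \<Longrightarrow> smooth_on (f a) S) \<Longrightarrow> smooth_on (\<lambda>x. \<Sum>a\<in>A. f a x) S"
  unfolding smooth_on_def by (rule allI, rule Ck_on_sum) simp_all

lemma smooth_on_inverse:
  fixes f :: "'a::euclidean_space \<Rightarrow> real"
  shows "open S \<Longrightarrow> (\<And>x. x \<in> S \<Longrightarrow> f x \<noteq> 0) \<Longrightarrow> smooth_on f S \<Longrightarrow> smooth_on (\<lambda>x. inverse (f x)) S"
  unfolding smooth_on_def by (rule allI, rule Ck_on_inverse) simp_all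

lemma smooth_on_compose:
  fixes g :: "'a::euclidean_space \<Rightarrow> 'b::euclidean_space" and f :: "'b \<Rightarrow> 'c::real_normed_vector"
  shows "open S \<Longrightarrow> open T \<Longrightarrow> (\<And>x. x \<in> S \<Longrightarrow> g x \<in> T) \<Longrightarrow> smooth_on f T \<Longrightarrow> smooth_on g S \<Longrightarrow>
    smooth_on (\<lambda>x. f (g x)) S"
  unfolding smooth_on_def by (rule allI, rule Ck_on_compose[of S T g]) simp_all

text \<open>Serves to extend functions by zero: \<open>f\<close> lives on a chart image and
  \<open>g = 0\<close> off a compact support.\<close>

lemma smooth_on_cases_open:
  assumes "open U" "open V" "smooth_on f U" "smooth_on g V" "\<And>x. x \<in> U \<Longrightarrow> x \<in> V \<Longrightarrow> f x = g x"
  shows "smooth_on (\<lambda>x. if x \<in> U then f x else g x) (U \<union> V)"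
proof (rule smooth_on_Un[OF assms(1,2)])
  show "smooth_on (\<lambda>x. if x \<in> U then f x else g x) U"
    by (rule smooth_on_cong[OF assms(1) _ assms(3)]) simp
  show "smooth_on (\<lambda>x. if x \<in> U then f x else g x) V"
    by (rule smooth_on_cong[OF assms(2) _ assms(4)]) (use assms(5) in auto)
qed

text \<open>The powers of \<open>1 / t\<close> are included to make the family closed under differentiation.\<close>

definition flat_exp :: "nat \<Rightarrow> real \<Rightarrow> real" where
  "flat_exp m t = (if t > 0 then (1 / t) ^ m * exp (- 1 / t) else 0)"

text \<open>Away from \<open>0\<close> this is the product rule on one of the two branches; at
  \<open>0\<close> both one-sided difference quotients tend to \<open>0\<close>.\<close>

lemma flat_exp_has_derivative:
  "(flat_exp m has_real_derivative (flat_exp (m + 2) t - real m * flat_exp (Suc m) t)) (at t)"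
proof -
  consider "t > 0" | "t < 0" | "t = 0" by linarith
  then show ?thesis
  proof cases
    case 1
    have "((\<lambda>t. (1 / t) ^ m * exp (- 1 / t)) has_real_derivative
        (flat_exp (m + 2) t - real m * flat_exp (Suc m) t)) (at t)"
      unfolding flat_exp_def using 1
      by (cases m) (auto intro!: derivative_eq_intros simp: field_simps power2_eq_square,
          metis One_nat_def power_eq_if)
    then show ?thesis
      by (rule has_field_derivative_transform_within_open[where S="{0<..}"])
        (use 1 in \<open>auto simp: flat_exp_def\<close>)
  next
    case 2
    have "((\<lambda>t. 0) has_real_derivative (flat_exp (m + 2) t - real m * flat_exp (Suc m) t)) (at t)"
      using 2 by (auto simp: flat_exp_def)
    then show ?thesis
      by (rule has_field_derivative_transform_within_open[where S="{..<0}"])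
        (use 2 in \<open>auto simp: flat_exp_def\<close>)
  next
    case 3
    \<comment> \<open>With \<open>u = 1 / h\<close> the quotient is
      \<open>u ^ (m + 1) / exp u\<close>, and the exponential dominates every power.\<close>
    have "((\<lambda>h. flat_exp m h / h) \<longlongrightarrow> 0) (at_right 0)"
    proof (rule Lim_transform_eventually)
      show "((\<lambda>h. inverse h ^ Suc m / exp (inverse h)) \<longlongrightarrow> 0) (at_right (0::real))"
        by (rule filterlim_compose[OF tendsto_power_div_exp_0 filterlim_inverse_at_top_right])
      show "eventually (\<lambda>h. inverse h ^ Suc m / exp (inverse h) = flat_exp m h / h) (at_right (0::real))"
        by (auto simp: flat_exp_def exp_minus field_simps intro: eventually_at_rightI[of 0 1])
    qed
    moreover have "((\<lambda>h. flat_exp m h / h) \<longlongrightarrow> 0) (at_left 0)"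
      by (rule Lim_transform_eventually[of "\<lambda>h. 0"])
        (auto simp: flat_exp_def intro!: eventually_at_leftI[of "-1"])
    ultimately have "((\<lambda>h. flat_exp m h / h) \<longlongrightarrow> 0) (at 0)"
      by (simp add: filterlim_split_at)
    then show ?thesis
      using 3 by (simp add: has_field_derivative_iff flat_exp_def)
  qed
qed

lemma Ck_on_flat_exp: "Ck_on k (flat_exp m) UNIV"
proof (induction k arbitrary: m)
  case 0
  then show ?case
    using flat_exp_has_derivative DERIV_isCont continuous_at_imp_continuous_on by (metis Ck_on.simps(1))
next
  case (Suc k)
  have d: "(flat_exp m has_derivative (\<lambda>v. v *\<^sub>R (flat_exp (m + 2) t + (- real m) *\<^sub>R flat_exp (Suc m) t))) (at t)" for t
    using flat_exp_has_derivative[of m t]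
    unfolding has_field_derivative_def by (rule has_derivative_eq_rhs) (auto simp: algebra_simps)
  have "Ck_on k (\<lambda>x. frechet_derivative (flat_exp m) (at x) v) UNIV" for v
    unfolding frechet_derivative_eq[OF d]
    by (rule Ck_on_bounded_linear[OF open_UNIV bounded_linear_scaleR_right
          Ck_on_add[OF open_UNIV Suc Ck_on_bounded_linear[OF open_UNIV bounded_linear_scaleR_right Suc]]])
  then show ?case
    using d by (auto simp: differentiable_on_def differentiable_def)
qed

lemma smooth_on_flat_exp: "smooth_on (flat_exp m) UNIV"
  unfolding smooth_on_def using Ck_on_flat_exp by blast

section \<open>Index calculus: insertion, contraction and infinitesimal rotations of spinor-valued
  tensors\<close>

section \<open>Linear algebra of spinor-valued tensors\<close>

lemma linear_matvec: "linear (\<lambda>u. (A :: complex ^ 'a ^ 'b) *v u)"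
  by (rule linearI) (simp_all add: matrix_vector_mult_def vec_eq_iff distrib_left sum.distrib scaleR_sum_right)

lemmas matvec_add = linear_add[OF linear_matvec]
  and matvec_diff = linear_diff[OF linear_matvec]
  and matvec_neg = linear_neg[OF linear_matvec]
  and matvec_sum = linear_sum[OF linear_matvec]
  and matvec_scaleR = linear_scale[OF linear_matvec]
  and matvec_0 = linear_0[OF linear_matvec]

lemmas matvec = matvec_add matvec_diff matvec_neg matvec_sum matvec_scaleR matvec_0

lemma sum_matrix_vector_mult: "(\<Sum>a\<in>F. A a) *v u = (\<Sum>a\<in>F. A a *v u)"
  by (induction F rule: infinite_finite_induct) (auto simp: matrix_vector_mult_add_rdistrib)

lemma scaleR_matrix_vector_mult: "(r *\<^sub>R A) *v u = r *\<^sub>R ((A :: complex ^ 'a ^ 'b) *v u)"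
  by (simp add: matrix_vector_mult_def vec_eq_iff scaleR_sum_right)

text \<open>Interior product with the \<open>k\<close>-th basis vector. Inductions on the index list
  peel off one \<open>slot\<close> at a time.\<close>

definition slot :: "'n \<Rightarrow> ('n, 's) sptensor \<Rightarrow> ('n, 's) sptensor" where
  "slot k u = (\<lambda>I. u (k # I))"

text \<open>\<open>ins I \<Phi>\<close> is the sum over \<open>r\<close> of \<open>\<Phi>\<close> evaluated at \<open>I ! r\<close> and the list \<open>I\<close> without its
  \<open>r\<close>-th entry.\<close>

primrec ins :: "'n list \<Rightarrow> ('n \<Rightarrow> ('n, 's::finite) sptensor) \<Rightarrow> complex ^ 's" where
  "ins [] \<Phi> = 0"
| "ins (k # I) \<Phi> = \<Phi> k I + ins I (\<lambda>l J. \<Phi> l (k # J))"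

text \<open>There is no division by the number of positions: that number reappears in
  \<open>herm_clsym\<close> and is absorbed in the constant \<open>qcon\<close>.\<close>

definition clsym :: "('n::finite \<Rightarrow> complex ^ 's ^ 's::finite) \<Rightarrow> ('n, 's) sptensor \<Rightarrow> ('n, 's) sptensor" where
  "clsym cl v = (\<lambda>I. ins I (\<lambda>k J. cl k *v v J))"

text \<open>If \<open>\<Phi> k\<close> is the covariant derivative of a section along
  \<open>e_k\<close>, this is its twisted Dirac operator, and \<open>dvg \<Phi>\<close> is its
  divergence.\<close>

definition clmul :: "('n::finite \<Rightarrow> complex ^ 's ^ 's::finite) \<Rightarrow> ('n \<Rightarrow> ('n, 's) sptensor) \<Rightarrow> ('n, 's) sptensor" where
  "clmul cl \<Phi> = (\<lambda>I. \<Sum>k\<in>UNIV. cl k *v \<Phi> k I)"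

definition dvg :: "('n::finite \<Rightarrow> ('n, 's::finite) sptensor) \<Rightarrow> ('n, 's) sptensor" where
  "dvg \<Phi> = (\<lambda>I. \<Sum>k\<in>UNIV. \<Phi> k (k # I))"

definition symt :: "('n, 's) sptensor \<Rightarrow> bool" where
  "symt u \<longleftrightarrow> (\<forall>I J. mset I = mset J \<longrightarrow> u I = u J)"

lemma symtD: "symt u \<Longrightarrow> mset I = mset J \<Longrightarrow> u I = u J"
  unfolding symt_def by blast

lemma symtI: "(\<And>I J. mset I = mset J \<Longrightarrow> u I = u J) \<Longrightarrow> symt u"
  unfolding symt_def by blast

lemma symt_swap: "symt u \<Longrightarrow> u (k # l # I) = u (l # k # I)"
  by (rule symtD) auto

lemma symt_slot: "symt u \<Longrightarrow> symt (slot k u)"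
  by (auto simp: symt_def slot_def)

lemma ins_add: "ins I (\<lambda>k J. \<Phi> k J + \<Psi> k J) = ins I \<Phi> + ins I \<Psi>"
  by (induction I arbitrary: \<Phi> \<Psi>) auto

lemma ins_0: "ins I (\<lambda>k J. 0) = 0"
  by (induction I) auto

lemma ins_scaleR: "ins I (\<lambda>k J. r *\<^sub>R \<Phi> k J) = r *\<^sub>R ins I \<Phi>"
  by (induction I arbitrary: \<Phi>) (auto simp: scaleR_add_right)

lemma ins_neg: "ins I (\<lambda>k J. - \<Phi> k J) = - ins I \<Phi>"
  using ins_scaleR[of I "-1" \<Phi>] by simp

lemma ins_diff: "ins I (\<lambda>k J. \<Phi> k J - \<Psi> k J) = ins I \<Phi> - ins I \<Psi>"
  using ins_add[of I \<Phi> "\<lambda>k J. - \<Psi> k J"] by (simp add: ins_neg)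

lemma ins_sum: "ins I (\<lambda>k J. \<Sum>a\<in>F. \<Phi> a k J) = (\<Sum>a\<in>F. ins I (\<Phi> a))"
  by (induction F rule: infinite_finite_induct) (auto simp: ins_0 ins_add)

lemma ins_matvec: "ins I (\<lambda>k J. C *v \<Phi> k J) = C *v ins I \<Phi>"
  by (induction I arbitrary: \<Phi>) (auto simp: matvec)

lemma ins_cong:
  "(\<And>k J. Suc (length J) = length I \<Longrightarrow> \<Phi> k J = \<Psi> k J) \<Longrightarrow> ins I \<Phi> = ins I \<Psi>"
proof (induction I arbitrary: \<Phi> \<Psi>)
  case (Cons k I)
  have "ins I (\<lambda>l J. \<Phi> l (k # J)) = ins I (\<lambda>l J. \<Psi> l (k # J))"
    by (rule Cons.IH) (simp add: Cons.prems)
  then show ?case by (simp add: Cons.prems)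
qed simp

text \<open>By symmetry every removed entry can be put back in front, so all positions contribute
  the same.\<close>

lemma ins_slot: "symt v \<Longrightarrow> ins I (\<lambda>k J. v (k # J)) = real (length I) *\<^sub>R v I"
proof (induction I arbitrary: v)
  case (Cons k I)
  have "ins I (\<lambda>l J. v (l # k # J)) = ins I (\<lambda>l J. slot k v (l # J))"
    by (rule ins_cong) (simp add: slot_def symt_swap[OF Cons.prems])
  then show ?case
    using Cons.IH[OF symt_slot[OF Cons.prems], of k] by (simp add: slot_def algebra_simps)
qed simp

text \<open>For symmetric \<open>\<Phi> k\<close> only the multiset of remaining entries matters, so
  deletion at a position may be replaced by \<open>remove1\<close>. In this form permutation
  invariance becomes accessible.\<close>

lemma ins_eq_sum_list:
  "(\<And>k. symt (\<Phi> k)) \<Longrightarrow> ins I \<Phi> = sum_list (map (\<lambda>x. \<Phi> x (remove1 x I)) I)"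
proof (induction I arbitrary: \<Phi>)
  case (Cons k I)
  have "ins I (\<lambda>l J. \<Phi> l (k # J)) = sum_list (map (\<lambda>x. \<Phi> x (k # remove1 x I)) I)"
    using Cons.IH[of "\<lambda>l. slot k (\<Phi> l)"] symt_slot[OF Cons.prems] by (simp add: slot_def)
  also have "map (\<lambda>x. \<Phi> x (k # remove1 x I)) I = map (\<lambda>x. \<Phi> x (remove1 x (k # I))) I"
    by (rule map_cong) (auto intro!: symtD[OF Cons.prems])
  finally show ?case by simp
qed simp

text \<open>Both sides are one and the same sum over the common multiset of entries.\<close>

lemma sum_list_remove1_cong:
  assumes "\<And>k. symt (\<Phi> k)" "mset I = mset J"
  shows "sum_list (map (\<lambda>x. \<Phi> x (remove1 x I)) I) = sum_list (map (\<lambda>x. \<Phi> x (remove1 x J)) J)"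
proof -
  have "\<Phi> x (remove1 x I) = \<Phi> x (remove1 x J)" for x
    by (rule symtD[OF assms(1)]) (simp add: assms(2))
  then have "sum_list (map (\<lambda>x. \<Phi> x (remove1 x I)) I) = (\<Sum>x\<in>#mset I. \<Phi> x (remove1 x J))"
    by (simp add: sum_mset_sum_list flip: mset_map)
  then show ?thesis
    by (simp add: assms(2) sum_mset_sum_list flip: mset_map)
qed

lemma symt_ins:
  assumes "\<And>k. symt (\<Phi> k)"
  shows "symt (\<lambda>I. ins I \<Phi>)"
  unfolding symt_def ins_eq_sum_list[OF assms] by (intro allI impI sum_list_remove1_cong[of \<Phi>] assms)

lemma symt_matvec: "symt v \<Longrightarrow> symt (\<lambda>J. C *v v J)"
  by (rule symtI) (drule (1) symtD, simp)

lemma symt_clsym: "symt v \<Longrightarrow> symt (clsym cl v)"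
  unfolding clsym_def by (intro symt_ins symt_matvec)

text \<open>The derivation extending \<open>A\<close> to tensors, acting on one index at a time.
  Together with the spinor action \<open>sigm\<close> it makes up \<open>drho\<close>; the two parts
  are treated separately because they commute with each other.\<close>

definition lact :: "real ^ 'n ^ 'n::finite \<Rightarrow> ('n, 's::finite) sptensor \<Rightarrow> ('n, 's) sptensor" where
  "lact A u = (\<lambda>I. \<Sum>r<length I. \<Sum>b\<in>UNIV. A $ (I ! r) $ b *\<^sub>R u (I[r := b]))"

definition sigm :: "('n::finite \<Rightarrow> complex ^ 's ^ 's::finite) \<Rightarrow> real ^ 'n ^ 'n \<Rightarrow> complex ^ 's \<Rightarrow> complex ^ 's" where
  "sigm cl A u = (1 / 4) *\<^sub>R (\<Sum>a\<in>UNIV. \<Sum>b\<in>UNIV. A $ a $ b *\<^sub>R (cl b *v (cl a *v u)))"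

lemma drho_eq: "drho cl A u I = sigm cl A (u I) + lact A u I"
  by (simp add: drho_def sigm_def lact_def)

lemma lact_Nil [simp]: "lact A u [] = 0"
  by (simp add: lact_def)

lemma lact_Cons: "lact A u (k # I) = lact A (slot k u) I + (\<Sum>b\<in>UNIV. A $ k $ b *\<^sub>R u (b # I))"
  by (simp add: lact_def sum.lessThan_Suc_shift slot_def del: sum.lessThan_Suc)

lemma lact_add: "lact A (\<lambda>J. u J + v J) I = lact A u I + lact A v I"
  by (simp add: lact_def scaleR_add_right sum.distrib)

lemma lact_scaleR: "lact A (\<lambda>J. r *\<^sub>R u J) I = r *\<^sub>R lact A u I"
  by (simp add: lact_def scaleR_sum_right mult_ac)

lemma lact_0: "lact A (\<lambda>J. 0) I = 0"
  by (simp add: lact_def)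

lemma lact_sum: "lact A (\<lambda>J. \<Sum>a\<in>F. u a J) I = (\<Sum>a\<in>F. lact A (u a) I)"
  by (induction F rule: infinite_finite_induct) (auto simp: lact_0 lact_add)

lemma lact_matvec: "lact A (\<lambda>J. C *v u J) I = C *v lact A u I"
  by (simp add: lact_def matvec)

lemma lact_matrix_add: "lact (A + B) u I = lact A u I + lact B u I"
  by (simp add: lact_def scaleR_add_left sum.distrib)

lemma lact_matrix_scaleR: "lact (r *\<^sub>R A) u I = r *\<^sub>R lact A u I"
  by (simp add: lact_def scaleR_sum_right)

lemma linear_sigm: "linear (sigm cl A)"
  by (rule linearI) (simp_all add: sigm_def matvec sum.distrib scaleR_sum_right algebra_simps)

lemmas sigm_add = linear_add[OF linear_sigm]
  and sigm_sum = linear_sum[OF linear_sigm]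
  and sigm_scaleR = linear_scale[OF linear_sigm]
  and sigm_0 = linear_0[OF linear_sigm]

lemma sigm_matrix_add: "sigm cl (A + B) u = sigm cl A u + sigm cl B u"
  by (simp add: sigm_def scaleR_add_left sum.distrib scaleR_add_right)

lemma sigm_matrix_scaleR: "sigm cl (r *\<^sub>R A) u = r *\<^sub>R sigm cl A u"
  by (simp add: sigm_def scaleR_sum_right mult_ac)

lemma drho_add: "drho cl A (\<lambda>J. u J + v J) I = drho cl A u I + drho cl A v I"
  by (simp add: drho_eq sigm_add lact_add)

lemma drho_scaleR: "drho cl A (\<lambda>J. r *\<^sub>R u J) I = r *\<^sub>R drho cl A u I"
  by (simp add: drho_eq sigm_scaleR lact_scaleR scaleR_add_right)

lemma drho_0: "drho cl A (\<lambda>J. 0) I = 0"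
  by (simp add: drho_eq sigm_0 lact_0)

lemma drho_sum: "drho cl A (\<lambda>J. \<Sum>a\<in>F. u a J) I = (\<Sum>a\<in>F. drho cl A (u a) I)"
  by (simp add: drho_eq sigm_sum lact_sum sum.distrib)

lemma drho_matrix_add: "drho cl (A + B) u I = drho cl A u I + drho cl B u I"
  by (simp add: drho_eq sigm_matrix_add lact_matrix_add)

lemma drho_matrix_scaleR: "drho cl (r *\<^sub>R A) u I = r *\<^sub>R drho cl A u I"
  by (simp add: drho_eq sigm_matrix_scaleR lact_matrix_scaleR scaleR_add_right)

lemma drho_matrix_0: "drho cl 0 u I = 0"
  using drho_matrix_scaleR[of cl 0 0 u I] by simp

lemma drho_matrix_sum: "drho cl (\<Sum>a\<in>F. A a) u I = (\<Sum>a\<in>F. drho cl (A a) u I)"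
  by (induction F rule: infinite_finite_induct) (auto simp: drho_matrix_0 drho_matrix_add)

lemma drho_matrix_diff: "drho cl (A - B) u I = drho cl A u I - drho cl B u I"
  using drho_matrix_add[of cl A "(-1) *\<^sub>R B" u I] by (simp only: drho_matrix_scaleR) simp

lemma drho_Cons: "drho cl A u (k # I) = drho cl A (slot k u) I + (\<Sum>b\<in>UNIV. A $ k $ b *\<^sub>R u (b # I))"
  by (simp add: drho_eq lact_Cons) (simp add: slot_def)

text \<open>Besides the remaining indices, \<open>A\<close> also rotates the inserted one, which is
  the family index of \<open>\<Phi>\<close>.\<close>

lemma lact_ins:
  "lact A (\<lambda>J. ins J \<Phi>) I = ins I (\<lambda>k J. lact A (\<Phi> k) J + (\<Sum>b\<in>UNIV. A $ k $ b *\<^sub>R \<Phi> b J))"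
proof (induction I arbitrary: \<Phi>)
  case (Cons k I)
  have "lact A (\<lambda>J. ins J \<Phi>) (k # I) = lact A (\<Phi> k) I + lact A (\<lambda>J. ins J (\<lambda>l. slot k (\<Phi> l))) I
      + (\<Sum>b\<in>UNIV. A $ k $ b *\<^sub>R \<Phi> b I) + (\<Sum>b\<in>UNIV. A $ k $ b *\<^sub>R ins I (\<lambda>l. slot b (\<Phi> l)))"
    by (simp add: lact_Cons slot_def lact_add scaleR_add_right sum.distrib)
  also have "\<dots> = ins (k # I) (\<lambda>k J. lact A (\<Phi> k) J + (\<Sum>b\<in>UNIV. A $ k $ b *\<^sub>R \<Phi> b J))"
    unfolding Cons.IH by (simp add: lact_Cons ins_add ins_sum ins_scaleR slot_def sum.distrib)
  finally show ?case .
qed simp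

lemma drho_ins:
  "drho cl A (\<lambda>J. ins J \<Phi>) I = ins I (\<lambda>k J. drho cl A (\<Phi> k) J + (\<Sum>b\<in>UNIV. A $ k $ b *\<^sub>R \<Phi> b J))"
proof -
  have "sigm cl A (ins I \<Phi>) = ins I (\<lambda>k J. sigm cl A (\<Phi> k J))"
    by (simp add: sigm_def ins_sum ins_scaleR ins_matvec)
  then show ?thesis
    by (simp add: drho_eq lact_ins ins_add)
qed

text \<open>Rotating the two contracted indices contributes two sums, which are negatives of each
  other because \<open>A\<close> is skew.\<close>

lemma drho_dvg:
  assumes "transpose A = - A"
  shows "drho cl A (dvg \<Phi>) I = dvg (\<lambda>k J. drho cl A (\<Phi> k) J + (\<Sum>b\<in>UNIV. A $ k $ b *\<^sub>R \<Phi> b J)) I"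
proof -
  have s: "A $ b $ k = - A $ k $ b" for k b
    using arg_cong[OF assms, of "\<lambda>B. B $ k $ b"] by (simp add: transpose_def)
  have "(\<Sum>k\<in>UNIV. \<Sum>b\<in>UNIV. A $ k $ b *\<^sub>R \<Phi> b (k # I)) = (\<Sum>k\<in>UNIV. \<Sum>b\<in>UNIV. A $ b $ k *\<^sub>R \<Phi> k (b # I))"
    by (rule sum.swap)
  also have "\<dots> = (\<Sum>k\<in>UNIV. \<Sum>b\<in>UNIV. (- A $ k $ b) *\<^sub>R \<Phi> k (b # I))"
    by (intro sum.cong refl arg_cong2[of _ _ _ _ "(*\<^sub>R)"] s)
  also have "\<dots> = - (\<Sum>k\<in>UNIV. \<Sum>b\<in>UNIV. A $ k $ b *\<^sub>R \<Phi> k (b # I))"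
    by (simp add: sum_negf)
  finally show ?thesis
    unfolding dvg_def by (simp add: drho_sum drho_Cons sum.distrib) (simp add: slot_def)
qed

text \<open>Actions on two different indices commute and cancel, so on each index only the matrix
  commutator survives.\<close>

lemma lact_commutator:
  fixes A B :: "real ^ 'n ^ 'n::finite" and u :: "('n, 's::finite) sptensor"
  shows "lact A (lact B u) I - lact B (lact A u) I = lact (A ** B - B ** A) u I"
proof (induction I arbitrary: u)
  case (Cons k I)
  have s: "slot k (lact B u) = (\<lambda>I. lact B (slot k u) I + (\<Sum>b\<in>UNIV. B $ k $ b *\<^sub>R slot b u I))" for B :: "real ^ 'n ^ 'n"
    by (simp add: fun_eq_iff slot_def[of k "lact B u"] lact_Cons) (simp add: slot_def)
  \<comment> \<open>With the first index split off, the two middle sums are interchanged by swapping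
    \<open>A\<close> and \<open>B\<close>, hence drop out of the commutator.\<close>
  have m: "lact A (lact B u) (k # I) = lact A (lact B (slot k u)) I
      + (\<Sum>b\<in>UNIV. B $ k $ b *\<^sub>R lact A (slot b u) I) + (\<Sum>b\<in>UNIV. A $ k $ b *\<^sub>R lact B (slot b u) I)
      + (\<Sum>c\<in>UNIV. (A ** B) $ k $ c *\<^sub>R u (c # I))" for A B :: "real ^ 'n ^ 'n"
    by (simp add: lact_Cons s lact_add lact_sum lact_scaleR sum.distrib scaleR_add_right)
      (simp add: matrix_matrix_mult_def scaleR_sum_left scaleR_sum_right, rule sum.swap)
  show ?case
    unfolding m lact_Cons[of "A ** B - B ** A"] Cons.IH[symmetric]
    by (simp add: algebra_simps sum_subtractf)
qed simp

section \<open>Hermitian forms on spinors and tensors\<close>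

section \<open>Clifford modules\<close>

lemma uminus_matrix_vector_mult: "(- A) *v u = - ((A :: complex ^ 'a ^ 'b) *v u)"
  by (simp add: matrix_vector_mult_def vec_eq_iff sum_negf)

lemma sum_swap3: "(\<Sum>a\<in>A. \<Sum>b\<in>B. \<Sum>c\<in>C. f a b c) = (\<Sum>c\<in>C. \<Sum>b\<in>B. \<Sum>a\<in>A. f a b c)"
proof -
  have "(\<Sum>a\<in>A. \<Sum>b\<in>B. \<Sum>c\<in>C. f a b c) = (\<Sum>a\<in>A. \<Sum>c\<in>C. \<Sum>b\<in>B. f a b c)"
    by (intro sum.cong refl sum.swap)
  also have "\<dots> = (\<Sum>c\<in>C. \<Sum>a\<in>A. \<Sum>b\<in>B. f a b c)"
    by (rule sum.swap)
  also have "\<dots> = (\<Sum>c\<in>C. \<Sum>b\<in>B. \<Sum>a\<in>A. f a b c)"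
    by (intro sum.cong refl sum.swap)
  finally show ?thesis .
qed

definition hs :: "complex ^ 's::finite \<Rightarrow> complex ^ 's \<Rightarrow> complex" where
  "hs u v = (\<Sum>a\<in>UNIV. u $ a * cnj (v $ a))"

lemma hs_add_left: "hs (u + v) w = hs u w + hs v w"
  by (simp add: hs_def algebra_simps sum.distrib)

lemma hs_add_right: "hs w (u + v) = hs w u + hs w v"
  by (simp add: hs_def algebra_simps sum.distrib)

lemma hs_scaleR_left: "hs (r *\<^sub>R u) w = r *\<^sub>R hs u w"
  by (simp add: hs_def scaleR_sum_right)

lemma hs_scaleR_right: "hs w (r *\<^sub>R u) = r *\<^sub>R hs w u"
  by (simp add: hs_def scaleR_sum_right)

lemma bounded_bilinear_hs: "bounded_bilinear hs"
proof -
  have "bilinear (hs :: complex ^ 's::finite \<Rightarrow> complex ^ 's \<Rightarrow> complex)"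
    unfolding bilinear_def
    by (auto intro!: linearI simp: hs_add_left hs_add_right hs_scaleR_left hs_scaleR_right)
  then show ?thesis
    by (simp add: bilinear_conv_bounded_bilinear)
qed

lemmas hs_0_left = bounded_bilinear.zero_left[OF bounded_bilinear_hs]
  and hs_0_right = bounded_bilinear.zero_right[OF bounded_bilinear_hs]
  and hs_minus_left = bounded_bilinear.minus_left[OF bounded_bilinear_hs]
  and hs_minus_right = bounded_bilinear.minus_right[OF bounded_bilinear_hs]
  and hs_sum_left = bounded_bilinear.sum_left[OF bounded_bilinear_hs]
  and hs_sum_right = bounded_bilinear.sum_right[OF bounded_bilinear_hs]

lemmas hs_simps = hs_add_left hs_add_right hs_scaleR_left hs_scaleR_right hs_0_left hs_0_right
  hs_minus_left hs_minus_right hs_sum_left hs_sum_right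

lemma hs_self: "hs u u = of_real (u \<bullet> u)"
  by (simp add: hs_def inner_vec_def complex_mult_cnj inner_complex_def power2_eq_square)

lemma hs_cnj: "cnj (hs u v) = hs v u"
  by (simp add: hs_def mult.commute)

lemma hs_adjoint: "hs (A *v u) v = hs u ((\<chi> a b. cnj (A $ b $ a)) *v v)"
  unfolding hs_def matrix_vector_mult_def
  by (simp add: sum_distrib_left sum_distrib_right mult_ac) (rule sum.swap)

lemma finite_length_eq: "finite {I :: 'n::finite list. length I = j}"
  using finite_lists_length_eq[of "UNIV :: 'n set" j] by simp

lemma sum_length_Suc:
  fixes f :: "'n::finite list \<Rightarrow> 'b::comm_monoid_add"
  shows "(\<Sum>I | length I = Suc j. f I) = (\<Sum>k\<in>UNIV. \<Sum>I | length I = j. f (k # I))"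
proof -
  have "(\<Sum>k\<in>UNIV. \<Sum>I | length I = j. f (k # I)) = (\<Sum>(k, I)\<in>UNIV \<times> {I. length I = j}. f (k # I))"
    by (rule sum.cartesian_product)
  also have "\<dots> = (\<Sum>I | length I = Suc j. f I)"
    by (rule sum.reindex_bij_witness[where i="\<lambda>I. (hd I, tl I)" and j="\<lambda>(k, I). k # I"])
      (auto simp: length_Suc_conv)
  finally show ?thesis by simp
qed

lemma herm_eq: "herm j u v = (\<Sum>I | length I = j. hs (u I) (v I))"
  by (simp add: herm_def hs_def)

lemma herm_0: "herm 0 u v = hs (u []) (v [])"
  by (simp add: herm_eq)

lemma herm_Suc: "herm (Suc j) u v = (\<Sum>k\<in>UNIV. herm j (slot k u) (slot k v))"
  by (simp add: herm_eq sum_length_Suc slot_def)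

lemma herm_add_left: "herm j (\<lambda>I. u I + v I) w = herm j u w + herm j v w"
  by (simp add: herm_eq hs_simps sum.distrib)

lemma herm_add_right: "herm j w (\<lambda>I. u I + v I) = herm j w u + herm j w v"
  by (simp add: herm_eq hs_simps sum.distrib)

lemma herm_scaleR_left: "herm j (\<lambda>I. r *\<^sub>R u I) w = r *\<^sub>R herm j u w"
  by (simp add: herm_eq hs_simps scaleR_sum_right)

lemma herm_scaleR_right: "herm j w (\<lambda>I. r *\<^sub>R u I) = r *\<^sub>R herm j w u"
  by (simp add: herm_eq hs_simps scaleR_sum_right)

lemma herm_diff_left: "herm j (\<lambda>I. u I - v I) w = herm j u w - herm j v w"
  using herm_add_left[of j u "\<lambda>I. (-1) *\<^sub>R v I" w] by (simp only: herm_scaleR_left) simp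

lemma herm_0_left: "herm j (\<lambda>I. 0) w = 0"
  by (simp add: herm_eq hs_simps)

lemma herm_0_right: "herm j w (\<lambda>I. 0) = 0"
  by (simp add: herm_eq hs_simps)

lemma herm_sum_left: "herm j (\<lambda>I. \<Sum>a\<in>F. u a I) w = (\<Sum>a\<in>F. herm j (u a) w)"
  by (induction F rule: infinite_finite_induct) (auto simp: herm_add_left herm_0_left)

lemma herm_sum_right: "herm j w (\<lambda>I. \<Sum>a\<in>F. u a I) = (\<Sum>a\<in>F. herm j w (u a))"
  by (induction F rule: infinite_finite_induct) (auto simp: herm_add_right herm_0_right)

lemma herm_cnj: "cnj (herm j u v) = herm j v u"
  by (simp add: herm_eq hs_cnj)

lemma herm_self: "herm j u u = of_real (\<Sum>I | length I = j. u I \<bullet> u I)"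
  by (simp add: herm_eq hs_self)

text \<open>\<open>herm j\<close> sees only lists of length \<open>j\<close>; membership in
  \<open>tensors j\<close> is what makes it definite.\<close>

lemma herm_self_eq_0D:
  assumes "herm j u u = 0" "u \<in> tensors j"
  shows "u = (\<lambda>I. 0)"
proof
  fix I
  have "(\<Sum>I | length I = j. u I \<bullet> u I) = 0"
    using assms(1) by (simp only: herm_self of_real_eq_0_iff)
  then have "\<forall>I\<in>{I. length I = j}. u I \<bullet> u I = 0"
    by (subst (asm) sum_nonneg_eq_0_iff) (auto simp: finite_length_eq)
  then show "u I = 0"
    using assms(2) by (cases "length I = j") (auto simp: tensors_def)
qed

lemma herm_lact:
  assumes "transpose A = - A"
  shows "herm j (lact A u) v = - herm j u (lact A v)"
proof (induction j arbitrary: u v)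
  case (Suc j)
  have s: "A $ b $ k = - A $ k $ b" for k b
    using arg_cong[OF assms, of "\<lambda>B. B $ k $ b"] by (simp add: transpose_def)
  have sl: "slot k (lact A w) = (\<lambda>I. lact A (slot k w) I + (\<Sum>b\<in>UNIV. A $ k $ b *\<^sub>R slot b w I))" for k and w :: "('a, 'b) sptensor"
    by (simp add: fun_eq_iff slot_def[of k "lact A w"] lact_Cons) (simp add: slot_def)
  have "(\<Sum>k\<in>UNIV. \<Sum>b\<in>UNIV. A $ k $ b *\<^sub>R herm j (slot b u) (slot k v))
      = (\<Sum>b\<in>UNIV. \<Sum>k\<in>UNIV. A $ k $ b *\<^sub>R herm j (slot b u) (slot k v))"
    by (rule sum.swap)
  also have "\<dots> = (\<Sum>b\<in>UNIV. \<Sum>k\<in>UNIV. (- A $ b $ k) *\<^sub>R herm j (slot b u) (slot k v))"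
    by (intro sum.cong refl arg_cong2[of _ _ _ _ "(*\<^sub>R)"] s)
  finally show ?case
    by (simp add: herm_Suc sl herm_add_left herm_add_right herm_sum_left herm_sum_right herm_scaleR_left
        herm_scaleR_right Suc sum.distrib sum_negf sum_subtractf)
qed (simp add: herm_0 hs_simps)

text \<open>As \<open>w\<close> is symmetric, each of the \<open>j + 1\<close> positions of the
  inserted index pairs in the same way. The factor \<open>m + 1\<close> in the adjoint of
  \<open>cliff\<close> originates here.\<close>

lemma herm_ins:
  "symt w \<Longrightarrow> herm (Suc j) (\<lambda>I. ins I \<Phi>) w = real (Suc j) *\<^sub>R (\<Sum>k\<in>UNIV. herm j (\<Phi> k) (slot k w))"
proof (induction j arbitrary: w \<Phi>)
  case (Suc j)
  have s: "slot k (\<lambda>I. ins I \<Phi>) = (\<lambda>I. \<Phi> k I + ins I (\<lambda>l. slot k (\<Phi> l)))" for k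
    by (simp add: slot_def)
  have "(\<Sum>k\<in>UNIV. \<Sum>l\<in>UNIV. herm j (slot k (\<Phi> l)) (slot l (slot k w)))
      = (\<Sum>l\<in>UNIV. \<Sum>k\<in>UNIV. herm j (slot k (\<Phi> l)) (slot l (slot k w)))"
    by (rule sum.swap)
  also have "\<dots> = (\<Sum>l\<in>UNIV. herm (Suc j) (\<Phi> l) (slot l w))"
    using symt_swap[OF Suc.prems] by (simp add: herm_Suc slot_def)
  finally have e: "(\<Sum>k\<in>UNIV. herm (Suc j) (\<lambda>I. ins I (\<lambda>l. slot k (\<Phi> l))) (slot k w))
      = real (Suc j) *\<^sub>R (\<Sum>l\<in>UNIV. herm (Suc j) (\<Phi> l) (slot l w))"
    by (simp only: Suc.IH[OF symt_slot[OF Suc.prems]] scaleR_sum_right[symmetric])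
  show ?case
    unfolding herm_Suc[of "Suc j"] s herm_add_left sum.distrib e by (simp add: scaleR_conv_of_real algebra_simps)
qed (simp add: herm_Suc herm_0 slot_def)

lemma tensorsD: "u \<in> tensors j \<Longrightarrow> length I \<noteq> j \<Longrightarrow> u I = 0"
  by (simp add: tensors_def)

lemma tensorsI: "(\<And>I. length I \<noteq> j \<Longrightarrow> u I = 0) \<Longrightarrow> u \<in> tensors j"
  by (simp add: tensors_def)

lemma sym0_iff: "u \<in> sym0 j \<longleftrightarrow> u \<in> tensors j \<and> symt u \<and> (\<forall>I. (\<Sum>k\<in>UNIV. u (k # k # I)) = 0)"
  by (simp add: sym0_def symt_def)

lemma symt_add: "symt u \<Longrightarrow> symt v \<Longrightarrow> symt (\<lambda>I. u I + v I)"
  by (rule symtI) (metis symtD)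

lemma symt_sum: "(\<And>a. a \<in> F \<Longrightarrow> symt (u a)) \<Longrightarrow> symt (\<lambda>I. \<Sum>a\<in>F. u a I)"
  by (rule symtI) (rule sum.cong, auto intro: symtD)

lemma symt_scaleR: "symt u \<Longrightarrow> symt (\<lambda>I. r *\<^sub>R u I)"
  by (rule symtI) (drule (1) symtD, simp)

lemma tensors_add: "u \<in> tensors j \<Longrightarrow> v \<in> tensors j \<Longrightarrow> (\<lambda>I. u I + v I) \<in> tensors j"
  by (simp add: tensors_def)

lemma tensors_scaleR: "u \<in> tensors j \<Longrightarrow> (\<lambda>I. r *\<^sub>R u I) \<in> tensors j"
  by (simp add: tensors_def)

lemma sym0_add: "u \<in> sym0 j \<Longrightarrow> v \<in> sym0 j \<Longrightarrow> (\<lambda>I. u I + v I) \<in> sym0 j"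
  by (simp add: sym0_iff tensors_add symt_add sum.distrib)

lemma sym0_scaleR: "u \<in> sym0 j \<Longrightarrow> (\<lambda>I. r *\<^sub>R u I) \<in> sym0 j"
  by (simp add: sym0_iff tensors_scaleR symt_scaleR flip: scaleR_sum_right)

lemma sym0_matvec: "u \<in> sym0 j \<Longrightarrow> (\<lambda>I. C *v u I) \<in> sym0 j"
  by (auto simp add: sym0_iff symt_matvec tensors_def matvec_0 simp flip: matvec_sum)

lemma sym0_0: "(\<lambda>I. 0) \<in> sym0 j"
  by (auto simp add: sym0_iff tensors_def intro: symtI)

lemma sym0_sum: "(\<And>a. a \<in> F \<Longrightarrow> u a \<in> sym0 j) \<Longrightarrow> (\<lambda>I. \<Sum>a\<in>F. u a I) \<in> sym0 j"
  by (induction F rule: infinite_finite_induct) (auto simp: sym0_0 sym0_add)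

text \<open>For symmetric \<open>u\<close>, changing the entry at one position depends only on that
  entry and the multiset of the others, so the action is again a sum over the multiset of
  indices.\<close>

lemma symt_lact:
  assumes "symt u"
  shows "symt (lact A u)"
proof -
  have e: "lact A u I = sum_list (map (\<lambda>x. \<Sum>b\<in>UNIV. A $ x $ b *\<^sub>R slot b u (remove1 x I)) I)" for I
  proof -
    have "lact A u I = (\<Sum>r<length I. \<Sum>b\<in>UNIV. A $ (I ! r) $ b *\<^sub>R slot b u (remove1 (I ! r) I))"
      unfolding lact_def slot_def
      by (intro sum.cong refl arg_cong2[of _ _ _ _ "(*\<^sub>R)"] symtD[OF assms]) (simp add: mset_update)
    then show ?thesis
      by (simp add: sum_list_sum_nth atLeast0LessThan)
  qed
  show ?thesis
    unfolding symt_def e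
    by (intro allI impI sum_list_remove1_cong[of "\<lambda>x J. \<Sum>b\<in>UNIV. A $ x $ b *\<^sub>R slot b u J"]
        symt_sum symt_scaleR symt_slot assms)
qed

lemma symt_drho: "symt u \<Longrightarrow> symt (drho cl A u)"
proof (rule symtI)
  fix I J :: "'a list"
  assume a: "symt u" "mset I = mset J"
  then show "drho cl A u I = drho cl A u J"
    unfolding drho_eq using symtD[OF a] symtD[OF symt_lact[OF a(1)] a(2)] by simp
qed

lemma cliff_add: "cliff cl (\<lambda>I. u I + v I) I = cliff cl u I + cliff cl v I"
  by (simp add: cliff_def matvec sum.distrib)

lemma cliff_scaleR: "cliff cl (\<lambda>I. r *\<^sub>R u I) I = r *\<^sub>R cliff cl u I"
  by (simp add: cliff_def matvec scaleR_sum_right)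

lemma cliff_0: "cliff cl (\<lambda>I. 0) I = 0"
  by (simp add: cliff_def matvec)

lemma cliff_clmul: "cliff cl u = clmul cl (\<lambda>k. slot k u)"
  by (simp add: cliff_def clmul_def slot_def)

lemma clsym_add: "clsym cl (\<lambda>I. u I + v I) I = clsym cl u I + clsym cl v I"
  by (simp add: clsym_def matvec ins_add)

lemma clsym_scaleR: "clsym cl (\<lambda>I. r *\<^sub>R u I) I = r *\<^sub>R clsym cl u I"
  by (simp add: clsym_def matvec ins_scaleR)

lemma clsym_0: "clsym cl (\<lambda>I. 0) I = 0"
  by (simp add: clsym_def matvec ins_0)

lemma cliff_tensors: "u \<in> tensors (Suc m) \<Longrightarrow> cliff cl u \<in> tensors m"
  by (simp add: tensors_def cliff_def matvec_0)

lemma cliff_tensors_0: "u \<in> tensors 0 \<Longrightarrow> cliff cl u = (\<lambda>I. 0)"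
  by (simp add: tensors_def cliff_def matvec_0)

lemma clsym_tensors:
  assumes "v \<in> tensors m"
  shows "clsym cl v \<in> tensors (Suc m)"
proof (rule tensorsI)
  fix I :: "'a list" assume "length I \<noteq> Suc m"
  then have "ins I (\<lambda>k J. cl k *v v J) = ins I (\<lambda>k J. 0)"
    by (intro ins_cong) (simp add: tensorsD[OF assms] matvec_0)
  then show "clsym cl v I = 0"
    by (simp add: clsym_def ins_0)
qed

section \<open>Clifford relations, the exchange rules and the fibres W_j\<close>

locale spinor_rep =
  fixes cl :: "'n::finite \<Rightarrow> complex ^ 's::finite ^ 's"
  assumes spinor: "spinor_module cl"
begin

text \<open>Oriented so that the second Clifford factor is moved to the front.\<close>

lemma cl_anticommute: "cl k *v (cl l *v u) = - (cl l *v (cl k *v u)) - (if k = l then 2 *\<^sub>R u else 0)"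
proof -
  have "cl k ** cl l + cl l ** cl k = (if k = l then mat (- 2) else 0)"
    using spinor by (simp add: spinor_module_def)
  moreover have "mat (- 2 :: complex) *v u = - (2 *\<^sub>R u)"
    by (simp add: vec_eq_iff matrix_vector_mult_def mat_def if_distrib[of "\<lambda>z. z * _"] cong: if_cong)
      (simp add: scaleR_conv_of_real)
  ultimately have "cl k *v (cl l *v u) + cl l *v (cl k *v u) = - (if k = l then 2 *\<^sub>R u else 0)"
    using matrix_vector_mult_add_rdistrib[of "cl k ** cl l" "cl l ** cl k" u]
    by (simp add: matrix_vector_mul_assoc split: if_splits)
  then have "cl k *v (cl l *v u) = - (if k = l then 2 *\<^sub>R u else 0) - cl l *v (cl k *v u)"
    by (simp only: eq_diff_eq)
  then show ?thesis
    by simp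
qed

lemma cl_sq: "cl k *v (cl k *v u) = - u"
proof -
  have "2 *\<^sub>R (cl k *v (cl k *v u) + u) = 0"
    using cl_anticommute[of k k u]
    by (simp only: refl if_True eq_diff_eq eq_neg_iff_add_eq_0 scaleR_2 scaleR_add_right ac_simps)
  then show ?thesis
    by (simp add: eq_neg_iff_add_eq_0)
qed

lemma hs_cl: "hs (cl k *v u) v = - hs u (cl k *v v)"
proof -
  have "(\<chi> a b. cnj (cl k $ b $ a)) = - cl k"
    using spinor by (simp add: spinor_module_def)
  then show ?thesis
    by (simp add: hs_adjoint uminus_matrix_vector_mult hs_minus_right)
qed

text \<open>Moving a fixed Clifford factor out of a contraction costs a sign and, from the one index
  where the factors coincide, twice the corresponding component. The exchange rules for
  \<open>cliff\<close> and \<open>clmul\<close> rest on this.\<close>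

lemma sum_cl_cl: "(\<Sum>k\<in>UNIV. cl k *v (cl l *v f k)) = - (cl l *v (\<Sum>k\<in>UNIV. cl k *v f k)) - 2 *\<^sub>R f l"
  unfolding cl_anticommute[of _ l] by (simp add: sum_subtractf sum_negf matvec)

lemma clmul_clsym: "clmul cl (\<lambda>k. clsym cl (\<Phi> k)) I = - clsym cl (clmul cl \<Phi>) I - 2 *\<^sub>R ins I \<Phi>"
proof -
  have "clmul cl (\<lambda>k. clsym cl (\<Phi> k)) I = ins I (\<lambda>l J. \<Sum>k\<in>UNIV. cl k *v (cl l *v \<Phi> k J))"
    by (simp add: clmul_def clsym_def ins_sum ins_matvec)
  then show ?thesis
    by (simp add: sum_cl_cl ins_diff ins_neg ins_scaleR clsym_def clmul_def)
qed

lemma dvg_clsym: "dvg (\<lambda>k. clsym cl (\<Phi> k)) I = clmul cl \<Phi> I + clsym cl (dvg \<Phi>) I"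
  by (simp add: dvg_def clsym_def clmul_def sum.distrib matvec ins_sum)

lemma cliff_clmul_swap: "cliff cl (clmul cl \<Phi>) I = - clmul cl (\<lambda>k. cliff cl (\<Phi> k)) I - 2 *\<^sub>R dvg \<Phi> I"
proof -
  have "cliff cl (clmul cl \<Phi>) I = (\<Sum>k\<in>UNIV. \<Sum>l\<in>UNIV. cl l *v (cl k *v \<Phi> k (l # I)))"
    unfolding cliff_def clmul_def by (simp add: matvec) (rule sum.swap)
  then show ?thesis
    by (simp add: sum_cl_cl sum_subtractf sum_negf clmul_def cliff_def dvg_def scaleR_sum_right)
qed

lemma cliff_clsym:
  "cliff cl (clsym cl v) I
    = - (real CARD('n) *\<^sub>R v I) - clsym cl (cliff cl v) I - 2 *\<^sub>R ins I (\<lambda>l J. v (l # J))"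
proof -
  have "cliff cl (clsym cl v) I = - (real CARD('n) *\<^sub>R v I) + ins I (\<lambda>l J. \<Sum>k\<in>UNIV. cl k *v (cl l *v v (k # J)))"
    by (simp add: cliff_def clsym_def matvec sum.distrib cl_sq sum_negf ins_sum ins_matvec sum_subtractf
        sum_constant_scaleR del: sum_constant)
  then show ?thesis
    by (simp add: sum_cl_cl ins_diff ins_neg ins_scaleR clsym_def cliff_def)
qed

lemma WfibD:
  assumes "u \<in> Wfib cl j"
  shows "u \<in> sym0 j" "symt u" "u \<in> tensors j" "cliff cl u I = 0" "(\<Sum>k\<in>UNIV. u (k # k # I)) = 0"
  using assms by (auto simp: Wfib_def sym0_iff)

lemma WfibI: "u \<in> sym0 j \<Longrightarrow> (\<And>I. cliff cl u I = 0) \<Longrightarrow> u \<in> Wfib cl j"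
  by (auto simp: Wfib_def)

lemma Wfib_add: "u \<in> Wfib cl j \<Longrightarrow> v \<in> Wfib cl j \<Longrightarrow> (\<lambda>I. u I + v I) \<in> Wfib cl j"
  by (intro WfibI sym0_add) (auto simp: WfibD cliff_add)

lemma Wfib_scaleR: "u \<in> Wfib cl j \<Longrightarrow> (\<lambda>I. r *\<^sub>R u I) \<in> Wfib cl j"
  by (intro WfibI sym0_scaleR) (auto simp: WfibD cliff_scaleR)

lemma Wfib_0: "(\<lambda>I. 0) \<in> Wfib cl j"
  by (intro WfibI sym0_0 cliff_0)

lemma Wfib_diff: "u \<in> Wfib cl j \<Longrightarrow> v \<in> Wfib cl j \<Longrightarrow> (\<lambda>I. u I - v I) \<in> Wfib cl j"
  using Wfib_add[OF _ Wfib_scaleR[of v j "-1"], of u] by simp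

lemma Wfib_Zero: "Wfib cl 0 = sym0 0"
  by (auto simp: Wfib_def sym0_iff cliff_tensors_0)

text \<open>Symmetry lets trace and Clifford contraction be taken in slots other than the fixed
  one.\<close>

lemma Wfib_slot:
  assumes "u \<in> Wfib cl (Suc j)"
  shows "slot k u \<in> Wfib cl j"
proof (rule WfibI)
  show "slot k u \<in> sym0 j"
    using WfibD[OF assms] symt_slot[OF WfibD(2)[OF assms], of k]
    by (auto simp: sym0_iff tensors_def slot_def symtD[OF WfibD(2)[OF assms], of "k # _ # _ # _" "_ # _ # k # _"])
  show "cliff cl (slot k u) I = 0" for I
    using WfibD(4)[OF assms, of "k # I"] by (simp add: cliff_def slot_def symt_swap[OF WfibD(2)[OF assms], of k])
qed

text \<open>Contracting twice pairs \<open>e_k e_l\<close> with a symmetric tensor, so only the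
  trace is left, and the trace vanishes.\<close>

lemma cliff_Wfib:
  assumes "u \<in> sym0 (Suc m)"
  shows "cliff cl u \<in> Wfib cl m"
proof -
  have u: "u \<in> tensors (Suc m)" "symt u" "\<And>I. (\<Sum>k\<in>UNIV. u (k # k # I)) = 0"
    using assms by (auto simp: sym0_iff)
  have "symt (cliff cl u)"
    unfolding cliff_clmul clmul_def by (intro symt_sum symt_matvec symt_slot u)
  moreover have "(\<Sum>k\<in>UNIV. cliff cl u (k # k # I)) = 0" for I
  proof -
    have "(\<Sum>k\<in>UNIV. cliff cl u (k # k # I)) = (\<Sum>l\<in>UNIV. cl l *v (\<Sum>k\<in>UNIV. u (l # k # k # I)))"
      unfolding cliff_def matvec by (rule sum.swap)
    also have "\<dots> = (\<Sum>l\<in>UNIV. cl l *v (\<Sum>k\<in>UNIV. u (k # k # l # I)))"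
      by (intro sum.cong refl arg_cong2[of _ _ _ _ "(*v)"] symtD[OF u(2)]) auto
    finally show ?thesis by (simp add: u(3) matvec)
  qed
  moreover have "cliff cl (cliff cl u) I = 0" for I
  proof -
    have "cliff cl (cliff cl u) I = - cliff cl (cliff cl u) I - 2 *\<^sub>R dvg (\<lambda>k. slot k u) I"
      using cliff_clmul_swap[of "\<lambda>k. slot k u" I]
      by (simp add: cliff_clmul) (simp add: clmul_def slot_def symt_swap[OF u(2)])
    then have "2 *\<^sub>R cliff cl (cliff cl u) I = 0"
      using u(3) by (simp add: dvg_def slot_def scaleR_2 eq_neg_iff_add_eq_0)
    then show ?thesis by simp
  qed
  ultimately show ?thesis
    using cliff_tensors[OF u(1), of cl] by (auto simp: Wfib_def sym0_iff fun_eq_iff)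
qed

text \<open>The trace of \<open>clsym cl v\<close> is twice \<open>cliff cl v\<close> plus the
  symmetrised Clifford product with the trace of \<open>v\<close>; both are zero in the
  fibre.\<close>

lemma clsym_sym0:
  assumes "v \<in> Wfib cl m"
  shows "clsym cl v \<in> sym0 (Suc m)"
proof -
  have "(\<Sum>k\<in>UNIV. clsym cl v (k # k # I)) = 2 *\<^sub>R cliff cl v I + ins I (\<lambda>l J. cl l *v (\<Sum>k\<in>UNIV. v (k # k # J)))" for I
    by (simp add: clsym_def cliff_def sum.distrib matvec ins_sum scaleR_2 scaleR_sum_right)
  then show ?thesis
    using WfibD[OF assms] by (simp add: sym0_iff clsym_tensors symt_clsym matvec_0 ins_0)
qed

lemma cliff_clsym_Wfib:
  assumes "v \<in> Wfib cl m"
  shows "cliff cl (clsym cl v) I = - ((real CARD('n) + 2 * real m) *\<^sub>R v I)"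
proof -
  \<comment> \<open>On lists of any other length \<open>v\<close> vanishes, so the length may be
    replaced by \<open>m\<close>.\<close>
  have l: "real (length I) *\<^sub>R v I = real m *\<^sub>R v I"
    using tensorsD[OF WfibD(3)[OF assms], of I] by (cases "length I = m") auto
  have c: "cliff cl v = (\<lambda>I. 0)"
    using assms by (simp add: Wfib_def)
  show ?thesis
    unfolding cliff_clsym ins_slot[OF WfibD(2)[OF assms]] l c clsym_0 by (simp add: algebra_simps)
qed

text \<open>The coefficient is \<open>n + 2 m\<close>, from \<open>cliff\<close> after
  \<open>clsym\<close>, lowered by \<open>2\<close> through \<open>dvg_clsym\<close>. It becomes the
  numerator of \<open>kap m\<close> when \<open>\<Phi>\<close> is a covariant derivative.\<close>

lemma cliff_clmul_clsym:
  assumes "\<And>k. \<Phi> k \<in> Wfib cl m"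
  shows "cliff cl (clmul cl (\<lambda>k. clsym cl (\<Phi> k))) I
    = (real CARD('n) + 2 * real m - 2) *\<^sub>R clmul cl \<Phi> I - 2 *\<^sub>R clsym cl (dvg \<Phi>) I"
proof -
  have e: "clmul cl (\<lambda>k. cliff cl (clsym cl (\<Phi> k))) I = - ((real CARD('n) + 2 * real m) *\<^sub>R clmul cl \<Phi> I)"
    by (simp add: clmul_def cliff_clsym_Wfib[OF assms] matvec sum_negf scaleR_sum_right)
  show ?thesis
    unfolding cliff_clmul_swap dvg_clsym e by (simp add: algebra_simps)
qed

text \<open>Skewness of Clifford multiplication accounts for the sign and \<open>herm_ins\<close>
  for the factor.\<close>

lemma herm_clsym:
  assumes "symt w"
  shows "herm (Suc m) (clsym cl v) w = - (real (Suc m) *\<^sub>R herm m v (cliff cl w))"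
proof -
  have "herm m (\<lambda>J. cl k *v v J) (slot k w) = - herm m v (\<lambda>I. cl k *v w (k # I))" for k
    by (simp add: herm_eq hs_cl sum_negf slot_def)
  then show ?thesis
    unfolding clsym_def herm_ins[OF assms] by (simp add: cliff_def herm_sum_right sum_negf)
qed

text \<open>The commutator with Clifford multiplication by \<open>e_k\<close> is multiplication by
  \<open>A e_k\<close>, the differential of the covering relation \<open>s v = (A v) s\<close>.
  Anticommuting \<open>e_k\<close> past two factors yields \<open>2\<close> twice, which the factor
  \<open>1 / 4\<close> normalises.\<close>

lemma sigm_cl:
  assumes "transpose A = - A"
  shows "sigm cl A (cl k *v u) = cl k *v sigm cl A u + (\<Sum>b\<in>UNIV. A $ b $ k *\<^sub>R (cl b *v u))"
proof -
  have s: "A $ k $ b = - A $ b $ k" for b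
    using arg_cong[OF assms, of "\<lambda>B. B $ b $ k"] by (simp add: transpose_def)
  have c: "cl b *v (cl a *v (cl k *v u)) = cl k *v (cl b *v (cl a *v u))
      + (if b = k then 2 else 0) *\<^sub>R (cl a *v u) - (if a = k then 2 else 0) *\<^sub>R (cl b *v u)" for a b
    using cl_anticommute[of a k u] cl_anticommute[of b k "cl a *v u"] by (auto simp: matvec)
  have "sigm cl A (cl k *v u) = cl k *v sigm cl A u
      + (1 / 4) *\<^sub>R ((\<Sum>a\<in>UNIV. A $ a $ k *\<^sub>R 2 *\<^sub>R (cl a *v u)) - (\<Sum>b\<in>UNIV. A $ k $ b *\<^sub>R 2 *\<^sub>R (cl b *v u)))"
  proof -
    have "(\<Sum>a\<in>UNIV. \<Sum>b\<in>UNIV. A $ a $ b *\<^sub>R (if b = k then 2 else 0) *\<^sub>R (cl a *v u))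
        = (\<Sum>a\<in>UNIV. A $ a $ k *\<^sub>R 2 *\<^sub>R (cl a *v u))"
      by (intro sum.cong refl) (simp add: if_distrib[of "\<lambda>r. _ *\<^sub>R r *\<^sub>R _"] if_distrib[of "\<lambda>r. _ *\<^sub>R r"] if_distrib[of "\<lambda>r. r *\<^sub>R _"] cong: if_cong)
    moreover have "(\<Sum>a\<in>UNIV. \<Sum>b\<in>UNIV. A $ a $ b *\<^sub>R (if a = k then 2 else 0) *\<^sub>R (cl b *v u))
        = (\<Sum>b\<in>UNIV. A $ k $ b *\<^sub>R 2 *\<^sub>R (cl b *v u))"
      by (subst sum.swap, intro sum.cong refl) (simp add: if_distrib[of "\<lambda>r. _ *\<^sub>R r"] if_distrib[of "\<lambda>r. r *\<^sub>R _"] cong: if_cong)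
    ultimately show ?thesis
      unfolding sigm_def c
      by (simp only: scaleR_add_right scaleR_diff_right sum.distrib sum_subtractf matvec) simp
  qed
  also have "(\<Sum>b\<in>UNIV. A $ k $ b *\<^sub>R 2 *\<^sub>R (cl b *v u)) = (\<Sum>b\<in>UNIV. - A $ b $ k *\<^sub>R 2 *\<^sub>R (cl b *v u))"
    by (intro sum.cong refl arg_cong2[of _ _ _ _ "(*\<^sub>R)"] s)
  finally show ?thesis
    by (simp add: sum_negf scaleR_sum_right)
qed

lemma hs_sigm:
  assumes "transpose A = - A"
  shows "hs (sigm cl A u) v = - hs u (sigm cl A v)"
proof -
  have s: "A $ b $ a = - A $ a $ b" for a b
    using arg_cong[OF assms, of "\<lambda>B. B $ a $ b"] by (simp add: transpose_def)
  have "(\<Sum>a\<in>UNIV. \<Sum>b\<in>UNIV. A $ a $ b *\<^sub>R hs u (cl a *v (cl b *v v)))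
      = (\<Sum>b\<in>UNIV. \<Sum>a\<in>UNIV. A $ a $ b *\<^sub>R hs u (cl a *v (cl b *v v)))"
    by (rule sum.swap)
  also have "\<dots> = (\<Sum>b\<in>UNIV. \<Sum>a\<in>UNIV. (- A $ b $ a) *\<^sub>R hs u (cl a *v (cl b *v v)))"
    by (intro sum.cong refl arg_cong2[of _ _ _ _ "(*\<^sub>R)"] s)
  finally show ?thesis
    by (simp add: sigm_def hs_simps hs_cl sum_negf)
qed

lemma herm_drho:
  assumes "transpose A = - A"
  shows "herm j (drho cl A u) v = - herm j u (drho cl A v)"
proof -
  have d: "drho cl A w = (\<lambda>I. sigm cl A (w I) + lact A w I)" for w
    by (simp add: fun_eq_iff drho_eq)
  have "herm j (\<lambda>I. sigm cl A (u I)) v = - herm j u (\<lambda>I. sigm cl A (v I))"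
    by (simp add: herm_eq hs_sigm[OF assms] sum_negf)
  then show ?thesis
    unfolding d herm_add_left herm_add_right by (simp add: herm_lact[OF assms])
qed

text \<open>By \<open>sigm_cl\<close> the operator \<open>sigm cl A\<close> is a derivation on the
  two Clifford factors in \<open>sigm cl B\<close>; the two resulting sums assemble into the entries
  of the matrix commutator.\<close>

lemma sigm_commutator:
  assumes "transpose A = - A" "transpose B = - B"
  shows "sigm cl A (sigm cl B u) - sigm cl B (sigm cl A u) = sigm cl (A ** B - B ** A) u"
proof -
  have sA: "A $ b $ a = - A $ a $ b" and sB: "B $ b $ a = - B $ a $ b" for a b
    using arg_cong[OF assms(1), of "\<lambda>B. B $ a $ b"] arg_cong[OF assms(2), of "\<lambda>B. B $ a $ b"]
    by (simp_all add: transpose_def)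
  have sA': "B $ a $ b * A $ c $ b = - (B $ a $ b * A $ b $ c)" for a b c
    using sA[of c b] by simp
  have "sigm cl A (sigm cl B u) = (1 / 4) *\<^sub>R (\<Sum>a\<in>UNIV. \<Sum>b\<in>UNIV. B $ a $ b *\<^sub>R
      (cl b *v (cl a *v sigm cl A u) + (\<Sum>c\<in>UNIV. A $ c $ a *\<^sub>R (cl b *v (cl c *v u)))
       + (\<Sum>c\<in>UNIV. A $ c $ b *\<^sub>R (cl c *v (cl a *v u)))))"
    unfolding sigm_def[of cl B] sigm_scaleR sigm_sum sigm_cl[OF assms(1)] matvec by (simp add: add.assoc)
  also have "\<dots> = sigm cl B (sigm cl A u)
      + (1 / 4) *\<^sub>R ((\<Sum>a\<in>UNIV. \<Sum>b\<in>UNIV. \<Sum>c\<in>UNIV. (B $ a $ b * A $ c $ a) *\<^sub>R (cl b *v (cl c *v u)))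
       + (\<Sum>a\<in>UNIV. \<Sum>b\<in>UNIV. \<Sum>c\<in>UNIV. (B $ a $ b * A $ c $ b) *\<^sub>R (cl c *v (cl a *v u))))"
    by (simp add: sigm_def[of cl B] scaleR_add_right sum.distrib scaleR_sum_right)
  also have "(\<Sum>a\<in>UNIV. \<Sum>b\<in>UNIV. \<Sum>c\<in>UNIV. (B $ a $ b * A $ c $ a) *\<^sub>R (cl b *v (cl c *v u)))
      = (\<Sum>c\<in>UNIV. \<Sum>b\<in>UNIV. (\<Sum>a\<in>UNIV. A $ c $ a * B $ a $ b) *\<^sub>R (cl b *v (cl c *v u)))"
    unfolding scaleR_sum_left by (subst sum_swap3) (simp add: mult.commute)
  also have "(\<Sum>a\<in>UNIV. \<Sum>b\<in>UNIV. \<Sum>c\<in>UNIV. (B $ a $ b * A $ c $ b) *\<^sub>R (cl c *v (cl a *v u)))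
      = (\<Sum>a\<in>UNIV. \<Sum>c\<in>UNIV. (- (\<Sum>b\<in>UNIV. B $ a $ b * A $ b $ c)) *\<^sub>R (cl c *v (cl a *v u)))"
    unfolding scaleR_sum_left sum_negf[symmetric]
    by (rule sum.cong[OF refl], subst sum.swap, intro sum.cong refl arg_cong2[of _ _ _ _ "(*\<^sub>R)"] sA')
  finally show ?thesis
    by (simp add: sigm_def[of cl "_ - _"] matrix_matrix_mult_def sum_subtractf scaleR_diff_left sum_negf)
qed

lemma drho_commutator:
  assumes "transpose A = - A" "transpose B = - B"
  shows "drho cl A (drho cl B u) I - drho cl B (drho cl A u) I = drho cl (A ** B - B ** A) u I"
proof -
  have d: "drho cl A w = (\<lambda>I. sigm cl A (w I) + lact A w I)" for A w
    by (simp add: fun_eq_iff drho_eq)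
  have "lact A (\<lambda>I. sigm cl B (u I)) I = sigm cl B (lact A u I)" for A B
    by (simp add: sigm_def lact_sum lact_scaleR lact_matvec)
  then show ?thesis
    unfolding d using sigm_commutator[OF assms, of "u I"] lact_commutator[of A B u I]
    by (simp add: lact_add sigm_add algebra_simps)
qed

lemma drho_clmul:
  assumes "transpose A = - A"
  shows "drho cl A (clmul cl \<Phi>) I = clmul cl (\<lambda>k J. drho cl A (\<Phi> k) J + (\<Sum>b\<in>UNIV. A $ k $ b *\<^sub>R \<Phi> b J)) I"
proof -
  have "drho cl A (\<lambda>J. cl k *v \<Phi> k J) I = cl k *v drho cl A (\<Phi> k) I + (\<Sum>b\<in>UNIV. A $ b $ k *\<^sub>R (cl b *v \<Phi> k I))" for k
    by (simp add: drho_eq lact_matvec sigm_cl[OF assms] matvec)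
  moreover have "(\<Sum>k\<in>UNIV. \<Sum>b\<in>UNIV. A $ b $ k *\<^sub>R (cl b *v \<Phi> k I)) = (\<Sum>k\<in>UNIV. \<Sum>b\<in>UNIV. A $ k $ b *\<^sub>R (cl k *v \<Phi> b I))"
    by (rule sum.swap)
  ultimately show ?thesis
    by (simp add: clmul_def drho_sum matvec sum.distrib)
qed

text \<open>The rotation of the contracted tensor index compensates that of the Clifford
  factor.\<close>

lemma drho_cliff:
  assumes "transpose A = - A"
  shows "drho cl A (cliff cl u) I = cliff cl (drho cl A u) I"
  unfolding cliff_clmul drho_clmul[OF assms] by (simp add: clmul_def slot_def[of _ "drho cl A u"] drho_Cons)
    (simp add: slot_def)

lemma drho_clsym:
  assumes "transpose A = - A"
  shows "drho cl A (clsym cl v) I = clsym cl (drho cl A v) I"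
proof -
  have s: "A $ k $ b = - A $ b $ k" for b k
    using arg_cong[OF assms, of "\<lambda>B. B $ b $ k"] by (simp add: transpose_def)
  have "drho cl A (\<lambda>J. cl k *v v J) J + (\<Sum>b\<in>UNIV. A $ k $ b *\<^sub>R (cl b *v v J)) = cl k *v drho cl A v J" for k J
  proof -
    have "(\<Sum>b\<in>UNIV. A $ k $ b *\<^sub>R (cl b *v v J)) = (\<Sum>b\<in>UNIV. (- A $ b $ k) *\<^sub>R (cl b *v v J))"
      by (intro sum.cong refl arg_cong2[of _ _ _ _ "(*\<^sub>R)"] s)
    then show ?thesis
      by (simp add: drho_eq lact_matvec sigm_cl[OF assms] matvec sum_negf)
  qed
  then show ?thesis
    unfolding clsym_def drho_ins by simp
qed

end

section \<open>Explicit projection to W_j, its complement and the isometric identification\<close>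

locale spinor_rep3 = spinor_rep cl for cl :: "'n::finite \<Rightarrow> complex ^ 's::finite ^ 's" +
  fixes dm :: real
  assumes dm_def: "dm = real CARD('n)" and card3: "dm \<ge> 3"
begin

lemma dm_pos: "dm + 2 * real m > 0" "dm > 0" "dm + 2 * real m - 2 > 0"
  using card3 by auto

lemmas cliff_clsym_dm = cliff_clsym_Wfib[folded dm_def]

text \<open>Two candidates for the projection differ by an element of the fibre that is orthogonal
  to the fibre, hence to itself.\<close>

lemma prW_unique:
  assumes "w \<in> Wfib cl j" "\<And>w'. w' \<in> Wfib cl j \<Longrightarrow> herm j (\<lambda>I. u I - w I) w' = 0"
  shows "prW cl j u = w"
  unfolding prW_def
proof (rule the_equality)
  show "w \<in> Wfib cl j \<and> (\<forall>w'\<in>Wfib cl j. herm j (\<lambda>I. u I - w I) w' = 0)"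
    using assms by blast
  fix v assume v: "v \<in> Wfib cl j \<and> (\<forall>w'\<in>Wfib cl j. herm j (\<lambda>I. u I - v I) w' = 0)"
  let ?d = "\<lambda>I. v I - w I"
  have d: "?d \<in> Wfib cl j"
    using v assms(1) Wfib_diff by blast
  have "herm j ?d ?d = herm j (\<lambda>I. u I - w I) ?d - herm j (\<lambda>I. u I - v I) ?d"
    unfolding herm_diff_left by simp
  also have "\<dots> = 0"
    using v d assms(2) by simp
  finally have "?d = (\<lambda>I. 0)"
    using herm_self_eq_0D WfibD(3)[OF d] by blast
  then show "v = w"
    by (metis eq_iff_diff_eq_0 ext)
qed

lemma prW_Zero: "u \<in> sym0 0 \<Longrightarrow> prW cl 0 u = u"
  by (rule prW_unique) (simp_all add: Wfib_Zero herm_0_left)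

text \<open>The coefficient is forced by \<open>cliff\<close> after \<open>clsym\<close> being the
  scalar \<open>-(n + 2 m)\<close>; the correction is orthogonal to the kernel of
  \<open>cliff\<close> by adjointness.\<close>

lemma prW_Suc:
  assumes "u \<in> sym0 (Suc m)"
  shows "prW cl (Suc m) u = (\<lambda>I. u I + (1 / (dm + 2 * real m)) *\<^sub>R clsym cl (cliff cl u) I)" (is "_ = ?w")
    and "prW cl (Suc m) u \<in> Wfib cl (Suc m)"
proof -
  have c: "cliff cl u \<in> Wfib cl m"
    by (rule cliff_Wfib[OF assms])
  have w: "?w \<in> Wfib cl (Suc m)"
  proof (rule WfibI)
    show "?w \<in> sym0 (Suc m)"
      by (intro sym0_add sym0_scaleR assms clsym_sym0 c)
    show "cliff cl ?w I = 0" for I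
      using dm_pos(1)[of m] by (simp add: cliff_add cliff_scaleR cliff_clsym_dm[OF c])
  qed
  show e: "prW cl (Suc m) u = ?w"
  proof (rule prW_unique[OF w])
    fix w' assume w': "w' \<in> Wfib cl (Suc m)"
    have "cliff cl w' = (\<lambda>I. 0)"
      using w' by (simp add: Wfib_def)
    then have "herm (Suc m) (clsym cl (cliff cl u)) w' = 0"
      by (simp add: herm_clsym[OF WfibD(2)[OF w']] herm_0_right)
    then have "herm (Suc m) (\<lambda>I. (- 1 / (dm + 2 * real m)) *\<^sub>R clsym cl (cliff cl u) I) w' = 0"
      by (simp only: herm_scaleR_left) simp
    then show "herm (Suc m) (\<lambda>I. u I - ?w I) w' = 0"
      by simp
  qed
  show "prW cl (Suc m) u \<in> Wfib cl (Suc m)"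
    unfolding e by (rule w)
qed

lemma prW_Wfib: "u \<in> sym0 j \<Longrightarrow> prW cl j u \<in> Wfib cl j"
  using prW_Suc(2) by (cases j) (auto simp: prW_Zero Wfib_Zero)

lemma prW_id: "w \<in> Wfib cl j \<Longrightarrow> prW cl j w = w"
  by (rule prW_unique) (simp_all add: herm_0_left)

lemma herm_prW:
  assumes "u \<in> sym0 j" "w \<in> Wfib cl j"
  shows "herm j (prW cl j u) w = herm j u w"
proof (cases j)
  case 0
  then show ?thesis using assms(1) by (simp add: prW_Zero)
next
  case (Suc m)
  have "cliff cl w = (\<lambda>I. 0)"
    using assms by (simp add: Wfib_def)
  then show ?thesis
    using assms WfibD(2)[OF assms(2)] unfolding Suc
    by (simp add: prW_Suc herm_add_left herm_scaleR_left herm_clsym herm_0_right)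
qed

lemma Wdecomp_prW:
  assumes "w \<in> Wfib cl (Suc m)" "v \<in> Wfib cl m"
  shows "prW cl (Suc m) (\<lambda>I. w I + r *\<^sub>R clsym cl v I) = w"
proof (rule prW_unique[OF assms(1)])
  fix w' assume w': "w' \<in> Wfib cl (Suc m)"
  have "cliff cl w' = (\<lambda>I. 0)"
    using w' by (simp add: Wfib_def)
  then have "herm (Suc m) (\<lambda>I. r *\<^sub>R clsym cl v I) w' = 0"
    by (simp add: herm_scaleR_left herm_clsym[OF WfibD(2)[OF w']] herm_0_right)
  then show "herm (Suc m) (\<lambda>I. w I + r *\<^sub>R clsym cl v I - w I) w' = 0"
    by simp
qed

lemma Wdecomp_cliff:
  assumes "w \<in> Wfib cl (Suc m)" "v \<in> Wfib cl m"
  shows "cliff cl (\<lambda>I. w I + r *\<^sub>R clsym cl v I) I = - ((r * (dm + 2 * real m)) *\<^sub>R v I)"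
  by (simp add: cliff_add cliff_scaleR WfibD(4)[OF assms(1)] cliff_clsym_dm[OF assms(2)])

text \<open>\<open>prW\<close> recovers the first component and \<open>cliff\<close> the second.
  This is the device for comparing blocks of the squared Dirac operator.\<close>

lemma Wdecomp_unique:
  assumes "w \<in> Wfib cl (Suc m)" "v \<in> Wfib cl m" "w' \<in> Wfib cl (Suc m)" "v' \<in> Wfib cl m"
    and "\<And>I. w I + clsym cl v I = w' I + clsym cl v' I"
  shows "w = w'" "v = v'"
proof -
  have e: "(\<lambda>I. w I + 1 *\<^sub>R clsym cl v I) = (\<lambda>I. w' I + 1 *\<^sub>R clsym cl v' I)"
    using assms(5) by simp
  show "w = w'"
    using arg_cong[OF e, of "prW cl (Suc m)"] unfolding Wdecomp_prW[OF assms(1,2)] Wdecomp_prW[OF assms(3,4)] .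
  have "(dm + 2 * real m) *\<^sub>R v I = (dm + 2 * real m) *\<^sub>R v' I" for I
    using arg_cong[OF e, of "\<lambda>u. cliff cl u I"]
    unfolding Wdecomp_cliff[OF assms(1,2)] Wdecomp_cliff[OF assms(3,4)] by simp
  then show "v = v'"
    using dm_pos(1)[of m] by (auto simp: scaleR_cancel_left)
qed

lemma Wcompl_eq:
  assumes "u \<in> Wcompl cl (Suc m)"
  shows "u I = (- 1 / (dm + 2 * real m)) *\<^sub>R clsym cl (cliff cl u) I"
proof -
  have u: "u \<in> sym0 (Suc m)" "\<And>w. w \<in> Wfib cl (Suc m) \<Longrightarrow> herm (Suc m) u w = 0"
    using assms by (auto simp: Wcompl_def)
  have "prW cl (Suc m) u = (\<lambda>I. 0)"
    by (rule prW_unique) (simp_all add: Wfib_0 u)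
  from fun_cong[OF this, of I] show ?thesis
    by (simp add: prW_Suc[OF u(1)] eq_neg_iff_add_eq_0)
qed

lemma clsym_Wcompl:
  assumes "v \<in> Wfib cl m"
  shows "(\<lambda>I. r *\<^sub>R clsym cl v I) \<in> Wcompl cl (Suc m)"
proof -
  have "herm (Suc m) (\<lambda>I. r *\<^sub>R clsym cl v I) w = 0" if w: "w \<in> Wfib cl (Suc m)" for w
  proof -
    have "cliff cl w = (\<lambda>I. 0)"
      using w by (simp add: Wfib_def)
    then show ?thesis
      by (simp add: herm_scaleR_left herm_clsym[OF WfibD(2)[OF w]] herm_0_right)
  qed
  then show ?thesis
    unfolding Wcompl_def by (simp add: sym0_scaleR clsym_sym0[OF assms])
qed

text \<open>The element is the power of a null vector \<open>e\<^sub>0 + \<i> e\<^sub>1\<close> tensored with a spinor which it annihilates.\<close>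

lemma Wfib_nonzero: "\<exists>v\<in>Wfib cl m. v \<noteq> (\<lambda>I. 0)"
proof -
  obtain k0 k1 :: 'n where k: "k0 \<noteq> k1"
    using card3 card_le_Suc0_iff_eq[of "UNIV :: 'n set"] unfolding dm_def by fastforce
  define Z where "Z u = cl k0 *v u + \<i> *s (cl k1 *v u)" for u
  have ZZ: "Z (Z u) = 0" for u
    using cl_anticommute[of k1 k0 u] k
    by (simp add: Z_def matvec vector_scalar_commute cl_sq vec.scale_right_distrib)
  obtain p where p: "Z p \<noteq> 0"
  proof (rule ccontr)
    assume n: "\<not> thesis"
    then have z: "Z u = 0" for u
      using that by blast
    define e :: "complex ^ 's" where "e = axis undefined 1"
    \<comment> \<open>The anticommutator of \<open>cl k0\<close> and \<open>Z\<close> is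
      \<open>-2\<close>, which is impossible if \<open>Z\<close> vanishes identically.\<close>
    have "cl k0 *v Z e + Z (cl k0 *v e) = - e - e"
      using k by (simp add: Z_def matvec vector_scalar_commute cl_sq cl_anticommute[of k1 k0 e])
    from arg_cong[OF this, of "\<lambda>v. v $ undefined"] show False
      by (simp add: z matvec_0 e_def axis_def)
  qed
  define z where "z k = (if k = k0 then 1 else if k = k1 then \<i> else 0)" for k
  define v where "v I = (if length I = m then prod_list (map z I) *s Z p else 0)" for I
  have sz: "(\<Sum>k\<in>UNIV. z k *s f k) = f k0 + \<i> *s f k1" for f :: "'n \<Rightarrow> complex ^ 's"
  proof -
    have "(\<Sum>k\<in>UNIV. z k *s f k) = (\<Sum>k\<in>{k0, k1}. z k *s f k)"
      by (rule sum.mono_neutral_right) (auto simp: z_def)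
    then show ?thesis using k by (simp add: z_def)
  qed
  have "symt v"
  proof (rule symtI)
    fix I J :: "'n list" assume e: "mset I = mset J"
    then have "prod_list (map z I) = prod_list (map z J)"
      by (simp add: prod_mset_prod_list[symmetric])
    then show "v I = v J"
      using mset_eq_length[OF e] by (simp add: v_def)
  qed
  moreover have "(\<Sum>k\<in>UNIV. v (k # k # I)) = 0" for I
  proof (cases "Suc (Suc (length I)) = m")
    case True
    then have "(\<Sum>k\<in>UNIV. v (k # k # I)) = (\<Sum>k\<in>UNIV. z k *s (z k *s (prod_list (map z I) *s Z p)))"
      by (simp add: v_def mult.assoc)
    then show ?thesis
      unfolding sz using k by (simp add: z_def)
  qed (simp add: v_def)
  moreover have "cliff cl v I = 0" for I
  proof (cases "Suc (length I) = m")
    case True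
    then have "cliff cl v I = (\<Sum>k\<in>UNIV. z k *s (prod_list (map z I) *s (cl k *v Z p)))"
      by (simp add: v_def cliff_def vector_scalar_commute mult.assoc)
    also have "\<dots> = prod_list (map z I) *s Z (Z p)"
      unfolding sz Z_def[of "Z p"] by (simp add: vec.scale_right_distrib mult.commute)
    finally show ?thesis
      by (simp add: ZZ)
  qed (simp add: v_def cliff_def matvec_0)
  ultimately have "v \<in> Wfib cl m"
    by (intro WfibI) (auto simp: sym0_iff tensors_def v_def)
  moreover have "v (replicate m k0) \<noteq> 0"
    using p by (simp add: v_def z_def)
  ultimately show ?thesis
    by (intro bexI[of _ v] notI) auto
qed

text \<open>By \<open>herm_Wcompl\<close> the contraction \<open>cliff\<close> divides norms on the
  complement by \<open>pcon m\<close>, so multiplying by \<open>pcon m\<close> makes it isometric.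
  \<open>qcon m\<close> is the coefficient with which \<open>clsym\<close> inverts this isometry; it
  is negative because \<open>cliff\<close> after \<open>clsym\<close> is.\<close>

definition pcon :: "nat \<Rightarrow> real" where
  "pcon m = sqrt ((real m + 1) / (dm + 2 * real m))"

definition qcon :: "nat \<Rightarrow> real" where
  "qcon m = - 1 / sqrt ((real m + 1) * (dm + 2 * real m))"

lemma pcon_qcon: "pcon m > 0" "pcon m * qcon m = - 1 / (dm + 2 * real m)" "qcon m \<noteq> 0"
  "- qcon m * (real m + 1) = pcon m" "(pcon m)\<^sup>2 = (real m + 1) / (dm + 2 * real m)"
proof -
  let ?b = "dm + 2 * real m"
  have b: "?b > 0" by (rule dm_pos)
  have s: "sqrt (real m + 1) * sqrt (real m + 1) = real m + 1" "sqrt ?b * sqrt ?b = ?b"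
    using b by auto
  have n: "sqrt (real m + 1) \<noteq> 0" "sqrt ?b \<noteq> 0"
    using b by auto
  show "pcon m > 0" using b by (simp add: pcon_def)
  show "qcon m \<noteq> 0" using b by (simp add: qcon_def)
  have xy: "x / y * (- 1 / (x * y)) = - 1 / (y * y)" "- (- 1 / (x * y)) * (x * x) = x / y"
    if "x \<noteq> 0" "y \<noteq> 0" for x y :: real
    using that by (simp_all add: field_simps)
  show "pcon m * qcon m = - 1 / ?b"
    using xy(1)[OF n] unfolding pcon_def qcon_def real_sqrt_mult real_sqrt_divide s(2) .
  show "- qcon m * (real m + 1) = pcon m"
    using xy(2)[OF n] unfolding pcon_def qcon_def real_sqrt_mult real_sqrt_divide s(1) .
  show "(pcon m)\<^sup>2 = (real m + 1) / ?b"
    unfolding pcon_def using b by simp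
qed

text \<open>Expressing one copy of \<open>u\<close> through \<open>clsym\<close> of its contraction
  and moving \<open>clsym\<close> to the other side produces the ratio
  \<open>(m + 1) / (n + 2 m)\<close>.\<close>

lemma herm_Wcompl:
  assumes "u \<in> Wcompl cl (Suc m)"
  shows "herm (Suc m) u u = of_real ((pcon m)\<^sup>2) * herm m (cliff cl u) (cliff cl u)"
proof -
  have "u \<in> sym0 (Suc m)"
    using assms by (simp add: Wcompl_def)
  then have "symt u"
    by (simp add: sym0_iff)
  have "u = (\<lambda>I. (- 1 / (dm + 2 * real m)) *\<^sub>R clsym cl (cliff cl u) I)"
    using Wcompl_eq[OF assms] by blast
  then have "herm (Suc m) u u = (- 1 / (dm + 2 * real m)) *\<^sub>R herm (Suc m) (clsym cl (cliff cl u)) u"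
    by (metis herm_scaleR_left)
  then show ?thesis
    unfolding herm_clsym[OF \<open>symt u\<close>] pcon_qcon(5)
    by (simp add: scaleR_conv_of_real algebra_simps add_divide_distrib)
qed

text \<open>For uniqueness the norm identity is tested on a nonzero element of the complement,
  namely \<open>clsym\<close> of a nonzero element of the fibre of degree \<open>m\<close>.\<close>

lemma ident_const_eq: "ident_const cl (Suc m) = pcon m"
  unfolding ident_const_def
proof (rule the_equality)
  have h: "herm m (\<lambda>I. a *\<^sub>R cliff cl u I) (\<lambda>I. a *\<^sub>R cliff cl u I) = of_real (a\<^sup>2) * herm m (cliff cl u) (cliff cl u)" for a u
    unfolding herm_scaleR_left herm_scaleR_right by (simp add: scaleR_conv_of_real power2_eq_square)
  show "pcon m > 0 \<and> (\<forall>u\<in>Wcompl cl (Suc m). herm (Suc m - 1) (\<lambda>I. pcon m *\<^sub>R cliff cl u I)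
      (\<lambda>I. pcon m *\<^sub>R cliff cl u I) = herm (Suc m) u u)"
    by (simp add: pcon_qcon(1) h herm_Wcompl)
  fix a assume a: "a > 0 \<and> (\<forall>u\<in>Wcompl cl (Suc m). herm (Suc m - 1) (\<lambda>I. a *\<^sub>R cliff cl u I)
      (\<lambda>I. a *\<^sub>R cliff cl u I) = herm (Suc m) u u)"
  obtain v where v: "v \<in> Wfib cl m" "v \<noteq> (\<lambda>I. 0)"
    using Wfib_nonzero by blast
  define u where "u = (\<lambda>I. 1 *\<^sub>R clsym cl v I)"
  have u: "u \<in> Wcompl cl (Suc m)"
    unfolding u_def by (rule clsym_Wcompl[OF v(1)])
  have cu: "cliff cl u = (\<lambda>I. (- (dm + 2 * real m)) *\<^sub>R v I)"
    by (simp add: u_def fun_eq_iff cliff_clsym_dm[OF v(1)] flip: scaleR_minus_left)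
  have "herm m (cliff cl u) (cliff cl u) \<noteq> 0"
  proof
    assume "herm m (cliff cl u) (cliff cl u) = 0"
    then have "herm m v v = 0"
      using dm_pos(1)[of m] unfolding cu herm_scaleR_left herm_scaleR_right by simp
    then show False
      using herm_self_eq_0D WfibD(3)[OF v(1)] v(2) by blast
  qed
  moreover have "herm m (\<lambda>I. a *\<^sub>R cliff cl u I) (\<lambda>I. a *\<^sub>R cliff cl u I) = herm (Suc m) u u"
    using a u by simp
  ultimately have "complex_of_real (a\<^sup>2) = complex_of_real ((pcon m)\<^sup>2)"
    unfolding h herm_Wcompl[OF u] mult_right_cancel[OF \<open>herm m (cliff cl u) (cliff cl u) \<noteq> 0\<close>] by simp
  then have "a\<^sup>2 = (pcon m)\<^sup>2"
    by (simp only: of_real_eq_iff)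
  then show "a = pcon m"
    using a pcon_qcon(1)[of m] by (simp add: power2_eq_iff)
qed

lemma ident_eq: "ident cl (Suc m) u = (\<lambda>I. pcon m *\<^sub>R cliff cl u I)"
  by (simp add: ident_def ident_const_eq)

lemma ident_inv_eq:
  assumes "v \<in> Wfib cl m"
  shows "ident_inv cl (Suc m) v = (\<lambda>I. qcon m *\<^sub>R clsym cl v I)"
  unfolding ident_inv_def
proof (rule inv_into_f_eq)
  show "inj_on (ident cl (Suc m)) (Wcompl cl (Suc m))"
  proof (rule inj_onI)
    fix u u' assume u: "u \<in> Wcompl cl (Suc m)" "u' \<in> Wcompl cl (Suc m)" "ident cl (Suc m) u = ident cl (Suc m) u'"
    have "pcon m *\<^sub>R cliff cl u I = pcon m *\<^sub>R cliff cl u' I" for I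
      by (rule fun_cong[OF u(3)[unfolded ident_eq], of I])
    then have "cliff cl u = cliff cl u'"
      using pcon_qcon(1)[of m] by (auto simp: scaleR_cancel_left)
    then show "u = u'"
      using Wcompl_eq[OF u(1)] Wcompl_eq[OF u(2)] by (intro ext) (simp only:)
  qed
  show "(\<lambda>I. qcon m *\<^sub>R clsym cl v I) \<in> Wcompl cl (Suc m)"
    by (rule clsym_Wcompl[OF assms])
  have "pcon m * (qcon m * (dm + 2 * real m)) = - 1"
    using dm_pos(1)[of m] by (simp add: pcon_qcon(2) flip: mult.assoc)
  then show "ident cl (Suc m) (\<lambda>I. qcon m *\<^sub>R clsym cl v I) = v"
    by (simp add: ident_eq cliff_scaleR cliff_clsym_dm[OF assms] fun_eq_iff)
qed

end

section \<open>Clifford contraction of the curvature action and the Casimir element\<close>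

section \<open>Curvature terms\<close>

text \<open>Row \<open>k\<close> of \<open>wedge a b\<close> is zero unless \<open>b = k\<close> or
  \<open>a = k\<close>, so sums over all rotation generators collapse to single sums.\<close>

lemma sum_wedge:
  fixes f :: "'n::finite \<Rightarrow> 'n \<Rightarrow> 'n \<Rightarrow> 'b::real_vector"
  shows "(\<Sum>a\<in>UNIV. \<Sum>b\<in>UNIV. \<Sum>c\<in>UNIV. wedge a b $ k $ c *\<^sub>R f a b c)
    = (\<Sum>a\<in>UNIV. f a k a) - (\<Sum>a\<in>UNIV. f k a a)"
proof -
  have w: "wedge a b $ k $ c *\<^sub>R x = (if c = a then if b = k then x else 0 else 0)
      - (if c = b then if a = k then x else 0 else 0)" for a b c and x :: 'b
    by (auto simp add: wedge_def)
  have "(\<Sum>a\<in>UNIV. \<Sum>b\<in>UNIV. \<Sum>c\<in>UNIV. wedge a b $ k $ c *\<^sub>R f a b c)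
      = (\<Sum>a\<in>UNIV. \<Sum>b\<in>UNIV. if b = k then f a b a else 0) - (\<Sum>a\<in>UNIV. \<Sum>b\<in>UNIV. if a = k then f a b b else 0)"
    unfolding w sum_subtractf by (simp only: sum.delta finite UNIV_I if_True)
  also have "(\<Sum>a\<in>UNIV. \<Sum>b\<in>UNIV. if a = k then f a b b else 0) = (\<Sum>b\<in>UNIV. f k b b)"
    by (subst sum.swap) simp
  finally show ?thesis by simp
qed

lemma wedge_swap: "wedge b a = - wedge a b"
  by (simp add: wedge_def vec_eq_iff)

lemma drho_uminus: "drho cl (- A) u I = - drho cl A u I"
  using drho_matrix_scaleR[of cl "-1" A u I] by simp

context spinor_rep
begin

lemma sigm_wedge: "sigm cl (wedge a b) u = (1 / 2) *\<^sub>R (cl a *v (cl b *v u) + (if a = b then u else 0))"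
proof -
  have s: "sigm cl (wedge a b) u = (1 / 4) *\<^sub>R (cl a *v (cl b *v u) - cl b *v (cl a *v u))"
  proof -
    have w: "wedge a b $ p $ q *\<^sub>R x = (if q = a then if p = b then x else 0 else 0)
      - (if q = b then if p = a then x else 0 else 0)" for p q and x :: "complex ^ 's"
      by (auto simp add: wedge_def)
    show ?thesis
      unfolding sigm_def w sum_subtractf by simp
  qed
  show ?thesis
  proof (cases "a = b")
    case False
    then have "cl a *v (cl b *v u) - cl b *v (cl a *v u) = 2 *\<^sub>R (cl a *v (cl b *v u))"
      using cl_anticommute[of b a u] by (simp add: scaleR_2)
    then show ?thesis
      using False by (simp add: s)
  next
    case True
    then show ?thesis
      using s by (simp add: cl_sq)
  qed
qed

lemma sum_off_diagonal:
  fixes x :: "'b::real_vector"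
  shows "(\<Sum>a\<in>(UNIV :: 'n set). \<Sum>b\<in>(UNIV :: 'n set). if a = b then 0 else x) = (real CARD('n) * (real CARD('n) - 1)) *\<^sub>R x"
proof -
  have "(if a = b then 0 else x) = x - (if a = b then x else 0)" for a b :: 'n
    by simp
  then have "(\<Sum>a\<in>(UNIV :: 'n set). \<Sum>b\<in>(UNIV :: 'n set). if a = b then 0 else x)
      = (\<Sum>a\<in>(UNIV :: 'n set). real CARD('n) *\<^sub>R x - x)"
    by (simp add: sum_subtractf sum_constant_scaleR del: sum_constant)
  then show ?thesis
    by (simp add: sum_constant_scaleR algebra_simps del: sum_constant)
qed

text \<open>On a single index \<open>m\<close> the generators give
  \<open>\<Sum> e_l e_m u(l) - e_m cliff u\<close>, which is \<open>-2 e_m cliff u - 2 u(m)\<close>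
  after exchanging the Clifford factors. Over all indices the first parts add up to
  \<open>clsym\<close> of \<open>cliff u\<close>, the second to the number of indices.\<close>

lemma lichnerowicz_lact:
  "symt u \<Longrightarrow> (\<Sum>l\<in>UNIV. \<Sum>k\<in>UNIV. cl l *v (cl k *v lact (wedge l k) u I))
    = - (2 *\<^sub>R clsym cl (cliff cl u) I) - (2 * real (length I)) *\<^sub>R u I"
proof (induction I arbitrary: u)
  case (Cons m I)
  have "cliff cl u (m # J) = cliff cl (slot m u) J" for J
    by (simp add: cliff_def slot_def symt_swap[OF Cons.prems, of m])
  then have c: "clsym cl (cliff cl u) (m # I) = cl m *v cliff cl u I + clsym cl (cliff cl (slot m u)) I"
    by (simp add: clsym_def)
  have "(\<Sum>l\<in>UNIV. \<Sum>k\<in>UNIV. cl l *v (cl k *v (\<Sum>b\<in>UNIV. wedge l k $ m $ b *\<^sub>R u (b # I))))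
      = (\<Sum>l\<in>UNIV. cl l *v (cl m *v u (l # I))) - cl m *v cliff cl u I"
    by (simp add: matvec sum_wedge cliff_def)
  also have "\<dots> = - (2 *\<^sub>R (cl m *v cliff cl u I)) - 2 *\<^sub>R u (m # I)"
    by (simp add: sum_cl_cl cliff_def scaleR_2)
  finally have e: "(\<Sum>l\<in>UNIV. \<Sum>k\<in>UNIV. cl l *v (cl k *v (\<Sum>b\<in>UNIV. wedge l k $ m $ b *\<^sub>R u (b # I))))
    = - (2 *\<^sub>R (cl m *v cliff cl u I)) - 2 *\<^sub>R u (m # I)" .
  show ?case
    unfolding lact_Cons matvec_add sum.distrib e Cons.IH[OF symt_slot[OF Cons.prems]] c
    by (simp add: slot_def algebra_simps)
qed (simp add: clsym_def matvec)

text \<open>This is the curvature term of the Weitzenboeck formula. On the spinor factor, each of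
  the \<open>n (n - 1)\<close> off-diagonal pairs contributes \<open>-1/2\<close>.\<close>

lemma lichnerowicz_drho:
  assumes "symt u"
  shows "(\<Sum>l\<in>UNIV. \<Sum>k\<in>UNIV. cl l *v (cl k *v drho cl (wedge l k) u I))
    = - ((real CARD('n) * (real CARD('n) - 1) / 2 + 2 * real (length I)) *\<^sub>R u I) - 2 *\<^sub>R clsym cl (cliff cl u) I"
proof -
  have "cl l *v (cl k *v sigm cl (wedge l k) x) = (if l = k then 0 else (- 1 / 2) *\<^sub>R x)" for l k x
    by (cases "l = k") (simp_all add: sigm_wedge matvec cl_sq cl_anticommute[of k l "cl k *v x"])
  then have e: "(\<Sum>l\<in>UNIV. \<Sum>k\<in>UNIV. cl l *v (cl k *v sigm cl (wedge l k) (u I)))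
      = (real CARD('n) * (real CARD('n) - 1)) *\<^sub>R ((- 1 / 2) *\<^sub>R u I)"
    by (simp only: sum_off_diagonal)
  show ?thesis
    unfolding drho_eq matvec_add sum.distrib lichnerowicz_lact[OF assms] e by (simp add: scaleR_add_left)
qed

text \<open>Each remaining index \<open>m\<close> contributes \<open>-u(m, k, ...)\<close>, the
  other part being a trace. These are the cross terms between one tensor index and the others in the
  Casimir element.\<close>

lemma sum_lact_wedge_slot:
  "symt (u :: ('n, 's) sptensor) \<Longrightarrow> (\<And>I. (\<Sum>k\<in>UNIV. u (k # k # I)) = 0) \<Longrightarrow>
    (\<Sum>a\<in>UNIV. lact (wedge a k) (slot a u) I) = - (real (length I) *\<^sub>R u (k # I))"
proof (induction I arbitrary: u)
  case (Cons m I)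
  have "(\<Sum>p\<in>UNIV. slot m u (p # p # J)) = 0" for J
    using Cons.prems(2)[of "m # J"] symtD[OF Cons.prems(1), of "m # _ # _ # J" "_ # _ # m # J"]
    by (simp add: slot_def)
  then have IH: "(\<Sum>a\<in>UNIV. lact (wedge a k) (slot a (slot m u)) I) = - (real (length I) *\<^sub>R slot m u (k # I))"
    by (intro Cons.IH symt_slot Cons.prems(1))
  have s: "slot m (slot a u) = slot a (slot m u)" for a
    by (simp add: slot_def fun_eq_iff symt_swap[OF Cons.prems(1)])
  have w: "wedge a k $ m $ b *\<^sub>R x = (if b = a then if m = k then x else 0 else 0)
      - (if b = k then if m = a then x else 0 else 0)" for a b and x :: "complex ^ 's"
    by (auto simp add: wedge_def)
  have "(\<Sum>a\<in>UNIV. \<Sum>b\<in>UNIV. wedge a k $ m $ b *\<^sub>R slot a u (b # I)) = - u (m # k # I)"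
    unfolding w sum_subtractf by (cases "m = k") (simp_all add: slot_def Cons.prems(2))
  then show ?case
    unfolding lact_Cons sum.distrib s IH
    by (simp add: slot_def symt_swap[OF Cons.prems(1), of k m] algebra_simps)
qed simp

text \<open>Peeling off one tensor index adds twice the cross terms between this index and the rest,
  and the value \<open>2 (1 - n)\<close> of the vector representation. The vanishing Clifford
  contraction and trace evaluate the cross terms; the total increment from \<open>j\<close> to
  \<open>j + 1\<close> is \<open>-(4 j + 2 n)\<close>.\<close>

lemma casimir_Wfib:
  "u \<in> Wfib cl j \<Longrightarrow> (\<Sum>a\<in>UNIV. \<Sum>b\<in>UNIV. drho cl (wedge a b) (drho cl (wedge a b) u) I)
    = - ((2 * real j * (real CARD('n) + real j - 1) + real CARD('n) * (real CARD('n) - 1) / 4) *\<^sub>R u I)"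
proof (induction j arbitrary: u I)
  case 0
  have t: "u J = 0" if "J \<noteq> []" for J
    using WfibD(3)[OF 0] that by (simp add: tensors_def)
  have l: "lact A v J = 0" if *: "\<And>J. J \<noteq> [] \<Longrightarrow> v J = 0" for A J and v :: "('n, 's) sptensor"
  proof -
    have "v (J[r := b]) = 0" if "r < length J" for r b
      by (rule *) (use that in auto)
    then show ?thesis
      unfolding lact_def by (intro sum.neutral ballI) simp
  qed
  have l1: "lact A u J = 0" for A J
    using l t by blast
  have e: "drho cl A (drho cl A u) I = sigm cl A (sigm cl A (u I))" for A
    using l[of "drho cl A u" A I] t by (simp add: drho_eq l1 sigm_0)
  have "sigm cl (wedge a b) (sigm cl (wedge a b) x) = (if a = b then 0 else (- 1 / 4) *\<^sub>R x)" for a b x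
    by (cases "a = b") (simp_all add: sigm_wedge matvec cl_sq cl_anticommute[of b a "cl b *v x"])
  then show ?case
    by (simp add: e sum_off_diagonal)
next
  case (Suc j)
  let ?N = "real CARD('n)"
  show ?case
  proof (cases I)
    case Nil
    then show ?thesis
      using WfibD(3)[OF Suc.prems] by (simp add: drho_eq tensors_def sigm_0)
  next
    case (Cons k J)
    have sl: "slot m (drho cl A u) = (\<lambda>I. drho cl A (slot m u) I + (\<Sum>b\<in>UNIV. A $ m $ b *\<^sub>R slot b u I))" for A m
      by (simp add: fun_eq_iff slot_def[of m "drho cl A u"] drho_Cons) (simp add: slot_def)
    have "drho cl A (drho cl A u) (k # J) = drho cl A (drho cl A (slot k u)) J
        + (\<Sum>c\<in>UNIV. A $ k $ c *\<^sub>R (2 *\<^sub>R drho cl A (slot c u) J + (\<Sum>b\<in>UNIV. A $ c $ b *\<^sub>R u (b # J))))" for A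
      unfolding drho_Cons[of cl A "drho cl A u"] sl drho_add drho_sum drho_scaleR
      by (simp only: drho_Cons scaleR_add_right sum.distrib scaleR_2 add.assoc)
    then have "(\<Sum>a\<in>UNIV. \<Sum>b\<in>UNIV. drho cl (wedge a b) (drho cl (wedge a b) u) (k # J))
      = (\<Sum>a\<in>UNIV. \<Sum>b\<in>UNIV. drho cl (wedge a b) (drho cl (wedge a b) (slot k u)) J)
        + ((\<Sum>a\<in>UNIV. 2 *\<^sub>R drho cl (wedge a k) (slot a u) J + (\<Sum>b\<in>UNIV. wedge a k $ a $ b *\<^sub>R u (b # J)))
        - (\<Sum>a\<in>UNIV. 2 *\<^sub>R drho cl (wedge k a) (slot a u) J + (\<Sum>b\<in>UNIV. wedge k a $ a $ b *\<^sub>R u (b # J))))"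
      by (simp add: sum.distrib sum_wedge)
    also have "(\<Sum>a\<in>UNIV. 2 *\<^sub>R drho cl (wedge k a) (slot a u) J + (\<Sum>b\<in>UNIV. wedge k a $ a $ b *\<^sub>R u (b # J)))
      = - (\<Sum>a\<in>UNIV. 2 *\<^sub>R drho cl (wedge a k) (slot a u) J + (\<Sum>b\<in>UNIV. wedge a k $ a $ b *\<^sub>R u (b # J)))"
      by (subst wedge_swap, subst wedge_swap) (simp add: drho_uminus sum_negf sum.distrib sum_subtractf)
    also have "(\<Sum>a\<in>UNIV. 2 *\<^sub>R drho cl (wedge a k) (slot a u) J + (\<Sum>b\<in>UNIV. wedge a k $ a $ b *\<^sub>R u (b # J)))
      = 2 *\<^sub>R ((- 1 / 2) *\<^sub>R u (k # J) - real (length J) *\<^sub>R u (k # J)) + (1 - ?N) *\<^sub>R u (k # J)"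
    proof -
      \<comment> \<open>As the Clifford contraction of \<open>u\<close> is zero, exchanging the
        factors leaves \<open>-2 u(k)\<close>; the diagonal term of \<open>sigm_wedge\<close> adds
        \<open>u(k)\<close>, and half of the sum remains.\<close>
      have "(\<Sum>a\<in>UNIV. sigm cl (wedge a k) (slot a u J)) = (- 1 / 2) *\<^sub>R u (k # J)"
      proof -
        have "(\<Sum>a\<in>UNIV. sigm cl (wedge a k) (slot a u J))
            = (1 / 2) *\<^sub>R ((\<Sum>a\<in>UNIV. cl a *v (cl k *v u (a # J))) + u (k # J))"
          by (simp add: sigm_wedge slot_def sum.distrib scaleR_add_right flip: scaleR_sum_right)
        also have "(\<Sum>a\<in>UNIV. cl a *v (cl k *v u (a # J))) = - 2 *\<^sub>R u (k # J)"
          using WfibD(4)[OF Suc.prems, of J] by (simp add: sum_cl_cl cliff_def matvec)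
        finally show ?thesis
          by (simp add: vec_eq_iff scaleR_conv_of_real field_simps)
      qed
      moreover have "(\<Sum>a\<in>UNIV. \<Sum>b\<in>UNIV. wedge a k $ a $ b *\<^sub>R u (b # J)) = (1 - ?N) *\<^sub>R u (k # J)"
      proof -
        have w: "wedge a k $ a $ b *\<^sub>R x = (if b = k then if a = k then x else 0 else 0) - (if b = k then x else 0)" for a b and x :: "complex ^ 's"
          by (auto simp add: wedge_def)
        show ?thesis
          unfolding w by (simp add: sum_subtractf sum_constant_scaleR algebra_simps del: sum_constant)
      qed
      moreover have "(\<Sum>a\<in>UNIV. lact (wedge a k) (slot a u) J) = - (real (length J) *\<^sub>R u (k # J))"
        by (rule sum_lact_wedge_slot) (use WfibD[OF Suc.prems] in auto)
      ultimately show ?thesis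
        by (simp add: drho_eq sum.distrib flip: scaleR_sum_right)
    qed
    also have "(\<Sum>a\<in>UNIV. \<Sum>b\<in>UNIV. drho cl (wedge a b) (drho cl (wedge a b) (slot k u)) J)
      = - ((2 * real j * (?N + real j - 1) + ?N * (?N - 1) / 4) *\<^sub>R u (k # J))"
      using Suc.IH[OF Wfib_slot[OF Suc.prems]] by (simp add: slot_def)
    also have "real (length J) *\<^sub>R u (k # J) = real j *\<^sub>R u (k # J)"
      using WfibD(3)[OF Suc.prems] by (cases "length J = j") (auto simp: tensors_def)
    finally show ?thesis
      unfolding Cons
      by (simp only: scaleR_scaleR flip: scaleR_minus_left scaleR_left_distrib scaleR_left_diff_distrib)
        (rule arg_cong[where f="\<lambda>r. r *\<^sub>R u (k # J)"], simp add: field_simps)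
  qed
qed

end

section \<open>Products of unit vectors, the double covering and equivariance of the fibrewise
  operations\<close>

section \<open>The spin group\<close>

definition cadj :: "complex ^ 's ^ 's::finite \<Rightarrow> complex ^ 's ^ 's" where
  "cadj A = (\<chi> a b. cnj (A $ b $ a))"

lemma cadj_mult: "cadj (A ** B) = cadj B ** cadj A"
  by (simp add: cadj_def matrix_matrix_mult_def vec_eq_iff mult.commute)

lemma cadj_mat_1: "cadj (mat 1) = mat 1"
  by (auto simp: cadj_def mat_def vec_eq_iff)

lemma hs_cadj: "hs (A *v u) v = hs u (cadj A *v v)"
  unfolding cadj_def by (rule hs_adjoint)

lemma matrix_mul_minus: "(- A) ** B = - (A ** (B :: complex ^ 'a ^ 'b))" "A ** (- B) = - (A ** (B :: complex ^ 'a ^ 'b))"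
  by (simp_all add: matrix_matrix_mult_def vec_eq_iff sum_negf)

lemma scaleR_matrix_mult:
  fixes A :: "'a::real_algebra_1 ^ 'm ^ 'n" and B :: "'a ^ 'k ^ 'm"
  shows "(r *\<^sub>R A) ** B = r *\<^sub>R (A ** B)" "A ** (r *\<^sub>R B) = r *\<^sub>R (A ** B)"
  by (simp_all add: matrix_matrix_mult_def vec_eq_iff scaleR_sum_right)

lemma matrix_mult_add:
  fixes A :: "'a::semiring_1 ^ 'm ^ 'n" and B :: "'a ^ 'k ^ 'm"
  shows "(A + A') ** B = A ** B + A' ** B" "A ** (B + B') = A ** B + A ** B'"
  by (simp_all add: matrix_matrix_mult_def vec_eq_iff sum.distrib algebra_simps)

lemma cvec_mult: "cvec cl v *v u = (\<Sum>k\<in>UNIV. v $ k *\<^sub>R (cl k *v u))"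
  by (simp add: cvec_def sum_matrix_vector_mult scaleR_matrix_vector_mult)

lemma cvec_axis: "cvec cl (axis k 1) = cl k"
  by (simp add: cvec_def axis_def if_distrib[of "\<lambda>r. r *\<^sub>R _"] cong: if_cong)

lemma linear_cvec: "linear (cvec cl)"
  by (rule linearI) (simp_all add: cvec_def scaleR_add_left sum.distrib scaleR_sum_right)

lemma rho_Nil: "rho cl s u [] = s *v u []"
  by (simp add: rho_def)

lemma rho_Cons: "rho cl s u (k # I) = (\<Sum>b\<in>UNIV. spin_cover cl s $ k $ b *\<^sub>R rho cl s (slot b u) I)"
  unfolding rho_def list.size One_nat_def add_Suc_right add_0_right sum_length_Suc
  by (simp add: prod.lessThan_Suc_shift slot_def scaleR_sum_right del: prod.lessThan_Suc)

lemma rho_add: "rho cl s (\<lambda>J. u J + v J) I = rho cl s u I + rho cl s v I"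
  by (simp add: rho_def matvec scaleR_add_right sum.distrib)

lemma rho_scaleR: "rho cl s (\<lambda>J. r *\<^sub>R u J) I = r *\<^sub>R rho cl s u I"
  by (simp add: rho_def matvec scaleR_sum_right mult_ac)

lemma rho_0: "rho cl s (\<lambda>J. 0) I = 0"
  by (simp add: rho_def matvec)

lemma rho_sum: "rho cl s (\<lambda>J. \<Sum>a\<in>F. u a J) I = (\<Sum>a\<in>F. rho cl s (u a) I)"
  by (induction F rule: infinite_finite_induct) (auto simp: rho_0 rho_add)

lemma rho_ins: "rho cl s (\<lambda>J. ins J \<Phi>) I = ins I (\<lambda>k J. \<Sum>b\<in>UNIV. spin_cover cl s $ k $ b *\<^sub>R rho cl s (\<Phi> b) J)"
proof (induction I arbitrary: \<Phi>)
  case (Cons k I)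
  have s: "slot b (\<lambda>J. ins J \<Phi>) = (\<lambda>J. \<Phi> b J + ins J (\<lambda>l. slot b (\<Phi> l)))" for b
    by (simp add: slot_def fun_eq_iff)
  have i: "ins I (\<lambda>l J. \<Sum>c\<in>UNIV. spin_cover cl s $ l $ c *\<^sub>R rho cl s (\<Phi> c) (k # J))
    = (\<Sum>b\<in>UNIV. spin_cover cl s $ k $ b *\<^sub>R ins I (\<lambda>l J. \<Sum>c\<in>UNIV. spin_cover cl s $ l $ c *\<^sub>R rho cl s (slot b (\<Phi> c)) J))"
    (is "_ = ?r")
  proof -
    have "?r = ins I (\<lambda>l J. \<Sum>b\<in>UNIV. \<Sum>c\<in>UNIV. spin_cover cl s $ l $ c *\<^sub>R spin_cover cl s $ k $ b *\<^sub>R rho cl s (slot b (\<Phi> c)) J)"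
      by (simp add: ins_sum scaleR_sum_right mult.commute flip: ins_scaleR)
    also have "\<dots> = ins I (\<lambda>l J. \<Sum>c\<in>UNIV. \<Sum>b\<in>UNIV. spin_cover cl s $ l $ c *\<^sub>R spin_cover cl s $ k $ b *\<^sub>R rho cl s (slot b (\<Phi> c)) J)"
      by (subst sum.swap) simp
    finally show ?thesis
      by (simp add: rho_Cons scaleR_sum_right)
  qed
  show ?case
    unfolding rho_Cons[of cl s "\<lambda>J. ins J \<Phi>"] s rho_add scaleR_add_right sum.distrib Cons.IH
    by (simp add: i)
qed (simp add: rho_Nil matvec_0)

context spinor_rep
begin

lemma cvec_anticommute: "cvec cl v ** cvec cl w + cvec cl w ** cvec cl v = (- 2 * (v \<bullet> w)) *\<^sub>R mat 1"
proof (subst matrix_eq, intro allI)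
  fix u
  have "cvec cl v *v (cvec cl w *v u) = (\<Sum>k\<in>UNIV. \<Sum>l\<in>UNIV. (v $ k * w $ l) *\<^sub>R (cl k *v (cl l *v u)))"
    by (simp add: cvec_mult matvec scaleR_sum_right mult.commute) (rule sum.swap)
  moreover have "cvec cl w *v (cvec cl v *v u) = (\<Sum>k\<in>UNIV. \<Sum>l\<in>UNIV. (v $ k * w $ l) *\<^sub>R (cl l *v (cl k *v u)))"
    by (simp add: cvec_mult matvec scaleR_sum_right mult.commute)
  moreover have "cl k *v (cl l *v u) + cl l *v (cl k *v u) = (if l = k then - 2 *\<^sub>R u else 0)" for k l
    by (simp add: cl_anticommute[of k l])
  ultimately have "cvec cl v *v (cvec cl w *v u) + cvec cl w *v (cvec cl v *v u)
      = (\<Sum>k\<in>UNIV. \<Sum>l\<in>UNIV. (v $ k * w $ l) *\<^sub>R (if l = k then - 2 *\<^sub>R u else 0))"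
    by (simp only: sum.distrib[symmetric] scaleR_add_right[symmetric])
  also have "\<dots> = (\<Sum>k\<in>UNIV. (v $ k * w $ k) *\<^sub>R (- 2 *\<^sub>R u))"
    by (simp add: if_distrib[of "\<lambda>x. _ *\<^sub>R x"] cong: if_cong)
  also have "\<dots> = (- 2 * (v \<bullet> w)) *\<^sub>R u"
    by (simp add: inner_vec_def scaleR_sum_left sum_distrib_left mult_ac sum_negf)
  finally show "(cvec cl v ** cvec cl w + cvec cl w ** cvec cl v) *v u = ((- 2 * (v \<bullet> w)) *\<^sub>R mat 1) *v u"
    by (simp add: matrix_vector_mult_add_rdistrib matrix_vector_mul_assoc scaleR_matrix_vector_mult
        uminus_matrix_vector_mult)
qed

lemma cvec_sq: "cvec cl v ** cvec cl v = (- (v \<bullet> v)) *\<^sub>R mat 1"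
proof -
  have "2 *\<^sub>R (cvec cl v ** cvec cl v) = 2 *\<^sub>R ((- (v \<bullet> v)) *\<^sub>R mat 1)"
    using cvec_anticommute[of v v] unfolding scaleR_2[of "cvec cl v ** cvec cl v"] by simp
  then show ?thesis
    by (simp only: scaleR_cancel_left) simp
qed

lemma cvec_eq_0D: "cvec cl v = 0 \<Longrightarrow> v = 0"
proof -
  assume "cvec cl v = 0"
  then have "(v \<bullet> v) *\<^sub>R (mat 1 :: complex ^ 's ^ 's) = 0"
    using cvec_sq[of v] by (simp add: matrix_matrix_mult_def vec_eq_iff)
  moreover have "(mat 1 :: complex ^ 's ^ 's) \<noteq> 0"
    by (auto simp: mat_def vec_eq_iff)
  ultimately show "v = 0"
    by simp
qed

lemma cadj_cvec: "cadj (cvec cl v) = - cvec cl v"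
proof -
  have "cnj (cl k $ b $ a) = - cl k $ a $ b" for k a b
  proof -
    have "(\<chi> a b. cnj (cl k $ b $ a)) = - cl k"
      using spinor by (simp add: spinor_module_def)
    from arg_cong[OF this, of "\<lambda>M. M $ a $ b"] show ?thesis by simp
  qed
  then show ?thesis
    by (simp add: cadj_def cvec_def vec_eq_iff sum_negf)
qed

primrec cprod :: "(real ^ 'n) list \<Rightarrow> complex ^ 's ^ 's" where
  "cprod [] = mat 1"
| "cprod (v # vs) = cvec cl v ** cprod vs"

lemma cprod_append: "cprod (xs @ ys) = cprod xs ** cprod ys"
  by (induction xs) (simp_all add: matrix_mul_assoc)

lemma cadj_cprod: "cadj (cprod vs) = (- 1) ^ length vs *\<^sub>R cprod (rev vs)"
  by (induction vs) (simp_all add: cadj_mat_1 cadj_mult cadj_cvec cprod_append matrix_mul_minus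
      scaleR_matrix_mult)

lemma trace_scaleR: "trace (r *\<^sub>R A) = r *\<^sub>R trace (A :: complex ^ 's ^ 's)"
  by (simp add: trace_def scaleR_sum_right)

text \<open>The first factor is carried to the end by transpositions. Each one changes the sign, up
  to a real multiple of the trace of a shorter even product, which is real by induction. The number
  of transpositions is odd and the trace is cyclic, so the imaginary part equals its own
  negative.\<close>

lemma trace_cprod_real: "even (length vs) \<Longrightarrow> Im (trace (cprod vs)) = 0"
proof (induction "length vs" arbitrary: vs rule: less_induct)
  case less
  show ?case
  proof (cases vs)
    case Nil
    then show ?thesis by (simp add: trace_def mat_def)
  next
    case (Cons v ws)
    have *: "Im (trace (cprod (v # xs @ ys))) = (- 1) ^ length xs * Im (trace (cprod (xs @ v # ys)))"
      if "length xs + length ys = length ws" for xs ys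
      using that
    proof (induction xs arbitrary: ys rule: rev_induct)
      case (snoc w xs)
      have "cprod (xs @ w # v # ys) + cprod (xs @ v # w # ys)
          = cprod xs ** (cvec cl w ** cvec cl v + cvec cl v ** cvec cl w) ** cprod ys"
        by (simp add: cprod_append matrix_mul_assoc matrix_mult_add)
      also have "\<dots> = (- 2 * (w \<bullet> v)) *\<^sub>R cprod (xs @ ys)"
        unfolding cvec_anticommute
        by (simp only: cprod_append scaleR_matrix_mult matrix_mul_rid)
      finally have "trace (cprod (xs @ w # v # ys)) + trace (cprod (xs @ v # w # ys))
          = (- 2 * (w \<bullet> v)) *\<^sub>R trace (cprod (xs @ ys))"
        by (metis trace_add trace_scaleR)
      then have "Im (trace (cprod (xs @ w # v # ys)) + trace (cprod (xs @ v # w # ys)))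
          = Im ((- 2 * (w \<bullet> v)) *\<^sub>R trace (cprod (xs @ ys)))"
        by simp
      moreover have l: "length vs = Suc (Suc (length (xs @ ys)))"
        using snoc.prems Cons by simp
      then have "Im (trace (cprod (xs @ ys))) = 0"
        using less.prems by (intro less.hyps) simp_all
      ultimately have "Im (trace (cprod (xs @ w # v # ys))) = - Im (trace (cprod (xs @ v # w # ys)))"
        by simp
      then show ?case
        using snoc.IH[of "w # ys"] snoc.prems by simp
    qed simp
    have "trace (cprod (ws @ [v])) = trace (cprod (v # ws))"
      by (simp add: cprod_append trace_mul_sym[of "cprod ws"])
    moreover have "odd (length ws)"
      using less.prems Cons by simp
    ultimately show ?thesis
      using *[of ws "[]"] Cons by simp
  qed
qed

lemma spin_group_cprod:
  "s \<in> spin_group cl \<Longrightarrow> \<exists>vs. s = cprod vs \<and> even (length vs) \<and> (\<forall>v\<in>set vs. norm v = 1)"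
proof (induction rule: spin_group.induct)
  case one
  then show ?case by (intro exI[of _ "[]"]) simp
next
  case (mult s v w)
  then obtain vs where "s = cprod vs" "even (length vs)" "\<forall>v\<in>set vs. norm v = 1"
    by blast
  then show ?case
    using mult by (intro exI[of _ "vs @ [v, w]"]) (simp add: cprod_append matrix_mul_assoc)
qed

lemma spin_group_unitary:
  assumes "s \<in> spin_group cl"
  shows "cadj s ** s = mat 1" "s ** cadj s = mat 1" "hs (s *v u) (s *v v) = hs u v"
proof -
  obtain vs where vs: "s = cprod vs" "even (length vs)" "\<forall>v\<in>set vs. norm v = 1"
    using spin_group_cprod[OF assms] by blast
  have "cadj (cprod vs) ** cprod vs = mat 1" if "\<forall>v\<in>set vs. norm v = 1" for vs
    using that
  proof (induction vs)
    case (Cons v vs)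
    have "v \<bullet> v = 1"
      using Cons.prems by (simp add: norm_eq_1)
    then have "cadj (cvec cl v) ** cvec cl v = mat 1"
      by (simp add: cadj_cvec matrix_mul_minus cvec_sq)
    then show ?case
      using Cons by (simp add: cadj_mult) (metis matrix_mul_assoc matrix_mul_lid)
  qed (simp add: cadj_mat_1)
  then show 1: "cadj s ** s = mat 1"
    using vs by simp
  then show "s ** cadj s = mat 1"
    by (simp add: matrix_left_right_inverse)
  show "hs (s *v u) (s *v v) = hs u v"
    by (simp add: hs_cadj matrix_vector_mul_assoc 1)
qed

text \<open>The adjoint of an even product of vectors is the reversed product, so
  \<open>s ** cadj t\<close> is again an even product.\<close>

lemma trace_spin_group_real:
  assumes "s \<in> spin_group cl" "t \<in> spin_group cl"
  shows "Im (trace (s ** cadj t)) = 0"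
proof -
  obtain vs ws where "s = cprod vs" "even (length vs)" "t = cprod ws" "even (length ws)"
    using spin_group_cprod assms by metis
  then show ?thesis
    using trace_cprod_real[of "vs @ rev ws"] by (simp add: cadj_cprod cprod_append)
qed

text \<open>Conjugation by a unit vector \<open>w\<close> sends \<open>x\<close> to
  \<open>2 (w \<bullet> x) w - x\<close>, the negative of a reflection and hence orthogonal; the
  generators of the group are products of two unit vectors.\<close>

lemma spin_cover_exists:
  assumes "s \<in> spin_group cl"
  shows "\<exists>A. orthogonal_matrix A \<and> (\<forall>v. s ** cvec cl v = cvec cl (A *v v) ** s)"
  using assms
proof (induction rule: spin_group.induct)
  case one
  then show ?case by (intro exI[of _ "mat 1"]) (simp add: orthogonal_matrix_id)
next
  case (mult s v w)
  obtain A where A: "orthogonal_matrix A" "\<And>x. s ** cvec cl x = cvec cl (A *v x) ** s"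
    using mult by blast
  have R: "\<exists>R. orthogonal_matrix R \<and> (\<forall>x. cvec cl w ** cvec cl x = cvec cl (R *v x) ** cvec cl w)" if "norm w = 1" for w
  proof -
    have w: "w \<bullet> w = 1" using that by (simp add: norm_eq_1)
    define r where "r x = (2 * (w \<bullet> x)) *\<^sub>R w - x" for x
    have lr: "linear r"
      by (rule linearI) (simp_all add: r_def inner_add_right algebra_simps)
    have "r x \<bullet> r y = x \<bullet> y" for x y
      by (simp add: r_def inner_diff_left inner_diff_right w inner_commute algebra_simps)
    then have "orthogonal_transformation r"
      by (simp add: orthogonal_transformation_def lr)
    then have "orthogonal_matrix (matrix r)"
      by (simp add: orthogonal_transformation_matrix)
    moreover have "cvec cl w ** cvec cl x = cvec cl (matrix r *v x) ** cvec cl w" for x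
    proof -
      have "cvec cl (matrix r *v x) ** cvec cl w = cvec cl (r x) ** cvec cl w"
        by (simp add: matrix_works lr)
      also have "\<dots> = (2 * (w \<bullet> x)) *\<^sub>R (cvec cl w ** cvec cl w) - cvec cl x ** cvec cl w"
        unfolding r_def linear_diff[OF linear_cvec] linear_scale[OF linear_cvec]
        by (simp add: vec_eq_iff matrix_matrix_mult_def left_diff_distrib sum_subtractf scaleR_sum_right)
      also have "\<dots> = (- 2 * (w \<bullet> x)) *\<^sub>R mat 1 - cvec cl x ** cvec cl w"
        by (simp add: cvec_sq w)
      also have "\<dots> = cvec cl w ** cvec cl x"
        unfolding cvec_anticommute[of w x, symmetric] by simp
      finally show ?thesis by simp
    qed
    ultimately show ?thesis by blast
  qed
  obtain V where V: "orthogonal_matrix V" "\<And>x. cvec cl v ** cvec cl x = cvec cl (V *v x) ** cvec cl v"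
    using R[OF mult(2)] by blast
  obtain W where W: "orthogonal_matrix W" "\<And>x. cvec cl w ** cvec cl x = cvec cl (W *v x) ** cvec cl w"
    using R[OF mult(3)] by blast
  have "s ** cvec cl v ** cvec cl w ** cvec cl x = cvec cl ((A ** V ** W) *v x) ** (s ** cvec cl v ** cvec cl w)" for x
    by (metis (no_types, lifting) A(2) V(2) W(2) matrix_mul_assoc matrix_vector_mul_assoc)
  then show ?case
    using A V W by (intro exI[of _ "A ** V ** W"]) (simp add: orthogonal_matrix_mul)
qed

text \<open>The matrix is unique because \<open>s\<close> is invertible and \<open>cvec\<close> is
  injective, so the definite description denotes the orthogonal matrix already constructed.\<close>

lemma spin_cover:
  assumes "s \<in> spin_group cl"
  shows "orthogonal_matrix (spin_cover cl s)" "s ** cvec cl v = cvec cl (spin_cover cl s *v v) ** s"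
proof -
  obtain A where A: "orthogonal_matrix A" "\<forall>v. s ** cvec cl v = cvec cl (A *v v) ** s"
    using spin_cover_exists[OF assms] by blast
  have "spin_cover cl s = A"
    unfolding spin_cover_def
  proof (rule the_equality)
    show "\<forall>v. s ** cvec cl v = cvec cl (A *v v) ** s"
      by (rule A(2))
    fix B assume B: "\<forall>v. s ** cvec cl v = cvec cl (B *v v) ** s"
    have "B *v v = A *v v" for v
    proof -
      have "cvec cl (B *v v) ** s ** cadj s = cvec cl (A *v v) ** s ** cadj s"
        using A(2) B by simp
      then have "cvec cl (B *v v) = cvec cl (A *v v)"
        by (simp add: spin_group_unitary[OF assms] flip: matrix_mul_assoc)
      then have "cvec cl (B *v v - A *v v) = 0"
        by (simp add: linear_diff[OF linear_cvec])
      then show ?thesis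
        using cvec_eq_0D by fastforce
    qed
    then show "B = A"
      by (simp add: matrix_eq)
  qed
  then show "orthogonal_matrix (spin_cover cl s)" "s ** cvec cl v = cvec cl (spin_cover cl s *v v) ** s"
    using A by auto
qed

lemma spin_cover_cl:
  assumes "s \<in> spin_group cl"
  shows "s *v (cl b *v u) = (\<Sum>k\<in>UNIV. spin_cover cl s $ k $ b *\<^sub>R (cl k *v (s *v u)))"
proof -
  have "s *v (cl b *v u) = cvec cl (spin_cover cl s *v axis b 1) *v (s *v u)"
    using spin_cover(2)[OF assms, of "axis b 1"] by (simp add: cvec_axis matrix_vector_mul_assoc)
  then show ?thesis
    by (simp add: cvec_mult matrix_vector_mul_component inner_axis row_def matrix_vector_mult_basis column_def)
qed

lemma rho_cl:
  assumes "s \<in> spin_group cl"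
  shows "rho cl s (\<lambda>J. cl b *v u J) I = (\<Sum>k\<in>UNIV. spin_cover cl s $ k $ b *\<^sub>R (cl k *v rho cl s u I))"
  unfolding rho_def spin_cover_cl[OF assms]
  by (simp add: matvec scaleR_sum_right mult.commute) (rule sum.swap)

lemma orthogonal_sum:
  assumes "orthogonal_matrix A"
  shows "(\<Sum>k\<in>UNIV. A $ k $ b * A $ k $ c) = (if b = c then 1 else 0)"
    "(\<Sum>k\<in>UNIV. A $ b $ k * A $ c $ k) = (if b = c then 1 else 0)"
proof -
  have "transpose A ** A = mat 1" "A ** transpose A = mat 1"
    using assms by (auto simp: orthogonal_matrix_def)
  then show "(\<Sum>k\<in>UNIV. A $ k $ b * A $ k $ c) = (if b = c then 1 else 0)"
    "(\<Sum>k\<in>UNIV. A $ b $ k * A $ c $ k) = (if b = c then 1 else 0)"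
    by (simp_all add: vec_eq_iff matrix_matrix_mult_def transpose_def mat_def)
qed

text \<open>Contracting two indices that are rotated by the same orthogonal matrix; the reason why
  \<open>dvg\<close> and \<open>herm\<close> are equivariant.\<close>

lemma orthogonal_contract:
  fixes f :: "'n \<Rightarrow> 'n \<Rightarrow> 'b::real_vector"
  assumes "orthogonal_matrix A"
  shows "(\<Sum>k\<in>UNIV. \<Sum>b\<in>UNIV. \<Sum>c\<in>UNIV. (A $ k $ b * A $ k $ c) *\<^sub>R f b c) = (\<Sum>b\<in>UNIV. f b b)"
    "(\<Sum>k\<in>UNIV. \<Sum>b\<in>UNIV. \<Sum>c\<in>UNIV. (A $ b $ k * A $ c $ k) *\<^sub>R f b c) = (\<Sum>b\<in>UNIV. f b b)"
proof -
  have r: "(\<Sum>k\<in>UNIV. \<Sum>b\<in>UNIV. \<Sum>c\<in>UNIV. g k b c *\<^sub>R f b c) = (\<Sum>b\<in>UNIV. \<Sum>c\<in>UNIV. (\<Sum>k\<in>UNIV. g k b c) *\<^sub>R f b c)"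
    for g :: "'n \<Rightarrow> 'n \<Rightarrow> 'n \<Rightarrow> real"
    unfolding scaleR_sum_left by (rule trans[OF sum.swap], rule sum.cong[OF refl], rule sum.swap)
  have d: "(\<Sum>b\<in>UNIV. \<Sum>c\<in>UNIV. (if b = c then 1 else 0) *\<^sub>R f b c) = (\<Sum>b\<in>UNIV. f b b)"
    by (simp add: if_distrib[of "\<lambda>r. r *\<^sub>R _"] cong: if_cong)
  show "(\<Sum>k\<in>UNIV. \<Sum>b\<in>UNIV. \<Sum>c\<in>UNIV. (A $ k $ b * A $ k $ c) *\<^sub>R f b c) = (\<Sum>b\<in>UNIV. f b b)"
    "(\<Sum>k\<in>UNIV. \<Sum>b\<in>UNIV. \<Sum>c\<in>UNIV. (A $ b $ k * A $ c $ k) *\<^sub>R f b c) = (\<Sum>b\<in>UNIV. f b b)"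
    unfolding r orthogonal_sum[OF assms] by (rule d)+
qed

lemma rho_clmul:
  assumes "s \<in> spin_group cl"
  shows "clmul cl (\<lambda>k J. \<Sum>b\<in>UNIV. spin_cover cl s $ k $ b *\<^sub>R rho cl s (\<Phi> b) J) I = rho cl s (clmul cl \<Phi>) I"
  by (simp add: clmul_def rho_sum rho_cl[OF assms] matvec) (rule sum.swap)

lemma rho_cliff:
  assumes "s \<in> spin_group cl"
  shows "cliff cl (rho cl s u) I = rho cl s (cliff cl u) I"
  unfolding cliff_clmul[of cl u] rho_clmul[OF assms, symmetric] by (simp add: cliff_def clmul_def rho_Cons)

lemma rho_dvg:
  assumes "s \<in> spin_group cl"
  shows "dvg (\<lambda>k J. \<Sum>b\<in>UNIV. spin_cover cl s $ k $ b *\<^sub>R rho cl s (\<Phi> b) J) I = rho cl s (dvg \<Phi>) I"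
  using orthogonal_contract(1)[OF spin_cover(1)[OF assms], of "\<lambda>b c. rho cl s (slot c (\<Phi> b)) I"]
  by (simp add: dvg_def rho_Cons rho_sum scaleR_sum_right slot_def)

lemma rho_clsym:
  assumes "s \<in> spin_group cl"
  shows "rho cl s (clsym cl v) I = clsym cl (rho cl s v) I"
proof -
  have "(\<Sum>b\<in>UNIV. spin_cover cl s $ k $ b *\<^sub>R rho cl s (\<lambda>J. cl b *v v J) J) = cl k *v rho cl s v J" for k J
    unfolding rho_cl[OF assms] scaleR_sum_right scaleR_scaleR
    by (subst sum.swap) (simp add: orthogonal_sum(2)[OF spin_cover(1)[OF assms]] if_distrib[of "\<lambda>r. r *\<^sub>R _"]
        cong: if_cong flip: scaleR_sum_left)
  then show ?thesis
    by (simp add: clsym_def rho_ins)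
qed

lemma herm_rho:
  assumes "s \<in> spin_group cl"
  shows "herm j (rho cl s u) (rho cl s v) = herm j u v"
proof (induction j arbitrary: u v)
  case 0
  show ?case by (simp add: herm_0 rho_Nil spin_group_unitary[OF assms])
next
  case (Suc j)
  have s: "slot k (rho cl s w) = (\<lambda>I. \<Sum>b\<in>UNIV. spin_cover cl s $ k $ b *\<^sub>R rho cl s (slot b w) I)" for k w
    by (simp add: slot_def[of k "rho cl s w"] rho_Cons)
  show ?case
    using orthogonal_contract(1)[OF spin_cover(1)[OF assms], of "\<lambda>b c. herm j (slot b u) (slot c v)"]
    by (simp add: herm_Suc s herm_sum_left herm_sum_right herm_scaleR_left herm_scaleR_right Suc scaleR_sum_right)
qed

text \<open>Both Clifford factors are rotated by the covering matrix, one on each side of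
  \<open>B\<close>.\<close>

lemma sigm_rho:
  assumes "s \<in> spin_group cl"
  shows "s *v sigm cl B u = sigm cl (spin_cover cl s ** B ** transpose (spin_cover cl s)) (s *v u)"
proof -
  let ?A = "spin_cover cl s"
  have "s *v (cl b *v (cl a *v u)) = (\<Sum>k\<in>UNIV. \<Sum>l\<in>UNIV. (?A $ k $ b * ?A $ l $ a) *\<^sub>R (cl k *v (cl l *v (s *v u))))" for a b
    by (simp add: spin_cover_cl[OF assms] matvec scaleR_sum_right)
  then have "s *v sigm cl B u = (1 / 4) *\<^sub>R (\<Sum>a\<in>UNIV. \<Sum>b\<in>UNIV. \<Sum>k\<in>UNIV. \<Sum>l\<in>UNIV. (?A $ l $ a * B $ a $ b * ?A $ k $ b) *\<^sub>R (cl k *v (cl l *v (s *v u))))"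
    by (simp add: sigm_def matvec scaleR_sum_right mult_ac)
  also have "(\<Sum>a\<in>UNIV. \<Sum>b\<in>UNIV. \<Sum>k\<in>UNIV. \<Sum>l\<in>UNIV. (?A $ l $ a * B $ a $ b * ?A $ k $ b) *\<^sub>R (cl k *v (cl l *v (s *v u))))
      = (\<Sum>a\<in>UNIV. \<Sum>l\<in>UNIV. \<Sum>k\<in>UNIV. \<Sum>b\<in>UNIV. (?A $ l $ a * B $ a $ b * ?A $ k $ b) *\<^sub>R (cl k *v (cl l *v (s *v u))))"
    by (rule sum.cong[OF refl], rule sum_swap3)
  also have "\<dots> = (\<Sum>l\<in>UNIV. \<Sum>a\<in>UNIV. \<Sum>k\<in>UNIV. \<Sum>b\<in>UNIV. (?A $ l $ a * B $ a $ b * ?A $ k $ b) *\<^sub>R (cl k *v (cl l *v (s *v u))))"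
    by (rule sum.swap)
  also have "\<dots> = (\<Sum>l\<in>UNIV. \<Sum>k\<in>UNIV. \<Sum>b\<in>UNIV. \<Sum>a\<in>UNIV. (?A $ l $ a * B $ a $ b * ?A $ k $ b) *\<^sub>R (cl k *v (cl l *v (s *v u))))"
    by (rule sum.cong[OF refl], rule trans[OF sum.swap], rule sum.cong[OF refl], rule sum.swap)
  finally show ?thesis
    by (simp add: sigm_def matrix_matrix_mult_def transpose_def scaleR_sum_left sum_distrib_right)
qed

text \<open>On the first index the claim is \<open>C A = A B\<close> for
  \<open>C = A B A\<^sup>T\<close>, which is orthogonality of the covering matrix
  \<open>A\<close>.\<close>

lemma lact_rho:
  assumes "s \<in> spin_group cl"
  shows "rho cl s (lact B u) I = lact (spin_cover cl s ** B ** transpose (spin_cover cl s)) (rho cl s u) I"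
proof (induction I arbitrary: u)
  case (Cons k I)
  let ?A = "spin_cover cl s" let ?C = "?A ** B ** transpose ?A"
  have sl: "slot k (lact B u) = (\<lambda>I. lact B (slot k u) I + (\<Sum>b\<in>UNIV. B $ k $ b *\<^sub>R slot b u I))" for k
    by (simp add: fun_eq_iff slot_def[of k "lact B u"] lact_Cons) (simp add: slot_def)
  have sr: "slot k (rho cl s u) = (\<lambda>I. \<Sum>b\<in>UNIV. ?A $ k $ b *\<^sub>R rho cl s (slot b u) I)" for k
    by (simp add: slot_def[of k "rho cl s u"] rho_Cons)
  have "?C ** ?A = ?A ** B"
    using spin_cover(1)[OF assms] by (simp add: orthogonal_matrix_def flip: matrix_mul_assoc)
  then have c: "(\<Sum>d\<in>UNIV. ?C $ k $ d * ?A $ d $ c) = (\<Sum>b\<in>UNIV. ?A $ k $ b * B $ b $ c)" for c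
    by (simp add: matrix_matrix_mult_def vec_eq_iff)
  have "(\<Sum>d\<in>UNIV. ?C $ k $ d *\<^sub>R rho cl s u (d # I)) = (\<Sum>c\<in>UNIV. (\<Sum>d\<in>UNIV. ?C $ k $ d * ?A $ d $ c) *\<^sub>R rho cl s (slot c u) I)"
    by (simp add: rho_Cons scaleR_sum_right scaleR_sum_left) (rule sum.swap)
  also have "\<dots> = (\<Sum>b\<in>UNIV. ?A $ k $ b *\<^sub>R (\<Sum>c\<in>UNIV. B $ b $ c *\<^sub>R rho cl s (slot c u) I))"
    unfolding c by (simp add: scaleR_sum_right scaleR_sum_left) (rule sum.swap)
  finally show ?case
    by (simp add: rho_Cons[of cl s "lact B u"] sl rho_add rho_sum rho_scaleR lact_Cons sr lact_sum lact_scaleR Cons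
        scaleR_add_right sum.distrib)
qed (simp add: rho_Nil matvec_0)

lemma drho_rho:
  assumes "s \<in> spin_group cl"
  shows "rho cl s (drho cl B u) I = drho cl (spin_cover cl s ** B ** transpose (spin_cover cl s)) (rho cl s u) I"
proof -
  have d: "drho cl B u = (\<lambda>I. sigm cl B (u I) + lact B u I)"
    by (simp add: fun_eq_iff drho_eq)
  have "rho cl s (\<lambda>I. sigm cl B (u I)) I = sigm cl (spin_cover cl s ** B ** transpose (spin_cover cl s)) (rho cl s u I)"
    by (simp add: rho_def sigm_rho[OF assms] sigm_sum sigm_scaleR)
  then show ?thesis
    unfolding d rho_add by (simp add: drho_eq lact_rho[OF assms])
qed

text \<open>The Hermitian form of \<open>-\<i> X\<close> attains its minimum \<open>\<lambda>\<close> on the unit sphere; the kernel of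
  \<open>X - \<i> \<lambda>\<close> is then a nonzero Clifford submodule.\<close>

lemma schur_skew:
  assumes comm: "\<And>k u. X *v (cl k *v u) = cl k *v (X *v u)"
    and skew: "\<And>u v. hs (X *v u) v = - hs u (X *v v)"
  obtains r :: real where "\<And>u. X *v u = (\<i> * of_real r) *s u"
proof -
  define q where "q u = Im (hs (X *v u) u)" for u
  have cX: "continuous_on S (\<lambda>u. X *v u)" for S
    by (rule linear_continuous_on) (simp add: linear_matvec linear_conv_bounded_linear[symmetric])
  have "continuous_on (sphere 0 1) q"
    unfolding q_def by (intro continuous_intros bounded_bilinear.continuous_on[OF bounded_bilinear_hs] cX)
  moreover have "sphere (0 :: complex ^ 's) 1 \<noteq> {}"
    by simp
  ultimately obtain w where w: "norm w = 1" "\<And>u. norm u = 1 \<Longrightarrow> q w \<le> q u"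
    using continuous_attains_inf[of "sphere (0 :: complex ^ 's) 1" q] by auto
  define r where "r = q w"
  define Y where "Y u = X *v u - (\<i> * of_real r) *s u" for u
  have smul: "hs (c *s u) v = c * hs u v" "hs u (c *s v) = cnj c * hs u v" for c u v
    by (simp_all add: hs_def sum_distrib_left mult_ac)
  have Yadd: "Y (u + v) = Y u + Y v" and YscaleR: "Y (t *\<^sub>R u) = t *\<^sub>R Y u" for u v t
    by (simp_all add: Y_def matvec vec_eq_iff algebra_simps)
  have hsd: "hs (a - b) c = hs a c - hs b c" "hs c (a - b) = hs c a - hs c b" for a b c
    using hs_add_left[of a "- b" c] hs_add_right[of c a "- b"] by (simp_all add: hs_simps)
  have Yskew: "hs (Y u) v = - hs u (Y v)" for u v
    by (simp add: Y_def hsd smul skew)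
  \<comment> \<open>\<open>p\<close> will be nonnegative with a zero at \<open>w\<close>, so its
    first variation at \<open>w\<close> vanishes.\<close>
  define p where "p u = Im (hs (Y u) u)" for u
  have p: "p u = q u - r * (norm u)\<^sup>2" for u
    by (simp add: p_def q_def Y_def hsd smul hs_self power2_norm_eq_inner)
  have p_nonneg: "p u \<ge> 0" for u
  proof (cases "u = 0")
    case True
    then show ?thesis by (simp add: p_def hs_simps)
  next
    case False
    define e where "e = (1 / norm u) *\<^sub>R u"
    have "u = norm u *\<^sub>R e" "norm e = 1"
      using False by (simp_all add: e_def)
    have "p u = (norm u)\<^sup>2 * p e"
      by (subst \<open>u = norm u *\<^sub>R e\<close>) (simp add: p_def YscaleR hs_simps power2_eq_square)
    moreover have "p e \<ge> 0"
      using w(2)[OF \<open>norm e = 1\<close>] by (simp add: p \<open>norm e = 1\<close> r_def)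
    ultimately show ?thesis by simp
  qed
  have pw: "p w = 0"
    by (simp add: p r_def w(1))
  have z0: "Im (hs (Y w) v) = 0" for v
  proof (rule ccontr)
    let ?a = "Im (hs (Y w) v)" let ?b = "p v"
    assume a: "?a \<noteq> 0"
    have e: "p (w + t *\<^sub>R v) = 2 * t * ?a + t\<^sup>2 * ?b" for t
    proof -
      have "hs (Y v) w = - cnj (hs (Y w) v)"
        by (simp add: Yskew[of v] hs_cnj)
      then have "Im (hs (Y v) w) = ?a"
        by simp
      then show ?thesis
        using pw by (simp add: p_def Yadd YscaleR hs_simps power2_eq_square algebra_simps)
    qed
    \<comment> \<open>A step along which \<open>2 t a + t\<^sup>2 b\<close> becomes negative;
      \<open>b + 1\<close> in place of \<open>b\<close> keeps the denominator positive when
      \<open>b = 0\<close>.\<close>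
    define t where "t = - ?a / (?b + 1)"
    have b1: "?b + 1 > 0" using p_nonneg[of v] by simp
    have "2 * (- x / c) * x + (- x / c)\<^sup>2 * y = (x / c)\<^sup>2 * (y - 2 * c)" if "c \<noteq> 0" for x y c :: real
      using that by (simp add: field_simps power2_eq_square)
    from this[of "?b + 1" ?a ?b] have "p (w + t *\<^sub>R v) = (?a / (?b + 1))\<^sup>2 * (- ?b - 2)"
      unfolding e t_def using b1 by simp
    moreover have "(?a / (?b + 1))\<^sup>2 * (- ?b - 2) < 0"
      using a b1 p_nonneg[of v] by (intro mult_pos_neg) auto
    ultimately show False
      using p_nonneg[of "w + t *\<^sub>R v"] by linarith
  qed
  \<comment> \<open>Testing with \<open>\<i>\<close> times \<open>Y w\<close> turns the imaginary
    part into minus the squared norm.\<close>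
  have "Y w = 0"
    using z0[of "\<i> *s Y w"] by (simp add: smul hs_self)
  have "vec.subspace {u. Y u = 0}"
    unfolding vec.subspace_def
    by (auto simp: Yadd) (auto simp: Y_def vec_eq_iff matrix_vector_mult_def sum_distrib_left[symmetric] mult.left_commute
        algebra_simps)
  moreover have "Y (cl k *v u) = cl k *v Y u" for k u
    by (simp add: Y_def matvec comm vector_scalar_commute)
  then have "\<forall>k. \<forall>u\<in>{u. Y u = 0}. cl k *v u \<in> {u. Y u = 0}"
    by (simp add: matvec_0)
  ultimately have "{u. Y u = 0} = {0} \<or> {u. Y u = 0} = UNIV"
    using spinor unfolding spinor_module_def by blast
  moreover have "w \<noteq> 0" using w(1) by auto
  ultimately have "Y u = 0" for u
    using \<open>Y w = 0\<close> by blast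
  then show ?thesis
    by (intro that[of r]) (simp add: Y_def)
qed

text \<open>The difference of both sides commutes with Clifford multiplication and is skew-Hermitian, hence
  an imaginary scalar; its trace is real.\<close>

lemma spin_gauge:
  assumes s: "s \<in> spin_group cl"
    and d1: "\<And>v. ds ** cvec cl v = cvec cl (dA *v v) ** s + cvec cl (spin_cover cl s *v v) ** ds"
    and d2: "cadj ds ** s + cadj s ** ds = 0"
    and d3: "Im (trace (ds ** cadj s)) = 0"
    and skew: "transpose (dA ** transpose (spin_cover cl s)) = - (dA ** transpose (spin_cover cl s))"
  shows "ds *v u = sigm cl (dA ** transpose (spin_cover cl s)) (s *v u)"
proof -
  let ?A = "spin_cover cl s" let ?W = "dA ** transpose ?A"
  define S where "S = (1 / 4) *\<^sub>R (\<Sum>a\<in>UNIV. \<Sum>b\<in>UNIV. ?W $ a $ b *\<^sub>R (cl b ** cl a))"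
  have S: "S *v u = sigm cl ?W u" for u
    by (simp add: S_def sigm_def scaleR_matrix_vector_mult sum_matrix_vector_mult matrix_vector_mul_assoc)
  define X where "X = ds ** cadj s - S"
  have X: "X *v u = ds *v (cadj s *v u) - sigm cl ?W u" for u
    by (simp add: X_def matrix_vector_mult_diff_rdistrib S matrix_vector_mul_assoc)
  have ot: "transpose ?A ** ?A = mat 1" "?A ** transpose ?A = mat 1"
    using spin_cover(1)[OF s] by (auto simp: orthogonal_matrix_def)
  have "X *v (cl k *v u) = cl k *v (X *v u)" for k u
  proof -
    \<comment> \<open>\<open>?w\<close> is the preimage of \<open>e_k\<close> under the covering
      matrix, so \<open>d1\<close> at \<open>?w\<close> yields the commutator of
      \<open>ds ** cadj s\<close> with \<open>cl k\<close>; \<open>sigm_cl\<close> gives the same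
      commutator for \<open>S\<close>.\<close>
    let ?w = "transpose ?A *v axis k 1"
    have Aw: "?A *v ?w = axis k 1"
      by (simp only: matrix_vector_mul_assoc ot matrix_vector_mul_lid)
    have "cadj s ** cl k = cadj s ** (cvec cl (?A *v ?w) ** s) ** cadj s"
      by (simp only: Aw cvec_axis spin_group_unitary[OF s] matrix_mul_rid flip: matrix_mul_assoc)
    also have "\<dots> = cvec cl ?w ** cadj s"
      unfolding spin_cover(2)[OF s, symmetric] by (simp add: spin_group_unitary[OF s] matrix_mul_assoc)
    finally have "ds ** cadj s ** cl k = (ds ** cvec cl ?w) ** cadj s"
      by (simp flip: matrix_mul_assoc)
    also have "\<dots> = cvec cl (dA *v ?w) + cl k ** (ds ** cadj s)"
      unfolding d1 Aw cvec_axis by (simp add: matrix_mult_add spin_group_unitary[OF s] flip: matrix_mul_assoc)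
    finally have "ds *v (cadj s *v (cl k *v u)) = cvec cl (dA *v ?w) *v u + cl k *v (ds *v (cadj s *v u))"
      by (simp add: matrix_vector_mul_assoc matrix_vector_mult_add_rdistrib[symmetric] matrix_mul_assoc)
    moreover have "cvec cl (dA *v ?w) *v u = (\<Sum>b\<in>UNIV. ?W $ b $ k *\<^sub>R (cl b *v u))"
      unfolding matrix_vector_mul_assoc by (simp add: cvec_mult matrix_vector_mult_basis column_def)
    ultimately show ?thesis
      by (simp add: X sigm_cl[OF skew] matvec)
  qed
  moreover have "hs (X *v u) v = - hs u (X *v v)" for u v
  proof -
    have "ds ** cadj s + s ** cadj ds = s ** (cadj s ** ds + cadj ds ** s) ** cadj s"
      by (simp add: matrix_mult_add matrix_mul_assoc spin_group_unitary[OF s])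
        (simp add: spin_group_unitary[OF s] flip: matrix_mul_assoc)
    also have "\<dots> = 0"
      using d2 by (simp add: add.commute matrix_matrix_mult_def vec_eq_iff)
    finally have "s ** cadj ds = - (ds ** cadj s)"
      by (simp add: eq_neg_iff_add_eq_0 add.commute)
    moreover have "cadj (ds ** cadj s) = s ** cadj ds"
      by (simp add: cadj_mult) (simp add: cadj_def)
    ultimately have "hs (ds *v (cadj s *v u)) v = - hs u (ds *v (cadj s *v v))"
      using hs_cadj[of "ds ** cadj s" u v] by (simp add: matrix_vector_mul_assoc uminus_matrix_vector_mult hs_simps)
    moreover have "hs (a - b) c = hs a c - hs b c" "hs c (a - b) = hs c a - hs c b" for a b c :: "complex ^ 's"
      using hs_add_left[of a "- b" c] hs_add_right[of c a "- b"] by (simp_all add: hs_simps)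
    ultimately show ?thesis
      by (simp add: X hs_sigm[OF skew])
  qed
  ultimately obtain r where r: "\<And>u. X *v u = (\<i> * of_real r) *s u"
    using schur_skew by blast
  have "Im (trace S) = 0"
  proof -
    have "Im (trace (cl b ** cl a)) = 0" for a b
      using trace_cprod_real[of "[axis b 1, axis a 1]"] by (simp add: cvec_axis)
    moreover have "trace (sum f F) = (\<Sum>a\<in>F. trace (f a))" for f :: "'n \<Rightarrow> complex ^ 's ^ 's" and F
      unfolding trace_def sum_component by (rule sum.swap)
    ultimately show ?thesis
      by (simp add: S_def trace_scaleR)
  qed
  then have "Im (trace X) = 0"
    using d3 by (simp add: X_def trace_sub)
  moreover have "trace X = of_nat CARD('s) * (\<i> * of_real r)"
  proof -
    have "X $ a $ a = \<i> * of_real r" for a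
      using arg_cong[OF r[of "axis a 1"], of "\<lambda>v. v $ a"]
      by (simp add: matrix_vector_mult_def axis_def if_distrib cong: if_cong)
    then show ?thesis by (simp add: trace_def)
  qed
  ultimately have "r = 0" by simp
  then have "X *v (s *v u) = 0"
    by (simp add: r)
  then show ?thesis
    unfolding X by (simp add: matrix_vector_mul_assoc spin_group_unitary[OF s])
qed

end

section \<open>Symmetry of second derivatives and differentiation in charts\<close>

section \<open>Calculus on manifolds\<close>

text \<open>The mean value theorem is used twice: along \<open>v\<close> for the difference in
  direction \<open>w\<close>, then along \<open>w\<close> for the derivative in direction
  \<open>v\<close>.\<close>

lemma second_difference:
  fixes f :: "'a::euclidean_space \<Rightarrow> real"
  assumes "open S" "smooth_on f S" "\<And>s t. 0 \<le> s \<Longrightarrow> s \<le> h \<Longrightarrow> 0 \<le> t \<Longrightarrow> t \<le> h \<Longrightarrow> x + s *\<^sub>R v + t *\<^sub>R w \<in> S"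
    and "h > 0"
  shows "\<exists>s t. 0 < s \<and> s < h \<and> 0 < t \<and> t < h \<and>
    f (x + h *\<^sub>R v + h *\<^sub>R w) - f (x + h *\<^sub>R v) - f (x + h *\<^sub>R w) + f x
      = h * h * frechet_derivative (\<lambda>y. frechet_derivative f (at y) v) (at (x + s *\<^sub>R v + t *\<^sub>R w)) w"
proof -
  have der: "((\<lambda>r. g (p + r *\<^sub>R u)) has_real_derivative frechet_derivative g (at (p + r *\<^sub>R u)) u) (at r)"
    if "smooth_on g S" "p + r *\<^sub>R u \<in> S" for g :: "'a \<Rightarrow> real" and p u r
  proof -
    have g: "(g has_derivative frechet_derivative g (at (p + r *\<^sub>R u))) (at (p + r *\<^sub>R u))"
      using smooth_on_imp_differentiable_at[OF that(1) assms(1) that(2)] by (simp add: frechet_derivative_works)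
    have "((\<lambda>r. g (p + r *\<^sub>R u)) has_derivative (\<lambda>d. frechet_derivative g (at (p + r *\<^sub>R u)) (d *\<^sub>R u))) (at r)"
      by (rule has_derivative_compose[where f="\<lambda>r. p + r *\<^sub>R u" and f'="\<lambda>d. d *\<^sub>R u", OF _ g])
        (auto intro!: derivative_eq_intros)
    moreover have "(\<lambda>d. frechet_derivative g (at (p + r *\<^sub>R u)) (d *\<^sub>R u)) = (*) (frechet_derivative g (at (p + r *\<^sub>R u)) u)"
      using has_derivative_linear[OF g] by (auto simp: linear_scale)
    ultimately show ?thesis
      by (simp add: has_field_derivative_def)
  qed
  have sv: "smooth_on (\<lambda>y. frechet_derivative f (at y) v) S"
    by (rule smooth_on_frechet_derivative[OF assms(2)])
  let ?F = "\<lambda>s. f ((x + h *\<^sub>R w) + s *\<^sub>R v) - f (x + s *\<^sub>R v)"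
  let ?F' = "\<lambda>s. frechet_derivative f (at ((x + h *\<^sub>R w) + s *\<^sub>R v)) v - frechet_derivative f (at (x + s *\<^sub>R v)) v"
  have "\<exists>s>0. s < h \<and> ?F h - ?F 0 = (h - 0) * ?F' s"
  proof (rule MVT2)
    show "DERIV ?F s :> ?F' s" if "0 \<le> s" "s \<le> h" for s
    proof (intro DERIV_diff der assms(2))
      show "x + h *\<^sub>R w + s *\<^sub>R v \<in> S" "x + s *\<^sub>R v \<in> S"
        using assms(3)[of s h] assms(3)[of s 0] assms(4) that by (simp_all add: algebra_simps)
    qed
  qed (rule assms(4))
  then obtain s where s: "0 < s" "s < h" "?F h - ?F 0 = h * ?F' s"
    by auto
  let ?G = "\<lambda>t. frechet_derivative f (at ((x + s *\<^sub>R v) + t *\<^sub>R w)) v"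
  let ?G' = "\<lambda>t. frechet_derivative (\<lambda>y. frechet_derivative f (at y) v) (at ((x + s *\<^sub>R v) + t *\<^sub>R w)) w"
  have "\<exists>t>0. t < h \<and> ?G h - ?G 0 = (h - 0) * ?G' t"
  proof (rule MVT2)
    show "DERIV ?G t :> ?G' t" if "0 \<le> t" "t \<le> h" for t
      using assms(3)[of s t] s that by (intro der[OF sv]) simp
  qed (rule assms(4))
  then obtain t where t: "0 < t" "t < h" "?G h - ?G 0 = h * ?G' t"
    by auto
  have "?F' s = ?G h - ?G 0"
    by (simp add: algebra_simps)
  then have "?F h - ?F 0 = h * (h * ?G' t)"
    using s(3) t(3) by simp
  then show ?thesis
    using s t by (intro exI[of _ s] exI[of _ t]) (simp add: algebra_simps)
qed

text \<open>The second difference is symmetric in \<open>v\<close> and \<open>w\<close>, so the two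
  mixed derivatives agree at two suitable points arbitrarily close to \<open>x\<close>; continuity
  carries this to \<open>x\<close>.\<close>

lemma schwarz_real:
  fixes f :: "'a::euclidean_space \<Rightarrow> real"
  assumes "open S" "smooth_on f S" "x \<in> S"
  shows "frechet_derivative (\<lambda>y. frechet_derivative f (at y) v) (at x) w
    = frechet_derivative (\<lambda>y. frechet_derivative f (at y) w) (at x) v"
proof (rule ccontr)
  let ?A = "\<lambda>x. frechet_derivative (\<lambda>y. frechet_derivative f (at y) v) (at x) w"
  let ?B = "\<lambda>x. frechet_derivative (\<lambda>y. frechet_derivative f (at y) w) (at x) v"
  assume "?A x \<noteq> ?B x"
  define e where "e = \<bar>?A x - ?B x\<bar> / 2"
  have "e > 0" using \<open>?A x \<noteq> ?B x\<close> by (simp add: e_def)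
  have "continuous_on S ?A" "continuous_on S ?B"
    by (intro smooth_on_imp_continuous_on smooth_on_frechet_derivative assms)+
  then have "isCont ?A x" "isCont ?B x"
    using assms by (simp_all add: continuous_on_eq_continuous_at)
  then obtain d1 d2 where d: "d1 > 0" "\<And>y. dist y x < d1 \<Longrightarrow> dist (?A y) (?A x) < e"
    "d2 > 0" "\<And>y. dist y x < d2 \<Longrightarrow> dist (?B y) (?B x) < e"
    using \<open>e > 0\<close> unfolding continuous_at_eps_delta by metis
  obtain d3 where d3: "d3 > 0" "ball x d3 \<subseteq> S"
    using assms openE by blast
  define d where "d = min d1 (min d2 d3)"
  \<comment> \<open>Small enough for the parallelogram spanned by \<open>h v\<close> and
    \<open>h w\<close> to stay within distance \<open>d\<close>; the summand \<open>1\<close> avoids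
    division by zero.\<close>
  define h where "h = d / (2 * (norm v + norm w + 1))"
  have "d > 0" using d d3 by (simp add: d_def)
  then have h: "h > 0"
    by (simp add: h_def add_nonneg_pos)
  have near: "dist (x + s *\<^sub>R v + t *\<^sub>R w) x < d" if "0 \<le> s" "s \<le> h" "0 \<le> t" "t \<le> h" for s t
  proof -
    have "dist (x + s *\<^sub>R v + t *\<^sub>R w) x \<le> norm (s *\<^sub>R v) + norm (t *\<^sub>R w)"
      using norm_triangle_ineq[of "s *\<^sub>R v" "t *\<^sub>R w"] by (simp add: dist_norm add.assoc)
    also have "\<dots> \<le> h * norm v + h * norm w"
      using that by (auto intro!: add_mono mult_right_mono)
    also have "\<dots> \<le> h * (norm v + norm w + 1)"
      using h by (simp add: algebra_simps)
    also have "\<dots> = d / 2"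
    proof -
      have k: "d / (2 * k) * k = d / 2" if "k \<noteq> 0" for k
        using that by simp
      have "norm v + norm w + 1 \<noteq> 0"
        by (smt (verit) norm_ge_zero)
      then show ?thesis unfolding h_def by (rule k)
    qed
    finally show ?thesis using \<open>d > 0\<close> by simp
  qed
  have inS: "x + s *\<^sub>R v + t *\<^sub>R w \<in> S" if "0 \<le> s" "s \<le> h" "0 \<le> t" "t \<le> h" for s t
    using near[OF that] d3 by (auto simp: d_def dist_commute)
  obtain s t where st: "0 < s" "s < h" "0 < t" "t < h"
    "f (x + h *\<^sub>R v + h *\<^sub>R w) - f (x + h *\<^sub>R v) - f (x + h *\<^sub>R w) + f x = h * h * ?A (x + s *\<^sub>R v + t *\<^sub>R w)"
    using second_difference[OF assms(1,2) inS h] by blast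
  have inS': "x + s *\<^sub>R w + t *\<^sub>R v \<in> S" if "0 \<le> s" "s \<le> h" "0 \<le> t" "t \<le> h" for s t
    using inS[of t s] that by (simp add: add.commute add.left_commute)
  obtain s' t' where st': "0 < s'" "s' < h" "0 < t'" "t' < h"
    "f (x + h *\<^sub>R w + h *\<^sub>R v) - f (x + h *\<^sub>R w) - f (x + h *\<^sub>R v) + f x = h * h * ?B (x + s' *\<^sub>R w + t' *\<^sub>R v)"
    using second_difference[OF assms(1,2) inS' h] by blast
  have "h * h * ?A (x + s *\<^sub>R v + t *\<^sub>R w) = h * h * ?B (x + s' *\<^sub>R w + t' *\<^sub>R v)"
    using st(5) st'(5) by (simp add: algebra_simps)
  then have "?A (x + s *\<^sub>R v + t *\<^sub>R w) = ?B (x + t' *\<^sub>R v + s' *\<^sub>R w)"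
    using h by (simp add: add.commute add.left_commute)
  moreover have "dist (?A (x + s *\<^sub>R v + t *\<^sub>R w)) (?A x) < e"
    using near[of s t] st by (intro d(2)) (simp add: d_def)
  moreover have "dist (?B (x + t' *\<^sub>R v + s' *\<^sub>R w)) (?B x) < e"
    using near[of t' s'] st' by (intro d(4)) (simp add: d_def)
  moreover have "False" if "a' = b'" "\<bar>a' - a\<bar> < \<bar>a - b\<bar> / 2" "\<bar>b' - b\<bar> < \<bar>a - b\<bar> / 2" for a b a' b' :: real
    using that by (auto simp: abs_if split: if_splits)
  ultimately show False
    unfolding e_def dist_real_def by blast
qed

lemma frechet_derivative_bounded_linear:
  assumes "bounded_linear L" "f differentiable at x"
  shows "frechet_derivative (\<lambda>x. L (f x)) (at x) v = L (frechet_derivative f (at x) v)"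
  by (subst frechet_derivative_eq[OF bounded_linear.has_derivative[OF assms(1)]])
    (use assms(2) frechet_derivative_works in blast)+

lemma schwarz:
  fixes f :: "'a::euclidean_space \<Rightarrow> 'b::euclidean_space"
  assumes "open S" "smooth_on f S" "x \<in> S"
  shows "frechet_derivative (\<lambda>y. frechet_derivative f (at y) v) (at x) w
    = frechet_derivative (\<lambda>y. frechet_derivative f (at y) w) (at x) v"
proof (rule euclidean_eqI)
  fix b :: 'b
  have s: "smooth_on (\<lambda>x. f x \<bullet> b) S"
    by (rule smooth_on_bounded_linear[OF assms(1) bounded_linear_inner_left assms(2)])
  have e: "frechet_derivative (\<lambda>y. frechet_derivative f (at y) v) (at x) w \<bullet> b
    = frechet_derivative (\<lambda>y. frechet_derivative (\<lambda>x. f x \<bullet> b) (at y) v) (at x) w" for v w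
  proof -
    have "frechet_derivative (\<lambda>x. f x \<bullet> b) (at y) v = frechet_derivative f (at y) v \<bullet> b" if "y \<in> S" for y
      by (rule frechet_derivative_bounded_linear[OF bounded_linear_inner_left smooth_on_imp_differentiable_at[OF assms(2,1) that]])
    then have "frechet_derivative (\<lambda>y. frechet_derivative (\<lambda>x. f x \<bullet> b) (at y) v) (at x)
        = frechet_derivative (\<lambda>y. frechet_derivative f (at y) v \<bullet> b) (at x)"
      by (rule frechet_derivative_cong_open[OF assms(1,3)])
    moreover have "(\<lambda>y. frechet_derivative f (at y) v) differentiable at x"
      by (rule smooth_on_imp_differentiable_at[OF smooth_on_frechet_derivative[OF assms(2)] assms(1,3)])
    ultimately show ?thesis
      by (simp add: frechet_derivative_bounded_linear[OF bounded_linear_inner_left])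
  qed
  show "frechet_derivative (\<lambda>y. frechet_derivative f (at y) v) (at x) w \<bullet> b
    = frechet_derivative (\<lambda>y. frechet_derivative f (at y) w) (at x) v \<bullet> b"
    unfolding e by (rule schwarz_real[OF assms(1) s assms(3)])
qed

lemma bounded_linear_axis: "bounded_linear (axis k :: 'b::euclidean_space \<Rightarrow> 'b ^ 'n::finite)"
proof -
  have "linear (axis k :: 'b \<Rightarrow> 'b ^ 'n)"
    by (rule linearI) (auto simp: axis_def vec_eq_iff)
  then show ?thesis
    by (simp add: linear_conv_bounded_linear)
qed

lemma sum_axis_component: "(\<Sum>k\<in>UNIV. axis k (v $ k)) = (v :: 'b::euclidean_space ^ 'n::finite)"
  by (simp add: vec_eq_iff axis_def)

lemma bounded_bilinear_matrix_mult:
  "bounded_bilinear (\<lambda>A B. (A :: 'a::{euclidean_space, real_algebra_1} ^ 'm ^ 'n) ** (B :: 'a ^ 'k ^ 'm))"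
proof -
  have "bilinear (\<lambda>A B. (A :: 'a ^ 'm ^ 'n) ** (B :: 'a ^ 'k ^ 'm))"
    unfolding bilinear_def by (auto intro!: linearI simp: matrix_mult_add scaleR_matrix_mult)
  then show ?thesis
    by (simp add: bilinear_conv_bounded_bilinear)
qed

lemma bounded_bilinear_matvec:
  "bounded_bilinear (\<lambda>A u. (A :: 'a::{euclidean_space, real_algebra_1} ^ 'm ^ 'n) *v u)"
proof -
  have "bilinear (\<lambda>A u. (A :: 'a ^ 'm ^ 'n) *v u)"
    unfolding bilinear_def
    by (auto intro!: linearI simp: matrix_vector_mult_def vec_eq_iff sum.distrib algebra_simps scaleR_sum_right)
  then show ?thesis
    by (simp add: bilinear_conv_bounded_bilinear)
qed

lemma bounded_linear_transpose: "bounded_linear (transpose :: real ^ 'm ^ 'n \<Rightarrow> real ^ 'n ^ 'm)"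
proof -
  have "linear (transpose :: real ^ 'm ^ 'n \<Rightarrow> real ^ 'n ^ 'm)"
    by (rule linearI) (simp_all add: transpose_def vec_eq_iff)
  then show ?thesis
    by (simp add: linear_conv_bounded_linear)
qed

lemma bounded_linear_cadj: "bounded_linear (cadj :: complex ^ 's ^ 's::finite \<Rightarrow> _)"
proof -
  have "linear (cadj :: complex ^ 's ^ 's \<Rightarrow> _)"
    by (rule linearI) (simp_all add: cadj_def vec_eq_iff)
  then show ?thesis
    by (simp add: linear_conv_bounded_linear)
qed

locale smooth_mfd =
  fixes M :: "('i, 'm::t2_space, 'n::finite, 'z) riem_manifold_scheme"
  assumes mfd: "smooth_manifold M"
begin

lemma open_patch: "open (patch M i)"
  using mfd by (simp add: smooth_manifold_def)

lemma patch_cover: "\<exists>i. x \<in> patch M i"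
  using mfd by (auto simp: smooth_manifold_def)

lemma homeo: "homeomorphism (patch M i) (chart M i ` patch M i) (chart M i) (parm M i)"
  using mfd by (simp add: smooth_manifold_def)

lemma parm_chart: "x \<in> patch M i \<Longrightarrow> parm M i (chart M i x) = x"
  using homeo[of i] by (simp add: homeomorphism_def)

lemma open_chart_image:
  assumes "open W" "W \<subseteq> patch M i"
  shows "open (chart M i ` W)"
proof -
  have "openin (top_of_set (chart M i ` patch M i)) (chart M i ` W)"
    by (rule homeomorphism_imp_open_map[OF homeo]) (use assms in \<open>simp add: openin_open_eq open_patch\<close>)
  moreover have "open (chart M i ` patch M i)"
    using mfd by (simp add: smooth_manifold_def)
  ultimately show ?thesis
    by (simp add: openin_open_eq)
qed

definition ok :: "'i \<Rightarrow> 'm set \<Rightarrow> bool" where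
  "ok i W \<longleftrightarrow> open W \<and> W \<subseteq> patch M i"

lemma ok_patch: "ok i (patch M i)"
  by (simp add: ok_def open_patch)

lemma ok_Int: "ok i (patch M i \<inter> patch M j)" "ok i (patch M j \<inter> patch M i)"
  by (auto simp: ok_def open_patch)

lemma ok_image: "ok i W \<Longrightarrow> open (chart M i ` W)"
  by (simp add: ok_def open_chart_image)

lemma ok_in: "ok i W \<Longrightarrow> x \<in> W \<Longrightarrow> x \<in> patch M i"
  by (auto simp: ok_def)

abbreviation sm :: "'i \<Rightarrow> ('m \<Rightarrow> 'b::real_normed_vector) \<Rightarrow> 'm set \<Rightarrow> bool" where
  "sm i f W \<equiv> smooth_fun_on M i f W"

abbreviation dd :: "'i \<Rightarrow> ('m \<Rightarrow> 'b::real_normed_vector) \<Rightarrow> 'm \<Rightarrow> real ^ 'n \<Rightarrow> 'b" where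
  "dd i f x v \<equiv> dir_deriv M i f x v"

lemma sm_iff: "sm i f W \<longleftrightarrow> smooth_on (\<lambda>y. f (parm M i y)) (chart M i ` W)"
  by (simp add: smooth_fun_on_def o_def)

lemma dd_eq: "dd i f x v = frechet_derivative (\<lambda>y. f (parm M i y)) (at (chart M i x)) v"
  by (simp add: dir_deriv_def o_def)

lemma sm_cong:
  assumes "ok i W" "sm i f W" "\<And>x. x \<in> W \<Longrightarrow> f x = g x"
  shows "sm i g W"
  unfolding sm_iff
  by (rule smooth_on_cong[OF ok_image[OF assms(1)] _ assms(2)[unfolded sm_iff]])
    (use assms ok_in parm_chart in auto)

lemma sm_subset: "sm i f W \<Longrightarrow> V \<subseteq> W \<Longrightarrow> sm i f V"
  unfolding sm_iff by (erule smooth_on_subset) auto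

lemma sm_const: "sm i (\<lambda>x. c) W"
  unfolding sm_iff by (rule smooth_on_const)

lemma sm_add: "ok i W \<Longrightarrow> sm i f W \<Longrightarrow> sm i g W \<Longrightarrow> sm i (\<lambda>x. f x + g x) W"
  unfolding sm_iff by (rule smooth_on_add[OF ok_image])

lemma sm_sum: "ok i W \<Longrightarrow> (\<And>a. a \<in> A \<Longrightarrow> sm i (f a) W) \<Longrightarrow> sm i (\<lambda>x. \<Sum>a\<in>A. f a x) W"
  unfolding sm_iff by (rule smooth_on_sum[OF ok_image])

lemma sm_linear: "ok i W \<Longrightarrow> bounded_linear L \<Longrightarrow> sm i f W \<Longrightarrow> sm i (\<lambda>x. L (f x)) W"
  unfolding sm_iff by (rule smooth_on_bounded_linear[OF ok_image])

lemma sm_bilinear: "ok i W \<Longrightarrow> bounded_bilinear p \<Longrightarrow> sm i f W \<Longrightarrow> sm i g W \<Longrightarrow> sm i (\<lambda>x. p (f x) (g x)) W"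
  unfolding sm_iff by (rule smooth_on_bounded_bilinear[OF ok_image])

lemma sm_minus: "ok i W \<Longrightarrow> sm i f W \<Longrightarrow> sm i (\<lambda>x. - f x) W"
  by (rule sm_linear[OF _ bounded_linear_minus[OF bounded_linear_ident]])

lemma sm_diff: "ok i W \<Longrightarrow> sm i f W \<Longrightarrow> sm i g W \<Longrightarrow> sm i (\<lambda>x. f x - g x) W"
  using sm_add[OF _ _ sm_minus, of i W f g] by simp

lemma sm_nth: "ok i W \<Longrightarrow> sm i f W \<Longrightarrow> sm i (\<lambda>x. f x $ k) W"
  by (rule sm_linear[OF _ bounded_linear_vec_nth])

lemma sm_vec:
  fixes f :: "'m \<Rightarrow> 'b::euclidean_space ^ 'k"
  assumes "ok i W" "\<And>k. sm i (\<lambda>x. f x $ k) W"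
  shows "sm i f W"
proof -
  have "sm i (\<lambda>x. axis k (f x $ k)) W" for k
    by (rule sm_linear[OF assms(1) bounded_linear_axis assms(2)])
  then have "sm i (\<lambda>x. \<Sum>k\<in>UNIV. axis k (f x $ k)) W"
    by (rule sm_sum[OF assms(1)])
  then show ?thesis by (simp add: sum_axis_component)
qed

lemma sm_has_derivative:
  assumes "ok i W" "sm i f W" "x \<in> W"
  shows "((\<lambda>y. f (parm M i y)) has_derivative dd i f x) (at (chart M i x))"
  using smooth_on_imp_differentiable_at[OF assms(2)[unfolded sm_iff] ok_image[OF assms(1)], of "chart M i x"] assms(3)
  by (simp add: frechet_derivative_works dir_deriv_def[abs_def] o_def)

lemma linear_dd: "ok i W \<Longrightarrow> sm i f W \<Longrightarrow> x \<in> W \<Longrightarrow> linear (dd i f x)"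
  using sm_has_derivative has_derivative_linear by blast

lemma sm_dd:
  assumes "ok i W" "sm i f W"
  shows "sm i (\<lambda>x. dd i f x v) W"
proof -
  have "smooth_on (\<lambda>y. frechet_derivative (\<lambda>y. f (parm M i y)) (at y) v) (chart M i ` W)"
    using assms(2) unfolding sm_iff by (rule smooth_on_frechet_derivative)
  then show ?thesis
    unfolding sm_iff dd_eq
    by (rule smooth_on_cong[OF ok_image[OF assms(1)], rotated])
      (use assms(1) ok_in parm_chart in auto)
qed

lemma dd_cong:
  assumes "ok i W" "x \<in> W" "\<And>x. x \<in> W \<Longrightarrow> f x = g x"
  shows "dd i f x v = dd i g x v"
proof -
  have "frechet_derivative (\<lambda>y. f (parm M i y)) (at (chart M i x)) = frechet_derivative (\<lambda>y. g (parm M i y)) (at (chart M i x))"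
    by (rule frechet_derivative_cong_open[OF ok_image[OF assms(1)]]) (use assms ok_in parm_chart in auto)
  then show ?thesis by (simp add: dd_eq)
qed

lemma dd_const: "dd i (\<lambda>x. c) x v = 0"
  by (simp add: dd_eq frechet_derivative_const)

lemma dd_eqI:
  "((\<lambda>y. f (parm M i y)) has_derivative f') (at (chart M i x)) \<Longrightarrow> dd i f x v = f' v"
  unfolding dd_eq by (simp add: frechet_derivative_eq)

lemma dd_add:
  "ok i W \<Longrightarrow> sm i f W \<Longrightarrow> sm i g W \<Longrightarrow> x \<in> W \<Longrightarrow> dd i (\<lambda>x. f x + g x) x v = dd i f x v + dd i g x v"
  by (rule dd_eqI[OF has_derivative_add[OF sm_has_derivative sm_has_derivative]])

lemma dd_linear:
  "ok i W \<Longrightarrow> bounded_linear L \<Longrightarrow> sm i f W \<Longrightarrow> x \<in> W \<Longrightarrow> dd i (\<lambda>x. L (f x)) x v = L (dd i f x v)"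
  by (rule dd_eqI[OF bounded_linear.has_derivative[OF _ sm_has_derivative]])

lemma dd_bilinear:
  assumes "ok i W" "bounded_bilinear p" "sm i f W" "sm i g W" "x \<in> W"
  shows "dd i (\<lambda>x. p (f x) (g x)) x v = p (f x) (dd i g x v) + p (dd i f x v) (g x)"
  using dd_eqI[OF bounded_bilinear.FDERIV[OF assms(2) sm_has_derivative sm_has_derivative], OF assms(1,3,5,1,4,5)]
  by (simp add: parm_chart ok_in[OF assms(1,5)])

lemma dd_sum:
  assumes "ok i W" "\<And>a. a \<in> A \<Longrightarrow> sm i (f a) W" "x \<in> W"
  shows "dd i (\<lambda>x. \<Sum>a\<in>A. f a x) x v = (\<Sum>a\<in>A. dd i (f a) x v)"
  by (rule dd_eqI[OF has_derivative_sum[OF sm_has_derivative]]) (use assms in auto)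

lemma dd_minus: "ok i W \<Longrightarrow> sm i f W \<Longrightarrow> x \<in> W \<Longrightarrow> dd i (\<lambda>x. - f x) x v = - dd i f x v"
  by (rule dd_linear[OF _ bounded_linear_minus[OF bounded_linear_ident]])

lemma dd_nth: "ok i W \<Longrightarrow> sm i f W \<Longrightarrow> x \<in> W \<Longrightarrow> dd i (\<lambda>x. f x $ k) x v = dd i f x v $ k"
  by (rule dd_linear[OF _ bounded_linear_vec_nth])

lemma dd_schwarz:
  fixes f :: "'m \<Rightarrow> 'b::euclidean_space"
  assumes "ok i W" "sm i f W" "x \<in> W"
  shows "dd i (\<lambda>y. dd i f y v) x w = dd i (\<lambda>y. dd i f y w) x v"
proof -
  have e: "dd i (\<lambda>y. dd i f y v) x w
    = frechet_derivative (\<lambda>y. frechet_derivative (\<lambda>y. f (parm M i y)) (at y) v) (at (chart M i x)) w" for v w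
  proof -
    have "frechet_derivative (\<lambda>y. dd i f (parm M i y) v) (at (chart M i x))
      = frechet_derivative (\<lambda>y. frechet_derivative (\<lambda>y. f (parm M i y)) (at y) v) (at (chart M i x))"
      by (rule frechet_derivative_cong_open[OF ok_image[OF assms(1)]])
        (use assms ok_in[OF assms(1)] parm_chart in \<open>auto simp: dd_eq\<close>)
    then show ?thesis by (simp add: dd_eq)
  qed
  show ?thesis
    unfolding e by (rule schwarz[OF ok_image[OF assms(1)] assms(2)[unfolded sm_iff]]) (use assms in auto)
qed

lemma sm_chart: "sm i (chart M j) (patch M i \<inter> patch M j)"
  using mfd by (simp add: smooth_manifold_def)

lemma sm_change:
  assumes "sm j f W" "open W" "W \<subseteq> patch M i \<inter> patch M j"
  shows "sm i f W"
proof -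
  have ok: "ok i W" "ok j W"
    using assms by (auto simp: ok_def)
  have "sm i (chart M j) W"
    by (rule sm_subset[OF sm_chart assms(3)])
  then have "smooth_on (\<lambda>y. f (parm M j (chart M j (parm M i y)))) (chart M i ` W)"
    unfolding sm_iff
    by (intro smooth_on_compose[OF ok_image[OF ok(1)] ok_image[OF ok(2)] _ assms(1)[unfolded sm_iff]])
      (use ok_in[OF ok(1)] parm_chart in auto)
  then show ?thesis
    unfolding sm_iff
    by (rule smooth_on_cong[OF ok_image[OF ok(1)], rotated]) (use ok_in[OF ok(1)] ok_in[OF ok(2)] parm_chart in auto)
qed

lemma jac_works:
  assumes "x \<in> patch M i" "x \<in> patch M j"
  shows "jac M i j x *v v = dd i (chart M j) x v"
proof -
  have "linear (dd i (chart M j) x)"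
    by (rule linear_dd[OF ok_Int(1) sm_chart]) (use assms in auto)
  then show ?thesis
    by (simp add: jac_def matrix_works)
qed

lemma dd_change:
  assumes "ok j W" "sm j f W" "x \<in> W" "x \<in> patch M i"
  shows "dd i f x v = dd j f x (jac M i j x *v v)"
proof -
  have x: "x \<in> patch M j" using assms ok_in by blast
  have c: "((\<lambda>y. chart M j (parm M i y)) has_derivative dd i (chart M j) x) (at (chart M i x))"
    by (rule sm_has_derivative[OF ok_Int(1) sm_chart]) (use x assms in auto)
  have "((\<lambda>y. f (parm M j (chart M j (parm M i y)))) has_derivative (\<lambda>v. dd j f x (dd i (chart M j) x v))) (at (chart M i x))"
    by (rule has_derivative_compose[OF c]) (use sm_has_derivative[OF assms(1-3)] in \<open>simp add: parm_chart assms(4)\<close>)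
  then have "((\<lambda>y. f (parm M i y)) has_derivative (\<lambda>v. dd j f x (dd i (chart M j) x v))) (at (chart M i x))"
    by (rule has_derivative_transform_within_open[OF _ ok_image[OF ok_Int(1)[of i j]]])
      (use x assms(4) parm_chart in auto)
  then show ?thesis
    by (simp add: dd_eqI jac_works[OF assms(4) x])
qed

lemma sm_jac: "sm i (jac M i j) (patch M i \<inter> patch M j)"
proof (rule sm_vec[OF ok_Int(1)], rule sm_vec[OF ok_Int(1)])
  fix a b
  have "sm i (\<lambda>x. dd i (chart M j) x (axis b 1) $ a) (patch M i \<inter> patch M j)"
    by (intro sm_nth[OF ok_Int(1)] sm_dd[OF ok_Int(1)] sm_chart)
  then show "sm i (\<lambda>x. jac M i j x $ a $ b) (patch M i \<inter> patch M j)"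
    by (simp add: jac_def matrix_def)
qed

text \<open>The chain rule for the coordinates of chart \<open>i\<close>, differentiated through
  chart \<open>j\<close>.\<close>

lemma jac_inverse:
  assumes "x \<in> patch M i" "x \<in> patch M j"
  shows "jac M j i x ** jac M i j x = mat 1"
proof (subst matrix_eq, intro allI)
  fix v
  have "sm j (chart M i) (patch M j \<inter> patch M i)"
    by (rule sm_chart)
  from dd_change[OF ok_Int(1) this, of x i v] have "dd j (chart M i) x (jac M i j x *v v) = dd i (chart M i) x v"
    using assms by simp
  moreover have "dd i (chart M i) x v = v"
  proof (rule dd_eqI)
    have "((\<lambda>y. y) has_derivative (\<lambda>v. v)) (at (chart M i x))"
      by (rule has_derivative_ident)
    then show "((\<lambda>y. chart M i (parm M i y)) has_derivative (\<lambda>v. v)) (at (chart M i x))"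
      by (rule has_derivative_transform_within_open[OF _ ok_image[OF ok_patch[of i]]])
        (use assms parm_chart in auto)
  qed
  ultimately show "(jac M j i x ** jac M i j x) *v v = mat 1 *v v"
    using assms by (simp add: jac_works flip: matrix_vector_mul_assoc)
qed

end

section \<open>Christoffel matrices, orthonormal frames and their transformation laws\<close>

section \<open>The Levi-Civita connection\<close>

lemma matrix_mult_diff:
  fixes A :: "'a::ring_1 ^ 'm ^ 'n" and B :: "'a ^ 'k ^ 'm"
  shows "(A - A') ** B = A ** B - A' ** B" "A ** (B - B') = A ** B - A ** B'"
  by (simp_all add: matrix_matrix_mult_def vec_eq_iff sum_subtractf algebra_simps)

lemma matrix_mult_minus:
  fixes A :: "'a::ring_1 ^ 'm ^ 'n" and B :: "'a ^ 'k ^ 'm"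
  shows "(- A) ** B = - (A ** B)" "A ** (- B) = - (A ** B)"
  by (simp_all add: matrix_matrix_mult_def vec_eq_iff sum_negf)

lemma transpose_add: "transpose (A + B) = transpose A + transpose (B :: real ^ 'm ^ 'n)"
  by (simp add: transpose_def vec_eq_iff)

lemma transpose_diff: "transpose (A - B) = transpose A - transpose (B :: real ^ 'm ^ 'n)"
  by (simp add: transpose_def vec_eq_iff)

lemma matvec_uminus: "(- A) *v u = - ((A :: real ^ 'm ^ 'n) *v u)"
  by (simp add: matrix_vector_mult_def vec_eq_iff sum_negf)

lemmas matalg = matrix_mult_add matrix_mult_diff matrix_mult_minus transpose_add transpose_diff
  matrix_transpose_mul transpose_transpose

lemma matrix_inv_eqI:
  fixes A B :: "real ^ 'n ^ 'n"
  assumes "A ** B = mat 1"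
  shows "matrix_inv A = B"
proof -
  have BA: "B ** A = mat 1"
    using assms by (simp add: matrix_left_right_inverse)
  have "A ** matrix_inv A = mat 1"
    using someI_ex[of "\<lambda>A'. A ** A' = mat 1 \<and> A' ** A = mat 1"] assms BA
    unfolding matrix_inv_def by blast
  then have "B ** (A ** matrix_inv A) = B"
    by simp
  then show ?thesis
    by (simp add: matrix_mul_assoc BA)
qed

text \<open>The usual argument for uniqueness of the Levi-Civita connection: a trilinear form which is symmetric
  in two and skew in another pair of its arguments vanishes.\<close>

lemma christoffel_unique:
  fixes g :: "real ^ 'n ^ 'n" and S :: "real ^ 'n \<Rightarrow> real ^ 'n ^ 'n"
  assumes inv: "ginv ** g = mat 1" and g: "transpose g = g"
    and sym: "\<And>v w. S v *v w = S w *v v" and skew: "\<And>v. g ** S v + transpose (S v) ** g = 0"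
  shows "S v = 0"
proof -
  define h where "h u v w = u \<bullet> (g *v (S v *v w))" for u v w
  have h1: "h u v w = h u w v" for u v w
    by (simp add: h_def sym[of v w])
  have tr: "x \<bullet> (transpose A *v y) = y \<bullet> (A *v x)" for x y and A :: "real ^ 'n ^ 'n"
    by (metis dot_lmul_matrix inner_commute transpose_matrix_vector)
  have h2: "h u v w = - h w v u" for u v w
  proof -
    have "g ** S v = - (transpose (S v) ** g)"
      using skew[of v] by (simp add: eq_neg_iff_add_eq_0)
    then have "h u v w = - (u \<bullet> (transpose (S v) *v (g *v w)))"
      by (simp add: h_def matrix_vector_mul_assoc matvec_uminus)
    also have "u \<bullet> (transpose (S v) *v (g *v w)) = w \<bullet> (g *v (S v *v u))"
      using tr[of u "S v" "g *v w"] tr[of w g "S v *v u"] by (simp add: g inner_commute)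
    finally show ?thesis by (simp add: h_def)
  qed
  \<comment> \<open>Alternating symmetry and skewness three times returns the same form with the
    opposite sign.\<close>
  have "h u v w = 0" for u v w
    using h1[of u v w] h2[of u w v] h1[of v w u] h2[of v u w] h1[of w u v] h2[of w v u] by simp
  then have "g *v (S v *v w) = 0" for v w
    using inner_eq_zero_iff[of "g *v (S v *v w)"] unfolding h_def by blast
  then have "(ginv ** g) *v (S v *v w) = 0" for v w
    by (simp flip: matrix_vector_mul_assoc)
  then have "S v *v w = 0 *v w" for v w
    by (simp add: inv)
  then show ?thesis
    by (subst matrix_eq) blast
qed

locale spin_mfd =
  fixes M :: "('i, 'm::{t2_space, second_countable_topology}, 'n::finite, 's::finite) spin_manifold"
  assumes rsm: "riemannian_spin_manifold M"

sublocale spin_mfd \<subseteq> smooth_mfd M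
  by unfold_locales (use rsm in \<open>simp add: riemannian_spin_manifold_def\<close>)

sublocale spin_mfd \<subseteq> spinor_rep "clif M"
  by unfold_locales (use rsm in \<open>simp add: riemannian_spin_manifold_def spin_structure_def\<close>)

context spin_mfd
begin

abbreviation gm :: "'i \<Rightarrow> 'm \<Rightarrow> real ^ 'n ^ 'n" where "gm \<equiv> gmet M"
abbreviation fr :: "'i \<Rightarrow> 'm \<Rightarrow> real ^ 'n ^ 'n" where "fr \<equiv> frame M"
abbreviation lf :: "'i \<Rightarrow> 'i \<Rightarrow> 'm \<Rightarrow> complex ^ 's ^ 's" where "lf \<equiv> lift M"
abbreviation cl :: "'n \<Rightarrow> complex ^ 's ^ 's" where "cl \<equiv> clif M"
abbreviation fc :: "'i \<Rightarrow> 'i \<Rightarrow> 'm \<Rightarrow> real ^ 'n ^ 'n" where "fc \<equiv> frame_change M"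

lemmas sm_mm = sm_bilinear[OF _ bounded_bilinear_matrix_mult]
  and dd_mm = dd_bilinear[OF _ bounded_bilinear_matrix_mult]
  and sm_mv = sm_bilinear[OF _ bounded_bilinear_matvec]
  and dd_mv = dd_bilinear[OF _ bounded_bilinear_matvec]
  and sm_scaleR = sm_bilinear[OF _ bounded_bilinear_scaleR]
  and dd_scaleR = dd_bilinear[OF _ bounded_bilinear_scaleR]
  and sm_mult = sm_bilinear[OF _ bounded_bilinear_mult]
  and sm_transpose = sm_linear[OF _ bounded_linear_transpose]
  and dd_transpose = dd_linear[OF _ bounded_linear_transpose]

lemma sm_gm: "sm i (gm i) (patch M i)"
  using rsm unfolding riemannian_spin_manifold_def riemannian_metric_def by blast

lemma gm_sym: "x \<in> patch M i \<Longrightarrow> transpose (gm i x) = gm i x"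
  using rsm unfolding riemannian_spin_manifold_def riemannian_metric_def by blast

lemma gm_change: "x \<in> patch M i \<Longrightarrow> x \<in> patch M j \<Longrightarrow> gm i x = transpose (jac M i j x) ** gm j x ** jac M i j x"
  using rsm unfolding riemannian_spin_manifold_def riemannian_metric_def by blast

lemma sm_fr: "sm i (fr i) (patch M i)"
  using rsm unfolding riemannian_spin_manifold_def spin_structure_def by blast

lemma fr_orth: "x \<in> patch M i \<Longrightarrow> transpose (fr i x) ** gm i x ** fr i x = mat 1"
  using rsm unfolding riemannian_spin_manifold_def spin_structure_def by blast

lemma sm_lf: "sm i (lf j i) (patch M i \<inter> patch M j)"
  using rsm unfolding riemannian_spin_manifold_def spin_structure_def by blast

lemma lf_spin: "x \<in> patch M i \<Longrightarrow> x \<in> patch M j \<Longrightarrow> lf j i x \<in> spin_group cl"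
  using rsm unfolding riemannian_spin_manifold_def spin_structure_def by blast

lemma lf_cover: "x \<in> patch M i \<Longrightarrow> x \<in> patch M j \<Longrightarrow> spin_cover cl (lf j i x) = fc j i x"
  using rsm unfolding riemannian_spin_manifold_def spin_structure_def by blast

lemma fr_inv:
  assumes "x \<in> patch M i"
  shows "fr i x ** (transpose (fr i x) ** gm i x) = mat 1" "matrix_inv (fr i x) = transpose (fr i x) ** gm i x"
    "gm i x ** (fr i x ** transpose (fr i x)) = mat 1" "fr i x ** transpose (fr i x) ** gm i x = mat 1"
    "matrix_inv (gm i x) = fr i x ** transpose (fr i x)"
proof -
  show 1: "fr i x ** (transpose (fr i x) ** gm i x) = mat 1"
    using fr_orth[OF assms] by (simp add: matrix_left_right_inverse)
  then show "matrix_inv (fr i x) = transpose (fr i x) ** gm i x"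
    by (rule matrix_inv_eqI)
  show "fr i x ** transpose (fr i x) ** gm i x = mat 1"
    using 1 by (simp add: matrix_mul_assoc)
  then show 2: "gm i x ** (fr i x ** transpose (fr i x)) = mat 1"
    by (simp add: matrix_left_right_inverse)
  then show "matrix_inv (gm i x) = fr i x ** transpose (fr i x)"
    by (rule matrix_inv_eqI)
qed

lemma sm_coord: "ok i W \<Longrightarrow> sm i f W \<Longrightarrow> sm i (coord_deriv M i a f) W"
  unfolding coord_deriv_def[abs_def] by (rule sm_dd)

lemma sm_gm_nth: "sm i (\<lambda>x. gm i x $ a $ b) (patch M i)"
  by (intro sm_nth[OF ok_patch] sm_gm)

lemma sm_matrix_inv_gm: "sm i (\<lambda>x. matrix_inv (gm i x)) (patch M i)"
  by (rule sm_cong[OF ok_patch, of i "\<lambda>x. fr i x ** transpose (fr i x)"])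
    (auto simp: fr_inv intro!: sm_mm sm_transpose ok_patch sm_fr)

lemma sm_christoffel: "sm i (\<lambda>x. christoffel M i x k a b) (patch M i)"
proof -
  have "sm i (\<lambda>x. matrix_inv (gm i x) $ k $ l *
        (coord_deriv M i a (\<lambda>y. gmet M i y $ b $ l) x
         + coord_deriv M i b (\<lambda>y. gmet M i y $ a $ l) x
         - coord_deriv M i l (\<lambda>y. gmet M i y $ a $ b) x)) (patch M i)" for l
    by (intro sm_mult sm_add sm_diff sm_coord ok_patch sm_gm_nth sm_nth sm_matrix_inv_gm)
  then have "sm i (\<lambda>x. \<Sum>l\<in>UNIV. matrix_inv (gm i x) $ k $ l *
        (coord_deriv M i a (\<lambda>y. gmet M i y $ b $ l) x
         + coord_deriv M i b (\<lambda>y. gmet M i y $ a $ l) x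
         - coord_deriv M i l (\<lambda>y. gmet M i y $ a $ b) x)) (patch M i)"
    by (intro sm_sum[OF ok_patch])
  then show ?thesis
    unfolding christoffel_def by (rule sm_linear[OF ok_patch bounded_linear_divide])
qed

text \<open>The matrix of the connection in direction \<open>v\<close> on coordinate fields. In
  matrix form torsion-freeness is \<open>chm_sym\<close> and compatibility with the metric is
  \<open>chm_metric\<close>.\<close>

definition chm :: "'i \<Rightarrow> 'm \<Rightarrow> real ^ 'n \<Rightarrow> real ^ 'n ^ 'n" where
  "chm i x v = (\<chi> k d. \<Sum>a\<in>UNIV. christoffel M i x k a d * v $ a)"

lemma linear_chm: "linear (chm i x)"
  by (rule linearI) (simp_all add: chm_def vec_eq_iff algebra_simps sum.distrib sum_distrib_left)

lemma linear_axis_expand: "linear f \<Longrightarrow> f v = (\<Sum>a\<in>UNIV. v $ a *\<^sub>R f (axis a (1 :: real)))"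
proof -
  assume f: "linear f"
  have "v = (\<Sum>a\<in>UNIV. v $ a *\<^sub>R axis a 1)"
    using basis_expansion[of v] by (simp add: scalar_mult_eq_scaleR)
  then have "f v = f (\<Sum>a\<in>UNIV. v $ a *\<^sub>R axis a 1)"
    by simp
  then show ?thesis
    by (simp add: linear_sum[OF f] linear_scale[OF f])
qed

lemma sm_chm:
  assumes "sm i V (patch M i)"
  shows "sm i (\<lambda>x. chm i x (V x)) (patch M i)"
proof (rule sm_vec[OF ok_patch], rule sm_vec[OF ok_patch])
  show "sm i (\<lambda>x. chm i x (V x) $ k $ d) (patch M i)" for k d
    by (simp add: chm_def, intro sm_sum sm_mult sm_nth ok_patch sm_christoffel assms)
qed

lemma chm_axis: "chm i x (axis a 1) $ k $ d = christoffel M i x k a d"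
  by (simp add: chm_def axis_def if_distrib cong: if_cong)

lemma gm_nth_sym: "x \<in> patch M i \<Longrightarrow> gm i x $ a $ b = gm i x $ b $ a"
  using arg_cong[OF gm_sym[of x i], of "\<lambda>A. A $ b $ a"] by (simp add: transpose_def)

lemma coord_gm_sym: "x \<in> patch M i \<Longrightarrow> coord_deriv M i k (\<lambda>y. gm i y $ a $ b) x = coord_deriv M i k (\<lambda>y. gm i y $ b $ a) x"
  unfolding coord_deriv_def by (rule dd_cong[OF ok_patch]) (auto intro: gm_nth_sym)

lemma christoffel_sym: "x \<in> patch M i \<Longrightarrow> christoffel M i x k a b = christoffel M i x k b a"
  unfolding christoffel_def by (simp add: coord_gm_sym[of x i _ a b] add.commute)

lemma chm_sym:
  assumes "x \<in> patch M i"
  shows "chm i x v *v w = chm i x w *v v"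
proof -
  have "(\<Sum>d\<in>UNIV. (\<Sum>a\<in>UNIV. christoffel M i x k a d * v $ a) * w $ d)
    = (\<Sum>d\<in>UNIV. (\<Sum>a\<in>UNIV. christoffel M i x k a d * w $ a) * v $ d)" for k
    unfolding sum_distrib_right
    by (subst sum.swap) (simp add: christoffel_sym[OF assms, of k] mult_ac)
  then show ?thesis
    by (simp add: chm_def matrix_vector_mult_def vec_eq_iff)
qed

lemma christoffel_lower:
  assumes "x \<in> patch M i"
  shows "(\<Sum>k\<in>UNIV. gm i x $ l $ k * christoffel M i x k a b)
    = (coord_deriv M i a (\<lambda>y. gm i y $ b $ l) x + coord_deriv M i b (\<lambda>y. gm i y $ a $ l) x
       - coord_deriv M i l (\<lambda>y. gm i y $ a $ b) x) / 2"
proof -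
  let ?c = "\<lambda>l. coord_deriv M i a (\<lambda>y. gm i y $ b $ l) x + coord_deriv M i b (\<lambda>y. gm i y $ a $ l) x
       - coord_deriv M i l (\<lambda>y. gm i y $ a $ b) x"
  have "gm i x ** matrix_inv (gm i x) = mat 1"
    by (simp add: fr_inv[OF assms])
  then have d: "(\<Sum>k\<in>UNIV. gm i x $ l $ k * matrix_inv (gm i x) $ k $ m) = (if l = m then 1 else 0)" for m
    by (simp add: matrix_matrix_mult_def mat_def vec_eq_iff)
  have e: "christoffel M i x k a b = (\<Sum>m\<in>UNIV. matrix_inv (gm i x) $ k $ m * (?c m / 2))" for k
    by (simp add: christoffel_def sum_divide_distrib)
  have "(\<Sum>k\<in>UNIV. gm i x $ l $ k * christoffel M i x k a b)
      = (\<Sum>m\<in>UNIV. (\<Sum>k\<in>UNIV. gm i x $ l $ k * matrix_inv (gm i x) $ k $ m) * (?c m / 2))"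
    unfolding e by (simp only: sum_distrib_left sum_distrib_right mult.assoc, rule sum.swap)
  also have "\<dots> = ?c l / 2"
  proof -
    have "(\<Sum>m\<in>UNIV. (if l = m then 1 else 0) * f m) = f l" for f :: "'n \<Rightarrow> real"
      by (simp add: if_distrib[of "\<lambda>r. r * _"] cong: if_cong)
    then show ?thesis
      unfolding d .
  qed
  finally show ?thesis .
qed

text \<open>After lowering an index in both Christoffel terms, the unwanted derivatives of the
  metric cancel by its symmetry. Both sides are linear in \<open>v\<close>, so coordinate vectors
  suffice.\<close>

lemma chm_metric:
  assumes "x \<in> patch M i"
  shows "dd i (gm i) x v = gm i x ** chm i x v + transpose (chm i x v) ** gm i x"
proof -
  have l1: "linear (dd i (gm i) x)"
    by (rule linear_dd[OF ok_patch sm_gm assms])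
  have l2: "linear (\<lambda>v. gm i x ** chm i x v + transpose (chm i x v) ** gm i x)"
    by (rule linearI) (simp_all add: linear_add[OF linear_chm] linear_scale[OF linear_chm] matalg scaleR_matrix_mult
        transpose_scalar scaleR_add_right)
  have "dd i (gm i) x (axis a 1) = gm i x ** chm i x (axis a 1) + transpose (chm i x (axis a 1)) ** gm i x" for a
  proof -
    have "dd i (gm i) x (axis a 1) $ b $ l
      = (\<Sum>k\<in>UNIV. gm i x $ b $ k * christoffel M i x k a l) + (\<Sum>k\<in>UNIV. gm i x $ l $ k * christoffel M i x k a b)" for b l
    proof -
      have "dd i (gm i) x (axis a 1) $ b $ l = coord_deriv M i a (\<lambda>y. gm i y $ b $ l) x"
        unfolding coord_deriv_def
        by (simp add: dd_nth[OF ok_patch sm_nth[OF ok_patch sm_gm] assms] dd_nth[OF ok_patch sm_gm assms])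
      then show ?thesis
        unfolding christoffel_lower[OF assms]
        using coord_gm_sym[OF assms, of a b l] coord_gm_sym[OF assms, of l a b] coord_gm_sym[OF assms, of b a l] by (simp add: field_simps)
    qed
    then show ?thesis
      using gm_nth_sym[OF assms]
      by (simp add: vec_eq_iff matrix_matrix_mult_def transpose_def chm_axis mult.commute)
  qed
  then show ?thesis
    by (subst linear_axis_expand[OF l1], subst linear_axis_expand[OF l2]) simp
qed

text \<open>\<open>E\<^sup>T g\<close> is the inverse of the frame matrix \<open>E\<close>, so this
  is the gauge transform \<open>E\<^sup>-\<^sup>1 (dE + C E)\<close> of the Christoffel matrix
  \<open>C\<close>. Unlike \<open>conn_form\<close> it accepts every tangent vector, which changes
  of frame require.\<close>

definition omega :: "'i \<Rightarrow> 'm \<Rightarrow> real ^ 'n \<Rightarrow> real ^ 'n ^ 'n" where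
  "omega i x v = transpose (fr i x) ** gm i x ** (dd i (fr i) x v + chm i x v ** fr i x)"

lemma conn_form_eq:
  assumes "x \<in> patch M i"
  shows "conn_form M i x k = omega i x (frame_vec M i x k)"
proof -
  let ?v = "frame_vec M i x k"
  let ?X = "dd i (fr i) x ?v + chm i x ?v ** fr i x"
  have "dd i (\<lambda>y. frame_vec M i y b) x ?v $ d = dd i (fr i) x ?v $ d $ b" for b d
  proof -
    have s: "sm i (\<lambda>y. frame_vec M i y b) (patch M i)"
      by (rule sm_vec[OF ok_patch]) (simp add: frame_vec_def column_def, intro sm_nth ok_patch sm_fr)
    have "dd i (\<lambda>y. frame_vec M i y b) x ?v $ d = dd i (\<lambda>y. fr i y $ d $ b) x ?v"
      by (subst dd_nth[OF ok_patch s assms, symmetric]) (simp add: frame_vec_def column_def)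
    then show ?thesis
      by (simp add: dd_nth[OF ok_patch sm_nth[OF ok_patch sm_fr] assms] dd_nth[OF ok_patch sm_fr assms])
  qed
  moreover have "(chm i x ?v ** fr i x) $ d $ b = (\<Sum>a\<in>UNIV. \<Sum>e\<in>UNIV. christoffel M i x d a e * ?v $ a * fr i x $ e $ b)" for d b
    unfolding matrix_matrix_mult_def chm_def by (simp add: sum_distrib_right) (rule sum.swap)
  ultimately have nf: "nabla_frame M i x ?v b = column b ?X" for b
    by (simp add: nabla_frame_def vec_eq_iff column_def) (simp add: frame_vec_def column_def)
  have L: "column b X \<bullet> (G *v column a E) = (transpose E ** transpose G ** X) $ a $ b" for a b and X G E :: "real ^ 'n ^ 'n"
  proof -
    have "(transpose E ** transpose G ** X) $ a $ b = (\<Sum>c\<in>UNIV. (\<Sum>d\<in>UNIV. E $ d $ a * G $ c $ d) * X $ c $ b)"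
      by (simp add: matrix_matrix_mult_def transpose_def)
    then show ?thesis
      by (simp add: inner_vec_def column_def matrix_vector_mult_def mult_ac)
  qed
  show ?thesis
    unfolding conn_form_def ginner_def nf omega_def
    by (simp add: vec_eq_iff frame_vec_def L gm_sym[OF assms])
qed

lemma fr_deriv:
  assumes "x \<in> patch M i"
  shows "dd i (fr i) x v = fr i x ** omega i x v - chm i x v ** fr i x"
  using fr_inv(1)[OF assms] by (simp add: omega_def matrix_mul_assoc)

text \<open>Differentiate \<open>E\<^sup>T g E = 1\<close> and insert
  \<open>chm_metric\<close>.\<close>

lemma omega_skew:
  assumes "x \<in> patch M i"
  shows "transpose (omega i x v) = - omega i x v"
proof -
  let ?E = "fr i x" let ?g = "gm i x" let ?dE = "dd i (fr i) x v" let ?C = "chm i x v"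
  have "dd i (\<lambda>x. transpose (fr i x) ** gm i x ** fr i x) x v = dd i (\<lambda>x. mat 1) x v"
    by (rule dd_cong[OF ok_patch assms]) (rule fr_orth)
  moreover have "dd i (\<lambda>x. transpose (fr i x) ** gm i x ** fr i x) x v
      = transpose ?E ** ?g ** ?dE + (transpose ?E ** dd i (gm i) x v + transpose ?dE ** ?g) ** ?E"
    by (simp add: dd_mm[OF ok_patch sm_mm[OF ok_patch sm_transpose[OF ok_patch sm_fr] sm_gm] sm_fr assms]
        dd_mm[OF ok_patch sm_transpose[OF ok_patch sm_fr] sm_gm assms] dd_transpose[OF ok_patch sm_fr assms])
  ultimately have "transpose ?E ** ?g ** ?dE + (transpose ?E ** (?g ** ?C + transpose ?C ** ?g) + transpose ?dE ** ?g) ** ?E = 0"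
    by (simp add: dd_const chm_metric[OF assms])
  then have "omega i x v + transpose (omega i x v) = 0"
    by (simp add: omega_def matalg gm_sym[OF assms] matrix_mul_assoc algebra_simps)
  then show ?thesis
    by (simp add: eq_neg_iff_add_eq_0 add.commute)
qed

lemma linear_omega:
  assumes "x \<in> patch M i"
  shows "linear (omega i x)"
  using linear_dd[OF ok_patch sm_fr assms] linear_chm[of i x]
  by (intro linearI) (simp_all add: omega_def linear_add linear_scale matalg scaleR_matrix_mult scaleR_add_right algebra_simps)

lemma sm_dd_vary:
  assumes "sm i f (patch M i)" "sm i V (patch M i)"
  shows "sm i (\<lambda>x. dd i f x (V x)) (patch M i)"
proof (rule sm_cong[OF ok_patch])
  show "sm i (\<lambda>x. \<Sum>a\<in>UNIV. V x $ a *\<^sub>R dd i f x (axis a 1)) (patch M i)"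
    by (intro sm_sum sm_scaleR sm_nth sm_dd ok_patch assms)
  show "(\<Sum>a\<in>UNIV. V x $ a *\<^sub>R dd i f x (axis a 1)) = dd i f x (V x)" if "x \<in> patch M i" for x
    using linear_axis_expand[OF linear_dd[OF ok_patch assms(1) that]] by metis
qed

lemma sm_omega:
  assumes "sm i V (patch M i)"
  shows "sm i (\<lambda>x. omega i x (V x)) (patch M i)"
  unfolding omega_def by (intro sm_mm sm_transpose sm_add sm_dd_vary sm_chm ok_patch sm_fr sm_gm assms)

lemma sm_frame_vec: "sm i (\<lambda>x. frame_vec M i x k) (patch M i)"
  by (rule sm_vec[OF ok_patch]) (simp add: frame_vec_def column_def, intro sm_nth ok_patch sm_fr)

lemma sm_conn_form: "sm i (\<lambda>x. conn_form M i x k) (patch M i)"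
  by (rule sm_cong[OF ok_patch sm_omega[OF sm_frame_vec]]) (simp add: conn_form_eq)

lemma conn_form_skew: "x \<in> patch M i \<Longrightarrow> transpose (conn_form M i x k) = - conn_form M i x k"
  by (simp add: conn_form_eq omega_skew)

text \<open>Uniqueness of the Levi-Civita connection replaces a computation with Christoffel
  symbols: pulled back to chart \<open>i\<close>, the connection of chart \<open>j\<close> is again
  torsion-free, by symmetry of the second derivatives of the coordinate change, and compatible with
  the metric.\<close>

lemma chm_change:
  assumes "x \<in> patch M i" "x \<in> patch M j"
  shows "jac M i j x ** chm i x v = dd i (jac M i j) x v + chm j x (jac M i j x *v v) ** jac M i j x"
proof -
  let ?J = "jac M i j x" let ?K = "jac M j i x"
  let ?D = "\<lambda>v. dd i (jac M i j) x v + chm j x (?J *v v) ** ?J"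
  have x: "x \<in> patch M i \<inter> patch M j" using assms by simp
  have KJ: "?K ** ?J = mat 1" and JK: "?J ** ?K = mat 1"
    using assms by (simp_all add: jac_inverse)
  have smg: "sm i (gm j) (patch M i \<inter> patch M j)"
    by (rule sm_change[OF sm_subset[OF sm_gm]]) (auto simp: open_patch)
  \<comment> \<open>Applied to a fixed vector, the derivative of the Jacobian is a second derivative
    of the coordinate change, which makes Schwarz's theorem applicable.\<close>
  have djac: "dd i (jac M i j) x v *v w = dd i (\<lambda>y. dd i (chart M j) y w) x v" for v w
  proof -
    have "dd i (\<lambda>y. jac M i j y *v w) x v = dd i (jac M i j) x v *v w"
      by (simp add: dd_mv[OF ok_Int(1) sm_jac sm_const x] dd_const)
    moreover have "dd i (\<lambda>y. jac M i j y *v w) x v = dd i (\<lambda>y. dd i (chart M j) y w) x v"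
      by (rule dd_cong[OF ok_Int(1) x]) (auto simp: jac_works)
    ultimately show ?thesis by simp
  qed
  have D_sym: "?D v *v w = ?D w *v v" for v w
    using dd_schwarz[OF ok_Int(1) sm_chart x, of w v] chm_sym[OF assms(2), of "?J *v v" "?J *v w"]
    by (simp add: djac matrix_vector_mult_add_rdistrib flip: matrix_vector_mul_assoc)
  have dg: "dd i (gm i) x v = transpose ?J ** gm j x ** ?D v + transpose (?D v) ** gm j x ** ?J" for v
  proof -
    have "dd i (gm i) x v = dd i (\<lambda>x. transpose (jac M i j x) ** gm j x ** jac M i j x) x v"
      by (rule dd_cong[OF ok_Int(1) x]) (simp add: gm_change)
    also have "\<dots> = transpose ?J ** gm j x ** dd i (jac M i j) x v
        + (transpose ?J ** dd i (gm j) x v + transpose (dd i (jac M i j) x v) ** gm j x) ** ?J"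
      by (simp add: dd_mm[OF ok_Int(1) sm_mm[OF ok_Int(1) sm_transpose[OF ok_Int(1) sm_jac] smg] sm_jac x]
        dd_mm[OF ok_Int(1) sm_transpose[OF ok_Int(1) sm_jac] smg x] dd_transpose[OF ok_Int(1) sm_jac x])
    also have "dd i (gm j) x v = gm j x ** chm j x (?J *v v) + transpose (chm j x (?J *v v)) ** gm j x"
      using dd_change[OF ok_patch sm_gm assms(2,1), of v] chm_metric[OF assms(2)] by simp
    finally show ?thesis
      by (simp add: matalg matrix_mul_assoc)
  qed
  have gK: "gm i x ** ?K = transpose ?J ** gm j x"
    by (simp add: gm_change[OF assms] JK flip: matrix_mul_assoc)
  have tK: "transpose ?K ** gm i x = gm j x ** ?J"
    using arg_cong[OF gK, of transpose] by (simp add: matrix_transpose_mul gm_sym assms)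
  define S where "S v = ?K ** ?D v - chm i x v" for v
  have "S v = 0" for v
  proof (rule christoffel_unique[OF fr_inv(4)[OF assms(1)] gm_sym[OF assms(1)]])
    show "S v *v w = S w *v v" for v w
      using D_sym[of v w] chm_sym[OF assms(1), of v w]
      by (simp add: S_def matrix_vector_mult_diff_rdistrib flip: matrix_vector_mul_assoc)
    show "gm i x ** S v + transpose (S v) ** gm i x = 0" for v
    proof -
      have "gm i x ** S v = transpose ?J ** gm j x ** ?D v - gm i x ** chm i x v"
        unfolding S_def matrix_mult_diff matrix_mul_assoc gK by simp
      moreover have "transpose (S v) ** gm i x = transpose (?D v) ** gm j x ** ?J - transpose (chm i x v) ** gm i x"
        unfolding S_def transpose_diff matrix_transpose_mul matrix_mult_diff
        by (simp add: tK flip: matrix_mul_assoc)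
      ultimately have "gm i x ** S v + transpose (S v) ** gm i x
          = (transpose ?J ** gm j x ** ?D v + transpose (?D v) ** gm j x ** ?J)
            - (gm i x ** chm i x v + transpose (chm i x v) ** gm i x)"
        by (simp only:) (simp add: algebra_simps)
      then show ?thesis
        unfolding dg[of v, symmetric] chm_metric[OF assms(1), of v, symmetric] by simp
    qed
  qed
  then have "?K ** ?D v = chm i x v"
    by (simp add: S_def)
  then have "?J ** chm i x v = ?J ** ?K ** ?D v"
    by (simp flip: matrix_mul_assoc)
  then show ?thesis
    by (simp add: JK)
qed

lemma fc_works:
  assumes "x \<in> patch M i" "x \<in> patch M j"
  shows "fr j x ** fc j i x = jac M i j x ** fr i x"
  using fr_inv(1,2)[OF assms(2)] by (simp add: frame_change_def matrix_mul_assoc)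

lemma fc_orth:
  assumes "x \<in> patch M i" "x \<in> patch M j"
  shows "transpose (fc j i x) ** fc j i x = mat 1" "fc j i x ** transpose (fc j i x) = mat 1"
  using spin_cover(1)[OF lf_spin[OF assms]] by (auto simp: lf_cover[OF assms] orthogonal_matrix_def)

lemma sm_over:
  assumes "sm j f (patch M j)"
  shows "sm i f (patch M i \<inter> patch M j)"
  by (rule sm_change[OF sm_subset[OF assms]]) (auto simp: open_patch)

lemma sm_fc: "sm i (fc j i) (patch M i \<inter> patch M j)"
proof (rule sm_cong[OF ok_Int(1)])
  show "sm i (\<lambda>x. transpose (fr j x) ** gm j x ** jac M i j x ** fr i x) (patch M i \<inter> patch M j)"
    by (intro sm_mm sm_transpose ok_Int(1) sm_over sm_fr sm_gm sm_jac sm_subset[OF sm_fr]) auto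
qed (simp add: frame_change_def fr_inv)

text \<open>Differentiate \<open>E_j A = J E_i\<close>. By \<open>chm_change\<close> the Christoffel
  terms cancel, and the gauge transformation law of a connection form remains.\<close>

lemma omega_change:
  assumes "x \<in> patch M i" "x \<in> patch M j"
  shows "omega j x (jac M i j x *v v)
    = fc j i x ** omega i x v ** transpose (fc j i x) - dd i (fc j i) x v ** transpose (fc j i x)"
proof -
  let ?J = "jac M i j x" let ?A = "fc j i x" let ?Ej = "fr j x" let ?Ei = "fr i x" let ?w = "?J *v v"
  have x: "x \<in> patch M i \<inter> patch M j" using assms by simp
  have smi: "sm i (fr i) (patch M i \<inter> patch M j)" by (rule sm_subset[OF sm_fr]) auto
  have "dd i (\<lambda>x. fr j x ** fc j i x) x v = dd i (\<lambda>x. jac M i j x ** fr i x) x v"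
    by (rule dd_cong[OF ok_Int(1) x]) (simp add: fc_works)
  then have "?Ej ** dd i (fc j i) x v + dd i (fr j) x v ** ?A = ?J ** dd i (fr i) x v + dd i (jac M i j) x v ** ?Ei"
    by (simp add: dd_mm[OF ok_Int(1) sm_over[OF sm_fr] sm_fc x] dd_mm[OF ok_Int(1) sm_jac smi x])
  then have "?Ej ** dd i (fc j i) x v + (?Ej ** omega j x ?w - chm j x ?w ** ?Ej) ** ?A
      = ?J ** (?Ei ** omega i x v - chm i x v ** ?Ei) + (?J ** chm i x v - chm j x ?w ** ?J) ** ?Ei"
    using chm_change[OF assms, of v] dd_change[OF ok_patch sm_fr assms(2,1), of v]
    by (simp add: fr_deriv assms)
  also have "\<dots> = ?Ej ** ?A ** omega i x v - chm j x ?w ** (?Ej ** ?A)"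
    unfolding fc_works[OF assms] by (simp add: matalg matrix_mul_assoc)
  finally have "?Ej ** (dd i (fc j i) x v + omega j x ?w ** ?A) = ?Ej ** (?A ** omega i x v)"
    by (simp add: matalg matrix_mul_assoc algebra_simps)
  then have "(transpose ?Ej ** gm j x ** ?Ej) ** (dd i (fc j i) x v + omega j x ?w ** ?A)
      = (transpose ?Ej ** gm j x ** ?Ej) ** (?A ** omega i x v)"
    by (simp flip: matrix_mul_assoc)
  then have "dd i (fc j i) x v + omega j x ?w ** ?A = ?A ** omega i x v"
    by (simp add: fr_orth[OF assms(2)])
  then have "(dd i (fc j i) x v + omega j x ?w ** ?A) ** transpose ?A = ?A ** omega i x v ** transpose ?A"
    by simp
  then show ?thesis
    by (simp add: matalg fc_orth[OF assms] algebra_simps flip: matrix_mul_assoc)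
qed

lemma frame_vec_change:
  assumes "x \<in> patch M i" "x \<in> patch M j"
  shows "frame_vec M j x k = jac M i j x *v (\<Sum>l\<in>UNIV. fc j i x $ k $ l *\<^sub>R frame_vec M i x l)"
proof -
  have "fr j x = jac M i j x ** (fr i x ** transpose (fc j i x))"
    using fc_works[OF assms] fc_orth(2)[OF assms] by (metis matrix_mul_assoc matrix_mul_rid)
  then have "frame_vec M j x k = column k (jac M i j x ** (fr i x ** transpose (fc j i x)))"
    by (simp add: frame_vec_def)
  also have "\<dots> = jac M i j x *v column k (fr i x ** transpose (fc j i x))"
    by (simp add: column_def matrix_matrix_mult_def matrix_vector_mult_def vec_eq_iff)
  also have "column k (fr i x ** transpose (fc j i x)) = (\<Sum>l\<in>UNIV. fc j i x $ k $ l *\<^sub>R frame_vec M i x l)"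
    by (simp add: column_def frame_vec_def matrix_matrix_mult_def transpose_def vec_eq_iff mult.commute)
  finally show ?thesis .
qed

text \<open>The hypotheses of \<open>spin_gauge\<close> are derivatives of identities valid along
  the lift: the covering relation, unitarity and reality of a trace. The result supplies the spinor
  part in the transformation of covariant derivatives.\<close>

lemma lf_deriv:
  assumes "x \<in> patch M i" "x \<in> patch M j"
  shows "dd i (lf j i) x v *v u = sigm cl (dd i (fc j i) x v ** transpose (fc j i x)) (lf j i x *v u)"
    and "transpose (dd i (fc j i) x v ** transpose (fc j i x)) = - (dd i (fc j i) x v ** transpose (fc j i x))"
proof -
  let ?s = "lf j i x" let ?A = "fc j i x" let ?dA = "dd i (fc j i) x v" let ?ds = "dd i (lf j i) x v"
  have x: "x \<in> patch M i \<inter> patch M j" using assms by simp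
  note cov = lf_cover[OF assms]
  have "dd i (\<lambda>y. fc j i y ** transpose (fc j i y)) x v = dd i (\<lambda>y. mat 1) x v"
    by (rule dd_cong[OF ok_Int(1) x]) (simp add: fc_orth)
  then have "?A ** transpose ?dA + ?dA ** transpose ?A = 0"
    by (simp add: dd_mm[OF ok_Int(1) sm_fc sm_transpose[OF ok_Int(1) sm_fc] x] dd_transpose[OF ok_Int(1) sm_fc x] dd_const)
  then show skew: "transpose (?dA ** transpose ?A) = - (?dA ** transpose ?A)"
    by (simp add: matalg eq_neg_iff_add_eq_0)
  have lc: "bounded_linear (cvec cl)"
    using linear_cvec by (simp add: linear_conv_bounded_linear)
  have d1: "?ds ** cvec cl w = cvec cl (?dA *v w) ** ?s + cvec cl (?A *v w) ** ?ds" for w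
  proof -
    have smA: "sm i (\<lambda>y. fc j i y *v w) (patch M i \<inter> patch M j)"
      by (intro sm_mv ok_Int(1) sm_fc sm_const)
    have "dd i (\<lambda>y. lf j i y ** cvec cl w) x v = dd i (\<lambda>y. cvec cl (fc j i y *v w) ** lf j i y) x v"
      by (rule dd_cong[OF ok_Int(1) x]) (use spin_cover(2)[OF lf_spin] lf_cover in auto)
    then show ?thesis
      by (simp add: dd_mm[OF ok_Int(1) sm_lf sm_const x] dd_const dd_mm[OF ok_Int(1) sm_linear[OF ok_Int(1) lc smA] sm_lf x]
          dd_linear[OF ok_Int(1) lc smA x] dd_mv[OF ok_Int(1) sm_fc sm_const x] add.commute)
  qed
  have smc: "sm i (\<lambda>y. cadj (lf j i y)) (patch M i \<inter> patch M j)"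
    by (rule sm_linear[OF ok_Int(1) bounded_linear_cadj sm_lf])
  have "dd i (\<lambda>y. cadj (lf j i y) ** lf j i y) x v = dd i (\<lambda>y. mat 1) x v"
    by (rule dd_cong[OF ok_Int(1) x]) (use spin_group_unitary(1)[OF lf_spin] in auto)
  then have d2: "cadj ?ds ** ?s + cadj ?s ** ?ds = 0"
    by (simp add: dd_mm[OF ok_Int(1) smc sm_lf x] dd_linear[OF ok_Int(1) bounded_linear_cadj sm_lf x] dd_const add.commute)
  have "bounded_linear (\<lambda>A :: complex ^ 's ^ 's. Im (trace A))"
  proof -
    have "linear (\<lambda>A :: complex ^ 's ^ 's. Im (trace A))"
      by (rule linearI) (simp_all add: trace_add trace_scaleR)
    then show ?thesis by (simp add: linear_conv_bounded_linear)
  qed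
  \<comment> \<open>\<open>?s\<close> is the value of the lift at the fixed point \<open>x\<close>,
    so the derivative falls on the other factor only.\<close>
  then have d3: "dd i (\<lambda>y. Im (trace (lf j i y ** cadj ?s))) x v = Im (trace (?ds ** cadj ?s))"
    using dd_linear[OF ok_Int(1) _ sm_mm[OF ok_Int(1) sm_lf sm_const] x, of "\<lambda>A. Im (trace A)" "cadj ?s" v]
    by (simp add: dd_mm[OF ok_Int(1) sm_lf sm_const x] dd_const)
  have "dd i (\<lambda>y. Im (trace (lf j i y ** cadj ?s))) x v = dd i (\<lambda>y. 0) x v"
    by (rule dd_cong[OF ok_Int(1) x]) (use trace_spin_group_real lf_spin assms in auto)
  then have d3': "Im (trace (?ds ** cadj ?s)) = 0"
    using d3 by (simp add: dd_const)
  show "?ds *v u = sigm cl (?dA ** transpose ?A) (?s *v u)"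
    using spin_gauge[OF lf_spin[OF assms] _ d2 d3'] d1 skew unfolding cov by blast
qed

end

section \<open>Covariance of the covariant derivative and parallel fibrewise operations\<close>

section \<open>Covariant derivatives of sections\<close>

context spin_mfd
begin

lemma matrix_mult_nth: "((A :: real ^ 'k ^ 'l) ** B) $ a $ b = (\<Sum>c\<in>UNIV. A $ a $ c * B $ c $ b)"
  by (simp add: matrix_matrix_mult_def)

definition smc :: "'i \<Rightarrow> ('m \<Rightarrow> ('n, 's) sptensor) \<Rightarrow> 'm set \<Rightarrow> bool" where
  "smc i u W \<longleftrightarrow> (\<forall>I. sm i (\<lambda>x. u x I) W)"

lemma smcD: "smc i u W \<Longrightarrow> sm i (\<lambda>x. u x I) W"
  by (simp add: smc_def)

lemma smcI: "(\<And>I. sm i (\<lambda>x. u x I) W) \<Longrightarrow> smc i u W"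
  by (simp add: smc_def)

lemma smc_slot: "smc i u W \<Longrightarrow> smc i (\<lambda>x. slot k (u x)) W"
  by (simp add: smc_def slot_def)

lemma bounded_linear_cmatvec: "bounded_linear (\<lambda>u. (C :: complex ^ 's ^ 's) *v u)"
  using linear_matvec by (simp add: linear_conv_bounded_linear)

lemmas sm_cmatvec = sm_linear[OF _ bounded_linear_cmatvec]
  and dd_cmatvec = dd_linear[OF _ bounded_linear_cmatvec]
  and sm_rscale = sm_linear[OF _ bounded_linear_scaleR_right]
  and dd_rscale = dd_linear[OF _ bounded_linear_scaleR_right]

lemma sm_ins: "ok i W \<Longrightarrow> (\<And>k J. sm i (\<lambda>x. \<Phi> x k J) W) \<Longrightarrow> sm i (\<lambda>x. ins I (\<Phi> x)) W"
proof (induction I arbitrary: \<Phi>)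
  case (Cons k I)
  have "sm i (\<lambda>x. ins I (\<lambda>l J. \<Phi> x l (k # J))) W"
    by (rule Cons.IH) (use Cons.prems in auto)
  then show ?case
    using Cons.prems by (simp add: sm_add)
qed (simp add: sm_const)

lemma dd_ins:
  "ok i W \<Longrightarrow> (\<And>k J. sm i (\<lambda>x. \<Phi> x k J) W) \<Longrightarrow> x \<in> W \<Longrightarrow>
    dd i (\<lambda>x. ins I (\<Phi> x)) x v = ins I (\<lambda>k J. dd i (\<lambda>x. \<Phi> x k J) x v)"
proof (induction I arbitrary: \<Phi>)
  case (Cons k I)
  have "sm i (\<lambda>x. ins I (\<lambda>l J. \<Phi> x l (k # J))) W"
    by (rule sm_ins) (use Cons.prems in auto)
  moreover have "dd i (\<lambda>x. ins I (\<lambda>l J. \<Phi> x l (k # J))) x v = ins I (\<lambda>l J. dd i (\<lambda>x. \<Phi> x l (k # J)) x v)"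
    by (rule Cons.IH) (use Cons.prems in auto)
  ultimately show ?case
    using Cons.prems by (simp add: dd_add)
qed (simp add: dd_const)

lemma smc_cliff:
  assumes "ok i W" "smc i u W"
  shows "smc i (\<lambda>x. cliff cl (u x)) W"
  unfolding cliff_def by (rule smcI, rule sm_sum[OF assms(1)], rule sm_cmatvec[OF assms(1) smcD[OF assms(2)]])

lemma smc_clsym:
  assumes "ok i W" "smc i u W"
  shows "smc i (\<lambda>x. clsym cl (u x)) W"
  unfolding clsym_def by (rule smcI, rule sm_ins[OF assms(1)], rule sm_cmatvec[OF assms(1) smcD[OF assms(2)]])

lemma smc_add: "ok i W \<Longrightarrow> smc i u W \<Longrightarrow> smc i v W \<Longrightarrow> smc i (\<lambda>x I. u x I + v x I) W"
  by (rule smcI, rule sm_add) (auto dest: smcD)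

lemma smc_rscale: "ok i W \<Longrightarrow> smc i u W \<Longrightarrow> smc i (\<lambda>x I. r *\<^sub>R u x I) W"
  by (rule smcI, rule sm_rscale) (auto dest: smcD)

lemma sm_rho: "ok i W \<Longrightarrow> W \<subseteq> patch M i \<inter> patch M j \<Longrightarrow> smc i u W \<Longrightarrow> sm i (\<lambda>x. rho cl (lf j i x) (u x) I) W"
proof (induction I arbitrary: u)
  case Nil
  then show ?case
    unfolding rho_Nil by (intro sm_mv smcD[of i u W] sm_subset[OF sm_lf])
next
  case (Cons k I)
  have "sm i (\<lambda>x. \<Sum>b\<in>UNIV. fc j i x $ k $ b *\<^sub>R rho cl (lf j i x) (slot b (u x)) I) W"
    by (intro sm_sum sm_scaleR sm_nth sm_subset[OF sm_fc] Cons smc_slot)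
  then show ?case
  proof (rule sm_cong[OF Cons.prems(1)])
    fix x assume "x \<in> W"
    then have "x \<in> patch M i" "x \<in> patch M j"
      using Cons.prems(2) by auto
    then show "(\<Sum>b\<in>UNIV. fc j i x $ k $ b *\<^sub>R rho cl (lf j i x) (slot b (u x)) I) = rho cl (lf j i x) (u x) (k # I)"
      by (simp add: rho_Cons lf_cover)
  qed
qed

text \<open>The derivative of the transition map acts through \<open>drho\<close> of
  \<open>dA A\<^sup>T\<close>: on spinors by \<open>lf_deriv\<close>, on each tensor index because
  \<open>dA = (dA A\<^sup>T) A\<close>.\<close>

lemma dd_rho:
  assumes "x \<in> patch M i \<inter> patch M j" (is "x \<in> ?W")
  shows "smc i u ?W \<Longrightarrow> dd i (\<lambda>x. rho cl (lf j i x) (u x) I) x v = rho cl (lf j i x) (\<lambda>I. dd i (\<lambda>x. u x I) x v) I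
    + drho cl (dd i (fc j i) x v ** transpose (fc j i x)) (rho cl (lf j i x) (u x)) I"
proof (induction I arbitrary: u)
  case Nil
  show ?case
    using assms lf_deriv(1)[of x i j v "u x []"]
    by (simp add: rho_Nil dd_mv[OF ok_Int(1) sm_lf smcD[OF Nil] assms] drho_eq)
next
  case (Cons k I)
  let ?s = "lf j i x" let ?A = "fc j i x" let ?dA = "dd i (fc j i) x v" let ?B = "?dA ** transpose ?A"
  have cov: "spin_cover cl ?s = ?A" using assms lf_cover by auto
  have sA: "sm i (\<lambda>x. fc j i x $ k $ b) ?W" for b
    by (intro sm_nth ok_Int(1) sm_fc)
  have dA: "dd i (\<lambda>x. fc j i x $ k $ b) x v = ?dA $ k $ b" for b
    by (simp add: dd_nth[OF ok_Int(1) sm_nth[OF ok_Int(1) sm_fc] assms] dd_nth[OF ok_Int(1) sm_fc assms])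
  have sr: "sm i (\<lambda>x. rho cl (lf j i x) (slot b (u x)) I) ?W" for b
    by (intro sm_rho ok_Int(1) smc_slot Cons) auto
  have "dd i (\<lambda>x. rho cl (lf j i x) (u x) (k # I)) x v
      = dd i (\<lambda>x. \<Sum>b\<in>UNIV. fc j i x $ k $ b *\<^sub>R rho cl (lf j i x) (slot b (u x)) I) x v"
    by (rule dd_cong[OF ok_Int(1) assms]) (use lf_cover in \<open>auto simp: rho_Cons\<close>)
  also have "\<dots> = (\<Sum>b\<in>UNIV. ?A $ k $ b *\<^sub>R dd i (\<lambda>x. rho cl (lf j i x) (slot b (u x)) I) x v
      + ?dA $ k $ b *\<^sub>R rho cl ?s (slot b (u x)) I)"
    by (subst dd_sum[OF ok_Int(1) sm_scaleR[OF ok_Int(1) sA sr] assms])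
      (simp add: dd_scaleR[OF ok_Int(1) sA sr assms] dA)
  also have "\<dots> = (\<Sum>b\<in>UNIV. ?A $ k $ b *\<^sub>R rho cl ?s (\<lambda>I. dd i (\<lambda>x. slot b (u x) I) x v) I)
      + (\<Sum>b\<in>UNIV. ?A $ k $ b *\<^sub>R drho cl ?B (rho cl ?s (slot b (u x))) I)
      + (\<Sum>b\<in>UNIV. ?dA $ k $ b *\<^sub>R rho cl ?s (slot b (u x)) I)"
    unfolding Cons.IH[OF smc_slot[OF Cons.prems]] by (simp add: scaleR_add_right sum.distrib)
  also have "(\<Sum>b\<in>UNIV. ?A $ k $ b *\<^sub>R rho cl ?s (\<lambda>I. dd i (\<lambda>x. slot b (u x) I) x v) I)
      = rho cl ?s (\<lambda>I. dd i (\<lambda>x. u x I) x v) (k # I)"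
    by (simp add: rho_Cons cov slot_def)
  also have "(\<Sum>b\<in>UNIV. ?A $ k $ b *\<^sub>R drho cl ?B (rho cl ?s (slot b (u x))) I) = drho cl ?B (slot k (rho cl ?s (u x))) I"
  proof -
    have "slot k (rho cl ?s (u x)) = (\<lambda>I. \<Sum>b\<in>UNIV. ?A $ k $ b *\<^sub>R rho cl ?s (slot b (u x)) I)"
      by (simp add: slot_def[of k "rho cl ?s (u x)"] rho_Cons cov)
    then show ?thesis
      by (simp add: drho_sum drho_scaleR)
  qed
  also have "(\<Sum>b\<in>UNIV. ?dA $ k $ b *\<^sub>R rho cl ?s (slot b (u x)) I) = (\<Sum>b\<in>UNIV. ?B $ k $ b *\<^sub>R rho cl ?s (u x) (b # I))"
  proof -
    have "?B ** ?A = ?dA"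
      using fc_orth(1)[of x i j] assms by (simp flip: matrix_mul_assoc)
    then have "?dA $ k $ c = (\<Sum>b\<in>UNIV. ?B $ k $ b * ?A $ b $ c)" for c
      unfolding matrix_mult_nth[symmetric] by simp
    then have "(\<Sum>c\<in>UNIV. ?dA $ k $ c *\<^sub>R rho cl ?s (slot c (u x)) I)
        = (\<Sum>c\<in>UNIV. \<Sum>b\<in>UNIV. ?B $ k $ b *\<^sub>R ?A $ b $ c *\<^sub>R rho cl ?s (slot c (u x)) I)"
      by (simp add: scaleR_sum_left)
    also have "\<dots> = (\<Sum>b\<in>UNIV. ?B $ k $ b *\<^sub>R rho cl ?s (u x) (b # I))"
      by (subst sum.swap) (simp add: rho_Cons cov scaleR_sum_right)
    finally show ?thesis .
  qed
  finally show ?case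
    by (simp add: drho_Cons add.assoc)
qed

abbreviation nab :: "('i, 'm, 'n, 's) field \<Rightarrow> 'i \<Rightarrow> 'm \<Rightarrow> 'n \<Rightarrow> ('n, 's) sptensor" where
  "nab \<psi> i x k \<equiv> slot k (nabla M \<psi> i x)"

lemma nabla_Nil: "nabla M \<psi> i x [] = 0"
  by (simp add: nabla_def)

lemma nabla_outside: "x \<notin> patch M i \<Longrightarrow> nabla M \<psi> i x = (\<lambda>I. 0)"
  by (auto simp: nabla_def fun_eq_iff split: list.splits)

lemma nab_eq:
  "x \<in> patch M i \<Longrightarrow> nab \<psi> i x k I = dd i (\<lambda>y. \<psi> i y I) x (frame_vec M i x k) + drho cl (conn_form M i x k) (\<psi> i x) I"
  by (simp add: slot_def nabla_def)

lemma sm_drho: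
  assumes "ok i W" "sm i A W" "smc i u W"
  shows "sm i (\<lambda>x. drho cl (A x) (u x) I) W"
  unfolding drho_def
  by (intro sm_add sm_rscale sm_sum sm_scaleR sm_nth sm_cmatvec assms(1,2) smcD[OF assms(3)])

lemma smc_nabla:
  assumes "smc i (\<psi> i) (patch M i)"
  shows "smc i (nabla M \<psi> i) (patch M i)"
proof (rule smcI)
  fix J
  show "sm i (\<lambda>x. nabla M \<psi> i x J) (patch M i)"
  proof (cases J)
    case Nil
    then show ?thesis by (simp add: nabla_Nil sm_const)
  next
    case (Cons k I)
    have "sm i (\<lambda>x. dd i (\<lambda>y. \<psi> i y I) x (frame_vec M i x k) + drho cl (conn_form M i x k) (\<psi> i x) I) (patch M i)"
      by (intro sm_add ok_patch sm_dd_vary smcD[OF assms] sm_frame_vec sm_drho sm_conn_form assms)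
    then show ?thesis
      by (rule sm_cong[OF ok_patch]) (simp add: Cons nabla_def)
  qed
qed

lemma sectionsD:
  assumes "\<psi> \<in> sections M V"
  shows "x \<notin> patch M i \<Longrightarrow> \<psi> i x = (\<lambda>I. 0)" "x \<in> patch M i \<Longrightarrow> \<psi> i x \<in> V" "smc i (\<psi> i) (patch M i)"
    "x \<in> patch M i \<Longrightarrow> x \<in> patch M j \<Longrightarrow> \<psi> j x = rho cl (lf j i x) (\<psi> i x)"
proof -
  have s: "\<forall>i x. x \<notin> patch M i \<longrightarrow> \<psi> i x = (\<lambda>I. 0)" "\<forall>i. \<forall>x\<in>patch M i. \<psi> i x \<in> V"
    "\<forall>i I. sm i (\<lambda>x. \<psi> i x I) (patch M i)"
    "\<forall>i j. \<forall>x\<in>patch M i \<inter> patch M j. \<psi> j x = rho cl (lf j i x) (\<psi> i x)"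
    using assms unfolding sections_def mem_Collect_eq by blast+
  show "x \<notin> patch M i \<Longrightarrow> \<psi> i x = (\<lambda>I. 0)" "x \<in> patch M i \<Longrightarrow> \<psi> i x \<in> V"
    using s(1,2) by blast+
  show "smc i (\<psi> i) (patch M i)"
    unfolding smc_def using s(3) by blast
  show "x \<in> patch M i \<Longrightarrow> x \<in> patch M j \<Longrightarrow> \<psi> j x = rho cl (lf j i x) (\<psi> i x)"
    using s(4) by blast
qed

lemma sectionsI:
  assumes "\<And>i x. x \<notin> patch M i \<Longrightarrow> \<psi> i x = (\<lambda>I. 0)" "\<And>i x. x \<in> patch M i \<Longrightarrow> \<psi> i x \<in> V"
    "\<And>i. smc i (\<psi> i) (patch M i)"
    "\<And>i j x I. x \<in> patch M i \<Longrightarrow> x \<in> patch M j \<Longrightarrow> \<psi> j x I = rho cl (lf j i x) (\<psi> i x) I"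
  shows "\<psi> \<in> sections M V"
proof -
  have 1: "\<forall>i x. x \<notin> patch M i \<longrightarrow> \<psi> i x = (\<lambda>I. 0)" "\<forall>i. \<forall>x\<in>patch M i. \<psi> i x \<in> V"
    using assms(1,2) by blast+
  have 2: "\<forall>i I. sm i (\<lambda>x. \<psi> i x I) (patch M i)"
    using assms(3) unfolding smc_def by blast
  have 3: "\<forall>i j. \<forall>x\<in>patch M i \<inter> patch M j. \<psi> j x = rho cl (lf j i x) (\<psi> i x)"
    by (intro allI ballI ext assms(4)) auto
  show ?thesis
    unfolding sections_def mem_Collect_eq using 1 2 3 by blast
qed

lemma sections_mono: "V \<subseteq> V' \<Longrightarrow> \<psi> \<in> sections M V \<Longrightarrow> \<psi> \<in> sections M V'"
  unfolding sections_def by blast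

lemma sections_in: "\<psi> \<in> sections M V \<Longrightarrow> (\<lambda>I. 0) \<in> V \<Longrightarrow> \<psi> i x \<in> V"
  using sectionsD(1,2)[of \<psi> V x i] by (cases "x \<in> patch M i") simp_all

text \<open>Equivariance of \<open>F\<close> is asked only where \<open>u\<close> and its rotated
  copy both lie in \<open>V\<close>; the explicit formula for \<open>prW\<close> is available for
  such tensors.\<close>

lemma sections_op:
  assumes "\<psi> \<in> sections M V" "F (\<lambda>I. 0) = (\<lambda>I. 0)" "\<And>u. u \<in> V \<Longrightarrow> F u \<in> V'"
    "\<And>i. smc i (\<lambda>x. F (\<psi> i x)) (patch M i)"
    "\<And>s u I. s \<in> spin_group cl \<Longrightarrow> u \<in> V \<Longrightarrow> rho cl s u \<in> V \<Longrightarrow> F (rho cl s u) I = rho cl s (F u) I"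
  shows "(\<lambda>i x. F (\<psi> i x)) \<in> sections M V'"
proof (rule sectionsI)
  note s = sectionsD[OF assms(1)]
  show "F (\<psi> i x) = (\<lambda>I. 0)" if "x \<notin> patch M i" for i x
    unfolding s(1)[OF that] by (rule assms(2))
  show "F (\<psi> i x) \<in> V'" if "x \<in> patch M i" for i x
    by (rule assms(3)[OF s(2)[OF that]])
  show "smc i (\<lambda>x. F (\<psi> i x)) (patch M i)" for i
    by (rule assms(4))
  show "F (\<psi> j x) I = rho cl (lf j i x) (F (\<psi> i x)) I" if "x \<in> patch M i" "x \<in> patch M j" for i j x I
    using s(2)[OF that(2)] unfolding s(4)[OF that] by (rule assms(5)[OF lf_spin[OF that] s(2)[OF that(1)]])
qed

lemma nabla_tensors:
  assumes "smc i (\<psi> i) (patch M i)" "\<And>y. y \<in> patch M i \<Longrightarrow> \<psi> i y \<in> tensors p"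
  shows "nabla M \<psi> i x \<in> tensors (Suc p)"
proof (cases "x \<in> patch M i")
  case True
  show ?thesis
  proof (rule tensorsI)
    fix J :: "'n list" assume J: "length J \<noteq> Suc p"
    show "nabla M \<psi> i x J = 0"
    proof (cases J)
      case (Cons k I)
      have "dd i (\<lambda>y. \<psi> i y I) x (frame_vec M i x k) = dd i (\<lambda>y. 0) x (frame_vec M i x k)"
        by (rule dd_cong[OF ok_patch True]) (use assms(2) J Cons in \<open>auto dest: tensorsD\<close>)
      moreover have "drho cl (conn_form M i x k) (\<psi> i x) I = 0"
        using J tensorsD[OF assms(2)[OF True]] by (simp add: drho_def Cons matvec_0)
      ultimately show ?thesis
        using True by (simp add: Cons nabla_def dd_const)
    qed (simp add: nabla_Nil)
  qed
qed (simp add: nabla_outside tensors_def)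

text \<open>Differentiating the transition map and changing the connection form by
  \<open>omega_change\<close> produce opposite inhomogeneous terms. Linearity in the direction then
  turns the change of frame into the rotation of the new index.\<close>

lemma nabla_sections:
  assumes "\<psi> \<in> sections M (tensors p)"
  shows "nabla M \<psi> \<in> sections M (tensors (Suc p))"
proof (rule sectionsI)
  note s = sectionsD[OF assms]
  show "nabla M \<psi> i x = (\<lambda>I. 0)" if "x \<notin> patch M i" for i x
    by (rule nabla_outside[OF that])
  show "nabla M \<psi> i x \<in> tensors (Suc p)" for i x
    by (rule nabla_tensors[where \<psi>=\<psi> and i=i and p=p, OF s(3,2)])
  show "smc i (nabla M \<psi> i) (patch M i)" for i
    by (rule smc_nabla[where \<psi>=\<psi> and i=i, OF s(3)])
  show "nabla M \<psi> j x J = rho cl (lf j i x) (nabla M \<psi> i x) J" if x: "x \<in> patch M i" "x \<in> patch M j" for i j x J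
  proof (cases J)
    case Nil
    then show ?thesis by (simp add: nabla_Nil rho_Nil matvec_0)
  next
    case (Cons k I)
    let ?W = "patch M i \<inter> patch M j" let ?s = "lf j i x" let ?A = "fc j i x"
    let ?V = "\<Sum>l\<in>UNIV. ?A $ k $ l *\<^sub>R frame_vec M i x l"
    have xW: "x \<in> ?W" using x by simp
    have smi: "smc i (\<psi> i) ?W"
      using s(3)[of i] sm_subset unfolding smc_def by blast
    have rho_conv: "(?A ** omega i x ?V ** transpose ?A) = spin_cover cl ?s ** omega i x ?V ** transpose (spin_cover cl ?s)"
      by (simp add: lf_cover[OF x])
    have fv: "frame_vec M j x k = jac M i j x *v ?V"
      by (rule frame_vec_change[OF x])
    have "dd j (\<lambda>y. \<psi> j y I) x (frame_vec M j x k) = dd i (\<lambda>y. \<psi> j y I) x ?V"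
      unfolding fv by (rule dd_change[OF ok_patch smcD[OF s(3)] x(2,1), symmetric])
    also have "\<dots> = dd i (\<lambda>y. rho cl (lf j i y) (\<psi> i y) I) x ?V"
      by (rule dd_cong[OF ok_Int(1) xW], rule fun_cong[OF s(4)]) auto
    also have "\<dots> = rho cl ?s (\<lambda>I. dd i (\<lambda>y. \<psi> i y I) x ?V) I
        + drho cl (dd i (fc j i) x ?V ** transpose ?A) (rho cl ?s (\<psi> i x)) I"
      by (rule dd_rho[OF xW smi])
    finally have e1: "dd j (\<lambda>y. \<psi> j y I) x (frame_vec M j x k) = rho cl ?s (\<lambda>I. dd i (\<lambda>y. \<psi> i y I) x ?V) I
        + drho cl (dd i (fc j i) x ?V ** transpose ?A) (rho cl ?s (\<psi> i x)) I" .
    have "conn_form M j x k = ?A ** omega i x ?V ** transpose ?A - dd i (fc j i) x ?V ** transpose ?A"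
      unfolding conn_form_eq[OF x(2)] fv by (rule omega_change[OF x])
    then have e2: "drho cl (conn_form M j x k) (\<psi> j x) I = rho cl ?s (drho cl (omega i x ?V) (\<psi> i x)) I
        - drho cl (dd i (fc j i) x ?V ** transpose ?A) (rho cl ?s (\<psi> i x)) I"
      unfolding s(4)[OF x] by (simp add: drho_matrix_diff rho_conv drho_rho[OF lf_spin[OF x]])
    have lin: "dd i (\<lambda>y. \<psi> i y I) x ?V + drho cl (omega i x ?V) (\<psi> i x) I = (\<Sum>l\<in>UNIV. ?A $ k $ l *\<^sub>R nab \<psi> i x l I)" for I
    proof -
      have "dd i (\<lambda>y. \<psi> i y I) x ?V = (\<Sum>l\<in>UNIV. ?A $ k $ l *\<^sub>R dd i (\<lambda>y. \<psi> i y I) x (frame_vec M i x l))"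
        using linear_dd[OF ok_patch smcD[OF s(3)] x(1), of I] by (simp add: linear_sum linear_scale)
      moreover have "omega i x ?V = (\<Sum>l\<in>UNIV. ?A $ k $ l *\<^sub>R conn_form M i x l)"
        using linear_omega[OF x(1)] by (simp add: linear_sum linear_scale conn_form_eq[OF x(1)])
      ultimately show ?thesis
        by (simp add: nab_eq[OF x(1)] drho_matrix_sum drho_matrix_scaleR scaleR_add_right sum.distrib)
    qed
    have "nabla M \<psi> j x (k # I) = nab \<psi> j x k I"
      by (simp add: slot_def)
    also have "\<dots> = rho cl ?s (\<lambda>I. dd i (\<lambda>y. \<psi> i y I) x ?V) I + rho cl ?s (drho cl (omega i x ?V) (\<psi> i x)) I"
      unfolding nab_eq[OF x(2)] e1 e2 by simp
    also have "\<dots> = rho cl ?s (\<lambda>I. \<Sum>l\<in>UNIV. ?A $ k $ l *\<^sub>R nab \<psi> i x l I) I"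
      unfolding rho_add[symmetric] lin ..
    also have "\<dots> = rho cl ?s (nabla M \<psi> i x) (k # I)"
      by (simp add: rho_Cons lf_cover[OF x] rho_sum rho_scaleR)
    finally show ?thesis by (simp add: Cons)
  qed
qed

text \<open>\<open>cliff\<close> has constant coefficients and commutes with \<open>drho\<close>,
  hence it is parallel; the same reason applies to \<open>clsym\<close>.\<close>

lemma nab_cliff:
  assumes "smc i (\<psi> i) (patch M i)" "x \<in> patch M i"
  shows "nab (\<lambda>i x. cliff cl (\<psi> i x)) i x k I = cliff cl (nab \<psi> i x k) I"
proof -
  have "dd i (\<lambda>y. cliff cl (\<psi> i y) I) x v = cliff cl (\<lambda>I. dd i (\<lambda>y. \<psi> i y I) x v) I" for v
    unfolding cliff_def
    by (simp add: dd_sum[OF ok_patch sm_cmatvec[OF ok_patch smcD[OF assms(1)]] assms(2)]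
        dd_cmatvec[OF ok_patch smcD[OF assms(1)] assms(2)])
  then show ?thesis
    by (simp add: nab_eq[OF assms(2)] drho_cliff[OF conn_form_skew[OF assms(2)]]
        nab_eq[OF assms(2), of k \<psi>, abs_def] cliff_add)
qed

lemma nab_clsym:
  assumes "smc i (\<psi> i) (patch M i)" "x \<in> patch M i"
  shows "nab (\<lambda>i x. clsym cl (\<psi> i x)) i x k I = clsym cl (nab \<psi> i x k) I"
proof -
  have "dd i (\<lambda>y. clsym cl (\<psi> i y) I) x v = clsym cl (\<lambda>I. dd i (\<lambda>y. \<psi> i y I) x v) I" for v
    unfolding clsym_def
    by (simp add: dd_ins[OF ok_patch sm_cmatvec[OF ok_patch smcD[OF assms(1)]] assms(2)]
        dd_cmatvec[OF ok_patch smcD[OF assms(1)] assms(2)])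
  then show ?thesis
    by (simp add: nab_eq[OF assms(2)] drho_clsym[OF conn_form_skew[OF assms(2)]]
        nab_eq[OF assms(2), of k \<psi>, abs_def] clsym_add)
qed

lemma nab_add:
  assumes "smc i (\<psi> i) (patch M i)" "smc i (\<phi> i) (patch M i)"
  shows "nabla M (\<lambda>i x I. \<psi> i x I + \<phi> i x I) i x J = nabla M \<psi> i x J + nabla M \<phi> i x J"
proof (cases "x \<in> patch M i")
  case True
  then show ?thesis
    by (cases J) (simp_all add: nabla_def dd_add[OF ok_patch smcD[OF assms(1)] smcD[OF assms(2)]] drho_add)
qed (simp add: nabla_outside)

lemma nab_rscale:
  assumes "smc i (\<psi> i) (patch M i)"
  shows "nabla M (\<lambda>i x I. r *\<^sub>R \<psi> i x I) i x J = r *\<^sub>R nabla M \<psi> i x J"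
proof (cases "x \<in> patch M i")
  case True
  then show ?thesis
    by (cases J) (simp_all add: nabla_def dd_rscale[OF ok_patch smcD[OF assms(1)]] drho_scaleR scaleR_add_right)
qed (simp add: nabla_outside)

text \<open>Symmetry and the trace condition are linear with constant coefficients and invariant
  under skew matrices, so both terms of the covariant derivative respect them.\<close>

lemma nab_sym0:
  assumes "smc i (\<psi> i) (patch M i)" "\<And>y. y \<in> patch M i \<Longrightarrow> \<psi> i y \<in> sym0 p" "x \<in> patch M i"
  shows "nab \<psi> i x k \<in> sym0 p"
proof -
  have t: "nab \<psi> i x k \<in> tensors p"
    using nabla_tensors[where \<psi>=\<psi> and i=i, OF assms(1), of p x] assms(2) by (simp add: sym0_iff tensors_def slot_def)
  have "symt (nab \<psi> i x k)"
  proof (rule symtI)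
    fix I J :: "'n list" assume IJ: "mset I = mset J"
    have "dd i (\<lambda>y. \<psi> i y I) x v = dd i (\<lambda>y. \<psi> i y J) x v" for v
      by (rule dd_cong[OF ok_patch assms(3)]) (use assms(2) IJ in \<open>auto simp: sym0_iff dest: symtD\<close>)
    moreover have "drho cl A (\<psi> i x) I = drho cl A (\<psi> i x) J" for A
      by (rule symtD[OF symt_drho IJ]) (use assms(2,3) in \<open>simp add: sym0_iff\<close>)
    ultimately show "nab \<psi> i x k I = nab \<psi> i x k J"
      by (simp add: nab_eq[OF assms(3)])
  qed
  moreover have "(\<Sum>l\<in>UNIV. nab \<psi> i x k (l # l # I)) = 0" for I
  proof -
    have "(\<Sum>l\<in>UNIV. dd i (\<lambda>y. \<psi> i y (l # l # I)) x v) = dd i (\<lambda>y. \<Sum>l\<in>UNIV. \<psi> i y (l # l # I)) x v" for v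
      by (rule dd_sum[OF ok_patch smcD[OF assms(1)] assms(3), symmetric])
    also have "dd i (\<lambda>y. \<Sum>l\<in>UNIV. \<psi> i y (l # l # I)) x v = dd i (\<lambda>y. 0) x v" for v
      by (rule dd_cong[OF ok_patch assms(3)]) (use assms(2) in \<open>auto simp: sym0_iff\<close>)
    finally have d: "(\<Sum>l\<in>UNIV. dd i (\<lambda>y. \<psi> i y (l # l # I)) x v) = 0" for v
      by (simp add: dd_const)
    let ?A = "conn_form M i x k"
    have "dvg (\<lambda>l. slot l (\<psi> i x)) = (\<lambda>I. 0)"
      using assms(2,3) by (simp add: dvg_def slot_def sym0_iff)
    then have "(\<Sum>l\<in>UNIV. drho cl ?A (\<psi> i x) (l # l # I)) = 0"
      using drho_dvg[OF conn_form_skew[OF assms(3)], of cl k "\<lambda>l. slot l (\<psi> i x)" I]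
      by (simp add: drho_0) (simp add: dvg_def slot_def drho_Cons[of _ _ "\<psi> i x"])
    then show ?thesis
      by (simp add: nab_eq[OF assms(3)] sum.distrib d)
  qed
  ultimately show ?thesis
    using t by (simp add: sym0_iff)
qed

lemma nab_Wfib:
  assumes "smc i (\<psi> i) (patch M i)" "\<And>y. y \<in> patch M i \<Longrightarrow> \<psi> i y \<in> Wfib cl p" "x \<in> patch M i"
  shows "nab \<psi> i x k \<in> Wfib cl p"
proof (rule WfibI)
  show "nab \<psi> i x k \<in> sym0 p"
    by (rule nab_sym0[where \<psi>=\<psi> and i=i, OF assms(1) _ assms(3)]) (use assms(2) WfibD in blast)
  fix I
  have "nab (\<lambda>i x. cliff cl (\<psi> i x)) i x k I = 0"
  proof -
    have z: "cliff cl (\<psi> i y) = (\<lambda>I. 0)" if "y \<in> patch M i" for y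
      using assms(2)[OF that] by (simp add: Wfib_def)
    have "dd i (\<lambda>y. cliff cl (\<psi> i y) I) x v = dd i (\<lambda>y. 0) x v" for v
      by (rule dd_cong[OF ok_patch assms(3)]) (simp add: z)
    then show ?thesis
      by (simp add: nab_eq[OF assms(3)] z[OF assms(3)] dd_const drho_0)
  qed
  then show "cliff cl (nab \<psi> i x k) I = 0"
    by (simp add: nab_cliff[where \<psi>=\<psi> and i=i, OF assms(1,3)])
qed

lemma twisted_dirac_eq: "twisted_dirac M \<psi> i x = cliff cl (nabla M \<psi> i x)"
  by (simp add: twisted_dirac_def cliff_def fun_eq_iff)

lemma twisted_dirac_clmul: "twisted_dirac M \<psi> i x = clmul cl (nab \<psi> i x)"
  by (simp add: twisted_dirac_eq cliff_clmul)

lemma twisted_dirac_outside: "x \<notin> patch M i \<Longrightarrow> twisted_dirac M \<psi> i x = (\<lambda>I. 0)"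
  by (simp add: twisted_dirac_eq nabla_outside cliff_0 fun_eq_iff)

lemma sym0_tensors: "sym0 p \<subseteq> tensors p"
  by (auto simp: sym0_iff)

lemma Wfib_sym0: "Wfib cl p \<subseteq> sym0 p"
  by (auto simp: Wfib_def)

lemma twisted_dirac_sections:
  assumes "\<psi> \<in> sections M (sym0 p)"
  shows "twisted_dirac M \<psi> \<in> sections M (sym0 p)"
proof -
  note s = sectionsD[OF assms]
  have n: "nabla M \<psi> \<in> sections M (tensors (Suc p))"
    by (rule nabla_sections[OF sections_mono[OF sym0_tensors assms]])
  have "(\<lambda>i x. cliff cl (nabla M \<psi> i x)) \<in> sections M (tensors p)"
    by (rule sections_op[OF n]) (auto simp: cliff_0 cliff_tensors rho_cliff fun_eq_iff intro!: smc_cliff ok_patch smc_nabla s)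
  then have t: "twisted_dirac M \<psi> \<in> sections M (tensors p)"
    by (simp add: twisted_dirac_eq[abs_def])
  have "twisted_dirac M \<psi> i x \<in> sym0 p" if "x \<in> patch M i" for i x
    unfolding twisted_dirac_clmul clmul_def
    by (intro sym0_sum sym0_matvec nab_sym0[where \<psi>=\<psi> and i=i, OF s(3) _ that] s(2))
  then show ?thesis
    by (intro sectionsI sectionsD(1,3)[OF t] fun_cong[OF sectionsD(4)[OF t]])
qed

lemma clsym_sections:
  assumes "\<psi> \<in> sections M (Wfib cl p)"
  shows "(\<lambda>i x. clsym cl (\<psi> i x)) \<in> sections M (sym0 (Suc p))"
  by (rule sections_op[OF assms])
    (auto simp: clsym_0 clsym_sym0 rho_clsym fun_eq_iff intro!: smc_clsym ok_patch sectionsD(3)[OF assms])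

lemma sections_add:
  assumes "\<psi> \<in> sections M V" "\<phi> \<in> sections M V" "\<And>u v. u \<in> V \<Longrightarrow> v \<in> V \<Longrightarrow> (\<lambda>I. u I + v I) \<in> V"
  shows "(\<lambda>i x I. \<psi> i x I + \<phi> i x I) \<in> sections M V"
proof (rule sectionsI)
  note s = sectionsD[OF assms(1)] and t = sectionsD[OF assms(2)]
  show "(\<lambda>I. \<psi> i x I + \<phi> i x I) = (\<lambda>I. 0)" if "x \<notin> patch M i" for i x
    by (simp add: s(1)[OF that] t(1)[OF that])
  show "(\<lambda>I. \<psi> i x I + \<phi> i x I) \<in> V" if "x \<in> patch M i" for i x
    by (rule assms(3)[OF s(2)[OF that] t(2)[OF that]])
  show "smc i (\<lambda>x I. \<psi> i x I + \<phi> i x I) (patch M i)" for i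
    by (rule smc_add[OF ok_patch s(3) t(3)])
  show "\<psi> j x I + \<phi> j x I = rho cl (lf j i x) (\<lambda>I. \<psi> i x I + \<phi> i x I) I" if "x \<in> patch M i" "x \<in> patch M j" for i j x I
    unfolding rho_add s(4)[OF that] t(4)[OF that] ..
qed

lemma sections_rscale:
  assumes "\<psi> \<in> sections M V" "\<And>u. u \<in> V \<Longrightarrow> (\<lambda>I. r *\<^sub>R u I) \<in> V"
  shows "(\<lambda>i x I. r *\<^sub>R \<psi> i x I) \<in> sections M V"
proof (rule sectionsI)
  note s = sectionsD[OF assms(1)]
  show "(\<lambda>I. r *\<^sub>R \<psi> i x I) = (\<lambda>I. 0)" if "x \<notin> patch M i" for i x
    by (simp add: s(1)[OF that])
  show "(\<lambda>I. r *\<^sub>R \<psi> i x I) \<in> V" if "x \<in> patch M i" for i x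
    by (rule assms(2)[OF s(2)[OF that]])
  show "smc i (\<lambda>x I. r *\<^sub>R \<psi> i x I) (patch M i)" for i
    by (rule smc_rscale[OF ok_patch s(3)])
  show "r *\<^sub>R \<psi> j x I = rho cl (lf j i x) (\<lambda>I. r *\<^sub>R \<psi> i x I) I" if "x \<in> patch M i" "x \<in> patch M j" for i j x I
    unfolding rho_scaleR s(4)[OF that] ..
qed

text \<open>The formal adjoint of \<open>nabla\<close> is the negative of \<open>ndiv\<close>.\<close>

definition ndiv :: "('i, 'm, 'n, 's) field \<Rightarrow> ('i, 'm, 'n, 's) field" where
  "ndiv \<Phi> = (\<lambda>i x. dvg (nab \<Phi> i x))"

lemma ndiv_eq: "ndiv \<Phi> i x I = (\<Sum>k\<in>UNIV. nabla M \<Phi> i x (k # k # I))"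
  by (simp add: ndiv_def dvg_def slot_def)

lemma ndiv_outside: "x \<notin> patch M i \<Longrightarrow> ndiv \<psi> i x = (\<lambda>I. 0)"
  by (simp add: ndiv_eq nabla_outside fun_eq_iff)

lemma ndiv_sections:
  assumes "\<psi> \<in> sections M (tensors (Suc p))"
  shows "ndiv \<psi> \<in> sections M (tensors p)"
  unfolding ndiv_def
proof (rule sections_op[OF nabla_sections[OF assms], where F="\<lambda>u. dvg (\<lambda>k. slot k u)"])
  show "smc i (\<lambda>x. dvg (nab \<psi> i x)) (patch M i)" for i
    unfolding dvg_def slot_def by (intro smcI sm_sum ok_patch smcD[OF smc_nabla[OF sectionsD(3)[OF assms]]])
  show "dvg (\<lambda>k. slot k (rho cl s u)) I = rho cl s (dvg (\<lambda>k. slot k u)) I" if "s \<in> spin_group cl" for s u I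
    using rho_dvg[OF that, of "\<lambda>k. slot k u" I] by (simp add: dvg_def slot_def[of _ "rho cl s u"] rho_Cons)
qed (auto simp: dvg_def slot_def tensors_def)

end

section \<open>From sectional curvature to the full curvature tensor\<close>

section \<open>Curvature\<close>

text \<open>The classical argument that sectional curvature determines the curvature tensor.
  Polarising \<open>sec\<close> makes \<open>T\<close> skew in its first and last arguments; with
  pair symmetry this makes it invariant under cyclic permutation of the first three, and the Bianchi
  identity becomes \<open>3 T = 0\<close>.\<close>

lemma curvature_tensor_zero:
  fixes T :: "'a::ab_group_add \<Rightarrow> 'a \<Rightarrow> 'a \<Rightarrow> 'a \<Rightarrow> real"
  assumes add: "\<And>u u' v w z. T (u + u') v w z = T u v w z + T u' v w z"
      "\<And>u v v' w z. T u (v + v') w z = T u v w z + T u v' w z"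
      "\<And>u v w w' z. T u v (w + w') z = T u v w z + T u v w' z"
      "\<And>u v w z z'. T u v w (z + z') = T u v w z + T u v w z'"
    and skew: "\<And>u v w z. T v u w z = - T u v w z" "\<And>u v w z. T u v z w = - T u v w z"
    and bianchi: "\<And>u v w z. T u v w z + T v w u z + T w u v z = 0"
    and sec: "\<And>u v. T u v v u = 0"
  shows "T u v w z = 0"
proof -
  have pair: "T u v w z = T w z u v" for u v w z
    using bianchi[of u v w z] bianchi[of v w z u] bianchi[of w z u v] bianchi[of z u v w]
      skew[of u v w z] skew[of v w u z] skew[of w u v z] skew[of v w z u] skew[of w z v u] skew[of z v w u]
      skew[of w z u v] skew[of z u w v] skew[of u w z v] skew[of z u v w] skew[of u v z w] skew[of v z u w]
      skew(1)[of u v z w] skew(1)[of u w v z] skew(1)[of z v u w]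
    by linarith
  have 1: "T u v w u = 0" for u v w
    using sec[of u "v + w"] sec[of u v] sec[of u w] pair[of u w v u] skew[of v u u w] skew(1)[of u v w u]
      skew(2)[of u v u w]
    by (simp add: add)
  have 2: "T u v w z = - T z v w u" for u v w z
    using 1[of "u + z" v w] 1[of u v w] 1[of z v w] by (simp add: add)
  have 3: "T u v w z = T w u v z" for u v w z
    using 2[of u v w z] pair[of z v w u] skew(1)[of u w v z] skew(1)[of w u z v] skew(2)[of u w v z] by linarith
  show ?thesis
    using bianchi[of u v w z] 3[of u v w z] 3[of v w u z] by linarith
qed

lemma real_matvec:
  fixes A :: "real ^ 'm ^ 'n"
  shows "(\<Sum>a\<in>F. B a) *v w = (\<Sum>a\<in>F. B a *v w)" "(r *\<^sub>R A) *v w = r *\<^sub>R (A *v w)"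
    "A *v (\<Sum>a\<in>F. v a) = (\<Sum>a\<in>F. A *v v a)" "A *v (r *\<^sub>R w) = r *\<^sub>R (A *v w)"
  by (rule bounded_bilinear.sum_left[OF bounded_bilinear_matvec] bounded_bilinear.sum_right[OF bounded_bilinear_matvec]
      bounded_bilinear.scaleR_left[OF bounded_bilinear_matvec] bounded_bilinear.scaleR_right[OF bounded_bilinear_matvec])+

lemma inner_transpose: "x \<bullet> (transpose A *v y) = (A *v x) \<bullet> (y :: real ^ 'n)"
  by (metis dot_lmul_matrix inner_commute transpose_matrix_vector)

context spin_mfd
begin

lemma gm_pos: "x \<in> patch M i \<Longrightarrow> v \<noteq> 0 \<Longrightarrow> v \<bullet> (gm i x *v v) > 0"
  using rsm unfolding riemannian_spin_manifold_def riemannian_metric_def by blast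

lemma dd_drho:
  assumes "ok i W" "sm i A W" "smc i u W" "x \<in> W"
  shows "dd i (\<lambda>x. drho cl (A x) (u x) I) x v = drho cl (dd i A x v) (u x) I + drho cl (A x) (\<lambda>I. dd i (\<lambda>x. u x I) x v) I"
proof -
  have A: "sm i (\<lambda>x. A x $ a $ b) W" "dd i (\<lambda>x. A x $ a $ b) x v = dd i A x v $ a $ b" for a b
    using assms by (auto intro: sm_nth simp: dd_nth[OF assms(1) sm_nth[OF assms(1,2)]] dd_nth[OF assms(1,2)])
  have u: "sm i (\<lambda>x. u x I) W" for I
    by (rule smcD[OF assms(3)])
  have c: "sm i (\<lambda>x. cl b *v (cl a *v u x I)) W"
    "dd i (\<lambda>x. cl b *v (cl a *v u x I)) x v = cl b *v (cl a *v dd i (\<lambda>x. u x I) x v)" for a b I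
    by (auto intro!: sm_cmatvec assms u simp: dd_cmatvec[OF assms(1) sm_cmatvec[OF assms(1) u] assms(4)] dd_cmatvec[OF assms(1) u assms(4)])
  have s: "sm i (\<lambda>x. A x $ a $ b *\<^sub>R (cl b *v (cl a *v u x I))) W" "sm i (\<lambda>x. A x $ a $ b *\<^sub>R u x J) W" for a b I J
    by (intro sm_scaleR assms(1) A c u)+
  have S: "sm i (\<lambda>x. \<Sum>b\<in>UNIV. A x $ a $ b *\<^sub>R (cl b *v (cl a *v u x I))) W"
    "sm i (\<lambda>x. \<Sum>b\<in>UNIV. A x $ a $ b *\<^sub>R u x (f b)) W"
    "sm i (\<lambda>x. \<Sum>a\<in>UNIV. \<Sum>b\<in>UNIV. A x $ a $ b *\<^sub>R (cl b *v (cl a *v u x I))) W"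
    "sm i (\<lambda>x. \<Sum>r<m. \<Sum>b\<in>UNIV. A x $ (h r) $ b *\<^sub>R u x (k r b)) W"
    for a I f m and h :: "nat \<Rightarrow> 'n" and k
    by (intro sm_sum assms(1) s)+
  show ?thesis
    unfolding drho_def
    by (simp add: dd_add[OF assms(1) sm_rscale[OF assms(1) S(3)] S(4) assms(4)] dd_rscale[OF assms(1) S(3) assms(4)]
        dd_sum[OF assms(1) S(1) assms(4)] dd_sum[OF assms(1) S(2) assms(4)] dd_sum[OF assms(1) s(1) assms(4)]
        dd_sum[OF assms(1) s(2) assms(4)] dd_scaleR[OF assms(1) A(1) c(1) assms(4)] dd_scaleR[OF assms(1) A(1) u assms(4)]
        A(2) c(2) sum.distrib scaleR_add_right)
qed

text \<open>Cartan's structure equation, the exterior derivative of the connection form plus its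
  commutator, in coordinate directions; \<open>curvK\<close> is the same expression in the
  Christoffel matrices.\<close>

definition curvF :: "'i \<Rightarrow> 'm \<Rightarrow> 'n \<Rightarrow> 'n \<Rightarrow> real ^ 'n ^ 'n" where
  "curvF i x a b = dd i (\<lambda>y. omega i y (axis b 1)) x (axis a 1) - dd i (\<lambda>y. omega i y (axis a 1)) x (axis b 1)
     + (omega i x (axis a 1) ** omega i x (axis b 1) - omega i x (axis b 1) ** omega i x (axis a 1))"

definition curvK :: "'i \<Rightarrow> 'm \<Rightarrow> 'n \<Rightarrow> 'n \<Rightarrow> real ^ 'n ^ 'n" where
  "curvK i x a b = dd i (\<lambda>y. chm i y (axis b 1)) x (axis a 1) - dd i (\<lambda>y. chm i y (axis a 1)) x (axis b 1)
     + (chm i x (axis a 1) ** chm i x (axis b 1) - chm i x (axis b 1) ** chm i x (axis a 1))"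

lemma curvF_skew:
  assumes "x \<in> patch M i"
  shows "transpose (curvF i x a b) = - curvF i x a b"
proof -
  have "transpose (dd i (\<lambda>y. omega i y w) x v) = - dd i (\<lambda>y. omega i y w) x v" for v w
  proof -
    have "transpose (dd i (\<lambda>y. omega i y w) x v) = dd i (\<lambda>y. transpose (omega i y w)) x v"
      by (rule dd_transpose[OF ok_patch sm_omega[OF sm_const] assms, symmetric])
    also have "\<dots> = dd i (\<lambda>y. - omega i y w) x v"
      by (rule dd_cong[OF ok_patch assms]) (rule omega_skew)
    finally show ?thesis
      by (simp add: dd_minus[OF ok_patch sm_omega[OF sm_const] assms])
  qed
  then show ?thesis
    by (simp add: curvF_def matalg omega_skew[OF assms])
qed

text \<open>Differentiate \<open>dE = E \<omega> - C E\<close> once more and antisymmetrise: the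
  second derivatives of the frame cancel, and the frame conjugates one curvature into the
  other.\<close>

lemma curvF_curvK:
  assumes "x \<in> patch M i"
  shows "fr i x ** curvF i x a b = curvK i x a b ** fr i x"
proof -
  let ?E = "fr i x" let ?C = "\<lambda>a. chm i x (axis a 1)" let ?w = "\<lambda>a. omega i x (axis a 1)"
  let ?dC = "\<lambda>b a. dd i (\<lambda>y. chm i y (axis b 1)) x (axis a 1)" let ?dw = "\<lambda>b a. dd i (\<lambda>y. omega i y (axis b 1)) x (axis a 1)"
  have sC: "sm i (\<lambda>y. chm i y (axis a 1)) (patch M i)" and so: "sm i (\<lambda>y. omega i y (axis a 1)) (patch M i)" for a
    by (intro sm_chm sm_omega sm_const)+
  have e: "?E ** ?dw b a + dd i (fr i) x (axis a 1) ** ?w b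
    = dd i (\<lambda>y. dd i (fr i) y (axis b 1)) x (axis a 1) + (?C b ** dd i (fr i) x (axis a 1) + ?dC b a ** ?E)" for a b
  proof -
    have "dd i (\<lambda>y. fr i y ** omega i y (axis b 1)) x (axis a 1)
        = dd i (\<lambda>y. dd i (fr i) y (axis b 1) + chm i y (axis b 1) ** fr i y) x (axis a 1)"
      by (rule dd_cong[OF ok_patch assms]) (simp add: fr_deriv)
    then show ?thesis
      by (simp add: dd_mm[OF ok_patch sm_fr so assms] dd_add[OF ok_patch sm_dd[OF ok_patch sm_fr] sm_mm[OF ok_patch sC sm_fr] assms]
          dd_mm[OF ok_patch sC sm_fr assms])
  qed
  have "?E ** ?dw b a - ?E ** ?dw a b = ?C b ** dd i (fr i) x (axis a 1) + ?dC b a ** ?E - dd i (fr i) x (axis a 1) ** ?w b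
      - (?C a ** dd i (fr i) x (axis b 1) + ?dC a b ** ?E - dd i (fr i) x (axis b 1) ** ?w a)"
  proof -
    have e': "?E ** ?dw b a = dd i (\<lambda>y. dd i (fr i) y (axis b 1)) x (axis a 1)
        + (?C b ** dd i (fr i) x (axis a 1) + ?dC b a ** ?E) - dd i (fr i) x (axis a 1) ** ?w b" for a b
      using e[of b a] by (simp only: eq_diff_eq)
    show ?thesis
      unfolding e' dd_schwarz[OF ok_patch sm_fr assms, of "axis b 1" "axis a 1"] by (simp add: algebra_simps)
  qed
  then show ?thesis
    by (simp add: curvF_def curvK_def matalg fr_deriv[OF assms] matrix_mul_assoc algebra_simps)
qed

lemma curv_eq:
  assumes "x \<in> patch M i"
  shows "curv M i x u v w = (\<Sum>a\<in>UNIV. \<Sum>b\<in>UNIV. (u $ a * v $ b) *\<^sub>R (curvK i x a b *v w))"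
proof -
  have sC: "sm i (\<lambda>y. chm i y (axis a 1)) (patch M i)" for a
    by (intro sm_chm sm_const)
  have "dd i (\<lambda>y. chm i y (axis b 1)) x v $ l $ k = dd i (\<lambda>y. christoffel M i y l b k) x v" for b v l k
    using dd_nth[OF ok_patch sm_nth[OF ok_patch sC] assms, of b l k v] dd_nth[OF ok_patch sC assms, of b l v]
    by (simp add: chm_axis)
  then have K: "curvK i x a b $ l $ k = coord_deriv M i a (\<lambda>y. christoffel M i y l b k) x
      - coord_deriv M i b (\<lambda>y. christoffel M i y l a k) x
      + (\<Sum>m\<in>UNIV. christoffel M i x l a m * christoffel M i x m b k
                   - christoffel M i x l b m * christoffel M i x m a k)" for a b l k
    by (simp add: curvK_def coord_deriv_def matrix_mult_nth chm_axis sum_subtractf)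
  show ?thesis
    by (simp add: vec_eq_iff curv_def matrix_vector_mult_def flip: K) (simp add: sum_distrib_left mult_ac)
qed

definition curvR :: "'i \<Rightarrow> 'm \<Rightarrow> real ^ 'n \<Rightarrow> real ^ 'n \<Rightarrow> real ^ 'n ^ 'n" where
  "curvR i x u v = (\<Sum>a\<in>UNIV. \<Sum>b\<in>UNIV. (u $ a * v $ b) *\<^sub>R curvF i x a b)"

lemma curvR_skew: "x \<in> patch M i \<Longrightarrow> transpose (curvR i x u v) = - curvR i x u v"
  unfolding curvR_def
  by (simp add: linear_sum[OF bounded_linear.linear[OF bounded_linear_transpose]]
      linear_scale[OF bounded_linear.linear[OF bounded_linear_transpose]] curvF_skew sum_negf)

lemma curv_curvR:
  assumes "x \<in> patch M i"
  shows "curv M i x u v (fr i x *v w) = fr i x *v (curvR i x u v *v w)"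
proof -
  have "curvK i x a b *v (fr i x *v w) = fr i x *v (curvF i x a b *v w)" for a b
    by (simp add: matrix_vector_mul_assoc curvF_curvK[OF assms])
  moreover have "curvR i x u v *v w = (\<Sum>a\<in>UNIV. \<Sum>b\<in>UNIV. (u $ a * v $ b) *\<^sub>R (curvF i x a b *v w))"
    unfolding curvR_def by (simp only: real_matvec)
  ultimately show ?thesis
    unfolding curv_eq[OF assms] by (simp only: real_matvec)
qed

lemma fr_surj:
  assumes "x \<in> patch M i"
  obtains w where "v = fr i x *v w"
  using fr_inv(1)[OF assms] by (metis matrix_vector_mul_assoc matrix_vector_mul_lid)

lemma ginner_fr:
  assumes "x \<in> patch M i"
  shows "ginner M i x (fr i x *v u) (fr i x *v v) = u \<bullet> v"
proof -
  have "(fr i x *v u) \<bullet> (gm i x *v (fr i x *v v)) = u \<bullet> ((transpose (fr i x) ** gm i x ** fr i x) *v v)"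
    by (simp only: inner_transpose flip: matrix_vector_mul_assoc)
  then show ?thesis
    by (simp add: ginner_def fr_orth[OF assms])
qed

lemma curv_add:
  assumes "x \<in> patch M i"
  shows "curv M i x (u + u') v w = curv M i x u v w + curv M i x u' v w"
    "curv M i x u (v + v') w = curv M i x u v w + curv M i x u v' w"
    "curv M i x u v (w + w') = curv M i x u v w + curv M i x u v w'"
    "curv M i x (r *\<^sub>R u) v w = r *\<^sub>R curv M i x u v w"
    "curv M i x v u w = - curv M i x u v w"
proof -
  show "curv M i x (u + u') v w = curv M i x u v w + curv M i x u' v w"
    "curv M i x u (v + v') w = curv M i x u v w + curv M i x u v' w"
    "curv M i x u v (w + w') = curv M i x u v w + curv M i x u v w'"
    "curv M i x (r *\<^sub>R u) v w = r *\<^sub>R curv M i x u v w"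
    unfolding curv_eq[OF assms]
    by (simp_all add: distrib_right distrib_left scaleR_add_left scaleR_add_right sum.distrib matrix_vector_right_distrib
        scaleR_sum_right mult.assoc)
  have K: "curvK i x b a = - curvK i x a b" for a b
    by (simp add: curvK_def)
  have "(v $ b * u $ a) *\<^sub>R (curvK i x b a *v w) = - ((u $ a * v $ b) *\<^sub>R (curvK i x a b *v w))" for a b
    by (subst K) (simp add: matvec_uminus mult.commute)
  then show "curv M i x v u w = - curv M i x u v w"
    unfolding curv_eq[OF assms] by (subst sum.swap) (simp add: sum_negf)
qed

text \<open>Torsion-freeness makes the derivative of \<open>C_b e_d\<close> and the vector
  \<open>C_a C_b e_d\<close> symmetric in \<open>b\<close> and \<open>d\<close>, so the cyclic sum
  cancels.\<close>

lemma curv_bianchi: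
  assumes "x \<in> patch M i"
  shows "curv M i x u v w + curv M i x v w u + curv M i x w u v = 0"
proof -
  have sC: "sm i (\<lambda>y. chm i y (axis a 1)) (patch M i)" for a
    by (intro sm_chm sm_const)
  have "dd i (\<lambda>y. chm i y (axis a 1)) x v *v axis b 1 = dd i (\<lambda>y. chm i y (axis b 1)) x v *v axis a 1" for a b v
  proof -
    have "dd i (\<lambda>y. chm i y (axis a 1) *v axis b 1) x v = dd i (\<lambda>y. chm i y (axis b 1) *v axis a 1) x v"
      by (rule dd_cong[OF ok_patch assms]) (rule chm_sym)
    then show ?thesis
      by (simp add: dd_mv[OF ok_patch sC sm_const assms] dd_const)
  qed
  moreover have "chm i x (axis a 1) *v (chm i x (axis b 1) *v axis d 1) = chm i x (axis a 1) *v (chm i x (axis d 1) *v axis b 1)" for a b d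
    by (simp add: chm_sym[OF assms, of "axis b 1"])
  ultimately have K: "curvK i x a b *v axis d 1 + curvK i x b d *v axis a 1 + curvK i x d a *v axis b 1 = 0" for a b d
    by (simp add: curvK_def matrix_vector_mult_add_rdistrib matrix_vector_mult_diff_rdistrib flip: matrix_vector_mul_assoc)
  have e: "curv M i x u v w = (\<Sum>a\<in>UNIV. \<Sum>b\<in>UNIV. \<Sum>d\<in>UNIV. (u $ a * v $ b * w $ d) *\<^sub>R (curvK i x a b *v axis d 1))" for u v w
  proof -
    have "curvK i x a b *v w = (\<Sum>d\<in>UNIV. w $ d *\<^sub>R (curvK i x a b *v axis d 1))" for a b
      by (rule linear_axis_expand[OF matrix_vector_mul_linear])
    then show ?thesis
      by (simp add: curv_eq[OF assms] scaleR_sum_right)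
  qed
  have "curv M i x v w u = (\<Sum>a\<in>UNIV. \<Sum>b\<in>UNIV. \<Sum>d\<in>UNIV. (u $ a * v $ b * w $ d) *\<^sub>R (curvK i x b d *v axis a 1))"
    unfolding e[of v w u]
    by (rule trans[OF sum.cong[OF refl sum.swap]], rule trans[OF sum.swap], rule sum.cong[OF refl]) (simp add: mult_ac)
  moreover have "curv M i x w u v = (\<Sum>a\<in>UNIV. \<Sum>b\<in>UNIV. \<Sum>d\<in>UNIV. (u $ a * v $ b * w $ d) *\<^sub>R (curvK i x d a *v axis b 1))"
    unfolding e[of w u v]
    by (rule trans[OF sum.swap], rule sum.cong[OF refl], rule trans[OF sum.swap]) (simp add: mult_ac)
  ultimately show ?thesis
    unfolding e[of u v w] by (simp add: K flip: sum.distrib scaleR_add_right)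
qed

end

locale cc_mfd = spin_mfd M
  for M :: "('i, 'm::{t2_space, second_countable_topology}, 'n::finite, 's::finite) spin_manifold" +
  fixes c :: real
  assumes cc: "constant_curvature M c"
begin

text \<open>Subtracting the model tensor leaves a tensor with all curvature symmetries and vanishing
  sectional curvature, to which \<open>curvature_tensor_zero\<close> applies.\<close>

lemma curv_constant:
  assumes x: "x \<in> patch M i"
  shows "ginner M i x (curv M i x u v w) z
    = c * (ginner M i x v w * ginner M i x u z - ginner M i x u w * ginner M i x v z)"
proof -
  let ?g = "ginner M i x" let ?R = "curv M i x"
  have gadd: "?g (a + b) d = ?g a d + ?g b d" "?g d (a + b) = ?g d a + ?g d b"
    "?g (r *\<^sub>R a) d = r * ?g a d" "?g d (r *\<^sub>R a) = r * ?g d a" "?g (- a) d = - ?g a d" "?g 0 d = 0" "?g d 0 = 0"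
    "?g (a - b) d = ?g a d - ?g b d" "?g d (a - b) = ?g d a - ?g d b" for a b d r
    by (simp_all add: ginner_def inner_add_left inner_add_right matrix_vector_right_distrib matrix_vector_mult_scaleR
        inner_diff_left inner_diff_right matrix_vector_mult_diff_distrib)
  have gcomm: "?g a b = ?g b a" for a b
    unfolding ginner_def using inner_transpose[of a "gm i x" b] by (simp only: gm_sym[OF x] inner_commute)
  have gpos: "a \<noteq> 0 \<Longrightarrow> ?g a a > 0" for a
    unfolding ginner_def by (rule gm_pos[OF x])
  have skew: "?g (?R u v z) w = - ?g (?R u v w) z" for u v w z
  proof -
    obtain w' z' where w': "w = fr i x *v w'" "z = fr i x *v z'"
      using fr_surj[OF x] by metis
    have "(curvR i x u v *v z') \<bullet> w' = z' \<bullet> (transpose (curvR i x u v) *v w')"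
      unfolding inner_transpose ..
    then show ?thesis
      unfolding w' curv_curvR[OF x] ginner_fr[OF x] by (simp add: curvR_skew[OF x] matvec_uminus inner_commute)
  qed
  define T where "T u v w z = ?g (?R u v w) z - c * (?g v w * ?g u z - ?g u w * ?g v z)" for u v w z
  have sec: "T u v v u = 0" for u v
  \<comment> \<open>The assumption on sectional curvature speaks of independent pairs only;
    dependent ones are settled directly by skewness.\<close>
  proof (cases "v = 0 \<or> (\<exists>t. u = t *\<^sub>R v)")
    case True
    have z: "?R a a b = 0" for a b
      using curv_add(5)[OF x, of a a b] by (simp add: vec_eq_iff)
    have "?R 0 u b = 0" for b
      using curv_add(4)[OF x, of 0 0 u b] by simp
    then have z': "?R u 0 b = 0" for b
      using curv_add(5)[OF x, of 0 u b] by simp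
    from True show ?thesis
    proof
      assume "v = 0"
      then show ?thesis by (simp add: T_def z' gadd)
    next
      assume "\<exists>t. u = t *\<^sub>R v"
      then obtain t where "u = t *\<^sub>R v" by blast
      then show ?thesis by (simp add: T_def curv_add(4)[OF x] z gadd)
    qed
  next
    case False
    define D where "D = ?g u u * ?g v v - (?g u v)\<^sup>2"
    have vv: "?g v v > 0" using False gpos by blast
    have "D \<noteq> 0"
    proof
      assume D: "D = 0"
      \<comment> \<open>A multiple of the component of \<open>u\<close> orthogonal to
        \<open>v\<close>; its squared length is \<open>D\<close> times that of
        \<open>v\<close>.\<close>
      let ?w = "?g v v *\<^sub>R u + (- ?g u v) *\<^sub>R v"
      have "?g ?w ?w = ?g v v * D"
        by (simp add: gadd gcomm[of v u] D_def power2_eq_square algebra_simps)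
      then have "?w = 0"
        using gpos[of ?w] D by force
      then have "u = (?g u v / ?g v v) *\<^sub>R v"
        using vv by (simp add: vec_eq_iff field_simps)
      then show False using False by blast
    qed
    have "independent {u, v}" "u \<noteq> v"
    proof -
      show "u \<noteq> v"
        using False by (metis scaleR_one)
      have "u \<notin> span {v}"
        using False by (auto simp: span_singleton)
      then show "independent {u, v}"
        using False \<open>u \<noteq> v\<close> by (auto simp: independent_insert)
    qed
    then have "?g (?R u v v) u / D = c"
      using cc x unfolding constant_curvature_def sectional_curvature_def D_def by blast
    then have "?g (?R u v v) u = c * D"
      using \<open>D \<noteq> 0\<close> by (simp add: field_simps)
    then show ?thesis
      by (simp add: T_def D_def gcomm[of v u] power2_eq_square algebra_simps)
  qed
  have "T u v w z = 0"
  proof (rule curvature_tensor_zero[of T])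
    fix u u' v v' w w' z z'
    show "T (u + u') v w z = T u v w z + T u' v w z" "T u (v + v') w z = T u v w z + T u v' w z"
      "T u v (w + w') z = T u v w z + T u v w' z" "T u v w (z + z') = T u v w z + T u v w z'"
      by (simp_all add: T_def curv_add(1-4)[OF x] gadd algebra_simps)
    show "T v u w z = - T u v w z"
      using curv_add(5)[OF x, of u v w] by (simp add: T_def gadd algebra_simps)
    show "T u v z w = - T u v w z"
      using skew[of u v z w] by (simp add: T_def algebra_simps)
    have "?g (?R u v w) z + ?g (?R v w u) z + ?g (?R w u v) z = 0"
      using arg_cong[OF curv_bianchi[OF x, of u v w], of "\<lambda>a. ?g a z"] by (simp only: gadd)
    then show "T u v w z + T v w u z + T w u v z = 0"
      by (simp add: T_def gcomm[of w v] gcomm[of u w] gcomm[of v u] algebra_simps)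
    show "T u v v u = 0" by (rule sec)
  qed
  then show ?thesis by (simp add: T_def)
qed

lemma frame_vec_fr: "frame_vec M i x k = fr i x *v axis k 1"
  by (simp add: frame_vec_def matrix_vector_mult_basis)

lemma ginner_frame:
  assumes "x \<in> patch M i"
  shows "ginner M i x (frame_vec M i x k) (frame_vec M i x l) = (if k = l then 1 else 0)"
  by (simp add: frame_vec_fr ginner_fr[OF assms] inner_axis_axis)

lemma frame_curv_constant:
  assumes "x \<in> patch M i"
  shows "frame_curv M i x a b k l = c * ((if b = k then 1 else 0) * (if a = l then 1 else 0)
    - (if a = k then 1 else 0) * (if b = l then 1 else 0))"
  unfolding frame_curv_def curv_constant[OF assms] ginner_frame[OF assms] ..

text \<open>The minus sign stems from the convention for \<open>wedge\<close>:
  \<open>wedge l k\<close> sends \<open>e_l\<close> to \<open>e_k\<close>.\<close>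

lemma curvR_constant:
  assumes "x \<in> patch M i"
  shows "curvR i x (frame_vec M i x l) (frame_vec M i x k) = - (c *\<^sub>R wedge l k)"
proof -
  have "curvR i x (frame_vec M i x l) (frame_vec M i x k) $ p $ m = frame_curv M i x l k m p" for p m
  proof -
    have "frame_curv M i x l k m p = (curvR i x (frame_vec M i x l) (frame_vec M i x k) *v axis m 1) \<bullet> axis p 1"
      unfolding frame_curv_def frame_vec_fr[of i x m] frame_vec_fr[of i x p] curv_curvR[OF assms] ginner_fr[OF assms] ..
    then show ?thesis
      by (simp add: matrix_vector_mult_basis inner_axis column_def)
  qed
  then show ?thesis
    by (auto simp: vec_eq_iff frame_curv_constant[OF assms] wedge_def)
qed

end

section \<open>Commuting covariant derivatives and the Lichnerowicz formula\<close>

section \<open>Second order identities\<close>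

context spin_mfd
begin

text \<open>Differentiation along coordinate fields, whose brackets vanish, isolates the curvature
  from the derivatives of the frame.\<close>

definition cov :: "('i, 'm, 'n, 's) field \<Rightarrow> 'i \<Rightarrow> 'n \<Rightarrow> 'm \<Rightarrow> ('n, 's) sptensor" where
  "cov \<psi> i a y = (\<lambda>I. dd i (\<lambda>y. \<psi> i y I) y (axis a 1) + drho cl (omega i y (axis a 1)) (\<psi> i y) I)"

lemma smc_cov:
  assumes "smc i (\<psi> i) (patch M i)"
  shows "smc i (cov \<psi> i a) (patch M i)"
  unfolding cov_def[abs_def]
  by (rule smcI, rule sm_add[OF ok_patch sm_dd[OF ok_patch smcD[OF assms]] sm_drho[OF ok_patch sm_omega[OF sm_const] assms]])

lemma nabla_cov:
  assumes "smc i (\<psi> i) (patch M i)" "y \<in> patch M i"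
  shows "nabla M \<psi> i y (k # I) = (\<Sum>a\<in>UNIV. fr i y $ a $ k *\<^sub>R cov \<psi> i a y I)"
proof -
  have "frame_vec M i y k $ a = fr i y $ a $ k" for a
    by (simp add: frame_vec_def column_def)
  moreover
  let ?v = "frame_vec M i y k"
  have "dd i (\<lambda>y. \<psi> i y I) y ?v = (\<Sum>a\<in>UNIV. ?v $ a *\<^sub>R dd i (\<lambda>y. \<psi> i y I) y (axis a 1))"
    by (rule linear_axis_expand[OF linear_dd[OF ok_patch smcD[OF assms(1)] assms(2)]])
  moreover have "omega i y ?v = (\<Sum>a\<in>UNIV. ?v $ a *\<^sub>R omega i y (axis a 1))"
    by (rule linear_axis_expand[OF linear_omega[OF assms(2)]])
  then have "drho cl (omega i y ?v) (\<psi> i y) I = (\<Sum>a\<in>UNIV. ?v $ a *\<^sub>R drho cl (omega i y (axis a 1)) (\<psi> i y) I)"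
    by (metis (no_types, lifting) drho_matrix_sum drho_matrix_scaleR sum.cong)
  moreover have "nabla M \<psi> i y (k # I) = dd i (\<lambda>y. \<psi> i y I) y ?v + drho cl (omega i y ?v) (\<psi> i y) I"
    using assms(2) by (simp add: nabla_def conn_form_eq)
  ultimately show ?thesis
    by (simp only: cov_def scaleR_add_right sum.distrib)
qed

text \<open>Second partial derivatives cancel by Schwarz's theorem and first derivatives of
  \<open>\<psi>\<close> cancel in pairs; what is left is the structure equation inside
  \<open>drho\<close>.\<close>

lemma cov_commutator:
  assumes "smc i (\<psi> i) (patch M i)" "x \<in> patch M i"
  defines "C \<equiv> \<lambda>b a I. dd i (\<lambda>y. cov \<psi> i a y I) x (axis b 1) + drho cl (omega i x (axis b 1)) (cov \<psi> i a x) I"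
  shows "C b a I - C a b I = drho cl (curvF i x b a) (\<psi> i x) I"
proof -
  have so: "sm i (\<lambda>y. omega i y (axis a 1)) (patch M i)" for a
    by (intro sm_omega sm_const)
  let ?w = "\<lambda>a. omega i x (axis a 1)" let ?d = "\<lambda>a I. dd i (\<lambda>y. \<psi> i y I) x (axis a 1)"
  have e: "C b a I = dd i (\<lambda>y. dd i (\<lambda>y. \<psi> i y I) y (axis a 1)) x (axis b 1)
      + (drho cl (dd i (\<lambda>y. omega i y (axis a 1)) x (axis b 1)) (\<psi> i x) I + drho cl (?w a) (?d b) I)
      + (drho cl (?w b) (?d a) I + drho cl (?w b) (drho cl (?w a) (\<psi> i x)) I)" for a b
    unfolding C_def
    by (simp add: cov_def dd_add[OF ok_patch sm_dd[OF ok_patch smcD[OF assms(1)]] sm_drho[OF ok_patch so assms(1)] assms(2)]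
        dd_drho[OF ok_patch so assms(1,2)] drho_add)
  have "C b a I - C a b I = (drho cl (dd i (\<lambda>y. omega i y (axis a 1)) x (axis b 1)) (\<psi> i x) I
      - drho cl (dd i (\<lambda>y. omega i y (axis b 1)) x (axis a 1)) (\<psi> i x) I)
      + (drho cl (?w b) (drho cl (?w a) (\<psi> i x)) I - drho cl (?w a) (drho cl (?w b) (\<psi> i x)) I)"
    unfolding e dd_schwarz[OF ok_patch smcD[OF assms(1)] assms(2), of I "axis a 1" "axis b 1"] by simp
  then show ?thesis
    by (simp add: drho_commutator[OF omega_skew omega_skew, OF assms(2,2)] curvF_def drho_matrix_add drho_matrix_diff)
qed

text \<open>The derivative of the frame splits into a connection term, cancelled by the action on
  the index added by the inner derivative, and a Christoffel term \<open>Q\<close>, which is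
  symmetric in the two directions since there is no torsion. Only the commutator along coordinate
  fields survives.\<close>

lemma nabla_commutator:
  assumes "smc i (\<psi> i) (patch M i)" "x \<in> patch M i"
  shows "nabla M (nabla M \<psi>) i x (l # k # I) - nabla M (nabla M \<psi>) i x (k # l # I)
    = drho cl (curvR i x (frame_vec M i x l) (frame_vec M i x k)) (\<psi> i x) I"
proof -
  let ?E = "fr i x" let ?e = "frame_vec M i x" let ?w = "\<lambda>l. conn_form M i x l"
  define C where "C b a = dd i (\<lambda>y. cov \<psi> i a y I) x (axis b 1) + drho cl (omega i x (axis b 1)) (cov \<psi> i a x) I" for b a
  define Q where "Q l k = (\<Sum>a\<in>UNIV. (chm i x (?e l) *v ?e k) $ a *\<^sub>R cov \<psi> i a x I)" for l k
  have Qs: "Q l k = Q k l" for l k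
    unfolding Q_def chm_sym[OF assms(2), of "?e l"] ..
  have ek: "?e k $ a = ?E $ a $ k" for k a
    by (simp add: frame_vec_def column_def)
  have sf: "sm i (\<lambda>y. fr i y $ a $ k) (patch M i)" for a k
    by (intro sm_nth ok_patch sm_fr)
  have sc: "sm i (\<lambda>y. cov \<psi> i a y I) (patch M i)" for a
    by (rule smcD[OF smc_cov[where \<psi>=\<psi> and i=i, OF assms(1)]])
  have S: "nabla M (nabla M \<psi>) i x (l # k # I) = (\<Sum>a\<in>UNIV. \<Sum>b\<in>UNIV. (?E $ b $ l * ?E $ a $ k) *\<^sub>R C b a) - Q l k" for l k
  proof -
    have "dd i (\<lambda>y. nabla M \<psi> i y (k # I)) x (?e l) = dd i (\<lambda>y. \<Sum>a\<in>UNIV. fr i y $ a $ k *\<^sub>R cov \<psi> i a y I) x (?e l)"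
      by (rule dd_cong[OF ok_patch assms(2)]) (rule nabla_cov[where \<psi>=\<psi> and i=i, OF assms(1)])
    also have "\<dots> = (\<Sum>a\<in>UNIV. ?E $ a $ k *\<^sub>R dd i (\<lambda>y. cov \<psi> i a y I) x (?e l) + dd i (fr i) x (?e l) $ a $ k *\<^sub>R cov \<psi> i a x I)"
      by (subst dd_sum[OF ok_patch sm_scaleR[OF ok_patch sf sc] assms(2)])
        (simp add: dd_scaleR[OF ok_patch sf sc assms(2)] dd_nth[OF ok_patch sm_nth[OF ok_patch sm_fr] assms(2)]
          dd_nth[OF ok_patch sm_fr assms(2)])
    finally have d1: "dd i (\<lambda>y. nabla M \<psi> i y (k # I)) x (?e l)
      = (\<Sum>a\<in>UNIV. ?E $ a $ k *\<^sub>R dd i (\<lambda>y. cov \<psi> i a y I) x (?e l)) + (\<Sum>a\<in>UNIV. dd i (fr i) x (?e l) $ a $ k *\<^sub>R cov \<psi> i a x I)"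
      by (simp add: sum.distrib)
    have "dd i (fr i) x (?e l) $ a $ k = (\<Sum>b\<in>UNIV. ?E $ a $ b * ?w l $ b $ k) - (chm i x (?e l) *v ?e k) $ a" for a
      by (simp add: fr_deriv[OF assms(2)] conn_form_eq[OF assms(2)] matrix_mult_nth matrix_vector_mult_def ek)
    then have "(\<Sum>a\<in>UNIV. dd i (fr i) x (?e l) $ a $ k *\<^sub>R cov \<psi> i a x I)
      = (\<Sum>a\<in>UNIV. \<Sum>b\<in>UNIV. ?w l $ b $ k *\<^sub>R ?E $ a $ b *\<^sub>R cov \<psi> i a x I) - Q l k"
      by (simp add: Q_def scaleR_diff_left sum_subtractf scaleR_sum_left mult.commute)
    also have "(\<Sum>a\<in>UNIV. \<Sum>b\<in>UNIV. ?w l $ b $ k *\<^sub>R ?E $ a $ b *\<^sub>R cov \<psi> i a x I)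
      = (\<Sum>b\<in>UNIV. ?w l $ b $ k *\<^sub>R nabla M \<psi> i x (b # I))"
      by (subst sum.swap) (simp add: nabla_cov[where \<psi>=\<psi> and i=i, OF assms] scaleR_sum_right)
    also have "\<dots> = (\<Sum>b\<in>UNIV. (- ?w l $ k $ b) *\<^sub>R nabla M \<psi> i x (b # I))"
    proof -
      have "?w l $ b $ k = - ?w l $ k $ b" for b
        using arg_cong[OF conn_form_skew[OF assms(2), of l], of "\<lambda>A. A $ k $ b"] by (simp add: transpose_def)
      then show ?thesis by simp
    qed
    finally have d2: "(\<Sum>a\<in>UNIV. dd i (fr i) x (?e l) $ a $ k *\<^sub>R cov \<psi> i a x I)
      = - (\<Sum>b\<in>UNIV. ?w l $ k $ b *\<^sub>R nabla M \<psi> i x (b # I)) - Q l k"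
      by (simp add: sum_negf)
    have "slot k (nabla M \<psi> i x) = (\<lambda>I. \<Sum>a\<in>UNIV. ?E $ a $ k *\<^sub>R cov \<psi> i a x I)"
      by (simp add: slot_def nabla_cov[where \<psi>=\<psi> and i=i, OF assms])
    then have d3: "drho cl (?w l) (nabla M \<psi> i x) (k # I) = (\<Sum>a\<in>UNIV. ?E $ a $ k *\<^sub>R drho cl (?w l) (cov \<psi> i a x) I)
      + (\<Sum>b\<in>UNIV. ?w l $ k $ b *\<^sub>R nabla M \<psi> i x (b # I))"
      by (simp add: drho_Cons drho_sum drho_scaleR)
    have d4: "dd i (\<lambda>y. cov \<psi> i a y I) x (?e l) + drho cl (?w l) (cov \<psi> i a x) I = (\<Sum>b\<in>UNIV. ?E $ b $ l *\<^sub>R C b a)" for a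
    proof -
      have "dd i (\<lambda>y. cov \<psi> i a y I) x (?e l) = (\<Sum>b\<in>UNIV. ?E $ b $ l *\<^sub>R dd i (\<lambda>y. cov \<psi> i a y I) x (axis b 1))"
        using linear_axis_expand[OF linear_dd[OF ok_patch sc assms(2)], of a "?e l"] by (simp add: ek)
      moreover have "?w l = (\<Sum>b\<in>UNIV. ?E $ b $ l *\<^sub>R omega i x (axis b 1))"
        using linear_axis_expand[OF linear_omega[OF assms(2)], of "?e l"] by (simp add: ek conn_form_eq[OF assms(2)])
      then have "drho cl (?w l) u I = (\<Sum>b\<in>UNIV. ?E $ b $ l *\<^sub>R drho cl (omega i x (axis b 1)) u I)" for u
        by (simp add: drho_matrix_sum drho_matrix_scaleR)
      ultimately show ?thesis
        by (simp add: C_def scaleR_add_right sum.distrib)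
    qed
    have "nabla M (nabla M \<psi>) i x (l # k # I) = dd i (\<lambda>y. nabla M \<psi> i y (k # I)) x (?e l) + drho cl (?w l) (nabla M \<psi> i x) (k # I)"
      using assms(2) by (simp add: nabla_def[of M "nabla M \<psi>"])
    also have "\<dots> = (\<Sum>a\<in>UNIV. ?E $ a $ k *\<^sub>R (dd i (\<lambda>y. cov \<psi> i a y I) x (?e l) + drho cl (?w l) (cov \<psi> i a x) I)) - Q l k"
      unfolding d1 d2 d3 by (simp add: scaleR_add_right sum.distrib)
    finally show ?thesis
      unfolding d4 by (simp add: scaleR_sum_right mult.commute)
  qed
  have "nabla M (nabla M \<psi>) i x (l # k # I) - nabla M (nabla M \<psi>) i x (k # l # I)
    = (\<Sum>a\<in>UNIV. \<Sum>b\<in>UNIV. (?E $ b $ l * ?E $ a $ k) *\<^sub>R C b a) - (\<Sum>a\<in>UNIV. \<Sum>b\<in>UNIV. (?E $ b $ k * ?E $ a $ l) *\<^sub>R C b a)"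
    unfolding S Qs[of k l] by simp
  also have "(\<Sum>a\<in>UNIV. \<Sum>b\<in>UNIV. (?E $ b $ k * ?E $ a $ l) *\<^sub>R C b a) = (\<Sum>a\<in>UNIV. \<Sum>b\<in>UNIV. (?E $ b $ l * ?E $ a $ k) *\<^sub>R C a b)"
    by (subst sum.swap) (simp add: mult.commute)
  also have "(\<Sum>a\<in>UNIV. \<Sum>b\<in>UNIV. (?E $ b $ l * ?E $ a $ k) *\<^sub>R C b a) - \<dots>
      = (\<Sum>a\<in>UNIV. \<Sum>b\<in>UNIV. (?E $ b $ l * ?E $ a $ k) *\<^sub>R drho cl (curvF i x b a) (\<psi> i x) I)"
    unfolding C_def cov_commutator[where \<psi>=\<psi> and i=i, OF assms, symmetric] by (simp add: scaleR_diff_right sum_subtractf)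
  also have "\<dots> = drho cl (curvR i x (?e l) (?e k)) (\<psi> i x) I"
    unfolding curvR_def by (subst sum.swap) (simp add: ek drho_matrix_sum drho_matrix_scaleR)
  finally show ?thesis .
qed

text \<open>A map with constant coefficients commuting with \<open>drho\<close> also commutes with
  second derivatives, because it does not touch the cotangent index which the first derivative
  adds.\<close>

lemma nabla2_op:
  assumes nab: "\<And>y k I. y \<in> patch M i \<Longrightarrow> nabla M \<Psi> i y (k # I) = F (slot k (nabla M \<psi> i y)) I"
    and Fd: "\<And>u I v. smc i u (patch M i) \<Longrightarrow> dd i (\<lambda>y. F (u y) I) x v = F (\<lambda>I. dd i (\<lambda>y. u y I) x v) I"
    and Fr: "\<And>A u I. transpose A = - A \<Longrightarrow> drho cl A (F u) I = F (drho cl A u) I"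
    and Fa: "\<And>u v I. F (\<lambda>I. u I + v I) I = F u I + F v I" and Fs: "\<And>r u I. F (\<lambda>I. r *\<^sub>R u I) I = r *\<^sub>R F u I"
    and smc: "smc i (\<psi> i) (patch M i)" and x: "x \<in> patch M i"
  shows "nabla M (nabla M \<Psi>) i x (l # k # I) = F (slot k (slot l (nabla M (nabla M \<psi>) i x))) I"
proof -
  let ?w = "conn_form M i x l"
  have F0: "F (\<lambda>I. 0) I = 0" for I
    using Fs[of 0 "\<lambda>I. 0" I] by simp
  have Fsum: "F (\<lambda>I. \<Sum>b\<in>B. u b I) I = (\<Sum>b\<in>B. F (u b) I)" for B :: "'n set" and u I
    by (induction B rule: infinite_finite_induct) (auto simp: F0 Fa)
  have s: "slot k (nabla M \<Psi> i x) = F (slot k (nabla M \<psi> i x))" for k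
    using nab[OF x] by (simp add: slot_def fun_eq_iff)
  have "dd i (\<lambda>y. nabla M \<Psi> i y (k # I)) x v = F (\<lambda>I. dd i (\<lambda>y. nabla M \<psi> i y (k # I)) x v) I" for v
  proof -
    have "dd i (\<lambda>y. nabla M \<Psi> i y (k # I)) x v = dd i (\<lambda>y. F (slot k (nabla M \<psi> i y)) I) x v"
      by (rule dd_cong[OF ok_patch x]) (rule nab)
    then show ?thesis
      using Fd[OF smc_slot[OF smc_nabla[where \<psi>=\<psi> and i=i, OF smc]], of k I v] by (simp add: slot_def)
  qed
  then have "nabla M (nabla M \<Psi>) i x (l # k # I) = F (\<lambda>I. dd i (\<lambda>y. nabla M \<psi> i y (k # I)) x (frame_vec M i x l)) I
      + (F (drho cl ?w (slot k (nabla M \<psi> i x))) I + (\<Sum>b\<in>UNIV. ?w $ k $ b *\<^sub>R F (slot b (nabla M \<psi> i x)) I))"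
    using x nab[OF x] by (simp add: nabla_def[of M "nabla M \<Psi>"] drho_Cons s Fr[OF conn_form_skew[OF x]])
  also have "\<dots> = F (\<lambda>I. dd i (\<lambda>y. nabla M \<psi> i y (k # I)) x (frame_vec M i x l)
      + (drho cl ?w (slot k (nabla M \<psi> i x)) I + (\<Sum>b\<in>UNIV. ?w $ k $ b *\<^sub>R slot b (nabla M \<psi> i x) I))) I"
    unfolding Fa Fsum Fs ..
  also have "(\<lambda>I. dd i (\<lambda>y. nabla M \<psi> i y (k # I)) x (frame_vec M i x l)
      + (drho cl ?w (slot k (nabla M \<psi> i x)) I + (\<Sum>b\<in>UNIV. ?w $ k $ b *\<^sub>R slot b (nabla M \<psi> i x) I)))
      = slot k (slot l (nabla M (nabla M \<psi>) i x))"
  proof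
    fix I
    have "slot k (slot l (nabla M (nabla M \<psi>) i x)) I = nabla M (nabla M \<psi>) i x (l # k # I)"
      by (simp add: slot_def)
    then show "dd i (\<lambda>y. nabla M \<psi> i y (k # I)) x (frame_vec M i x l)
        + (drho cl ?w (slot k (nabla M \<psi> i x)) I + (\<Sum>b\<in>UNIV. ?w $ k $ b *\<^sub>R slot b (nabla M \<psi> i x) I))
      = slot k (slot l (nabla M (nabla M \<psi>) i x)) I"
      using x by (simp add: nabla_def[of M "nabla M \<psi>"] drho_Cons) (simp add: slot_def)
  qed
  finally show ?thesis .
qed

lemma dd_cliff:
  assumes "smc i u (patch M i)" "x \<in> patch M i"
  shows "dd i (\<lambda>y. cliff cl (u y) I) x v = cliff cl (\<lambda>I. dd i (\<lambda>y. u y I) x v) I"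
  unfolding cliff_def
  by (simp add: dd_sum[OF ok_patch sm_cmatvec[OF ok_patch smcD[OF assms(1)]] assms(2)]
      dd_cmatvec[OF ok_patch smcD[OF assms(1)] assms(2)])

lemma dd_clsym:
  assumes "smc i u (patch M i)" "x \<in> patch M i"
  shows "dd i (\<lambda>y. clsym cl (u y) I) x v = clsym cl (\<lambda>I. dd i (\<lambda>y. u y I) x v) I"
  unfolding clsym_def
  by (simp add: dd_ins[OF ok_patch sm_cmatvec[OF ok_patch smcD[OF assms(1)]] assms(2)]
      dd_cmatvec[OF ok_patch smcD[OF assms(1)] assms(2)])

text \<open>\<open>bochner\<close> is \<open>\<nabla>\<^sup>*\<nabla>\<close>, see \<open>rough_laplacian_eq\<close>.\<close>

definition bochner :: "('i, 'm, 'n, 's) field \<Rightarrow> ('i, 'm, 'n, 's) field" where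
  "bochner \<psi> = (\<lambda>i x I. - ndiv (nabla M \<psi>) i x I)"

lemma bochner_eq: "bochner \<psi> i x I = - (\<Sum>k\<in>UNIV. slot k (slot k (nabla M (nabla M \<psi>) i x)) I)"
  by (simp add: bochner_def ndiv_eq slot_def)

lemma bochner_clsym:
  assumes "smc i (\<psi> i) (patch M i)" "x \<in> patch M i"
  shows "bochner (\<lambda>i x. clsym cl (\<psi> i x)) i x I = clsym cl (bochner \<psi> i x) I"
proof -
  have "nabla M (nabla M (\<lambda>i x. clsym cl (\<psi> i x))) i x (l # k # I) = clsym cl (slot k (slot l (nabla M (nabla M \<psi>) i x))) I" for k l I
  proof (rule nabla2_op[where \<Psi>="\<lambda>i x. clsym cl (\<psi> i x)" and F="clsym cl" and \<psi>=\<psi> and i=i,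
        OF _ dd_clsym[OF _ assms(2)] drho_clsym clsym_add clsym_scaleR assms])
    show "nabla M (\<lambda>i x. clsym cl (\<psi> i x)) i y (k # I) = clsym cl (nab \<psi> i y k) I" if "y \<in> patch M i" for y k I
      using nab_clsym[where \<psi>=\<psi> and i=i, OF assms(1) that, of k I] by (simp add: slot_def[of k "nabla M _ i y"])
  qed
  then have "bochner (\<lambda>i x. clsym cl (\<psi> i x)) i x I = - (\<Sum>k\<in>UNIV. clsym cl (slot k (slot k (nabla M (nabla M \<psi>) i x))) I)"
    by (simp add: bochner_def ndiv_eq)
  also have "\<dots> = clsym cl (bochner \<psi> i x) I"
    unfolding bochner_eq[abs_def] clsym_def by (simp add: matvec ins_neg ins_sum)
  finally show ?thesis .
qed

lemma bochner_cliff: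
  assumes "smc i (\<psi> i) (patch M i)" "x \<in> patch M i"
  shows "bochner (\<lambda>i x. cliff cl (\<psi> i x)) i x I = cliff cl (bochner \<psi> i x) I"
proof -
  have "nabla M (nabla M (\<lambda>i x. cliff cl (\<psi> i x))) i x (l # k # I) = cliff cl (slot k (slot l (nabla M (nabla M \<psi>) i x))) I" for k l I
  proof (rule nabla2_op[where \<Psi>="\<lambda>i x. cliff cl (\<psi> i x)" and F="cliff cl" and \<psi>=\<psi> and i=i,
        OF _ dd_cliff[OF _ assms(2)] drho_cliff cliff_add cliff_scaleR assms])
    show "nabla M (\<lambda>i x. cliff cl (\<psi> i x)) i y (k # I) = cliff cl (nab \<psi> i y k) I" if "y \<in> patch M i" for y k I
      using nab_cliff[where \<psi>=\<psi> and i=i, OF assms(1) that, of k I] by (simp add: slot_def[of k "nabla M _ i y"])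
  qed
  then have "bochner (\<lambda>i x. cliff cl (\<psi> i x)) i x I = - (\<Sum>k\<in>UNIV. cliff cl (slot k (slot k (nabla M (nabla M \<psi>) i x))) I)"
    by (simp add: bochner_def ndiv_eq)
  also have "\<dots> = cliff cl (bochner \<psi> i x) I"
    unfolding bochner_eq[abs_def] cliff_def by (simp add: matvec sum_negf) (rule sum.swap)
  finally show ?thesis .
qed

lemma nabla_zero: "(\<And>y. y \<in> patch M i \<Longrightarrow> \<psi> i y = (\<lambda>I. 0)) \<Longrightarrow> nabla M \<psi> i x = (\<lambda>I. 0)"
proof
  fix J assume z: "\<And>y. y \<in> patch M i \<Longrightarrow> \<psi> i y = (\<lambda>I. 0)"
  show "nabla M \<psi> i x J = 0"
  proof (cases "x \<in> patch M i")
    case True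
    have "dd i (\<lambda>y. \<psi> i y I) x v = dd i (\<lambda>y. 0) x v" for I v
      by (rule dd_cong[OF ok_patch True]) (simp add: z)
    then show ?thesis
      using True by (cases J) (simp_all add: nabla_def z dd_const drho_0)
  qed (simp add: nabla_outside)
qed

end

context cc_mfd
begin

text \<open>With the two summation indices renamed and the Clifford factors anticommuted, the square
  of the Dirac operator equals its own negative plus twice the Bochner Laplacian, up to the
  curvature term evaluated by \<open>lichnerowicz_drho\<close>.\<close>

lemma lichnerowicz:
  assumes "smc i (\<psi> i) (patch M i)" "\<And>y. y \<in> patch M i \<Longrightarrow> \<psi> i y \<in> sym0 j" "x \<in> patch M i"
  shows "twisted_dirac M (twisted_dirac M \<psi>) i x I = bochner \<psi> i x I
    + (c * (real CARD('n) * (real CARD('n) - 1) / 4 + real j)) *\<^sub>R \<psi> i x I + c *\<^sub>R clsym cl (cliff cl (\<psi> i x)) I"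
proof -
  let ?S = "\<lambda>l k. nabla M (nabla M \<psi>) i x (l # k # I)" let ?N = "real CARD('n)"
  define X where "X = (\<Sum>l\<in>UNIV. \<Sum>k\<in>UNIV. cl l *v (cl k *v ?S l k))"
  have DD: "twisted_dirac M (twisted_dirac M \<psi>) i x I = X"
  proof -
    have "nab (\<lambda>i x. cliff cl (nabla M \<psi> i x)) i x l I = cliff cl (nab (nabla M \<psi>) i x l) I" for l
      by (rule nab_cliff[where \<psi>="nabla M \<psi>" and i=i, OF smc_nabla[where \<psi>=\<psi> and i=i, OF assms(1)] assms(3)])
    then show ?thesis
      unfolding X_def twisted_dirac_clmul[of "twisted_dirac M \<psi>"] unfolding twisted_dirac_eq[abs_def]
      by (simp add: clmul_def matvec) (simp add: cliff_def slot_def matvec)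
  qed
  have R: "?S k l = ?S l k + c *\<^sub>R drho cl (wedge l k) (\<psi> i x) I" for l k
    using nabla_commutator[where \<psi>=\<psi> and i=i, OF assms(1,3), of l k I]
    unfolding curvR_constant[OF assms(3)] drho_uminus drho_matrix_scaleR by (simp add: algebra_simps)
  have "X = (\<Sum>l\<in>UNIV. \<Sum>k\<in>UNIV. cl k *v (cl l *v ?S k l))"
    unfolding X_def by (rule sum.swap)
  also have "\<dots> = (\<Sum>l\<in>UNIV. \<Sum>k\<in>UNIV. - (cl l *v (cl k *v ?S k l)) - (if l = k then 2 *\<^sub>R ?S k l else 0))"
  proof (intro sum.cong refl)
    fix l k
    show "cl k *v (cl l *v ?S k l) = - (cl l *v (cl k *v ?S k l)) - (if l = k then 2 *\<^sub>R ?S k l else 0)"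
      using cl_anticommute[of k l "?S k l"] by (simp only: eq_commute[of l k])
  qed
  also have "\<dots> = - (\<Sum>l\<in>UNIV. \<Sum>k\<in>UNIV. cl l *v (cl k *v ?S k l)) - 2 *\<^sub>R (\<Sum>l\<in>UNIV. ?S l l)"
    by (simp add: sum_subtractf sum_negf scaleR_sum_right)
  also have "(\<Sum>l\<in>UNIV. \<Sum>k\<in>UNIV. cl l *v (cl k *v ?S k l)) = X + c *\<^sub>R (\<Sum>l\<in>UNIV. \<Sum>k\<in>UNIV. cl l *v (cl k *v drho cl (wedge l k) (\<psi> i x) I))"
  proof -
    have "cl l *v (cl k *v ?S k l) = cl l *v (cl k *v ?S l k) + c *\<^sub>R (cl l *v (cl k *v drho cl (wedge l k) (\<psi> i x) I))" for l k
      unfolding R[of k l] by (simp add: matvec)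
    then show ?thesis
      unfolding X_def by (simp add: sum.distrib scaleR_sum_right)
  qed
  also have "(\<Sum>l\<in>UNIV. \<Sum>k\<in>UNIV. cl l *v (cl k *v drho cl (wedge l k) (\<psi> i x) I))
      = - ((?N * (?N - 1) / 2 + 2 * real j) *\<^sub>R \<psi> i x I) - 2 *\<^sub>R clsym cl (cliff cl (\<psi> i x)) I"
  proof -
    have "symt (\<psi> i x)" "\<psi> i x \<in> tensors j"
      using assms(2,3) by (auto simp: sym0_iff)
    moreover from this have "(?N * (?N - 1) / 2 + 2 * real (length I)) *\<^sub>R \<psi> i x I = (?N * (?N - 1) / 2 + 2 * real j) *\<^sub>R \<psi> i x I"
      by (cases "length I = j") (auto dest: tensorsD)
    ultimately show ?thesis
      by (simp add: lichnerowicz_drho)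
  qed
  \<comment> \<open>Solve \<open>X = - (X + c Y) - 2 \<Sum> S l l\<close> for \<open>X\<close>,
    where \<open>Y\<close> is the Clifford-contracted curvature action.\<close>
  finally have "X = - (\<Sum>l\<in>UNIV. ?S l l) + (c * (?N * (?N - 1) / 4 + real j)) *\<^sub>R \<psi> i x I + c *\<^sub>R clsym cl (cliff cl (\<psi> i x)) I"
    by (simp only: vec_eq_iff vector_scaleR_component vector_add_component vector_minus_component vector_uminus_component)
      (simp add: scaleR_conv_of_real field_simps)
  then show ?thesis
    by (simp add: DD bochner_def ndiv_eq)
qed

text \<open>For given \<open>a\<close> and \<open>b\<close> only \<open>(k, l) = (b, a)\<close> and
  \<open>(a, b)\<close> survive, and they contribute equally after \<open>wedge_swap\<close>. This
  leaves a multiple of the Casimir element; off the patch both sides are \<open>0\<close>.\<close>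

lemma curv_endo_eq:
  assumes "\<psi> \<in> Gam M j"
  shows "(1 / 2) *\<^sub>R curv_endo M \<psi> i x I
    = ((real j * (real CARD('n) + real j - 1) + real CARD('n) * (real CARD('n) - 1) / 8) * c) *\<^sub>R \<psi> i x I"
proof (cases "x \<in> patch M i")
  case True
  let ?u = "\<psi> i x" let ?N = "real CARD('n)"
  have u: "?u \<in> Wfib cl j"
    using sectionsD(2)[OF assms[unfolded Gam_def] True] .
  have e: "frame_curv M i x a b k l *\<^sub>R v
    = (if k = b then if l = a then c *\<^sub>R v else 0 else 0) - (if k = a then if l = b then c *\<^sub>R v else 0 else 0)" for a b k l and v :: "complex ^ 's"
    by (simp add: frame_curv_constant[OF True])
  have i: "(\<Sum>l\<in>UNIV. if P then g l else 0) = (if P then \<Sum>l\<in>UNIV. g l else 0)" for P and g :: "'n \<Rightarrow> complex ^ 's"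
    by simp
  have "(\<Sum>k\<in>UNIV. \<Sum>l\<in>UNIV. frame_curv M i x a b k l *\<^sub>R drho cl (wedge a b) (drho cl (wedge k l) ?u) I)
      = - (2 * c) *\<^sub>R drho cl (wedge a b) (drho cl (wedge a b) ?u) I" for a b
  proof -
    have "drho cl (wedge b a) ?u = (\<lambda>I. (- 1) *\<^sub>R drho cl (wedge a b) ?u I)"
      by (simp add: fun_eq_iff wedge_swap[of b a] drho_uminus)
    then have "drho cl (wedge a b) (drho cl (wedge b a) ?u) I = - drho cl (wedge a b) (drho cl (wedge a b) ?u) I"
      by (simp only: drho_scaleR) simp
    then show ?thesis
      unfolding e sum_subtractf i by (simp add: vec_eq_iff scaleR_conv_of_real)
  qed
  then have "curv_endo M \<psi> i x I = (1 / 2) *\<^sub>R (\<Sum>a\<in>UNIV. \<Sum>b\<in>UNIV. - (2 * c) *\<^sub>R drho cl (wedge a b) (drho cl (wedge a b) ?u) I)"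
    by (simp only: curv_endo_def)
  also have "\<dots> = (- c) *\<^sub>R (\<Sum>a\<in>UNIV. \<Sum>b\<in>UNIV. drho cl (wedge a b) (drho cl (wedge a b) ?u) I)"
    by (simp add: scaleR_sum_right sum_negf)
  finally show ?thesis
    unfolding casimir_Wfib[OF u]
    by (simp only: vec_eq_iff vector_scaleR_component vector_uminus_component) (simp add: scaleR_conv_of_real field_simps)
next
  case False
  have "drho cl A (\<lambda>I. 0) = (\<lambda>I. 0)" for A
    by (simp add: drho_0 fun_eq_iff)
  then show ?thesis
    using sectionsD(1)[OF assms[unfolded Gam_def] False] by (simp add: curv_endo_def)
qed

end

section \<open>The four blocks of the twisted Dirac operator and the relations between them\<close>

section \<open>The blocks of the twisted Dirac operator\<close>

context spinor_rep3
begin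

text \<open>For \<open>m = j - 1\<close> this is \<open>(n + 2 j - 4) / (n + 2 j - 2)\<close>; for
  \<open>m = j\<close> its square is the coefficient of the squared \<open>D_j\<close> in the last
  formula for the Laplacian.\<close>

abbreviation kap :: "nat \<Rightarrow> real" where
  "kap m \<equiv> (dm + 2 * real m - 2) / (dm + 2 * real m)"

lemma rho_prW:
  assumes "s \<in> spin_group cl" "u \<in> sym0 j" "rho cl s u \<in> sym0 j"
  shows "prW cl j (rho cl s u) I = rho cl s (prW cl j u) I"
proof (cases j)
  case 0
  then show ?thesis using assms by (simp add: prW_Zero)
next
  case (Suc m)
  have "cliff cl (rho cl s u) = rho cl s (cliff cl u)"
    by (simp add: fun_eq_iff rho_cliff[OF assms(1)])
  then show ?thesis
    using assms unfolding Suc by (simp add: prW_Suc(1) rho_clsym rho_add rho_scaleR)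
qed

text \<open>Three terms at once, the shape of the expressions of the Laplacian to which the
  operators will be applied.\<close>

lemma prW_lincomb:
  assumes "u \<in> sym0 j" "v \<in> sym0 j" "w \<in> sym0 j"
  shows "prW cl j (\<lambda>I. u I + s *\<^sub>R v I + r *\<^sub>R w I) I = prW cl j u I + s *\<^sub>R prW cl j v I + r *\<^sub>R prW cl j w I"
proof -
  have l: "(\<lambda>I. u I + s *\<^sub>R v I + r *\<^sub>R w I) \<in> sym0 j"
    by (intro sym0_add sym0_scaleR assms)
  show ?thesis
  proof (cases j)
    case 0
    then show ?thesis using assms l by (simp add: prW_Zero)
  next
    case (Suc m)
    have "cliff cl (\<lambda>I. u I + s *\<^sub>R v I + r *\<^sub>R w I) = (\<lambda>I. cliff cl u I + s *\<^sub>R cliff cl v I + r *\<^sub>R cliff cl w I)"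
      by (simp only: fun_eq_iff cliff_add cliff_scaleR) simp
    then show ?thesis
      using assms l unfolding Suc by (simp add: prW_Suc(1) clsym_add clsym_scaleR scaleR_add_right mult.commute)
  qed
qed

end

locale spin3_mfd = spin_mfd M
  for M :: "('i, 'm::{t2_space, second_countable_topology}, 'n::finite, 's::finite) spin_manifold" +
  assumes card_ge_3: "CARD('n) \<ge> 3"

sublocale spin3_mfd \<subseteq> spinor_rep3 "clif M" "real CARD('n)"
  by unfold_locales (use card_ge_3 in simp_all)

context spin3_mfd
begin

lemma Gam_sym0: "\<psi> \<in> Gam M j \<Longrightarrow> \<psi> \<in> sections M (sym0 j)"
  unfolding Gam_def by (rule sections_mono[OF Wfib_sym0])

lemma Gam_in: "\<psi> \<in> Gam M j \<Longrightarrow> \<psi> i x \<in> Wfib cl j"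
  unfolding Gam_def by (rule sections_in[OF _ Wfib_0])

lemma sym0_in: "\<psi> \<in> sections M (sym0 j) \<Longrightarrow> \<psi> i x \<in> sym0 j"
  by (rule sections_in[OF _ sym0_0])

lemma prW_sections:
  assumes "\<psi> \<in> sections M (sym0 j)"
  shows "(\<lambda>i x. prW cl j (\<psi> i x)) \<in> Gam M j"
  unfolding Gam_def
proof (rule sections_op[OF assms])
  note s = sectionsD[OF assms]
  show "prW cl j (\<lambda>I. 0) = (\<lambda>I. 0)"
    by (rule prW_id[OF Wfib_0])
  show "prW cl j u \<in> Wfib cl j" if "u \<in> sym0 j" for u
    by (rule prW_Wfib[OF that])
  show "smc i (\<lambda>x. prW cl j (\<psi> i x)) (patch M i)" for i
  proof (cases j)
    case 0
    then show ?thesis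
      using s(3)[of i] sym0_in[OF assms] by (simp add: prW_Zero)
  next
    case (Suc m)
    show ?thesis
      unfolding Suc prW_Suc(1)[OF sym0_in[OF assms, unfolded Suc]]
      by (intro smc_add smc_rscale smc_clsym smc_cliff s(3) ok_patch)
  qed
  show "prW cl j (rho cl t u) I = rho cl t (prW cl j u) I" if "t \<in> spin_group cl" "u \<in> sym0 j" "rho cl t u \<in> sym0 j" for t u I
    by (rule rho_prW[OF that])
qed

lemma Dj_Gam: "\<psi> \<in> Gam M j \<Longrightarrow> Dj M j \<psi> \<in> Gam M j"
  unfolding Dj_def by (rule prW_sections[OF twisted_dirac_sections[OF Gam_sym0]])

lemma cliff_sections:
  assumes "\<psi> \<in> sections M (sym0 (Suc m))"
  shows "(\<lambda>i x. cliff cl (\<psi> i x)) \<in> Gam M m"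
  unfolding Gam_def
  by (rule sections_op[OF assms])
    (auto simp: cliff_0 rho_cliff cliff_Wfib fun_eq_iff intro!: smc_cliff ok_patch sectionsD(3)[OF assms])

lemma Gam_rscale: "\<psi> \<in> Gam M j \<Longrightarrow> (\<lambda>i x I. r *\<^sub>R \<psi> i x I) \<in> Gam M j"
  unfolding Gam_def by (erule sections_rscale) (rule Wfib_scaleR)

lemma Gam_add: "\<psi> \<in> Gam M j \<Longrightarrow> \<phi> \<in> Gam M j \<Longrightarrow> (\<lambda>i x I. \<psi> i x I + \<phi> i x I) \<in> Gam M j"
  unfolding Gam_def by (erule (1) sections_add) (rule Wfib_add)

lemma Gam_lincomb:
  "\<psi> \<in> Gam M j \<Longrightarrow> \<phi> \<in> Gam M j \<Longrightarrow> \<xi> \<in> Gam M j \<Longrightarrow> (\<lambda>i x I. \<psi> i x I + s *\<^sub>R \<phi> i x I + r *\<^sub>R \<xi> i x I) \<in> Gam M j"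
  by (intro Gam_add Gam_rscale)

text \<open>The subtracted projection lies in the kernel of \<open>cliff\<close>, so it does not
  affect the contraction.\<close>

lemma Tminus_eq:
  assumes "\<psi> \<in> Gam M (Suc m)"
  shows "Tminus M (Suc m) \<psi> i x = (\<lambda>I. pcon m *\<^sub>R cliff cl (twisted_dirac M \<psi> i x) I)"
proof -
  let ?u = "twisted_dirac M \<psi> i x" let ?w = "prW cl (Suc m) ?u"
  have u: "?u \<in> sym0 (Suc m)"
    by (rule sym0_in[OF twisted_dirac_sections[OF Gam_sym0[OF assms]]])
  have "cliff cl ?w I = 0" for I
    by (rule WfibD(4)[OF prW_Wfib[OF u]])
  then have "cliff cl (\<lambda>I. ?u I + (- 1) *\<^sub>R ?w I) I = cliff cl ?u I" for I
    by (simp only: cliff_add cliff_scaleR) simp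
  then show ?thesis
    by (simp add: Tminus_def ident_eq)
qed

lemma Tminus_Gam:
  assumes "\<psi> \<in> Gam M (Suc m)"
  shows "Tminus M (Suc m) \<psi> \<in> Gam M m"
proof -
  have "Tminus M (Suc m) \<psi> = (\<lambda>i x I. pcon m *\<^sub>R cliff cl (twisted_dirac M \<psi> i x) I)"
    by (intro ext) (simp add: Tminus_eq[OF assms])
  then show ?thesis
    using Gam_rscale[OF cliff_sections[OF twisted_dirac_sections[OF Gam_sym0[OF assms]]]] by simp
qed

text \<open>The covariant derivatives of the section stay in the kernel of \<open>cliff\<close>, so
  exchanging \<open>cliff\<close> with \<open>clmul\<close> leaves the divergence alone.\<close>

lemma Tminus_dvg:
  assumes "\<psi> \<in> Gam M (Suc m)"
  shows "Tminus M (Suc m) \<psi> i x I = - (2 * pcon m) *\<^sub>R dvg (nab \<psi> i x) I"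
proof -
  have z: "cliff cl (nab \<psi> i x k) = (\<lambda>I. 0)" for k
  proof (cases "x \<in> patch M i")
    case True
    have "nab \<psi> i x k \<in> Wfib cl (Suc m)"
      using sectionsD(3)[OF assms[unfolded Gam_def]] Gam_in[OF assms] by (rule nab_Wfib[where \<psi>=\<psi> and i=i, OF _ _ True])
    then show ?thesis by (simp add: Wfib_def)
  qed (simp add: nabla_outside slot_def cliff_0 fun_eq_iff)
  have "cliff cl (twisted_dirac M \<psi> i x) I = - 2 *\<^sub>R dvg (nab \<psi> i x) I"
    unfolding twisted_dirac_clmul cliff_clmul_swap z by (simp add: clmul_def matvec_0)
  then show ?thesis
    by (simp add: Tminus_eq[OF assms])
qed

text \<open>On sections this is \<open>ident_inv\<close> applied fibrewise, see
  \<open>emb_eq\<close>: the isometric copy of \<open>S_m\<close> inside the trace-free tensors of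
  degree \<open>m + 1\<close>.\<close>

definition emb :: "nat \<Rightarrow> ('i, 'm, 'n, 's) field \<Rightarrow> ('i, 'm, 'n, 's) field" where
  "emb m \<phi> = (\<lambda>i x I. qcon m *\<^sub>R clsym cl (\<phi> i x) I)"

lemma emb_eq: "\<phi> \<in> Gam M m \<Longrightarrow> (\<lambda>i x. ident_inv cl (Suc m) (\<phi> i x)) = emb m \<phi>"
  by (simp add: emb_def ident_inv_eq[OF Gam_in])

lemma emb_sections: "\<phi> \<in> Gam M m \<Longrightarrow> emb m \<phi> \<in> sections M (sym0 (Suc m))"
  unfolding emb_def Gam_def by (intro sections_rscale clsym_sections sym0_scaleR)

lemma Tplus_eq: "\<phi> \<in> Gam M m \<Longrightarrow> Tplus M m \<phi> i x = prW cl (Suc m) (twisted_dirac M (emb m \<phi>) i x)"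
  by (simp add: Tplus_def emb_eq)

lemma Tplus_Gam: "\<phi> \<in> Gam M m \<Longrightarrow> Tplus M m \<phi> \<in> Gam M (Suc m)"
  using prW_sections[OF twisted_dirac_sections[OF emb_sections]] by (simp flip: Tplus_eq)

lemma twisted_dirac_Zero: "\<psi> \<in> Gam M 0 \<Longrightarrow> twisted_dirac M \<psi> = Dj M 0 \<psi>"
  using sym0_in[OF twisted_dirac_sections[OF Gam_sym0]] by (simp add: Dj_def prW_Zero fun_eq_iff)

lemma twisted_dirac_Suc:
  assumes "\<psi> \<in> Gam M (Suc m)"
  shows "twisted_dirac M \<psi> i x I = Dj M (Suc m) \<psi> i x I + emb m (Tminus M (Suc m) \<psi>) i x I"
proof -
  have "twisted_dirac M \<psi> i x \<in> sym0 (Suc m)"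
    by (rule sym0_in[OF twisted_dirac_sections[OF Gam_sym0[OF assms]]])
  moreover have "qcon m * pcon m = - 1 / (real CARD('n) + 2 * real m)"
    by (simp add: pcon_qcon(2) mult.commute)
  ultimately show ?thesis
    by (simp add: emb_def Tminus_eq[OF assms] clsym_scaleR Dj_def prW_Suc(1))
qed

lemma twisted_dirac_emb_clmul:
  assumes "\<phi> \<in> Gam M m" "x \<in> patch M i"
  shows "twisted_dirac M (emb m \<phi>) i x = (\<lambda>I. qcon m *\<^sub>R clmul cl (\<lambda>k. clsym cl (nab \<phi> i x k)) I)"
proof -
  note s = sectionsD[OF assms(1)[unfolded Gam_def]]
  have "smc i (\<lambda>x. clsym cl (\<phi> i x)) (patch M i)"
    by (rule smc_clsym[OF ok_patch s(3)])
  then have "nabla M (emb m \<phi>) i x J = qcon m *\<^sub>R nabla M (\<lambda>i x. clsym cl (\<phi> i x)) i x J" for J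
    unfolding emb_def by (rule nab_rscale[where \<psi>="\<lambda>i x. clsym cl (\<phi> i x)" and i=i])
  then have "nab (emb m \<phi>) i x k = (\<lambda>I. qcon m *\<^sub>R clsym cl (nab \<phi> i x k) I)" for k
    using nab_clsym[where \<psi>=\<phi> and i=i, OF s(3) assms(2), of k] by (simp add: slot_def[of k "nabla M (emb m \<phi>) i x"]
        slot_def[of k "nabla M (\<lambda>i x. clsym cl (\<phi> i x)) i x"] fun_eq_iff)
  then show ?thesis
    by (simp add: twisted_dirac_clmul clmul_def matvec scaleR_sum_right)
qed

text \<open>\<open>cliff_clmul_clsym\<close> gives \<open>n + 2 m - 2\<close> times the twisted
  Dirac operator of degree \<open>m\<close> minus twice the symmetrised divergence. The latter is
  exactly the part in the lower summand, so \<open>D_m\<close> remains.\<close>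

lemma cliff_twisted_dirac_emb:
  assumes "\<phi> \<in> Gam M m"
  shows "cliff cl (twisted_dirac M (emb m \<phi>) i x) I = (qcon m * (real CARD('n) + 2 * real m - 2)) *\<^sub>R Dj M m \<phi> i x I"
proof (cases "x \<in> patch M i")
  case True
  note s = sectionsD[OF assms[unfolded Gam_def]]
  have n: "nab \<phi> i x k \<in> Wfib cl m" for k
    by (rule nab_Wfib[where \<psi>=\<phi> and i=i, OF s(3) s(2) True])
  have "cliff cl (twisted_dirac M (emb m \<phi>) i x) I
    = qcon m *\<^sub>R ((real CARD('n) + 2 * real m - 2) *\<^sub>R twisted_dirac M \<phi> i x I - 2 *\<^sub>R clsym cl (dvg (nab \<phi> i x)) I)"
    unfolding twisted_dirac_emb_clmul[OF assms True] cliff_scaleR cliff_clmul_clsym[OF n] unfolding twisted_dirac_clmul ..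
  also have "(real CARD('n) + 2 * real m - 2) *\<^sub>R twisted_dirac M \<phi> i x I - 2 *\<^sub>R clsym cl (dvg (nab \<phi> i x)) I
    = (real CARD('n) + 2 * real m - 2) *\<^sub>R Dj M m \<phi> i x I"
  proof (cases m)
    case 0
    \<comment> \<open>In degree \<open>0\<close> there is no index to contract and no lower
      summand.\<close>
    have "dvg (nab \<phi> i x) = (\<lambda>I. 0)"
      using WfibD(3)[OF n] by (simp add: dvg_def tensors_def 0 fun_eq_iff)
    then show ?thesis
      using assms by (simp add: 0 twisted_dirac_Zero clsym_0)
  next
    case (Suc m')
    let ?D = "real CARD('n) + 2 * real m'"
    have D: "?D > 0" by (rule dm_pos)
    have "Tminus M m \<phi> i x = (\<lambda>I. (- (2 * pcon m')) *\<^sub>R dvg (nab \<phi> i x) I)"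
      using Tminus_dvg[OF assms[unfolded Suc]] unfolding Suc by blast
    then have "emb m' (Tminus M m \<phi>) i x I = (- 2 * (pcon m' * qcon m')) *\<^sub>R clsym cl (dvg (nab \<phi> i x)) I"
      by (simp only: emb_def clsym_scaleR scaleR_scaleR) (simp add: mult_ac)
    \<comment> \<open>As \<open>m = m' + 1\<close>, the denominator in \<open>pcon_qcon(2)\<close>
      is the factor \<open>n + 2 m - 2\<close>, which is why the two divergence terms match.\<close>
    moreover have "?D * (- 2 * (pcon m' * qcon m')) = 2"
      using D unfolding pcon_qcon(2) by (simp add: field_simps)
    ultimately have "?D *\<^sub>R emb m' (Tminus M m \<phi>) i x I = 2 *\<^sub>R clsym cl (dvg (nab \<phi> i x)) I"
      by (simp only: scaleR_scaleR)
    moreover have "real CARD('n) + 2 * real m - 2 = ?D"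
      by (simp add: Suc)
    moreover have "twisted_dirac M \<phi> i x I = Dj M m \<phi> i x I + emb m' (Tminus M m \<phi>) i x I"
      unfolding Suc by (rule twisted_dirac_Suc) (use assms in \<open>simp add: Suc\<close>)
    ultimately show ?thesis
      by (simp only: scaleR_add_right) simp
  qed
  finally show ?thesis by simp
next
  case False
  have "Dj M m \<phi> i x I = 0"
    using sectionsD(1)[OF Dj_Gam[OF assms, unfolded Gam_def] False] by simp
  then show ?thesis
    using False by (simp add: twisted_dirac_outside cliff_0)
qed

text \<open>Undoing the correction in \<open>prW_Suc\<close> recovers the component in the
  complement from the contraction and exhibits the right column of the block matrix.\<close>

lemma twisted_dirac_emb:
  assumes "\<phi> \<in> Gam M m"
  shows "twisted_dirac M (emb m \<phi>) i x I = Tplus M m \<phi> i x I + emb m (\<lambda>i x I. (- kap m) *\<^sub>R Dj M m \<phi> i x I) i x I"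
proof -
  have "twisted_dirac M (emb m \<phi>) i x \<in> sym0 (Suc m)"
    by (rule sym0_in[OF twisted_dirac_sections[OF emb_sections[OF assms]]])
  moreover have "cliff cl (twisted_dirac M (emb m \<phi>) i x) = (\<lambda>I. (qcon m * (real CARD('n) + 2 * real m - 2)) *\<^sub>R Dj M m \<phi> i x I)"
    using cliff_twisted_dirac_emb[OF assms] by blast
  ultimately have "Tplus M m \<phi> i x I = twisted_dirac M (emb m \<phi>) i x I
      + (1 / (real CARD('n) + 2 * real m)) *\<^sub>R (qcon m * (real CARD('n) + 2 * real m - 2)) *\<^sub>R clsym cl (Dj M m \<phi> i x) I"
    by (simp only: Tplus_eq[OF assms] prW_Suc(1) clsym_scaleR)
  moreover have "emb m (\<lambda>i x I. (- kap m) *\<^sub>R Dj M m \<phi> i x I) i x I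
      = - ((1 / (real CARD('n) + 2 * real m)) *\<^sub>R (qcon m * (real CARD('n) + 2 * real m - 2)) *\<^sub>R clsym cl (Dj M m \<phi> i x) I)"
    by (simp only: emb_def clsym_scaleR scaleR_scaleR flip: scaleR_minus_left) simp
  ultimately show ?thesis by simp
qed

lemma twisted_dirac_lincomb:
  assumes "\<And>i. smc i (\<psi> i) (patch M i)" "\<And>i. smc i (\<phi> i) (patch M i)" "\<And>i. smc i (\<xi> i) (patch M i)"
  shows "twisted_dirac M (\<lambda>i x I. \<psi> i x I + s *\<^sub>R \<phi> i x I + r *\<^sub>R \<xi> i x I) i x I
    = twisted_dirac M \<psi> i x I + s *\<^sub>R twisted_dirac M \<phi> i x I + r *\<^sub>R twisted_dirac M \<xi> i x I"
proof -
  note sc = smc_rscale[OF ok_patch]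
  have "nabla M (\<lambda>i x I. \<psi> i x I + s *\<^sub>R \<phi> i x I + r *\<^sub>R \<xi> i x I) i x J
      = nabla M \<psi> i x J + s *\<^sub>R nabla M \<phi> i x J + r *\<^sub>R nabla M \<xi> i x J" for J
    using nab_add[where \<psi>="\<lambda>i x I. \<psi> i x I + s *\<^sub>R \<phi> i x I" and \<phi>="\<lambda>i x I. r *\<^sub>R \<xi> i x I" and i=i,
        OF smc_add[OF ok_patch assms(1) sc[OF assms(2)]] sc[OF assms(3)]]
      nab_add[where \<psi>=\<psi> and \<phi>="\<lambda>i x I. s *\<^sub>R \<phi> i x I" and i=i, OF assms(1) sc[OF assms(2)]]
      nab_rscale[where \<psi>=\<phi> and i=i, OF assms(2)] nab_rscale[where \<psi>=\<xi> and i=i, OF assms(3)]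
    by simp
  then have "nabla M (\<lambda>i x I. \<psi> i x I + s *\<^sub>R \<phi> i x I + r *\<^sub>R \<xi> i x I) i x
      = (\<lambda>J. nabla M \<psi> i x J + s *\<^sub>R nabla M \<phi> i x J + r *\<^sub>R nabla M \<xi> i x J)"
    by blast
  then show ?thesis
    by (simp only: twisted_dirac_eq cliff_add cliff_scaleR)
qed

lemma smc_Gam: "\<psi> \<in> Gam M j \<Longrightarrow> smc i (\<psi> i) (patch M i)"
  unfolding Gam_def by (rule sectionsD(3))

lemma Dj_lincomb:
  assumes "\<psi> \<in> Gam M j" "\<phi> \<in> Gam M j" "\<xi> \<in> Gam M j"
  shows "Dj M j (\<lambda>i x I. \<psi> i x I + s *\<^sub>R \<phi> i x I + r *\<^sub>R \<xi> i x I) i x I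
    = Dj M j \<psi> i x I + s *\<^sub>R Dj M j \<phi> i x I + r *\<^sub>R Dj M j \<xi> i x I"
proof -
  note s = sym0_in[OF twisted_dirac_sections[OF Gam_sym0]]
  have "twisted_dirac M (\<lambda>i x I. \<psi> i x I + s *\<^sub>R \<phi> i x I + r *\<^sub>R \<xi> i x I) i x
    = (\<lambda>I. twisted_dirac M \<psi> i x I + s *\<^sub>R twisted_dirac M \<phi> i x I + r *\<^sub>R twisted_dirac M \<xi> i x I)"
    by (rule ext, rule twisted_dirac_lincomb) (intro smc_Gam[OF assms(1)] smc_Gam[OF assms(2)] smc_Gam[OF assms(3)])+
  then show ?thesis
    by (simp only: Dj_def prW_lincomb[OF s[OF assms(1)] s[OF assms(2)] s[OF assms(3)]])
qed

lemma Tminus_lincomb: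
  assumes "\<psi> \<in> Gam M (Suc m)" "\<phi> \<in> Gam M (Suc m)" "\<xi> \<in> Gam M (Suc m)"
  shows "Tminus M (Suc m) (\<lambda>i x I. \<psi> i x I + s *\<^sub>R \<phi> i x I + r *\<^sub>R \<xi> i x I) i x I
    = Tminus M (Suc m) \<psi> i x I + s *\<^sub>R Tminus M (Suc m) \<phi> i x I + r *\<^sub>R Tminus M (Suc m) \<xi> i x I"
proof -
  have "twisted_dirac M (\<lambda>i x I. \<psi> i x I + s *\<^sub>R \<phi> i x I + r *\<^sub>R \<xi> i x I) i x
    = (\<lambda>I. twisted_dirac M \<psi> i x I + s *\<^sub>R twisted_dirac M \<phi> i x I + r *\<^sub>R twisted_dirac M \<xi> i x I)"
    by (rule ext, rule twisted_dirac_lincomb) (intro smc_Gam[OF assms(1)] smc_Gam[OF assms(2)] smc_Gam[OF assms(3)])+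
  then show ?thesis
    by (simp only: Tminus_eq[OF assms(1)] Tminus_eq[OF assms(2)] Tminus_eq[OF assms(3)]
        Tminus_eq[OF Gam_lincomb[OF assms]] cliff_add cliff_scaleR scaleR_add_right scaleR_scaleR mult.commute)
qed

lemma Tplus_lincomb:
  assumes "\<psi> \<in> Gam M m" "\<phi> \<in> Gam M m" "\<xi> \<in> Gam M m"
  shows "Tplus M m (\<lambda>i x I. \<psi> i x I + s *\<^sub>R \<phi> i x I + r *\<^sub>R \<xi> i x I) i x I
    = Tplus M m \<psi> i x I + s *\<^sub>R Tplus M m \<phi> i x I + r *\<^sub>R Tplus M m \<xi> i x I"
proof -
  note s = sym0_in[OF twisted_dirac_sections[OF emb_sections]]
  have "emb m (\<lambda>i x I. \<psi> i x I + s *\<^sub>R \<phi> i x I + r *\<^sub>R \<xi> i x I)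
    = (\<lambda>i x I. emb m \<psi> i x I + s *\<^sub>R emb m \<phi> i x I + r *\<^sub>R emb m \<xi> i x I)"
    by (simp only: emb_def clsym_add clsym_scaleR scaleR_add_right scaleR_scaleR mult.commute)
  moreover have "twisted_dirac M (\<lambda>i x I. emb m \<psi> i x I + s *\<^sub>R emb m \<phi> i x I + r *\<^sub>R emb m \<xi> i x I) i x
    = (\<lambda>I. twisted_dirac M (emb m \<psi>) i x I + s *\<^sub>R twisted_dirac M (emb m \<phi>) i x I + r *\<^sub>R twisted_dirac M (emb m \<xi>) i x I)"
    by (rule ext, rule twisted_dirac_lincomb) (intro sectionsD(3)[OF emb_sections] assms)+
  ultimately show ?thesis
    by (simp only: Tplus_eq[OF assms(1)] Tplus_eq[OF assms(2)] Tplus_eq[OF assms(3)] Tplus_eq[OF Gam_lincomb[OF assms]]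
        prW_lincomb[OF s[OF assms(1)] s[OF assms(2)] s[OF assms(3)]])
qed

text \<open>Makes homogeneity of the operators an instance of their three-term linearity.\<close>

lemma lincomb_rscale:
  fixes \<psi> :: "('i, 'm, 'n, 's) field"
  shows "(\<lambda>i x I. r *\<^sub>R \<psi> i x I) = (\<lambda>i x I. \<psi> i x I + (r - 1) *\<^sub>R \<psi> i x I + 0 *\<^sub>R \<psi> i x I)"
  by (simp add: fun_eq_iff algebra_simps)

lemma Dj_rscale: "\<psi> \<in> Gam M j \<Longrightarrow> Dj M j (\<lambda>i x I. r *\<^sub>R \<psi> i x I) i x I = r *\<^sub>R Dj M j \<psi> i x I"
  unfolding lincomb_rscale Dj_lincomb by (simp add: scaleR_left_diff_distrib)

lemma Tplus_rscale: "\<psi> \<in> Gam M m \<Longrightarrow> Tplus M m (\<lambda>i x I. r *\<^sub>R \<psi> i x I) i x I = r *\<^sub>R Tplus M m \<psi> i x I"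
  unfolding lincomb_rscale Tplus_lincomb by (simp add: scaleR_left_diff_distrib)

end

locale cc3_mfd = cc_mfd M c + spin3_mfd M
  for M :: "('i, 'm::{t2_space, second_countable_topology}, 'n::finite, 's::finite) spin_manifold" and c :: real
begin

lemma dirac_square:
  assumes "\<psi> \<in> Gam M j"
  shows "twisted_dirac M (twisted_dirac M \<psi>) i x I
    = bochner \<psi> i x I + (c * (real CARD('n) * (real CARD('n) - 1) / 4 + real j)) *\<^sub>R \<psi> i x I"
proof (cases "x \<in> patch M i")
  case True
  have "cliff cl (\<psi> i x) = (\<lambda>I. 0)"
    using Gam_in[OF assms] by (simp add: Wfib_def)
  then show ?thesis
    using lichnerowicz[where \<psi>=\<psi> and i=i, OF smc_Gam[OF assms] sym0_in[OF Gam_sym0[OF assms]] True, of I]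
    by (simp add: clsym_0)
next
  case False
  then show ?thesis
    using sectionsD(1)[OF assms[unfolded Gam_def] False] by (simp add: twisted_dirac_outside bochner_def ndiv_outside)
qed

text \<open>By \<open>dirac_square\<close> the result differs from a twice iterated Dirac operator
  by a multiple of \<open>\<psi>\<close>, hence is symmetric and trace-free; \<open>cliff\<close> is
  parallel and passes through, so its kernel is preserved.\<close>

lemma bochner_Gam:
  assumes "\<psi> \<in> Gam M j"
  shows "bochner \<psi> \<in> Gam M j"
proof -
  let ?C = "c * (real CARD('n) * (real CARD('n) - 1) / 4 + real j)"
  have "bochner \<psi> = (\<lambda>i x I. twisted_dirac M (twisted_dirac M \<psi>) i x I + (- ?C) *\<^sub>R \<psi> i x I)"
    by (intro ext) (simp add: dirac_square[OF assms])
  moreover have "(\<lambda>i x I. twisted_dirac M (twisted_dirac M \<psi>) i x I + (- ?C) *\<^sub>R \<psi> i x I) \<in> sections M (sym0 j)"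
    by (intro sections_add sections_rscale twisted_dirac_sections Gam_sym0 assms sym0_add sym0_scaleR)
  ultimately have s: "bochner \<psi> \<in> sections M (sym0 j)"
    by simp
  have "bochner \<psi> i x \<in> Wfib cl j" for i x
  proof (rule WfibI)
    show "bochner \<psi> i x \<in> sym0 j"
      by (rule sym0_in[OF s])
    fix I
    show "cliff cl (bochner \<psi> i x) I = 0"
    proof (cases "x \<in> patch M i")
      case True
      have "nabla M (\<lambda>i x. cliff cl (\<psi> i x)) i y = (\<lambda>I. 0)" for y
        by (rule nabla_zero) (use Gam_in[OF assms] in \<open>simp add: Wfib_def\<close>)
      then have "nabla M (nabla M (\<lambda>i x. cliff cl (\<psi> i x))) i x = (\<lambda>I. 0)"
        by (rule nabla_zero)
      then have "bochner (\<lambda>i x. cliff cl (\<psi> i x)) i x I = 0"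
        by (simp add: bochner_def ndiv_eq)
      then show ?thesis
        by (simp add: bochner_cliff[where \<psi>=\<psi> and i=i, OF smc_Gam[OF assms] True])
    next
      case False
      then show ?thesis
        using sectionsD(1)[OF s False] by (simp add: cliff_0)
    qed
  qed
  then show ?thesis
    unfolding Gam_def by (intro sectionsI sectionsD(1,3)[OF s] fun_cong[OF sectionsD(4)[OF s]])
qed

text \<open>Both systems of relations come from decomposing \<open>D(j)\<^sup>2\<close>, which by the Lichnerowicz formula
  preserves \<open>S\<^sub>j\<close> and its complement.\<close>

lemma dirac_blocks:
  assumes "\<psi> \<in> Gam M (Suc m)"
  shows "Dj M (Suc m) (Dj M (Suc m) \<psi>) i x I + Tplus M m (Tminus M (Suc m) \<psi>) i x I
      = bochner \<psi> i x I + (c * (real CARD('n) * (real CARD('n) - 1) / 4 + real (Suc m))) *\<^sub>R \<psi> i x I" (is ?A)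
    and "Tminus M (Suc m) (Dj M (Suc m) \<psi>) i x I = kap m *\<^sub>R Dj M m (Tminus M (Suc m) \<psi>) i x I" (is ?B)
proof -
  let ?D = "Dj M (Suc m)" let ?T = "Tminus M (Suc m)" let ?C = "c * (real CARD('n) * (real CARD('n) - 1) / 4 + real (Suc m))"
  note D = Dj_Gam[OF assms] and T = Tminus_Gam[OF assms]
  let ?w = "\<lambda>I. ?D (?D \<psi>) i x I + Tplus M m (?T \<psi>) i x I"
  let ?v = "\<lambda>I. ?T (?D \<psi>) i x I + (- kap m) *\<^sub>R Dj M m (?T \<psi>) i x I"
  have "twisted_dirac M \<psi> = (\<lambda>i x I. ?D \<psi> i x I + 1 *\<^sub>R emb m (?T \<psi>) i x I + 0 *\<^sub>R emb m (?T \<psi>) i x I)"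
    by (intro ext) (simp add: twisted_dirac_Suc[OF assms])
  then have "twisted_dirac M (twisted_dirac M \<psi>) i x I
      = twisted_dirac M (?D \<psi>) i x I + 1 *\<^sub>R twisted_dirac M (emb m (?T \<psi>)) i x I + 0 *\<^sub>R twisted_dirac M (emb m (?T \<psi>)) i x I" for I
    by (simp only: twisted_dirac_lincomb[OF smc_Gam[OF D] sectionsD(3)[OF emb_sections[OF T]] sectionsD(3)[OF emb_sections[OF T]]])
  then have e: "twisted_dirac M (twisted_dirac M \<psi>) i x I = ?w I + qcon m *\<^sub>R clsym cl ?v I" for I
    unfolding twisted_dirac_Suc[OF D] twisted_dirac_emb[OF T]
    by (simp only: emb_def clsym_add clsym_scaleR scaleR_add_right) simp
  have w: "?w \<in> Wfib cl (Suc m)"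
    by (intro Wfib_add Gam_in[OF Dj_Gam[OF D]] Gam_in[OF Tplus_Gam[OF T]])
  have v: "?v \<in> Wfib cl m"
    by (intro Wfib_add Wfib_scaleR Gam_in[OF Tminus_Gam[OF D]] Gam_in[OF Dj_Gam[OF T]])
  have w': "(\<lambda>I. bochner \<psi> i x I + ?C *\<^sub>R \<psi> i x I) \<in> Wfib cl (Suc m)"
    by (intro Wfib_add Wfib_scaleR Gam_in[OF bochner_Gam[OF assms]] Gam_in[OF assms])
  \<comment> \<open>One decomposition comes from the blocks, the other from
    \<open>dirac_square\<close>, which has no part in the complement.\<close>
  have "?w I + clsym cl (\<lambda>I. qcon m *\<^sub>R ?v I) I = (bochner \<psi> i x I + ?C *\<^sub>R \<psi> i x I) + clsym cl (\<lambda>I. 0) I" for I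
    unfolding clsym_scaleR e[symmetric] dirac_square[OF assms] by (simp add: clsym_0)
  note u = Wdecomp_unique[OF w Wfib_scaleR[OF v] w' Wfib_0 this]
  show ?A using fun_cong[OF u(1), of I] .
  show ?B using fun_cong[OF u(2), of I] pcon_qcon(3)[of m] by simp
qed

lemma dirac_blocks_emb:
  assumes "\<phi> \<in> Gam M m"
  shows "Tminus M (Suc m) (Tplus M m \<phi>) i x I + (kap m)\<^sup>2 *\<^sub>R Dj M m (Dj M m \<phi>) i x I
      = bochner \<phi> i x I + (c * (real CARD('n) * (real CARD('n) - 1) / 4 + 1 - real CARD('n) - real m)) *\<^sub>R \<phi> i x I" (is ?A)
    and "Dj M (Suc m) (Tplus M m \<phi>) i x I = kap m *\<^sub>R Tplus M m (Dj M m \<phi>) i x I" (is ?B)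
proof -
  let ?D = "Dj M m" let ?T = "Tplus M m"
  let ?C = "c * (real CARD('n) * (real CARD('n) - 1) / 4 + 1 - real CARD('n) - real m)"
  let ?K = "c * (real CARD('n) * (real CARD('n) - 1) / 4 + real (Suc m))"
  note D = Dj_Gam[OF assms] and T = Tplus_Gam[OF assms]
  let ?w = "\<lambda>I. Dj M (Suc m) (?T \<phi>) i x I + (- kap m) *\<^sub>R ?T (?D \<phi>) i x I"
  let ?v = "\<lambda>I. Tminus M (Suc m) (?T \<phi>) i x I + (kap m)\<^sup>2 *\<^sub>R ?D (?D \<phi>) i x I"
  have "twisted_dirac M (emb m \<phi>) = (\<lambda>i x I. ?T \<phi> i x I + (- kap m) *\<^sub>R emb m (?D \<phi>) i x I + 0 *\<^sub>R emb m (?D \<phi>) i x I)"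
    by (intro ext, subst twisted_dirac_emb[OF assms]) (simp add: emb_def clsym_scaleR mult.commute del: scaleR_minus_left)
  then have "twisted_dirac M (twisted_dirac M (emb m \<phi>)) i x I
      = twisted_dirac M (?T \<phi>) i x I + (- kap m) *\<^sub>R twisted_dirac M (emb m (?D \<phi>)) i x I + 0 *\<^sub>R twisted_dirac M (emb m (?D \<phi>)) i x I" for I
    by (simp only: twisted_dirac_lincomb[OF smc_Gam[OF T] sectionsD(3)[OF emb_sections[OF D]] sectionsD(3)[OF emb_sections[OF D]]])
  then have e: "twisted_dirac M (twisted_dirac M (emb m \<phi>)) i x I = ?w I + qcon m *\<^sub>R clsym cl ?v I" for I
    unfolding twisted_dirac_Suc[OF T] twisted_dirac_emb[OF D]
    by (simp only: emb_def clsym_add clsym_scaleR scaleR_add_right) (simp add: power2_eq_square mult_ac)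
  \<comment> \<open>On the image of \<open>emb\<close>, \<open>clsym\<close> after
    \<open>cliff\<close> is the scalar \<open>-(n + 2 m)\<close>; this turns the constant
    \<open>?K\<close> of degree \<open>m + 1\<close> into \<open>?C\<close>.\<close>
  have e': "twisted_dirac M (twisted_dirac M (emb m \<phi>)) i x I = qcon m *\<^sub>R clsym cl (\<lambda>I. bochner \<phi> i x I + ?C *\<^sub>R \<phi> i x I) I" for I
  proof (cases "x \<in> patch M i")
    case True
    have s: "smc i (\<lambda>x. clsym cl (\<phi> i x)) (patch M i)" for i
      by (rule smc_clsym[OF ok_patch smc_Gam[OF assms]])
    have n: "nabla M (emb m \<phi>) = (\<lambda>i x J. qcon m *\<^sub>R nabla M (\<lambda>i x. clsym cl (\<phi> i x)) i x J)"
      unfolding emb_def by (intro ext nab_rscale[where \<psi>="\<lambda>i x. clsym cl (\<phi> i x)"] s)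
    have "nabla M (\<lambda>i x J. qcon m *\<^sub>R nabla M (\<lambda>i x. clsym cl (\<phi> i x)) i x J) i x J
        = qcon m *\<^sub>R nabla M (nabla M (\<lambda>i x. clsym cl (\<phi> i x))) i x J" for J
      by (rule nab_rscale[where \<psi>="nabla M (\<lambda>i x. clsym cl (\<phi> i x))" and i=i], rule smc_nabla[where \<psi>="\<lambda>i x. clsym cl (\<phi> i x)" and i=i], rule s)
    then have b: "bochner (emb m \<phi>) i x I = qcon m *\<^sub>R clsym cl (bochner \<phi> i x) I"
    proof -
      have "bochner (emb m \<phi>) i x I = qcon m *\<^sub>R bochner (\<lambda>i x. clsym cl (\<phi> i x)) i x I"
        using \<open>\<And>J. nabla M _ i x J = _\<close> by (simp add: bochner_def ndiv_eq n scaleR_sum_right)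
      then show ?thesis
        by (simp only: bochner_clsym[where \<psi>=\<phi> and i=i, OF smc_Gam[OF assms] True, of I])
    qed
    have "cliff cl (emb m \<phi> i x) = (\<lambda>I. (- (qcon m * (real CARD('n) + 2 * real m))) *\<^sub>R \<phi> i x I)"
      by (simp add: emb_def cliff_scaleR cliff_clsym_dm[OF Gam_in[OF assms]] fun_eq_iff)
    then have "clsym cl (cliff cl (emb m \<phi> i x)) I = (- (qcon m * (real CARD('n) + 2 * real m))) *\<^sub>R clsym cl (\<phi> i x) I"
      by (simp only: clsym_scaleR)
    then have "twisted_dirac M (twisted_dirac M (emb m \<phi>)) i x I = qcon m *\<^sub>R clsym cl (bochner \<phi> i x) I
      + ?K *\<^sub>R qcon m *\<^sub>R clsym cl (\<phi> i x) I + c *\<^sub>R (- (qcon m * (real CARD('n) + 2 * real m))) *\<^sub>R clsym cl (\<phi> i x) I"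
      using lichnerowicz[where \<psi>="emb m \<phi>" and i=i, OF sectionsD(3)[OF emb_sections[OF assms]] sym0_in[OF emb_sections[OF assms]] True, of I]
      by (simp only: b) (simp only: emb_def)
    also have "\<dots> = qcon m *\<^sub>R (clsym cl (bochner \<phi> i x) I + ?C *\<^sub>R clsym cl (\<phi> i x) I)"
      unfolding scaleR_add_right scaleR_scaleR add.assoc
      unfolding scaleR_left_distrib[symmetric] by (rule arg_cong[where f="\<lambda>r. _ + r *\<^sub>R _"]) (simp add: field_simps)
    finally show ?thesis
      by (simp only: clsym_add clsym_scaleR)
  next
    case False
    have "bochner \<phi> i x = (\<lambda>I. 0)" "\<phi> i x = (\<lambda>I. 0)"
      using sectionsD(1)[OF assms[unfolded Gam_def] False] False by (simp_all add: bochner_def ndiv_outside)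
    then show ?thesis
      using False by (simp add: twisted_dirac_outside clsym_0)
  qed
  have w: "?w \<in> Wfib cl (Suc m)"
    by (intro Wfib_add Wfib_scaleR Gam_in[OF Dj_Gam[OF T]] Gam_in[OF Tplus_Gam[OF D]])
  have v: "?v \<in> Wfib cl m"
    by (intro Wfib_add Wfib_scaleR Gam_in[OF Tminus_Gam[OF T]] Gam_in[OF Dj_Gam[OF D]])
  have v': "(\<lambda>I. bochner \<phi> i x I + ?C *\<^sub>R \<phi> i x I) \<in> Wfib cl m"
    by (intro Wfib_add Wfib_scaleR Gam_in[OF bochner_Gam[OF assms]] Gam_in[OF assms])
  have "?w I + clsym cl (\<lambda>I. qcon m *\<^sub>R ?v I) I = 0 + clsym cl (\<lambda>I. qcon m *\<^sub>R (bochner \<phi> i x I + ?C *\<^sub>R \<phi> i x I)) I" for I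
    unfolding clsym_scaleR e[symmetric] e' by simp
  note u = Wdecomp_unique[OF w Wfib_scaleR[OF v] Wfib_0 Wfib_scaleR[OF v'] this]
  show ?A using fun_cong[OF u(2), of I] pcon_qcon(3)[of m] by (simp only: scaleR_cancel_left) simp
  show ?B using fun_cong[OF u(1), of I] by simp
qed

text \<open>\<open>Lap j\<close> is the standard Laplacian on \<open>S\<^sub>j\<close>, see \<open>std_laplacian_eq\<close>.\<close>

definition Lap :: "nat \<Rightarrow> ('i, 'm, 'n, 's) field \<Rightarrow> ('i, 'm, 'n, 's) field" where
  "Lap j \<psi> = (\<lambda>i x I. bochner \<psi> i x I
     + ((real j * (real CARD('n) + real j - 1) + real CARD('n) * (real CARD('n) - 1) / 8) * c) *\<^sub>R \<psi> i x I)"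

text \<open>The constant accompanying \<open>D_j\<close> and \<open>T_j^-\<close>; at
  \<open>j + 1\<close> it is also the constant accompanying \<open>T_j^+\<close>, both formulas
  coming from squares of twisted Dirac operators.\<close>

definition lapc :: "nat \<Rightarrow> real" where
  "lapc j = (real j * (real CARD('n) + real j - 2) - real CARD('n) * (real CARD('n) - 1) / 8) * c"

lemma Lap_Zero: "\<psi> \<in> Gam M 0 \<Longrightarrow> Lap 0 \<psi> i x I = Dj M 0 (Dj M 0 \<psi>) i x I + lapc 0 *\<^sub>R \<psi> i x I"
proof -
  assume a: "\<psi> \<in> Gam M 0"
  have e: "Dj M 0 (Dj M 0 \<psi>) i x I = bochner \<psi> i x I + (c * (real CARD('n) * (real CARD('n) - 1) / 4 + real 0)) *\<^sub>R \<psi> i x I"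
    unfolding dirac_square[OF a, symmetric] by (simp only: twisted_dirac_Zero[OF a] twisted_dirac_Zero[OF Dj_Gam[OF a]])
  show ?thesis
    unfolding e Lap_def lapc_def add.assoc scaleR_left_distrib[symmetric]
    by (rule arg_cong[where f="\<lambda>r. _ + r *\<^sub>R _"]) (simp add: field_simps)
qed

text \<open>Subtracting \<open>n (n - 1) / 4 + j\<close> from the Casimir constant leaves the
  constant in \<open>lapc j\<close>, here for \<open>j = m + 1\<close>.\<close>

lemma Lap_Suc:
  assumes "\<psi> \<in> Gam M (Suc m)"
  shows "Lap (Suc m) \<psi> i x I = Dj M (Suc m) (Dj M (Suc m) \<psi>) i x I
    + 1 *\<^sub>R Tplus M m (Tminus M (Suc m) \<psi>) i x I + lapc (Suc m) *\<^sub>R \<psi> i x I"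
  unfolding scaleR_one dirac_blocks(1)[OF assms] Lap_def lapc_def add.assoc scaleR_left_distrib[symmetric]
  by (rule arg_cong[where f="\<lambda>r. _ + r *\<^sub>R _"]) (simp add: field_simps)

text \<open>The Laplacian of degree \<open>m\<close>, read off from the lower block of the squared
  Dirac operator of degree \<open>m + 1\<close>.\<close>

lemma Lap_up:
  assumes "\<phi> \<in> Gam M m"
  shows "Lap m \<phi> i x I = Tminus M (Suc m) (Tplus M m \<phi>) i x I
    + (kap m)\<^sup>2 *\<^sub>R Dj M m (Dj M m \<phi>) i x I + lapc (Suc m) *\<^sub>R \<phi> i x I"
  unfolding dirac_blocks_emb(1)[OF assms] Lap_def lapc_def add.assoc scaleR_left_distrib[symmetric]
  by (rule arg_cong[where f="\<lambda>r. _ + r *\<^sub>R _"]) (simp add: field_simps)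

text \<open>Moving \<open>D\<close> past \<open>T^+\<close> on one side and past \<open>T^-\<close>
  on the other produces the same factor \<open>kap\<close>, so both sides contain the same multiple
  of \<open>T^+ D T^-\<close>.\<close>

lemma Dj_Lap:
  assumes "\<psi> \<in> Gam M j"
  shows "Dj M j (Lap j \<psi>) = Lap j (Dj M j \<psi>)"
proof (intro ext)
  fix i x I
  show "Dj M j (Lap j \<psi>) i x I = Lap j (Dj M j \<psi>) i x I"
  proof (cases j)
    case 0
    note a = assms[unfolded 0]
    have "Lap 0 \<psi> = (\<lambda>i x I. Dj M 0 (Dj M 0 \<psi>) i x I + 0 *\<^sub>R \<psi> i x I + lapc 0 *\<^sub>R \<psi> i x I)"
      by (intro ext) (simp add: Lap_Zero[OF a])
    then show ?thesis
      unfolding 0 by (simp only: Dj_lincomb[OF Dj_Gam[OF Dj_Gam[OF a]] a a] Lap_Zero[OF Dj_Gam[OF a]]) simp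
  next
    case (Suc m)
    note a = assms[unfolded Suc]
    note D = Dj_Gam[OF a] and T = Tminus_Gam[OF a]
    have "Lap (Suc m) \<psi> = (\<lambda>i x I. Dj M (Suc m) (Dj M (Suc m) \<psi>) i x I
        + 1 *\<^sub>R Tplus M m (Tminus M (Suc m) \<psi>) i x I + lapc (Suc m) *\<^sub>R \<psi> i x I)"
      by (intro ext Lap_Suc[OF a])
    moreover have "Tminus M (Suc m) (Dj M (Suc m) \<psi>) = (\<lambda>i x I. kap m *\<^sub>R Dj M m (Tminus M (Suc m) \<psi>) i x I)"
      by (intro ext dirac_blocks(2)[OF a])
    ultimately show ?thesis
      unfolding Suc by (simp only: Dj_lincomb[OF Dj_Gam[OF D] Tplus_Gam[OF T] a] Lap_Suc[OF D]
          dirac_blocks_emb(2)[OF T] Tplus_rscale[OF Dj_Gam[OF T]])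
  qed
qed

text \<open>The source Laplacian is expanded by \<open>Lap_Suc\<close> and the target Laplacian by
  \<open>Lap_up\<close>. Moving \<open>T^-\<close> past the square of \<open>D\<close> gives exactly
  the squared \<open>kap\<close> of the latter, and the constants coincide.\<close>

lemma Tminus_Lap:
  assumes "\<psi> \<in> Gam M (Suc m)"
  shows "Tminus M (Suc m) (Lap (Suc m) \<psi>) = Lap m (Tminus M (Suc m) \<psi>)"
proof (intro ext)
  fix i x I
  note D = Dj_Gam[OF assms] and T = Tminus_Gam[OF assms]
  have "Lap (Suc m) \<psi> = (\<lambda>i x I. Dj M (Suc m) (Dj M (Suc m) \<psi>) i x I
      + 1 *\<^sub>R Tplus M m (Tminus M (Suc m) \<psi>) i x I + lapc (Suc m) *\<^sub>R \<psi> i x I)"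
    by (intro ext Lap_Suc[OF assms])
  moreover have "Tminus M (Suc m) (Dj M (Suc m) \<psi>) = (\<lambda>i x I. kap m *\<^sub>R Dj M m (Tminus M (Suc m) \<psi>) i x I)"
    by (intro ext dirac_blocks(2)[OF assms])
  ultimately show "Tminus M (Suc m) (Lap (Suc m) \<psi>) i x I = Lap m (Tminus M (Suc m) \<psi>) i x I"
    by (simp only: Tminus_lincomb[OF Dj_Gam[OF D] Tplus_Gam[OF T] assms] Lap_up[OF T]
        dirac_blocks(2)[OF D] Dj_rscale[OF Dj_Gam[OF T]]) (simp add: power2_eq_square)
qed

text \<open>As for \<open>Tminus_Lap\<close>, with the two expansions in exchanged roles.\<close>

lemma Tplus_Lap:
  assumes "\<phi> \<in> Gam M m"
  shows "Tplus M m (Lap m \<phi>) = Lap (Suc m) (Tplus M m \<phi>)"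
proof (intro ext)
  fix i x I
  note D = Dj_Gam[OF assms] and T = Tplus_Gam[OF assms]
  have "Lap m \<phi> = (\<lambda>i x I. Tminus M (Suc m) (Tplus M m \<phi>) i x I
    + (kap m)\<^sup>2 *\<^sub>R Dj M m (Dj M m \<phi>) i x I + lapc (Suc m) *\<^sub>R \<phi> i x I)"
    by (intro ext Lap_up[OF assms])
  moreover have "Dj M (Suc m) (Tplus M m \<phi>) = (\<lambda>i x I. kap m *\<^sub>R Tplus M m (Dj M m \<phi>) i x I)"
    by (intro ext dirac_blocks_emb(2)[OF assms])
  ultimately show "Tplus M m (Lap m \<phi>) i x I = Lap (Suc m) (Tplus M m \<phi>) i x I"
    by (simp only: Tplus_lincomb[OF Tminus_Gam[OF T] Dj_Gam[OF D] assms] Lap_Suc[OF T]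
        dirac_blocks_emb(2)[OF D] Dj_rscale[OF Tplus_Gam[OF D]]) (simp add: power2_eq_square)
qed

end

section \<open>Bump functions, the derivative of the determinant, integrals of derivatives\<close>

section \<open>Cutoff functions, determinants and integration over Euclidean space\<close>

lemma smooth_on_flat_exp_dist: "smooth_on (\<lambda>x. flat_exp 0 (s + t * ((x - a) \<bullet> (x - a)))) (UNIV :: 'a::euclidean_space set)"
proof -
  have d: "smooth_on (\<lambda>x :: 'a. x + - a) UNIV"
    by (intro smooth_on_add smooth_on_ident smooth_on_const) auto
  have "smooth_on (\<lambda>x :: 'a. s + t * ((x - a) \<bullet> (x - a))) UNIV"
    using smooth_on_bounded_bilinear[OF open_UNIV bounded_bilinear_inner d d]
    by (intro smooth_on_add smooth_on_const smooth_on_bounded_linear[OF _ bounded_linear_mult_right]) auto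
  then show ?thesis
    by (rule smooth_on_compose[OF open_UNIV open_UNIV UNIV_I smooth_on_flat_exp])
qed

text \<open>\<open>u\<close> is positive inside radius \<open>2 r\<close> and \<open>w\<close>
  outside radius \<open>r\<close>, so the denominator vanishes nowhere.\<close>

definition plateau :: "'a::euclidean_space \<Rightarrow> real \<Rightarrow> 'a \<Rightarrow> real" where
  "plateau a r x = (let u = flat_exp 0 ((2 * r)\<^sup>2 - (x - a) \<bullet> (x - a)); w = flat_exp 0 ((x - a) \<bullet> (x - a) - r\<^sup>2)
     in u / (u + w))"

lemma plateau:
  assumes "r > 0"
  shows "smooth_on (plateau a r) UNIV" "plateau a r x \<ge> 0" "dist a x < r \<Longrightarrow> plateau a r x = 1"
    "dist a x \<ge> 2 * r \<Longrightarrow> plateau a r x = 0"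
proof -
  let ?u = "\<lambda>x. flat_exp 0 ((2 * r)\<^sup>2 - (x - a) \<bullet> (x - a))" and ?w = "\<lambda>x. flat_exp 0 ((x - a) \<bullet> (x - a) - r\<^sup>2)"
  have e: "(x - a) \<bullet> (x - a) = (dist a x)\<^sup>2" for x
    by (simp add: dist_norm power2_norm_eq_inner inner_commute norm_minus_commute[of a])
  have nn: "?u x \<ge> 0" "?w x \<ge> 0" for x
    by (simp_all add: flat_exp_def)
  have pos: "?u x + ?w x > 0" for x
  proof (cases "dist a x < 2 * r")
    case True
    then have "?u x > 0"
      using assms power_strict_mono[of "dist a x" "2 * r" 2] by (simp add: e flat_exp_def)
    then show ?thesis using nn(2)[of x] by linarith
  next
    case False
    then have "r\<^sup>2 < (dist a x)\<^sup>2"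
      using assms by (intro power_strict_mono) auto
    then have "?w x > 0"
      by (simp add: e flat_exp_def)
    then show ?thesis using nn(1)[of x] by linarith
  qed
  have su: "smooth_on ?u UNIV" and sw: "smooth_on ?w UNIV"
    using smooth_on_flat_exp_dist[of "(2 * r)\<^sup>2" "- 1" a] smooth_on_flat_exp_dist[of "- (r\<^sup>2)" 1 a] by simp_all
  have "smooth_on (\<lambda>x. ?u x * inverse (?u x + ?w x)) UNIV"
    using pos by (intro smooth_on_bounded_bilinear[OF open_UNIV bounded_bilinear_mult] smooth_on_inverse smooth_on_add su sw)
      (auto simp: less_imp_neq[symmetric])
  then show "smooth_on (plateau a r) UNIV"
    by (simp add: plateau_def[abs_def] Let_def divide_inverse)
  show "plateau a r x \<ge> 0"
    unfolding plateau_def Let_def using nn by (intro divide_nonneg_nonneg add_nonneg_nonneg)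
  show "plateau a r x = 1" if "dist a x < r"
  proof -
    have "?w x = 0"
      using that power_mono[of "dist a x" r 2] by (simp add: e flat_exp_def)
    then show ?thesis
      using pos[of x] by (simp add: plateau_def Let_def)
  qed
  show "plateau a r x = 0" if "dist a x \<ge> 2 * r"
  proof -
    have "(2 * r)\<^sup>2 \<le> (dist a x)\<^sup>2"
      using that assms by (intro power_mono) auto
    then have "?u x = 0"
      unfolding e flat_exp_def by simp
    then show ?thesis
      by (simp add: plateau_def Let_def)
  qed
qed

text \<open>The derivative is a multiple of the reciprocal of \<open>sqrt\<close> itself, so
  induction on the order applies.\<close>

lemma smooth_on_sqrt: "smooth_on sqrt {0<..}"
proof -
  have d: "(sqrt has_derivative (\<lambda>v. v * (inverse 2 * inverse (sqrt x)))) (at x)" if "x > 0" for x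
  proof -
    have "(\<lambda>v. v * (inverse 2 * inverse (sqrt x))) = (*) (inverse (sqrt x) / 2)"
      by (simp add: fun_eq_iff)
    then show ?thesis
      using DERIV_real_sqrt[OF that] unfolding has_field_derivative_def by simp
  qed
  have "Ck_on k sqrt {0<..}" for k
  proof (induction k)
    case 0
    then show ?case by (simp add: continuous_on_real_sqrt)
  next
    case (Suc k)
    have "Ck_on k (\<lambda>x. v * (inverse 2 * inverse (sqrt x))) {0<..}" for v
      by (intro Ck_on_bounded_linear[OF _ bounded_linear_mult_right] Ck_on_inverse Suc) auto
    then have "Ck_on k (\<lambda>x. frechet_derivative sqrt (at x) v) {0<..}" for v
      by (subst Ck_on_cong[where g="\<lambda>x. v * (inverse 2 * inverse (sqrt x))"]) (auto simp: frechet_derivative_eq[OF d])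
    then show ?case
      using d by (auto simp: differentiable_on_eq_differentiable_at differentiable_def)
  qed
  then show ?thesis by (simp add: smooth_on_def)
qed

text \<open>Multiplication by the inverse \<open>B\<close> reduces Jacobi's formula to the identity
  matrix. There a permutation other than the identity moves at least two indices, so after one
  differentiation its product still has a vanishing off-diagonal factor.\<close>

lemma has_derivative_det:
  fixes f :: "'a::real_normed_vector \<Rightarrow> real ^ 'n ^ 'n"
  assumes "(f has_derivative f') (at x)" "B ** f x = mat 1"
  shows "((\<lambda>y. det (f y)) has_derivative (\<lambda>v. det (f x) * trace (B ** f' v))) (at x)"
proof -
  have 1: "((\<lambda>y. det (g y)) has_derivative (\<lambda>v. trace (g' v))) (at x)"
    if g: "(g has_derivative g') (at x)" "g x = mat 1" for g :: "'a \<Rightarrow> real ^ 'n ^ 'n" and g'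
  proof -
    have nth: "((\<lambda>y. g y $ i $ j) has_derivative (\<lambda>v. g' v $ i $ j)) (at x)" for i j
      using bounded_linear.has_derivative[OF bounded_linear_vec_nth
          bounded_linear.has_derivative[OF bounded_linear_vec_nth g(1), of i], of j] .
    let ?P = "{p. p permutes (UNIV :: 'n set)}"
    have "((\<lambda>y. det (g y)) has_derivative
        (\<lambda>v. \<Sum>p\<in>?P. of_int (sign p) * (\<Sum>i\<in>UNIV. g' v $ i $ p i * (\<Prod>j\<in>UNIV - {i}. g x $ j $ p j)))) (at x)"
      unfolding det_def by (intro has_derivative_sum has_derivative_mult_right has_derivative_prod nth)
    moreover have "of_int (sign p) * (\<Sum>i\<in>UNIV. g' v $ i $ p i * (\<Prod>j\<in>UNIV - {i}. g x $ j $ p j))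
        = (if p = id then trace (g' v) else 0)" if "p \<in> ?P" for p v
    proof (cases "p = id")
      case True
      then show ?thesis by (simp add: g(2) mat_def trace_def sign_id)
    next
      case False
      have "(\<Prod>j\<in>UNIV - {i}. g x $ j $ p j) = 0" for i
      proof -
        have "\<exists>j. j \<noteq> i \<and> p j \<noteq> j"
        proof (rule ccontr)
          assume n: "\<nexists>j. j \<noteq> i \<and> p j \<noteq> j"
          then have "p i = i"
            using that permutes_inj[of p UNIV] by (metis injD mem_Collect_eq)
          then show False using n False by (metis eq_id_iff)
        qed
        then obtain j where j: "j \<noteq> i" "p j \<noteq> j" by blast
        then have "g x $ j $ p j = 0"
          by (simp add: g(2) mat_def)
        with j(1) show ?thesis by (intro prod_zero) auto
      qed
      then show ?thesis
        using False by (simp only: mult_zero_right sum.neutral_const if_False)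
    qed
    then have "(\<Sum>p\<in>?P. of_int (sign p) * (\<Sum>i\<in>UNIV. g' v $ i $ p i * (\<Prod>j\<in>UNIV - {i}. g x $ j $ p j)))
        = (\<Sum>p\<in>?P. if p = id then trace (g' v) else 0)" for v
      by (intro sum.cong) auto
    ultimately show ?thesis
      by (simp only: sum.delta finite_permutations[OF finite] mem_Collect_eq permutes_id if_True)
  qed
  have "((\<lambda>y. det (B ** f y)) has_derivative (\<lambda>v. trace (B ** f' v))) (at x)"
    by (rule 1[OF bounded_linear.has_derivative[OF bounded_bilinear.bounded_linear_right[OF bounded_bilinear_matrix_mult] assms(1)] assms(2)])
  then have "((\<lambda>y. det (f x) * det (B ** f y)) has_derivative (\<lambda>v. det (f x) * trace (B ** f' v))) (at x)"
    by (intro has_derivative_mult_right)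
  moreover have "det (f x) * det (B ** A) = det A" for A
    using arg_cong[OF assms(2), of det] by (simp add: det_mul det_I mult.commute mult.left_commute)
  ultimately show ?thesis by simp
qed

lemma integrable_continuous_compact:
  fixes f :: "'a::euclidean_space \<Rightarrow> 'b::{banach, second_countable_topology}"
  assumes "continuous_on UNIV f" "compact K" "\<And>y. y \<notin> K \<Longrightarrow> f y = 0"
  shows "integrable lborel f"
proof -
  have "integrable lborel (\<lambda>x. indicator K x *\<^sub>R f x)"
    using assms by (intro borel_integrable_compact continuous_on_subset[OF assms(1)]) auto
  moreover have "(\<lambda>x. indicator K x *\<^sub>R f x) = f"
    using assms(3) by (auto simp: indicator_def fun_eq_iff)
  ultimately show ?thesis by simp
qed

text \<open>The set where \<open>f\<close> is nonzero is open and a null set, hence empty.\<close>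

lemma integral_nonneg_continuous_eq_0:
  fixes f :: "'a::euclidean_space \<Rightarrow> real"
  assumes "continuous_on UNIV f" "integrable lborel f" "\<And>y. f y \<ge> 0" "integral\<^sup>L lborel f = 0"
  shows "f x = 0"
proof (rule ccontr)
  assume "f x \<noteq> 0"
  have o: "open {y. f y \<noteq> 0}"
    using assms(1) by (intro open_Collect_neq) (auto intro: continuous_on_const)
  have "AE y in lborel. f y = 0"
    using assms integral_nonneg_eq_0_iff_AE[OF assms(2)] by simp
  then have "{y. f y \<noteq> 0} \<in> null_sets lborel"
    using o by (subst (asm) AE_iff_null_sets[symmetric, where N="{y. f y \<noteq> 0}", simplified]) (auto simp: eventually_mono)
  then have "negligible {y. f y \<noteq> 0}"
    by (simp add: negligible_iff_null_sets null_sets_completionI)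
  then show False
    using open_not_negligible[OF o] \<open>f x \<noteq> 0\<close> by auto
qed

lemma integral_translation:
  fixes f :: "'a::euclidean_space \<Rightarrow> 'b::{banach, second_countable_topology}"
  assumes "f \<in> borel_measurable borel"
  shows "integral\<^sup>L lborel (\<lambda>y. f (y + c)) = integral\<^sup>L lborel f"
proof -
  have "integral\<^sup>L (distr lborel borel ((+) c)) f = integral\<^sup>L lborel (\<lambda>y. f (c + y))"
    using assms by (intro integral_distr) auto
  then show ?thesis
    by (simp add: lborel_distr_plus add.commute)
qed

text \<open>By translation invariance the integrals of the difference quotients vanish.\<close>

lemma integral_frechet_derivative_eq_0:
  fixes G :: "'a::euclidean_space \<Rightarrow> 'b::euclidean_space"
  assumes G: "smooth_on G UNIV" and K: "compact K" "\<And>y. y \<notin> K \<Longrightarrow> G y = 0"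
  shows "integral\<^sup>L lborel (\<lambda>y. frechet_derivative G (at y) v) = 0"
proof -
  define D where "D y = frechet_derivative G (at y)" for y
  have der: "(G has_derivative D y) (at y)" for y
    unfolding D_def using smooth_on_imp_differentiable_at[OF G open_UNIV UNIV_I] by (simp add: frechet_derivative_works)
  have cG: "continuous_on UNIV G" and cD: "continuous_on UNIV (\<lambda>y. D y v)"
    unfolding D_def by (intro smooth_on_imp_continuous_on smooth_on_frechet_derivative G)+
  have D0: "D y v = 0" if "y \<notin> K" for y
  proof -
    have "frechet_derivative G (at y) = frechet_derivative (\<lambda>y. 0) (at y)"
      by (rule frechet_derivative_cong_open[of "- K"]) (use that K compact_imp_closed in auto)
    then show ?thesis by (simp add: D_def frechet_derivative_const)
  qed
  obtain B where B: "\<And>y. norm (D y v) \<le> B" "B \<ge> 0"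
  proof -
    have "bounded ((\<lambda>y. D y v) ` K)"
      by (intro compact_imp_bounded compact_continuous_image continuous_on_subset[OF cD] K) auto
    then obtain B where "\<And>y. y \<in> K \<Longrightarrow> norm (D y v) \<le> B"
      by (auto simp: bounded_iff)
    then have "norm (D y v) \<le> max B 0" for y
      using D0[of y] by (cases "y \<in> K") (auto simp: max.coboundedI1)
    then show ?thesis by (rule that) simp
  qed
  obtain R where R: "\<And>y. y \<in> K \<Longrightarrow> norm y \<le> R"
    using compact_imp_bounded[OF K(1)] by (auto simp: bounded_iff)
  define t where "t n = inverse (real (Suc n))" for n
  have t: "t n > 0" "t n \<le> 1" for n
    by (auto simp: t_def field_simps)
  define s where "s n y = (1 / t n) *\<^sub>R (G (y + t n *\<^sub>R v) - G y)" for n y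
  have iG: "integrable lborel G"
    by (rule integrable_continuous_compact[OF cG K])
  have mG: "G \<in> borel_measurable borel"
    by (rule borel_measurable_continuous_onI[OF cG])
  have int_s: "integral\<^sup>L lborel (s n) = 0" for n
  proof -
    have "compact ((\<lambda>y. y - t n *\<^sub>R v) ` K)"
      by (intro compact_continuous_image K continuous_intros)
    moreover have "G (y + t n *\<^sub>R v) = 0" if "y \<notin> (\<lambda>y. y - t n *\<^sub>R v) ` K" for y
      using that by (intro K(2)) (metis add_diff_cancel image_eqI)
    ultimately have "integrable lborel (\<lambda>y. G (y + t n *\<^sub>R v))"
      by (intro integrable_continuous_compact) (auto intro!: continuous_on_compose2[OF cG] continuous_intros)
    then show ?thesis
      unfolding s_def by (simp add: iG integral_translation[OF mG])
  qed
  have ptw: "(\<lambda>n. s n y) \<longlonglongrightarrow> D y v" for y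
  proof (cases "v = 0")
    case True
    then show ?thesis
      using linear_0[OF has_derivative_linear[OF der[of y]]] by (simp add: s_def)
  next
    case False
    have t0: "t \<longlonglongrightarrow> 0"
      unfolding t_def by (rule LIMSEQ_inverse_real_of_nat)
    have "(\<lambda>n. norm (G (y + t n *\<^sub>R v) - G y - D y (t n *\<^sub>R v)) / norm (t n *\<^sub>R v)) \<longlonglongrightarrow> 0"
    proof (rule filterlim_compose[where g="\<lambda>h. norm (G (y + h) - G y - D y h) / norm h" and f="\<lambda>n. t n *\<^sub>R v"])
      show "((\<lambda>h. norm (G (y + h) - G y - D y h) / norm h) \<longlongrightarrow> 0) (at 0)"
        using der[of y] by (simp add: has_derivative_at)
      have "(\<lambda>n. t n *\<^sub>R v) \<longlonglongrightarrow> 0"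
        using tendsto_scaleR[OF t0 tendsto_const, of v] by simp
      then show "filterlim (\<lambda>n. t n *\<^sub>R v) (at 0) sequentially"
        using t(1) False by (simp add: filterlim_at less_imp_neq[symmetric])
    qed
    from tendsto_mult_left[OF this, of "norm v"]
    have "(\<lambda>n. norm v * (norm (G (y + t n *\<^sub>R v) - G y - D y (t n *\<^sub>R v)) / norm (t n *\<^sub>R v))) \<longlonglongrightarrow> 0"
      by simp
    moreover have "norm v * (norm (G (y + t n *\<^sub>R v) - G y - D y (t n *\<^sub>R v)) / norm (t n *\<^sub>R v)) = norm (s n y - D y v)" for n
    proof -
      have "s n y - D y v = (1 / t n) *\<^sub>R (G (y + t n *\<^sub>R v) - G y - D y (t n *\<^sub>R v))"
        using t(1)[of n] by (simp add: s_def linear_scale[OF has_derivative_linear[OF der]] scaleR_diff_right)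
      then show ?thesis
        using False t(1)[of n] by simp
    qed
    ultimately have "(\<lambda>n. norm (s n y - D y v)) \<longlonglongrightarrow> 0"
      by simp
    then show ?thesis
      by (rule LIM_zero_cancel[OF tendsto_norm_zero_cancel])
  qed
  \<comment> \<open>The mean value theorem bounds the difference quotients by \<open>B\<close>; as
    \<open>t n \<le> 1\<close>, they vanish off a ball whose radius exceeds that of the support by
    \<open>norm v\<close>.\<close>
  have bound: "norm (s n y) \<le> indicator (cball 0 (R + norm v)) y * B" for n y
  proof (cases "y \<in> cball 0 (R + norm v)")
    case True
    have "((\<lambda>r. G (y + r *\<^sub>R v)) has_derivative (\<lambda>h. D (y + r *\<^sub>R v) (h *\<^sub>R v))) (at r)" for r
    proof -
      have "((\<lambda>r. y + r *\<^sub>R v) has_derivative (\<lambda>h. h *\<^sub>R v)) (at r)"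
        by (auto intro!: derivative_eq_intros)
      then show ?thesis
        by (rule has_derivative_compose[OF _ der])
    qed
    then have "\<exists>r\<in>{0<..<t n}. norm (G (y + t n *\<^sub>R v) - G (y + 0 *\<^sub>R v)) \<le> norm (D (y + r *\<^sub>R v) ((t n - 0) *\<^sub>R v))"
      by (intro mvt_general[OF t(1)[of n], of "\<lambda>r. G (y + r *\<^sub>R v)" "\<lambda>r h. D (y + r *\<^sub>R v) (h *\<^sub>R v)"]
          continuous_on_compose2[OF cG] continuous_intros) auto
    then obtain r where "norm (G (y + t n *\<^sub>R v) - G (y + 0 *\<^sub>R v)) \<le> norm (D (y + r *\<^sub>R v) ((t n - 0) *\<^sub>R v))"
      by blast
    then have "norm (G (y + t n *\<^sub>R v) - G y) \<le> t n * norm (D (y + r *\<^sub>R v) v)"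
      using t(1)[of n] by (simp add: linear_scale[OF has_derivative_linear[OF der]])
    also have "\<dots> \<le> t n * B"
      using t(1)[of n] B(1) by (intro mult_left_mono) auto
    finally have "norm (s n y) \<le> B"
      unfolding s_def norm_scaleR using t(1)[of n] by (simp add: field_simps)
    then show ?thesis
      using True by simp
  next
    case False
    have "norm y \<le> norm (y + t n *\<^sub>R v) + norm v"
    proof -
      have "norm y \<le> norm (y + t n *\<^sub>R v) + norm (t n *\<^sub>R v)"
        using norm_triangle_ineq4[of "y + t n *\<^sub>R v" "t n *\<^sub>R v"] by simp
      moreover have "norm (t n *\<^sub>R v) \<le> norm v"
        using t[of n] mult_right_mono[of "t n" 1 "norm v"] by simp
      ultimately show ?thesis by linarith
    qed
    then have "y \<notin> K" "y + t n *\<^sub>R v \<notin> K"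
      using False R[of y] R[of "y + t n *\<^sub>R v"] norm_ge_zero[of v] by (auto simp del: norm_ge_zero)
    then show ?thesis
      using False K(2) by (simp add: s_def)
  qed
  have "(\<lambda>n. integral\<^sup>L lborel (s n)) \<longlonglongrightarrow> integral\<^sup>L lborel (\<lambda>y. D y v)"
  proof (rule integral_dominated_convergence)
    show "integrable lborel (\<lambda>y. indicator (cball 0 (R + norm v)) y * B :: real)"
      by (intro integrable_mult_left integrable_real_indicator) (use emeasure_bounded_finite[OF bounded_cball] in \<open>simp_all add: infinity_ennreal_def\<close>)
    show "(\<lambda>y. D y v) \<in> borel_measurable lborel"
      using borel_measurable_continuous_onI[OF cD] by simp
    have "continuous_on UNIV (s n)" for n
      unfolding s_def by (intro continuous_intros continuous_on_compose2[OF cG]) auto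
    then show "s n \<in> borel_measurable lborel" for n
      using borel_measurable_continuous_onI[of "s n"] by simp
  qed (use ptw bound in auto)
  then have "integral\<^sup>L lborel (\<lambda>y. D y v) = 0"
    unfolding int_s using LIMSEQ_unique tendsto_const by metis
  then show ?thesis
    by (simp add: D_def)
qed

section \<open>Cutoffs, the volume density and integrals in a single chart\<close>

section \<open>Integration over the manifold\<close>

context smooth_mfd
begin

definition zero_ext :: "'i \<Rightarrow> ('m \<Rightarrow> 'b::real_normed_vector) \<Rightarrow> real ^ 'n \<Rightarrow> 'b" where
  "zero_ext i f y = (if y \<in> chart M i ` patch M i then f (parm M i y) else 0)"

lemma continuous_chart: "continuous_on (patch M i) (chart M i)"
  using homeo[of i] by (simp add: homeomorphism_def)

lemma continuous_parm: "continuous_on (chart M i ` patch M i) (parm M i)"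
  using homeo[of i] by (simp add: homeomorphism_def)

lemma compact_chart_image: "compact K \<Longrightarrow> K \<subseteq> patch M i \<Longrightarrow> compact (chart M i ` K)"
  using compact_continuous_image continuous_on_subset[OF continuous_chart] by blast

lemma zero_ext_outside:
  assumes "K \<subseteq> patch M i" "\<And>x. x \<in> patch M i \<Longrightarrow> x \<notin> K \<Longrightarrow> f x = 0" "y \<notin> chart M i ` K"
  shows "zero_ext i f y = 0"
  using assms unfolding zero_ext_def by (auto simp: parm_chart) (metis imageI)

text \<open>The chart image and the complement of the compact image of \<open>K\<close> form an open
  cover on whose overlap the function is zero.\<close>

lemma smooth_zero_ext:
  assumes "sm i f (patch M i)" "compact K" "K \<subseteq> patch M i" "\<And>x. x \<in> patch M i \<Longrightarrow> x \<notin> K \<Longrightarrow> f x = 0"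
  shows "smooth_on (zero_ext i f) UNIV"
proof -
  let ?U = "chart M i ` patch M i" let ?V = "- chart M i ` K"
  have "smooth_on (\<lambda>y. if y \<in> ?U then f (parm M i y) else 0) (?U \<union> ?V)"
  proof (rule smooth_on_cases_open)
    show "open ?U" by (rule ok_image[OF ok_patch])
    show "open ?V" using compact_imp_closed[OF compact_chart_image[OF assms(2,3)]] by auto
    show "smooth_on (\<lambda>y. f (parm M i y)) ?U" using assms(1) by (simp add: sm_iff)
    show "smooth_on (\<lambda>y. 0) ?V" by (rule smooth_on_const)
    show "f (parm M i y) = 0" if "y \<in> ?U" "y \<in> ?V" for y
      using that assms(4) by (auto simp: parm_chart) (metis imageI)
  qed
  moreover have "?U \<union> ?V = UNIV"
    using assms(3) by auto
  ultimately show ?thesis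
    by (simp add: zero_ext_def[abs_def])
qed

lemma sm_Un:
  assumes "ok j V" "ok j W" "sm j f V" "sm j f W"
  shows "sm j f (V \<union> W)"
  using assms(3,4) unfolding sm_iff image_Un by (rule smooth_on_Un[OF ok_image[OF assms(1)] ok_image[OF assms(2)]])

text \<open>A plateau function in the chart, extended by zero. In any other chart it is smooth on
  the overlap by change of coordinates and off \<open>K\<close> because it vanishes there;
  \<open>K\<close> is closed as the space is Hausdorff.\<close>

lemma cutoff:
  assumes "x \<in> patch M i"
  shows "\<exists>\<beta> V K. open V \<and> x \<in> V \<and> compact K \<and> K \<subseteq> patch M i \<and> (\<forall>j. sm j \<beta> (patch M j)) \<and>
    (\<forall>y. \<beta> y \<ge> 0) \<and> (\<forall>y\<in>V. \<beta> y = (1 :: real)) \<and> (\<forall>y. y \<notin> K \<longrightarrow> \<beta> y = 0)"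
proof -
  let ?U = "chart M i ` patch M i" let ?a = "chart M i x"
  obtain e where e: "e > 0" "cball ?a e \<subseteq> ?U"
    using ok_image[OF ok_patch] assms open_contains_cball by blast
  define r where "r = e / 2"
  have r: "r > 0" "2 * r = e" using e by (simp_all add: r_def)
  define \<beta> where "\<beta> y = (if y \<in> patch M i then plateau ?a r (chart M i y) else 0)" for y
  define V where "V = patch M i \<inter> chart M i -` ball ?a r"
  define K where "K = parm M i ` cball ?a e"
  have "open V"
    unfolding V_def by (rule continuous_open_preimage[OF continuous_chart open_patch open_ball])
  moreover have K: "compact K" "K \<subseteq> patch M i"
    unfolding K_def using e(2) parm_chart
    by (auto intro!: compact_continuous_image continuous_on_subset[OF continuous_parm])
  moreover have \<beta>0: "\<beta> y = 0" if "y \<notin> K" for y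
  proof (cases "y \<in> patch M i")
    case True
    then have "chart M i y \<notin> cball ?a e"
      using that parm_chart[OF True] unfolding K_def by force
    then show ?thesis
      using r by (simp add: \<beta>_def plateau(4))
  qed (simp add: \<beta>_def)
  moreover have "sm j \<beta> (patch M j)" for j
  proof -
    have "closed K" by (rule compact_imp_closed[OF K(1)])
    have ok: "ok j (patch M j \<inter> patch M i)" "ok j (patch M j - K)"
      using open_patch \<open>closed K\<close> by (auto simp: ok_def)
    have "sm i (\<lambda>y. plateau ?a r (chart M i y)) (patch M j \<inter> patch M i)"
      unfolding sm_iff
      by (rule smooth_on_cong[OF ok_image[OF ok_Int(2)] _ smooth_on_subset[OF plateau(1)[OF r(1), of ?a]]]) (auto simp: parm_chart)
    then have "sm i \<beta> (patch M j \<inter> patch M i)"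
      by (rule sm_cong[OF ok_Int(2)]) (simp add: \<beta>_def)
    then have 1: "sm j \<beta> (patch M j \<inter> patch M i)"
      by (rule sm_change) (use ok in \<open>auto simp: ok_def\<close>)
    have 2: "sm j \<beta> (patch M j - K)"
      by (rule sm_cong[OF ok(2) sm_const[where c=0]]) (simp add: \<beta>0)
    have "patch M j = (patch M j \<inter> patch M i) \<union> (patch M j - K)"
      using K(2) by auto
    then show ?thesis
      using sm_Un[OF ok 1 2] by simp
  qed
  moreover have "\<beta> y \<ge> 0" for y
    using plateau(2)[OF r(1), of ?a] by (simp add: \<beta>_def)
  moreover have "\<beta> y = 1" if "y \<in> V" for y
    using that plateau(3)[OF r(1), of ?a] by (simp add: \<beta>_def V_def)
  ultimately show ?thesis
    using assms r by (intro exI[of _ \<beta>] exI[of _ V] exI[of _ K]) (auto simp: V_def)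
qed

lemma sm_prod:
  fixes f :: "'a \<Rightarrow> 'm \<Rightarrow> real"
  assumes "ok i W" "\<And>a. a \<in> A \<Longrightarrow> sm i (f a) W"
  shows "sm i (\<lambda>x. \<Prod>a\<in>A. f a x) W"
  using assms(2) by (induction A rule: infinite_finite_induct)
    (auto intro!: sm_const sm_bilinear[OF assms(1) bounded_bilinear_mult])

lemma sm_det:
  fixes A :: "'m \<Rightarrow> real ^ 'k ^ 'k"
  assumes "ok i W" "sm i A W"
  shows "sm i (\<lambda>x. det (A x)) W"
  unfolding det_def
  by (intro sm_sum assms sm_linear[OF _ bounded_linear_mult_right] sm_prod sm_nth)

end

context spin_mfd
begin

text \<open>Taking determinants in \<open>E\<^sup>T g E = 1\<close> exhibits \<open>det g\<close> as
  the reciprocal of a square.\<close>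

lemma det_gm: "x \<in> patch M i \<Longrightarrow> det (gm i x) > 0"
proof -
  assume "x \<in> patch M i"
  then have "det (gm i x) * (det (fr i x))\<^sup>2 = 1"
    using arg_cong[OF fr_orth, of x i det] by (simp add: det_mul det_I power2_eq_square mult_ac)
  then show ?thesis
    by (metis zero_less_one zero_less_mult_pos2 zero_le_power2 mult_not_zero less_eq_real_def zero_neq_one)
qed

definition vol :: "'i \<Rightarrow> 'm \<Rightarrow> real" where
  "vol i x = sqrt (det (gm i x))"

lemma sm_vol: "sm i (vol i) (patch M i)"
proof -
  have "sm i (\<lambda>x. det (gm i x)) (patch M i)"
    by (intro sm_det ok_patch sm_gm)
  then show ?thesis
    unfolding sm_iff vol_def[abs_def]
    by (rule smooth_on_compose[OF ok_image[OF ok_patch] _ _ smooth_on_sqrt, rotated -1])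
      (auto simp: det_gm parm_chart)
qed

text \<open>By Jacobi's formula and \<open>chm_metric\<close>, the logarithmic derivative of
  \<open>det g\<close> is twice the trace of the Christoffel matrix; the square root halves
  it.\<close>

lemma dd_vol:
  assumes "x \<in> patch M i"
  shows "dd i (vol i) x v = vol i x * trace (chm i x v)"
proof (rule dd_eqI)
  let ?g = "gm i x" let ?y = "chart M i x"
  have inv: "matrix_inv ?g ** ?g = mat 1"
    using fr_inv[OF assms] by simp
  have tr: "trace (matrix_inv ?g ** dd i (gm i) x v) = 2 * trace (chm i x v)" for v
  proof -
    have "trace (matrix_inv ?g ** (transpose (chm i x v) ** ?g)) = trace (transpose (chm i x v) ** ?g ** matrix_inv ?g)"
      by (rule trace_mul_sym)
    also have "\<dots> = trace (chm i x v)"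
      using inv by (simp add: matrix_left_right_inverse flip: matrix_mul_assoc) (simp add: trace_def transpose_def)
    finally show ?thesis
      by (simp add: chm_metric[OF assms] matalg trace_add) (simp add: matrix_mul_assoc inv)
  qed
  have "((\<lambda>y. det (gm i (parm M i y))) has_derivative (\<lambda>v. det ?g * trace (matrix_inv ?g ** dd i (gm i) x v))) (at ?y)"
    using has_derivative_det[OF sm_has_derivative[OF ok_patch sm_gm assms], of "matrix_inv ?g"] inv
    by (simp add: parm_chart[OF assms])
  then have d: "((\<lambda>y. det (gm i (parm M i y))) has_derivative (\<lambda>v. 2 * det ?g * trace (chm i x v))) (at ?y)"
    unfolding tr by (simp add: mult_ac)
  have "((\<lambda>y. sqrt (det (gm i (parm M i y)))) has_derivative (\<lambda>v. (2 * det ?g * trace (chm i x v)) * (inverse (sqrt (det ?g)) / 2))) (at ?y)"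
    using has_derivative_real_sqrt[OF _ d] det_gm[OF assms] by (simp add: parm_chart[OF assms])
  moreover have "(2 * det ?g * t) * (inverse (sqrt (det ?g)) / 2) = vol i x * t" for t
    using det_gm[OF assms] by (simp add: vol_def field_simps)
  then have "(\<lambda>v. (2 * det ?g * trace (chm i x v)) * (inverse (sqrt (det ?g)) / 2)) = (\<lambda>v. vol i x * trace (chm i x v))"
    by (intro ext)
  ultimately show "((\<lambda>y. vol i (parm M i y)) has_derivative (\<lambda>v. vol i x * trace (chm i x v))) (at ?y)"
    unfolding vol_def by simp
qed

text \<open>The transition maps are unitary, so the patch chosen in \<open>pt_herm\<close> does not
  matter.\<close>

lemma pt_herm_eq:
  assumes "\<psi> \<in> sections M V" "\<phi> \<in> sections M V'" "x \<in> patch M i"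
  shows "pt_herm M p \<psi> \<phi> x = herm p (\<psi> i x) (\<phi> i x)"
proof -
  define j where "j = (SOME i. x \<in> patch M i)"
  have j: "x \<in> patch M j"
    unfolding j_def using assms(3) by (rule someI[of "\<lambda>i. x \<in> patch M i"])
  note s = sectionsD(4)[OF assms(1)] and t = sectionsD(4)[OF assms(2)]
  show ?thesis
    unfolding pt_herm_def j_def[symmetric] Let_def s[OF assms(3) j] t[OF assms(3) j]
    by (rule herm_rho[OF lf_spin[OF assms(3) j]])
qed

lemma sections_cutoff:
  assumes "\<psi> \<in> sections M V" "\<And>j. sm j \<beta> (patch M j)" "\<And>r u. u \<in> V \<Longrightarrow> (\<lambda>I. r *\<^sub>R u I) \<in> V"
  shows "(\<lambda>i x I. \<beta> x *\<^sub>R \<psi> i x I) \<in> sections M V"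
proof (rule sectionsI)
  note s = sectionsD[OF assms(1)]
  show "(\<lambda>I. \<beta> x *\<^sub>R \<psi> i x I) = (\<lambda>I. 0)" if "x \<notin> patch M i" for i x
    by (simp add: s(1)[OF that])
  show "(\<lambda>I. \<beta> x *\<^sub>R \<psi> i x I) \<in> V" if "x \<in> patch M i" for i x
    by (rule assms(3)[OF s(2)[OF that]])
  show "smc i (\<lambda>x I. \<beta> x *\<^sub>R \<psi> i x I) (patch M i)" for i
    by (intro smcI sm_scaleR ok_patch assms(2) smcD[OF s(3)])
  show "\<beta> x *\<^sub>R \<psi> j x I = rho cl (lf j i x) (\<lambda>I. \<beta> x *\<^sub>R \<psi> i x I) I" if "x \<in> patch M i" "x \<in> patch M j" for i j x I
    unfolding rho_scaleR s(4)[OF that] ..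
qed

text \<open>Takes the place of a partition of unity. By compactness finitely many sets on which a
  cutoff equals \<open>1\<close> cover the support, and splitting \<open>\<psi>\<close> into
  \<open>\<beta> \<psi>\<close> and \<open>(1 - \<beta>) \<psi>\<close> eliminates one of them at a
  time.\<close>

lemma compact_support_induct:
  assumes "\<psi> \<in> sections M V" "compact_support \<psi>"
    and V: "\<And>u v. u \<in> V \<Longrightarrow> v \<in> V \<Longrightarrow> (\<lambda>I. u I + v I) \<in> V" "\<And>r u. u \<in> V \<Longrightarrow> (\<lambda>I. r *\<^sub>R u I) \<in> V"
    and loc: "\<And>\<psi> i K. \<psi> \<in> sections M V \<Longrightarrow> compact K \<Longrightarrow> K \<subseteq> patch M i \<Longrightarrow>
      (\<And>x j. x \<notin> K \<Longrightarrow> \<psi> j x = (\<lambda>I. 0)) \<Longrightarrow> P \<psi>"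
    and add: "\<And>\<psi> \<phi>. \<psi> \<in> sections M V \<Longrightarrow> \<phi> \<in> sections M V \<Longrightarrow> P \<psi> \<Longrightarrow> P \<phi> \<Longrightarrow> P (\<lambda>i x I. \<psi> i x I + \<phi> i x I)"
  shows "P \<psi>"
proof -
  obtain K where K: "compact K" "\<And>x j. x \<notin> K \<Longrightarrow> \<psi> j x = (\<lambda>I. 0)"
    using assms(2) by (auto simp: compact_support_def)
  define R where "R x i \<beta> W L \<longleftrightarrow> open W \<and> x \<in> W \<and> compact L \<and> L \<subseteq> patch M i \<and> (\<forall>j. sm j \<beta> (patch M j)) \<and>
    (\<forall>y\<in>W. \<beta> y = (1 :: real)) \<and> (\<forall>y. y \<notin> L \<longrightarrow> \<beta> y = 0)" for x i \<beta> W L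
  have "\<forall>x. \<exists>i \<beta> W L. R x i \<beta> W L"
  proof
    fix x
    obtain i where "x \<in> patch M i"
      using patch_cover by blast
    from cutoff[OF this] show "\<exists>i \<beta> W L. R x i \<beta> W L"
      unfolding R_def by blast
  qed
  then obtain i \<beta> W L where R: "\<And>x. R x (i x) (\<beta> x) (W x) (L x)"
    by metis
  have c: "open (W x)" "x \<in> W x" "compact (L x)" "L x \<subseteq> patch M (i x)"
    "sm j (\<beta> x) (patch M j)" "y \<in> W x \<Longrightarrow> \<beta> x y = 1" "y \<notin> L x \<Longrightarrow> \<beta> x y = 0" for x j y
    using R[of x] unfolding R_def by blast+
  obtain F where F: "finite F" "K \<subseteq> (\<Union>x\<in>F. W x)"
    by (rule compactE_image[OF K(1), of K W]) (use c(1,2) in auto)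
  have "P \<psi>" if "\<psi> \<in> sections M V" "\<And>x j. x \<notin> (\<Union>a\<in>F. W a) \<Longrightarrow> \<psi> j x = (\<lambda>I. 0)" for \<psi>
    using F(1) that
  proof (induction F arbitrary: \<psi>)
    \<comment> \<open>Now \<open>\<psi>\<close> vanishes identically, and the empty set is a compact
      subset of any patch.\<close>
    case empty
    show ?case
      by (rule loc[OF empty.prems(1) compact_empty empty_subsetI]) (use empty.prems(2) in auto)
  next
    case (insert a F)
    let ?\<psi>1 = "\<lambda>i x I. \<beta> a x *\<^sub>R \<psi> i x I" and ?\<psi>2 = "\<lambda>i x I. (1 + - 1 *\<^sub>R \<beta> a x) *\<^sub>R \<psi> i x I"
    have s1: "?\<psi>1 \<in> sections M V"
      by (rule sections_cutoff[OF insert.prems(1) c(5) V(2)])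
    have s2: "?\<psi>2 \<in> sections M V"
      by (rule sections_cutoff[OF insert.prems(1) _ V(2)]) (intro sm_add sm_rscale sm_const ok_patch c(5))
    have "P ?\<psi>1"
      by (rule loc[OF s1 c(3,4)[of a]]) (simp add: c(7))
    moreover have "P ?\<psi>2"
    proof (rule insert.IH[OF s2])
      fix x j assume x: "x \<notin> (\<Union>a\<in>F. W a)"
      show "?\<psi>2 j x = (\<lambda>I. 0)"
      proof (cases "x \<in> W a")
        case False
        then have "\<psi> j x = (\<lambda>I. 0)"
          using x by (intro insert.prems(2)) auto
        then show ?thesis by simp
      qed (simp add: c(6))
    qed
    ultimately have "P (\<lambda>i x I. ?\<psi>1 i x I + ?\<psi>2 i x I)"
      by (rule add[OF s1 s2])
    moreover have "(\<lambda>i x I. ?\<psi>1 i x I + ?\<psi>2 i x I) = \<psi>"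
      by (simp add: fun_eq_iff scaleR_left_diff_distrib)
    ultimately show ?case by simp
  qed
  then show ?thesis
    using assms(1) K(2) F(2) by blast
qed

end

locale spin_vol = spin_mfd M
  for M :: "('i, 'm::{t2_space, second_countable_topology}, 'n::finite, 's::finite) spin_manifold" +
  fixes \<mu> :: "'m measure"
  assumes rvol: "riemannian_volume M \<mu>"
begin

lemma sets_vol: "sets \<mu> = sets borel"
  using rvol by (simp add: riemannian_volume_def)

lemma emeasure_vol:
  "A \<in> sets borel \<Longrightarrow> A \<subseteq> patch M i \<Longrightarrow>
    emeasure \<mu> A = (\<integral>\<^sup>+ y. indicator (chart M i ` A) y * ennreal (vol i (parm M i y)) \<partial>lborel)"
  using rvol unfolding riemannian_volume_def vol_def by blast

text \<open>The volume is prescribed on measurable sets only. Pushing its restriction to the patch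
  forward along the chart gives Lebesgue measure with density \<open>vol\<close>, and the rules for
  densities and image measures carry this over to integrals.\<close>

lemma integral_patch:
  fixes f :: "'m \<Rightarrow> 'b::euclidean_space"
  assumes "sm i f (patch M i)" "compact K" "K \<subseteq> patch M i" "\<And>x. x \<notin> K \<Longrightarrow> f x = 0"
  shows "integrable \<mu> f" "integral\<^sup>L \<mu> f = integral\<^sup>L lborel (zero_ext i (\<lambda>x. vol i x *\<^sub>R f x))"
proof -
  let ?U = "patch M i" let ?C = "chart M i ` patch M i"
  \<comment> \<open>The chart, extended by \<open>0\<close> to a measurable map on the whole
    manifold; the density \<open>indicator ?U\<close> discards the additional points.\<close>
  define c where "c x = indicator ?U x *\<^sub>R chart M i x" for x
  have oC: "open ?C" by (rule ok_image[OF ok_patch])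
  have mc: "c \<in> borel_measurable borel"
    unfolding c_def[abs_def] by (intro borel_measurable_continuous_on_indicator continuous_chart) (simp add: open_patch)
  have mc': "c \<in> measurable (density \<mu> (indicator ?U)) borel"
    using mc sets_vol by (simp add: measurable_def space_density sets_eq_imp_space_eq[OF sets_vol])
  have mext: "continuous_on ?C (\<lambda>y. g (parm M i y)) \<Longrightarrow> zero_ext i g \<in> borel_measurable borel" for g :: "'m \<Rightarrow> 'c::real_normed_vector"
  proof -
    assume "continuous_on ?C (\<lambda>y. g (parm M i y))"
    then have "(\<lambda>y. indicator ?C y *\<^sub>R g (parm M i y)) \<in> borel_measurable borel"
      using oC by (intro borel_measurable_continuous_on_indicator) auto
    moreover have "(\<lambda>y. indicator ?C y *\<^sub>R g (parm M i y)) = zero_ext i g"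
      by (auto simp: zero_ext_def indicator_def fun_eq_iff)
    ultimately show ?thesis by simp
  qed
  have mw: "zero_ext i (vol i) \<in> borel_measurable borel" and mF: "zero_ext i f \<in> borel_measurable borel"
    using sm_vol assms(1) by (intro mext smooth_on_imp_continuous_on; simp add: sm_iff)+
  have w0: "zero_ext i (vol i) y \<ge> 0" for y
    using det_gm by (auto simp: zero_ext_def vol_def parm_chart less_imp_le)
  have D: "distr (density \<mu> (indicator ?U)) borel c = density lborel (\<lambda>y. ennreal (zero_ext i (vol i) y))"
  proof (rule measure_eqI)
    fix A assume "A \<in> sets (distr (density \<mu> (indicator ?U)) borel c)"
    then have A: "A \<in> sets borel" by simp
    define B where "B = ?U \<inter> c -` A"
    have B: "B \<in> sets borel"
      unfolding B_def using measurable_sets_borel[OF mc A] open_patch by auto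
    have cB: "chart M i ` B = ?C \<inter> A"
      by (auto simp: B_def c_def)
    have sp: "space \<mu> = UNIV"
      using sets_eq_imp_space_eq[OF sets_vol] by simp
    have "emeasure (distr (density \<mu> (indicator ?U)) borel c) A = emeasure (density \<mu> (indicator ?U)) (c -` A)"
      using emeasure_distr[OF mc' A] by (simp add: sp)
    also have "\<dots> = (\<integral>\<^sup>+ x. indicator ?U x * indicator (c -` A) x \<partial>\<mu>)"
      using measurable_sets_borel[OF mc A] open_patch by (intro emeasure_density) (auto simp: sets_vol measurable_cong_sets[OF sets_vol refl])
    also have "\<dots> = (\<integral>\<^sup>+ x. indicator B x \<partial>\<mu>)"
      by (intro nn_integral_cong) (auto simp: B_def indicator_def)
    also have "\<dots> = emeasure \<mu> B"
      using B by (intro nn_integral_indicator) (simp add: sets_vol)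
    also have "\<dots> = (\<integral>\<^sup>+ y. indicator (chart M i ` B) y * ennreal (vol i (parm M i y)) \<partial>lborel)"
      by (rule emeasure_vol[OF B]) (auto simp: B_def)
    also have "\<dots> = (\<integral>\<^sup>+ y. ennreal (zero_ext i (vol i) y) * indicator A y \<partial>lborel)"
      unfolding cB by (intro nn_integral_cong) (auto simp: zero_ext_def indicator_def)
    also have "\<dots> = emeasure (density lborel (\<lambda>y. ennreal (zero_ext i (vol i) y))) A"
      using mw A by (intro emeasure_density[symmetric]) auto
    finally show "emeasure (distr (density \<mu> (indicator ?U)) borel c) A = emeasure (density lborel (\<lambda>y. ennreal (zero_ext i (vol i) y))) A" .
  qed simp
  have "f x = indicator ?U x *\<^sub>R zero_ext i f (c x)" for x
    using assms(3,4) by (cases "x \<in> ?U") (auto simp: c_def zero_ext_def parm_chart)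
  then have fF: "(\<lambda>x. indicator ?U x *\<^sub>R zero_ext i f (c x)) = f"
    by (simp add: fun_eq_iff)
  have mFc: "(\<lambda>x. zero_ext i f (c x)) \<in> borel_measurable \<mu>"
    using measurable_compose[OF mc mF] by (simp add: measurable_cong_sets[OF sets_vol refl])
  have mU: "(indicator ?U :: 'm \<Rightarrow> real) \<in> borel_measurable \<mu>"
    using open_patch by (simp add: measurable_cong_sets[OF sets_vol refl])
  have ind: "density \<mu> (indicator ?U) = density \<mu> (\<lambda>x. ennreal (indicator ?U x))"
    by (intro arg_cong[where f="density \<mu>"]) (auto simp: indicator_def fun_eq_iff)
  have wF: "(\<lambda>y. zero_ext i (vol i) y *\<^sub>R zero_ext i f y) = zero_ext i (\<lambda>x. vol i x *\<^sub>R f x)"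
    by (auto simp: zero_ext_def fun_eq_iff)
  have "smooth_on (zero_ext i (\<lambda>x. vol i x *\<^sub>R f x)) UNIV"
    by (rule smooth_zero_ext[OF _ assms(2,3)]) (auto intro!: sm_scaleR ok_patch sm_vol assms(1) simp: assms(4))
  moreover have "zero_ext i (\<lambda>x. vol i x *\<^sub>R f x) y = 0" if "y \<notin> chart M i ` K" for y
    by (rule zero_ext_outside[OF assms(3) _ that]) (simp add: assms(4))
  ultimately have iF: "integrable lborel (zero_ext i (\<lambda>x. vol i x *\<^sub>R f x))"
    by (intro integrable_continuous_compact[OF _ compact_chart_image[OF assms(2,3)]] smooth_on_imp_continuous_on)
  then have "integrable (density lborel (\<lambda>y. ennreal (zero_ext i (vol i) y))) (zero_ext i f)"
    using mw mF w0 by (simp add: integrable_density wF)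
  then have "integrable (density \<mu> (indicator ?U)) (\<lambda>x. zero_ext i f (c x))"
    unfolding D[symmetric] by (simp add: integrable_distr_eq[OF mc' mF])
  then show "integrable \<mu> f"
    unfolding ind using integrable_density[OF mFc mU] by (simp add: fF)
  have "integral\<^sup>L \<mu> f = integral\<^sup>L \<mu> (\<lambda>x. indicator ?U x *\<^sub>R zero_ext i f (c x))"
    by (simp add: fF)
  also have "\<dots> = integral\<^sup>L (density \<mu> (indicator ?U)) (\<lambda>x. zero_ext i f (c x))"
    unfolding ind by (rule integral_density[OF mFc mU, symmetric]) simp
  also have "\<dots> = integral\<^sup>L (distr (density \<mu> (indicator ?U)) borel c) (zero_ext i f)"
    by (rule integral_distr[OF mc' mF, symmetric])
  also have "\<dots> = integral\<^sup>L lborel (\<lambda>y. zero_ext i (vol i) y *\<^sub>R zero_ext i f y)"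
    unfolding D using mw mF w0 by (intro integral_density) auto
  finally show "integral\<^sup>L \<mu> f = integral\<^sup>L lborel (zero_ext i (\<lambda>x. vol i x *\<^sub>R f x))"
    unfolding wF .
qed

end

section \<open>Integration by parts and uniqueness of formal adjoints\<close>

section \<open>Formal adjoints\<close>

context smooth_mfd
begin

text \<open>Extended by zero, each summand is a derivative of a compactly supported smooth function
  on Euclidean space.\<close>

lemma integral_divergence_eq_0:
  fixes Z :: "'n \<Rightarrow> 'm \<Rightarrow> 'b::euclidean_space"
  assumes Z: "\<And>a. sm i (Z a) (patch M i)" "\<And>a x. x \<in> patch M i \<Longrightarrow> x \<notin> K \<Longrightarrow> Z a x = 0"
    and K: "compact K" "K \<subseteq> patch M i"
  shows "integral\<^sup>L lborel (zero_ext i (\<lambda>x. \<Sum>a\<in>UNIV. dd i (Z a) x (axis a 1))) = 0"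
proof -
  let ?C = "chart M i ` patch M i"
  have s: "smooth_on (zero_ext i (Z a)) UNIV" for a
    by (rule smooth_zero_ext[OF Z(1) K Z(2)])
  have z: "zero_ext i (Z a) y = 0" if "y \<notin> chart M i ` K" for a y
    by (rule zero_ext_outside[OF K(2) Z(2) that])
  have cK: "compact (chart M i ` K)"
    by (rule compact_chart_image[OF K])
  have z': "frechet_derivative (zero_ext i (Z a)) (at y) v = 0" if "y \<notin> chart M i ` K" for a y v
  proof -
    have "frechet_derivative (zero_ext i (Z a)) (at y) = frechet_derivative (\<lambda>y. 0) (at y)"
      by (rule frechet_derivative_cong_open[of "- chart M i ` K"]) (use z that compact_imp_closed[OF cK] in auto)
    then show ?thesis by (simp add: frechet_derivative_const)
  qed
  have "zero_ext i (\<lambda>x. \<Sum>a\<in>UNIV. dd i (Z a) x (axis a 1)) y = (\<Sum>a\<in>UNIV. frechet_derivative (zero_ext i (Z a)) (at y) (axis a 1))" for y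
  proof (cases "y \<in> ?C")
    case True
    then obtain x where x: "x \<in> patch M i" "y = chart M i x" by auto
    have "frechet_derivative (zero_ext i (Z a)) (at y) = frechet_derivative (\<lambda>y. Z a (parm M i y)) (at y)" for a
      by (rule frechet_derivative_cong_open[OF ok_image[OF ok_patch] True]) (simp add: zero_ext_def)
    then show ?thesis
      using x by (simp add: zero_ext_def parm_chart dd_eq)
  next
    case False
    then have "y \<notin> chart M i ` K" using K(2) by auto
    then show ?thesis using False by (simp add: zero_ext_def z')
  qed
  then have "zero_ext i (\<lambda>x. \<Sum>a\<in>UNIV. dd i (Z a) x (axis a 1)) = (\<lambda>y. \<Sum>a\<in>UNIV. frechet_derivative (zero_ext i (Z a)) (at y) (axis a 1))"
    by (rule HOL.ext)
  moreover have "integrable lborel (\<lambda>y. frechet_derivative (zero_ext i (Z a)) (at y) v)" for a v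
    by (rule integrable_continuous_compact[OF smooth_on_imp_continuous_on[OF smooth_on_frechet_derivative[OF s]] cK z'])
  ultimately show ?thesis
    by (simp add: integral_frechet_derivative_eq_0[OF s cK z])
qed

end

context spin_mfd
begin

lemma sm_herm:
  assumes "ok i W" "smc i u W" "smc i v W"
  shows "sm i (\<lambda>x. herm p (u x) (v x)) W"
  unfolding herm_eq by (intro sm_sum sm_bilinear[OF _ bounded_bilinear_hs] smcD[OF assms(2)] smcD[OF assms(3)] assms(1))

lemma dd_herm:
  assumes "ok i W" "smc i u W" "smc i v W" "x \<in> W"
  shows "dd i (\<lambda>x. herm p (u x) (v x)) x w
    = herm p (u x) (\<lambda>I. dd i (\<lambda>x. v x I) x w) + herm p (\<lambda>I. dd i (\<lambda>x. u x I) x w) (v x)"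
proof -
  have "sm i (\<lambda>x. hs (u x I) (v x I)) W" for I
    by (intro sm_bilinear[OF _ bounded_bilinear_hs] smcD[OF assms(2)] smcD[OF assms(3)] assms(1))
  then show ?thesis
    unfolding herm_eq
    by (simp add: dd_sum[OF assms(1) _ assms(4)] sum.distrib
        dd_bilinear[OF assms(1) bounded_bilinear_hs smcD[OF assms(2)] smcD[OF assms(3)] assms(4)])
qed

text \<open>The connection acts by skew operators, which cancel between the two arguments except on
  the contracted index. This remainder makes the right-hand side the divergence of the vector field
  with frame components \<open>X\<close>.\<close>

lemma herm_nabla_ndiv:
  fixes \<psi> \<Phi> :: "('i, 'm, 'n, 's) field" and p :: nat
  assumes "smc i (\<psi> i) (patch M i)" "smc i (\<Phi> i) (patch M i)" "x \<in> patch M i"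
  defines "X \<equiv> \<lambda>k x. herm p (\<psi> i x) (slot k (\<Phi> i x))"
  shows "herm (Suc p) (nabla M \<psi> i x) (\<Phi> i x) + herm p (\<psi> i x) (ndiv \<Phi> i x)
    = (\<Sum>k\<in>UNIV. dd i (X k) x (frame_vec M i x k)) + (\<Sum>k\<in>UNIV. \<Sum>b\<in>UNIV. conn_form M i x k $ k $ b *\<^sub>R X b x)"
proof -
  let ?e = "frame_vec M i x" let ?w = "conn_form M i x"
  have n: "nab \<psi> i x k = (\<lambda>I. dd i (\<lambda>y. \<psi> i y I) x (?e k) + drho cl (?w k) (\<psi> i x) I)" for k
    using nab_eq[OF assms(3)] by blast
  have d: "ndiv \<Phi> i x = (\<lambda>I. \<Sum>k\<in>UNIV. (dd i (\<lambda>y. slot k (\<Phi> i y) I) x (?e k) + drho cl (?w k) (slot k (\<Phi> i x)) I)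
      + (\<Sum>b\<in>UNIV. ?w k $ k $ b *\<^sub>R slot b (\<Phi> i x) I))"
    using assms(3) by (simp add: ndiv_eq nabla_def drho_Cons fun_eq_iff add.assoc) (simp add: slot_def)
  have x: "dd i (X k) x v = herm p (\<psi> i x) (\<lambda>I. dd i (\<lambda>y. slot k (\<Phi> i y) I) x v)
      + herm p (\<lambda>I. dd i (\<lambda>y. \<psi> i y I) x v) (slot k (\<Phi> i x))" for k v
    unfolding X_def by (rule dd_herm[OF ok_patch assms(1) smc_slot[OF assms(2)] assms(3)])
  have "herm p (drho cl (?w k) (\<psi> i x)) (slot k (\<Phi> i x)) = - herm p (\<psi> i x) (drho cl (?w k) (slot k (\<Phi> i x)))" for k
    by (rule herm_drho[OF conn_form_skew[OF assms(3)]])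
  then show ?thesis
    unfolding herm_Suc n d x
    by (simp add: herm_add_left herm_add_right herm_sum_right herm_scaleR_right sum.distrib sum_negf sum_subtractf X_def)
qed

text \<open>Torsion-freeness permits the trace over either lower index of the Christoffel
  symbols.\<close>

lemma trace_chm: "x \<in> patch M i \<Longrightarrow> trace (chm i x (axis d 1)) = (\<Sum>a\<in>UNIV. chm i x (axis a 1) $ a $ d)"
  by (simp add: trace_def chm_axis christoffel_sym[of x i _ _ d])

text \<open>The derivative of the density contributes the trace of the Christoffel matrix, which
  cancels the Christoffel part in the derivative of the frame; the connection form remains.\<close>

lemma divergence_frame:
  fixes X :: "'n \<Rightarrow> 'm \<Rightarrow> complex"
  assumes X: "\<And>k. sm i (X k) (patch M i)" and x: "x \<in> patch M i"
  shows "(\<Sum>a\<in>UNIV. dd i (\<lambda>x. vol i x *\<^sub>R (\<Sum>k\<in>UNIV. fr i x $ a $ k *\<^sub>R X k x)) x (axis a 1))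
    = vol i x *\<^sub>R ((\<Sum>k\<in>UNIV. dd i (X k) x (frame_vec M i x k)) + (\<Sum>k\<in>UNIV. \<Sum>b\<in>UNIV. conn_form M i x k $ k $ b *\<^sub>R X b x))"
proof -
  let ?E = "fr i x" let ?t = "\<lambda>d. trace (chm i x (axis d 1))"
  define Y where "Y a x = (\<Sum>k\<in>UNIV. fr i x $ a $ k *\<^sub>R X k x)" for a x
  have sf: "sm i (\<lambda>y. fr i y $ a $ k) (patch M i)" for a k
    by (intro sm_nth ok_patch sm_fr)
  have sY: "sm i (Y a) (patch M i)" for a
    unfolding Y_def[abs_def] by (intro sm_sum sm_scaleR ok_patch sf X)
  have ek: "frame_vec M i x k $ a = ?E $ a $ k" for k a
    by (simp add: frame_vec_def column_def)
  have Xk: "dd i (X k) x (frame_vec M i x k) = (\<Sum>a\<in>UNIV. ?E $ a $ k *\<^sub>R dd i (X k) x (axis a 1))" for k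
    using linear_axis_expand[OF linear_dd[OF ok_patch X x], of k "frame_vec M i x k"] by (simp only: ek)
  have wk: "conn_form M i x k $ k $ b = (\<Sum>a\<in>UNIV. ?E $ a $ k * omega i x (axis a 1) $ k $ b)" for k b
    using linear_axis_expand[OF linear_omega[OF x], of "frame_vec M i x k"] by (simp add: conn_form_eq[OF x] ek)
  have dfr: "dd i (\<lambda>y. fr i y $ a $ k) x (axis a 1)
      = (\<Sum>b\<in>UNIV. ?E $ a $ b * omega i x (axis a 1) $ b $ k) - (\<Sum>d\<in>UNIV. chm i x (axis a 1) $ a $ d * ?E $ d $ k)" for a k
    by (simp add: dd_nth[OF ok_patch sm_nth[OF ok_patch sm_fr] x] dd_nth[OF ok_patch sm_fr x] fr_deriv[OF x] matrix_mult_nth)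
  have tr: "(\<Sum>a\<in>UNIV. dd i (\<lambda>y. fr i y $ a $ k) x (axis a 1))
      = (\<Sum>b\<in>UNIV. conn_form M i x b $ b $ k) - (\<Sum>d\<in>UNIV. ?t d * ?E $ d $ k)" for k
  proof -
    have "(\<Sum>a\<in>UNIV. \<Sum>d\<in>UNIV. chm i x (axis a 1) $ a $ d * ?E $ d $ k) = (\<Sum>d\<in>UNIV. ?t d * ?E $ d $ k)"
      by (subst sum.swap) (simp add: trace_chm[OF x] sum_distrib_right)
    moreover have "(\<Sum>a\<in>UNIV. \<Sum>b\<in>UNIV. ?E $ a $ b * omega i x (axis a 1) $ b $ k) = (\<Sum>b\<in>UNIV. conn_form M i x b $ b $ k)"
      unfolding wk by (rule sum.swap)
    ultimately show ?thesis
      by (simp add: dfr sum_subtractf)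
  qed
  have dY: "dd i (Y a) x v = (\<Sum>k\<in>UNIV. ?E $ a $ k *\<^sub>R dd i (X k) x v) + (\<Sum>k\<in>UNIV. dd i (\<lambda>y. fr i y $ a $ k) x v *\<^sub>R X k x)" for a v
    unfolding Y_def[abs_def]
    by (subst dd_sum[OF ok_patch sm_scaleR[OF ok_patch sf X] x]) (simp add: dd_scaleR[OF ok_patch sf X x] sum.distrib)
  have "(\<Sum>a\<in>UNIV. dd i (Y a) x (axis a 1))
      = (\<Sum>k\<in>UNIV. dd i (X k) x (frame_vec M i x k)) + (\<Sum>k\<in>UNIV. (\<Sum>a\<in>UNIV. dd i (\<lambda>y. fr i y $ a $ k) x (axis a 1)) *\<^sub>R X k x)"
    unfolding dY sum.distrib Xk scaleR_sum_left by (rule arg_cong2[of _ _ _ _ "(+)"]; rule sum.swap)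
  also have "(\<Sum>k\<in>UNIV. (\<Sum>a\<in>UNIV. dd i (\<lambda>y. fr i y $ a $ k) x (axis a 1)) *\<^sub>R X k x)
      = (\<Sum>k\<in>UNIV. \<Sum>b\<in>UNIV. conn_form M i x k $ k $ b *\<^sub>R X b x) - (\<Sum>d\<in>UNIV. ?t d *\<^sub>R Y d x)"
  proof -
    have "(\<Sum>k\<in>UNIV. (\<Sum>d\<in>UNIV. ?t d * ?E $ d $ k) *\<^sub>R X k x) = (\<Sum>d\<in>UNIV. ?t d *\<^sub>R Y d x)"
      unfolding Y_def scaleR_sum_left scaleR_sum_right by (subst sum.swap) simp
    moreover have "(\<Sum>k\<in>UNIV. (\<Sum>b\<in>UNIV. conn_form M i x b $ b $ k) *\<^sub>R X k x) = (\<Sum>k\<in>UNIV. \<Sum>b\<in>UNIV. conn_form M i x k $ k $ b *\<^sub>R X b x)"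
      unfolding scaleR_sum_left by (rule sum.swap)
    ultimately show ?thesis
      unfolding tr scaleR_left_diff_distrib sum_subtractf by simp
  qed
  finally have div: "(\<Sum>a\<in>UNIV. dd i (Y a) x (axis a 1)) + (\<Sum>d\<in>UNIV. ?t d *\<^sub>R Y d x)
      = (\<Sum>k\<in>UNIV. dd i (X k) x (frame_vec M i x k)) + (\<Sum>k\<in>UNIV. \<Sum>b\<in>UNIV. conn_form M i x k $ k $ b *\<^sub>R X b x)"
    by simp
  have "(\<Sum>a\<in>UNIV. dd i (\<lambda>x. vol i x *\<^sub>R Y a x) x (axis a 1))
      = vol i x *\<^sub>R ((\<Sum>a\<in>UNIV. dd i (Y a) x (axis a 1)) + (\<Sum>d\<in>UNIV. ?t d *\<^sub>R Y d x))"
    by (simp add: dd_scaleR[OF ok_patch sm_vol sY x] dd_vol[OF x] scaleR_add_right scaleR_sum_right sum.distrib)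
  then show ?thesis
    unfolding div unfolding Y_def .
qed

lemma nabla_support:
  assumes "closed K" "\<And>x. x \<notin> K \<Longrightarrow> \<psi> i x = (\<lambda>I. 0)" "x \<notin> K"
  shows "nabla M \<psi> i x = (\<lambda>I. 0)"
proof (cases "x \<in> patch M i")
  case True
  have ok: "ok i (patch M i - K)"
    using assms(1) open_patch by (auto simp: ok_def)
  have "dd i (\<lambda>y. \<psi> i y I) x v = dd i (\<lambda>y. 0) x v" for I v
    by (rule dd_cong[OF ok]) (use True assms in auto)
  then have "nabla M \<psi> i x J = 0" for J
    using True assms(2)[OF assms(3)] by (cases J) (simp_all add: nabla_def dd_const drho_0)
  then show ?thesis by blast
qed (simp add: nabla_outside)

lemma ndiv_support:
  assumes "closed K" "\<And>x. x \<notin> K \<Longrightarrow> \<psi> i x = (\<lambda>I. 0)" "x \<notin> K"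
  shows "ndiv \<psi> i x = (\<lambda>I. 0)"
  using nabla_support[where \<psi>=\<psi> and i=i and K=K, OF assms] by (simp add: ndiv_eq fun_eq_iff)

lemma pt_herm_simps:
  "pt_herm M p (\<lambda>i x I. \<psi> i x I + \<phi> i x I) \<xi> x = pt_herm M p \<psi> \<xi> x + pt_herm M p \<phi> \<xi> x"
  "pt_herm M p \<xi> (\<lambda>i x I. \<psi> i x I + \<phi> i x I) x = pt_herm M p \<xi> \<psi> x + pt_herm M p \<xi> \<phi> x"
  "pt_herm M p (\<lambda>i x I. r *\<^sub>R \<psi> i x I) \<xi> x = r *\<^sub>R pt_herm M p \<psi> \<xi> x"
  "pt_herm M p \<xi> (\<lambda>i x I. r *\<^sub>R \<psi> i x I) x = r *\<^sub>R pt_herm M p \<xi> \<psi> x"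
  "cnj (pt_herm M p \<psi> \<phi> x) = pt_herm M p \<phi> \<psi> x"
  by (simp_all add: pt_herm_def Let_def herm_add_left herm_add_right herm_scaleR_left herm_scaleR_right herm_cnj)

lemma pt_herm_0:
  "(\<And>i. \<psi> i x = (\<lambda>I. 0)) \<Longrightarrow> pt_herm M p \<psi> \<phi> x = 0" "(\<And>i. \<phi> i x = (\<lambda>I. 0)) \<Longrightarrow> pt_herm M p \<psi> \<phi> x = 0"
  by (simp_all add: pt_herm_def Let_def herm_0_left herm_0_right)

lemma sm_pt_herm:
  assumes "\<psi> \<in> sections M V" "\<phi> \<in> sections M V'"
  shows "sm i (pt_herm M p \<psi> \<phi>) (patch M i)"
proof -
  have "sm i (\<lambda>x. herm p (\<psi> i x) (\<phi> i x)) (patch M i)"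
    by (intro sm_herm ok_patch sectionsD(3)[OF assms(1)] sectionsD(3)[OF assms(2)])
  then show ?thesis
    by (rule sm_cong[OF ok_patch]) (simp add: pt_herm_eq[OF assms])
qed

end

context spin_vol
begin

text \<open>Integrability is included because the integral of a non-integrable function is
  \<open>0\<close> by convention, so the equation by itself would not be additive.\<close>

definition ibp :: "nat \<Rightarrow> ('i, 'm, 'n, 's) field \<Rightarrow> ('i, 'm, 'n, 's) field \<Rightarrow> bool" where
  "ibp p \<psi> \<Phi> \<longleftrightarrow> integrable \<mu> (pt_herm M (Suc p) (nabla M \<psi>) \<Phi>) \<and> integrable \<mu> (pt_herm M p \<psi> (ndiv \<Phi>)) \<and>
     L2_herm M \<mu> (Suc p) (nabla M \<psi>) \<Phi> = - L2_herm M \<mu> p \<psi> (ndiv \<Phi>)"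

lemma ibp_local:
  assumes s: "\<psi> \<in> sections M (tensors p)" "\<Phi> \<in> sections M (tensors (Suc p))"
    and K: "compact K" "K \<subseteq> patch M i"
    and supp: "(\<forall>x j. x \<notin> K \<longrightarrow> \<psi> j x = (\<lambda>I. 0)) \<or> (\<forall>x j. x \<notin> K \<longrightarrow> \<Phi> j x = (\<lambda>I. 0))"
  shows "ibp p \<psi> \<Phi>"
proof -
  let ?f = "pt_herm M (Suc p) (nabla M \<psi>) \<Phi>" let ?g = "pt_herm M p \<psi> (ndiv \<Phi>)"
  let ?X = "\<lambda>k x. herm p (\<psi> i x) (slot k (\<Phi> i x))"
  let ?Z = "\<lambda>a x. vol i x *\<^sub>R (\<Sum>k\<in>UNIV. fr i x $ a $ k *\<^sub>R ?X k x)"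
  have cK: "closed K" by (rule compact_imp_closed[OF K(1)])
  note sn = nabla_sections[OF s(1)] and sd = ndiv_sections[OF s(2)]
  note s3 = sectionsD(3)[OF s(1)] sectionsD(3)[OF s(2)]
  have sf: "sm i ?f (patch M i)" and sg: "sm i ?g (patch M i)"
    by (rule sm_pt_herm[OF sn s(2)], rule sm_pt_herm[OF s(1) sd])
  have f0: "?f x = 0" and g0: "?g x = 0" and X0: "?X k x = 0" if "x \<notin> K" for x k
  proof -
    have "(\<forall>j. \<psi> j x = (\<lambda>I. 0) \<and> nabla M \<psi> j x = (\<lambda>I. 0)) \<or> (\<forall>j. \<Phi> j x = (\<lambda>I. 0) \<and> ndiv \<Phi> j x = (\<lambda>I. 0))"
      using supp nabla_support[OF cK _ that, of \<psi>] ndiv_support[OF cK _ that, of \<Phi>] that by blast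
    then show "?f x = 0" "?g x = 0" "?X k x = 0"
      by (auto simp: pt_herm_0 herm_0_left herm_0_right slot_def)
  qed
  have sX: "sm i (?X k) (patch M i)" for k
    by (intro sm_herm ok_patch s3 smc_slot)
  note If = integral_patch[OF sf K f0] and Ig = integral_patch[OF sg K g0]
  have "integral\<^sup>L \<mu> (\<lambda>x. ?f x + ?g x) = integral\<^sup>L lborel (zero_ext i (\<lambda>x. vol i x *\<^sub>R (?f x + ?g x)))"
    by (rule integral_patch(2)[OF sm_add[OF ok_patch sf sg] K]) (simp add: f0 g0)
  also have "zero_ext i (\<lambda>x. vol i x *\<^sub>R (?f x + ?g x)) = zero_ext i (\<lambda>x. \<Sum>a\<in>UNIV. dd i (?Z a) x (axis a 1))"
  proof
    fix y
    have "vol i x *\<^sub>R (?f x + ?g x) = (\<Sum>a\<in>UNIV. dd i (?Z a) x (axis a 1))" if x: "x \<in> patch M i" for x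
      unfolding divergence_frame[OF sX x] pt_herm_eq[OF sn s(2) x] pt_herm_eq[OF s(1) sd x]
        herm_nabla_ndiv[where \<psi>=\<psi> and \<Phi>=\<Phi> and i=i, OF s3 x] ..
    then show "zero_ext i (\<lambda>x. vol i x *\<^sub>R (?f x + ?g x)) y = zero_ext i (\<lambda>x. \<Sum>a\<in>UNIV. dd i (?Z a) x (axis a 1)) y"
      by (auto simp: zero_ext_def parm_chart)
  qed
  also have "integral\<^sup>L lborel (zero_ext i (\<lambda>x. \<Sum>a\<in>UNIV. dd i (?Z a) x (axis a 1))) = 0"
    by (rule integral_divergence_eq_0[OF _ _ K])
      (auto intro!: sm_scaleR sm_sum sm_nth sX sm_vol sm_fr ok_patch simp: X0)
  finally have "integral\<^sup>L \<mu> ?f + integral\<^sup>L \<mu> ?g = 0"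
    using If(1) Ig(1) by simp
  then show ?thesis
    using If(1) Ig(1) by (simp add: ibp_def L2_herm_def eq_neg_iff_add_eq_0)
qed


lemma ibp_add:
  assumes "\<psi> \<in> sections M (tensors p)" "\<psi>' \<in> sections M (tensors p)" "ibp p \<psi> \<Phi>" "ibp p \<psi>' \<Phi>"
  shows "ibp p (\<lambda>i x I. \<psi> i x I + \<psi>' i x I) \<Phi>"
proof -
  have n: "nabla M (\<lambda>i x I. \<psi> i x I + \<psi>' i x I) = (\<lambda>i x J. nabla M \<psi> i x J + nabla M \<psi>' i x J)"
    by (intro HOL.ext nab_add[where \<psi>=\<psi> and \<phi>=\<psi>'] sectionsD(3)[OF assms(1)] sectionsD(3)[OF assms(2)])
  show ?thesis
    using assms(3,4) by (simp add: ibp_def n pt_herm_simps[abs_def] L2_herm_def)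
qed

lemma ibp_add_right:
  assumes "\<Phi> \<in> sections M (tensors (Suc p))" "\<Phi>' \<in> sections M (tensors (Suc p))" "ibp p \<psi> \<Phi>" "ibp p \<psi> \<Phi>'"
  shows "ibp p \<psi> (\<lambda>i x I. \<Phi> i x I + \<Phi>' i x I)"
proof -
  have "nabla M (\<lambda>i x I. \<Phi> i x I + \<Phi>' i x I) = (\<lambda>i x J. nabla M \<Phi> i x J + nabla M \<Phi>' i x J)"
    by (intro HOL.ext nab_add[where \<psi>=\<Phi> and \<phi>=\<Phi>'] sectionsD(3)[OF assms(1)] sectionsD(3)[OF assms(2)])
  then have n: "ndiv (\<lambda>i x I. \<Phi> i x I + \<Phi>' i x I) = (\<lambda>i x I. ndiv \<Phi> i x I + ndiv \<Phi>' i x I)"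
    by (simp add: ndiv_eq fun_eq_iff sum.distrib)
  show ?thesis
    using assms(3,4) by (simp add: ibp_def n pt_herm_simps[abs_def] L2_herm_def)
qed

text \<open>Either argument may carry the compact support: the adjoint of \<open>T^+\<close> is
  tested on the first one, the adjoint of \<open>T^-\<close> on the second.\<close>

lemma ibp:
  assumes "\<psi> \<in> sections M (tensors p)" "\<Phi> \<in> sections M (tensors (Suc p))" "compact_support \<psi> \<or> compact_support \<Phi>"
  shows "ibp p \<psi> \<Phi>"
  using assms(3)
proof
  assume c: "compact_support \<psi>"
  show ?thesis
  proof (rule compact_support_induct[OF assms(1) c tensors_add tensors_scaleR, where P="\<lambda>\<psi>. ibp p \<psi> \<Phi>"])
    show "ibp p \<psi> \<Phi>" if "\<psi> \<in> sections M (tensors p)" "compact K" "K \<subseteq> patch M i" "\<And>x j. x \<notin> K \<Longrightarrow> \<psi> j x = (\<lambda>I. 0)" for \<psi> i K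
      by (rule ibp_local[OF that(1) assms(2) that(2,3)]) (use that(4) in blast)
  qed (assumption | rule ibp_add)+
next
  assume c: "compact_support \<Phi>"
  show ?thesis
  proof (rule compact_support_induct[OF assms(2) c tensors_add tensors_scaleR, where P="ibp p \<psi>"])
    show "ibp p \<psi> \<Phi>" if "\<Phi> \<in> sections M (tensors (Suc p))" "compact K" "K \<subseteq> patch M i" "\<And>x j. x \<notin> K \<Longrightarrow> \<Phi> j x = (\<lambda>I. 0)" for \<Phi> i K
      by (rule ibp_local[OF assms(1) that(1) that(2,3)]) (use that(4) in blast)
  qed (assumption | rule ibp_add_right)+
qed

text \<open>Testing with a cutoff times the difference \<open>\<delta>\<close> gives a vanishing
  integral of \<open>\<beta>\<close> times the squared norm of \<open>\<delta>\<close>. This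
  function is continuous and nonnegative, so \<open>\<delta>\<close> is zero where
  \<open>\<beta>\<close> is \<open>1\<close>.\<close>

lemma L2_herm_eq_imp_eq:
  assumes \<xi>: "\<xi> \<in> Gam M j" "\<xi>' \<in> Gam M j"
    and L: "\<And>\<eta>. \<eta> \<in> Gam M j \<Longrightarrow> compact_support \<eta> \<Longrightarrow> L2_herm M \<mu> j \<eta> \<xi> = L2_herm M \<mu> j \<eta> \<xi>'"
  shows "\<xi> = \<xi>'"
proof (rule HOL.ext, rule HOL.ext)
  fix i x
  note \<xi>s = \<xi>[unfolded Gam_def]
  show "\<xi> i x = \<xi>' i x"
  proof (cases "x \<in> patch M i")
    case True
    define \<delta> where "\<delta> = (\<lambda>i x I. \<xi> i x I + (- 1) *\<^sub>R \<xi>' i x I)"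
    have \<delta>: "\<delta> \<in> sections M (Wfib cl j)"
      unfolding \<delta>_def by (intro sections_add sections_rscale \<xi>s Wfib_add Wfib_scaleR)
    obtain \<beta> W K where b: "x \<in> W" "compact K" "K \<subseteq> patch M i" "\<And>j. sm j \<beta> (patch M j)" "\<And>y. \<beta> y \<ge> 0"
      "\<And>y. y \<in> W \<Longrightarrow> \<beta> y = (1 :: real)" "\<And>y. y \<notin> K \<Longrightarrow> \<beta> y = 0"
      using cutoff[OF True] by blast
    define \<eta> where "\<eta> = (\<lambda>i x I. \<beta> x *\<^sub>R \<delta> i x I)"
    have \<eta>: "\<eta> \<in> sections M (Wfib cl j)"
      unfolding \<eta>_def by (rule sections_cutoff[OF \<delta> b(4) Wfib_scaleR])
    have \<eta>0: "\<eta> k y = (\<lambda>I. 0)" if "y \<notin> K" for k y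
      using that by (simp add: \<eta>_def b(7))
    have "compact_support \<eta>"
      unfolding compact_support_def using b(2) \<eta>0 by blast
    then have L2: "L2_herm M \<mu> j \<eta> \<xi> = L2_herm M \<mu> j \<eta> \<xi>'"
      using \<eta> by (intro L) (simp_all add: Gam_def)
    have p0: "pt_herm M j \<eta> \<phi> y = 0" if "y \<notin> K" for y \<phi>
      by (rule pt_herm_0(1)) (rule \<eta>0[OF that])
    have I: "integrable \<mu> (pt_herm M j \<eta> \<phi>)" if "\<phi> \<in> sections M (Wfib cl j)" for \<phi>
      using sm_pt_herm[OF \<eta> that] b(2,3) p0 by (rule integral_patch(1))
    let ?h = "pt_herm M j \<eta> \<delta>"
    have "?h = (\<lambda>y. pt_herm M j \<eta> \<xi> y - pt_herm M j \<eta> \<xi>' y)"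
      unfolding \<delta>_def by (rule HOL.ext, simp only: pt_herm_simps) simp
    then have h: "integrable \<mu> ?h" "integral\<^sup>L \<mu> ?h = 0"
      using I[OF \<xi>s(1)] I[OF \<xi>s(2)] L2 by (simp_all add: L2_herm_def)
    let ?r = "\<lambda>y. Re (?h y)"
    have hr: "?h y = of_real (\<beta> y * (\<Sum>I | length I = j. \<delta> k y I \<bullet> \<delta> k y I))" if "y \<in> patch M k" for y k
    proof -
      have "?h y = \<beta> y *\<^sub>R herm j (\<delta> k y) (\<delta> k y)"
        unfolding pt_herm_eq[OF \<eta> \<delta> that] unfolding \<eta>_def by (rule herm_scaleR_left)
      then show ?thesis
        by (simp add: herm_self scaleR_conv_of_real)
    qed
    have r: "?r y \<ge> 0" for y
    proof -
      obtain k where "y \<in> patch M k" using patch_cover by blast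
      then show ?thesis
        by (simp only: hr Re_complex_of_real) (intro mult_nonneg_nonneg b(5) sum_nonneg inner_ge_zero)
    qed
    have sr: "sm i ?r (patch M i)"
      by (intro sm_linear[OF ok_patch bounded_linear_Re] sm_pt_herm[OF \<eta> \<delta>])
    let ?g = "zero_ext i (\<lambda>y. vol i y *\<^sub>R ?r y)"
    have r0: "?r y = 0" if "y \<notin> K" for y
      using p0[OF that] by simp
    have "integral\<^sup>L lborel ?g = integral\<^sup>L \<mu> ?r"
      by (rule integral_patch(2)[OF sr b(2,3) r0, symmetric])
    also have "\<dots> = 0"
      using h by simp
    finally have g: "integral\<^sup>L lborel ?g = 0" .
    have cg: "continuous_on UNIV ?g"
      by (rule smooth_on_imp_continuous_on, rule smooth_zero_ext[OF _ b(2,3)])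
        (auto intro!: sm_mult ok_patch sm_vol sr simp: r0)
    have ig: "integrable lborel ?g"
      by (rule integrable_continuous_compact[OF cg compact_chart_image[OF b(2,3)]], rule zero_ext_outside[OF b(3)]) (auto simp: r0)
    have "?g y \<ge> 0" for y
      using det_gm r by (auto simp: zero_ext_def parm_chart vol_def less_imp_le)
    from integral_nonneg_continuous_eq_0[OF cg ig this g, of "chart M i x"]
    have "?r x = 0"
      using True det_gm[OF True] by (simp add: zero_ext_def parm_chart vol_def)
    then have "herm j (\<delta> i x) (\<delta> i x) = 0"
      using hr[OF True] b(6)[OF b(1)] by (simp add: herm_self)
    then have "\<delta> i x = (\<lambda>I. 0)"
      using herm_self_eq_0D WfibD(3) sectionsD(2)[OF \<delta> True] by blast
    then show ?thesis
      by (simp add: \<delta>_def fun_eq_iff)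
  next
    case False
    then show ?thesis
      using sectionsD(1)[OF \<xi>s(1) False] sectionsD(1)[OF \<xi>s(2) False] by simp
  qed
qed

lemma formal_adjoint_eqI:
  assumes "\<xi> \<in> Gam M j" "\<And>\<eta>. \<eta> \<in> Gam M j \<Longrightarrow> compact_support \<eta> \<Longrightarrow> L2_herm M \<mu> q (T \<eta>) \<phi> = L2_herm M \<mu> j \<eta> \<xi>"
  shows "formal_adjoint M \<mu> j q T \<phi> = \<xi>"
  unfolding formal_adjoint_def
proof (rule the_equality)
  show "\<xi> \<in> Gam M j \<and> (\<forall>\<psi>\<in>Gam M j. compact_support \<psi> \<longrightarrow> L2_herm M \<mu> q (T \<psi>) \<phi> = L2_herm M \<mu> j \<psi> \<xi>)"
    using assms by blast
  show "\<xi>' = \<xi>" if "\<xi>' \<in> Gam M j \<and> (\<forall>\<psi>\<in>Gam M j. compact_support \<psi> \<longrightarrow> L2_herm M \<mu> q (T \<psi>) \<phi> = L2_herm M \<mu> j \<psi> \<xi>')" for \<xi>'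
    using that assms by (intro L2_herm_eq_imp_eq[where j=j]) auto
qed

lemma Gam_tensors: "\<psi> \<in> Gam M j \<Longrightarrow> \<psi> \<in> sections M (tensors j)"
  unfolding Gam_def by (rule sections_mono[OF subset_trans[OF Wfib_sym0 sym0_tensors]])

lemma L2_herm_scaleR_right: "L2_herm M \<mu> p \<psi> (\<lambda>i x I. r *\<^sub>R \<phi> i x I) = r *\<^sub>R L2_herm M \<mu> p \<psi> \<phi>"
  by (simp add: L2_herm_def pt_herm_simps)

lemma L2_herm_cnj: "cnj (L2_herm M \<mu> p \<psi> \<phi>) = L2_herm M \<mu> p \<phi> \<psi>"
proof -
  have "cnj (L2_herm M \<mu> p \<psi> \<phi>) = (\<integral>x. cnj (pt_herm M p \<psi> \<phi> x) \<partial>\<mu>)"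
    unfolding L2_herm_def by (rule Bochner_Integration.integral_cnj[symmetric])
  then show ?thesis
    by (simp add: L2_herm_def pt_herm_simps)
qed

text \<open>Membership of \<open>bochner \<psi>\<close> in \<open>Gam M j\<close> is assumed here
  since its proof passes through the Lichnerowicz formula for constant curvature.\<close>

lemma rough_laplacian_eq:
  assumes "\<psi> \<in> Gam M j" "bochner \<psi> \<in> Gam M j"
  shows "rough_laplacian M \<mu> j \<psi> = bochner \<psi>"
  unfolding rough_laplacian_def
proof (rule formal_adjoint_eqI[OF assms(2)])
  fix \<eta> assume \<eta>: "\<eta> \<in> Gam M j" "compact_support \<eta>"
  have "bochner \<psi> = (\<lambda>i x I. (- 1) *\<^sub>R ndiv (nabla M \<psi>) i x I)"
    by (simp add: bochner_def)
  then show "L2_herm M \<mu> (Suc j) (nabla M \<eta>) (nabla M \<psi>) = L2_herm M \<mu> j \<eta> (bochner \<psi>)"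
    using ibp[OF Gam_tensors[OF \<eta>(1)] nabla_sections[OF Gam_tensors[OF assms(1)]]] \<eta>(2)
    by (simp only: ibp_def L2_herm_scaleR_right) simp
qed

end

section \<open>T^+ and T^- as mutual adjoints, and the Laplacian formulas\<close>

section \<open>The adjoints of the blocks\<close>

locale spin3_vol = spin3_mfd M + spin_vol M \<mu>
  for M :: "('i, 'm::{t2_space, second_countable_topology}, 'n::finite, 's::finite) spin_manifold" and \<mu> :: "'m measure"
begin

text \<open>Pairing with a section in the kernel of \<open>cliff\<close> removes both the projection
  and the \<open>clsym\<close> part of \<open>clmul_clsym\<close>. The \<open>ins\<close> part
  yields the factor \<open>-2 qcon (m + 1)\<close>, which is \<open>2 pcon\<close> by the choice of
  the constants.\<close>

lemma pt_herm_Tplus: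
  assumes "\<phi> \<in> Gam M m" "\<psi> \<in> Gam M (Suc m)"
  shows "pt_herm M (Suc m) (Tplus M m \<phi>) \<psi> x = (2 * pcon m) *\<^sub>R pt_herm M (Suc m) (nabla M \<phi>) \<psi> x"
proof -
  obtain i where i: "x \<in> patch M i"
    using patch_cover by blast
  note \<phi> = assms(1)[unfolded Gam_def] and \<psi> = assms(2)[unfolded Gam_def] and T = Tplus_Gam[OF assms(1), unfolded Gam_def]
  note w = Gam_in[OF assms(2), of i x]
  let ?D = "twisted_dirac M (emb m \<phi>) i x"
  have cw: "cliff cl (\<psi> i x) = (\<lambda>I. 0)"
    using w by (simp add: Wfib_def)
  have "herm (Suc m) (Tplus M m \<phi> i x) (\<psi> i x) = herm (Suc m) ?D (\<psi> i x)"
    unfolding Tplus_eq[OF assms(1)]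
    by (rule herm_prW[OF sym0_in[OF twisted_dirac_sections[OF emb_sections[OF assms(1)]]] w])
  also have "?D = (\<lambda>I. (- qcon m) *\<^sub>R clsym cl (clmul cl (nab \<phi> i x)) I + (- 2 * qcon m) *\<^sub>R ins I (nab \<phi> i x))"
    unfolding twisted_dirac_emb_clmul[OF assms(1) i] clmul_clsym by (simp add: scaleR_diff_right mult.commute)
  also have "herm (Suc m) \<dots> (\<psi> i x) = (- 2 * qcon m * (real m + 1)) *\<^sub>R herm (Suc m) (nabla M \<phi> i x) (\<psi> i x)"
    unfolding herm_add_left herm_scaleR_left herm_clsym[OF WfibD(2)[OF w]] cw herm_ins[OF WfibD(2)[OF w]] herm_Suc[of m "nabla M \<phi> i x"]
    by (simp add: herm_0_right add.commute)
  also have "- 2 * qcon m * (real m + 1) = 2 * pcon m"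
    using pcon_qcon(4)[of m] by (simp add: algebra_simps)
  finally show ?thesis
    by (simp only: pt_herm_eq[OF T \<psi> i] pt_herm_eq[OF nabla_sections[OF Gam_tensors[OF assms(1)]] \<psi> i])
qed

lemma L2_herm_Tplus:
  assumes "\<phi> \<in> Gam M m" "\<psi> \<in> Gam M (Suc m)" "compact_support \<phi> \<or> compact_support \<psi>"
  shows "L2_herm M \<mu> (Suc m) (Tplus M m \<phi>) \<psi> = L2_herm M \<mu> m \<phi> (Tminus M (Suc m) \<psi>)"
proof -
  have "Tminus M (Suc m) \<psi> = (\<lambda>i x I. (- (2 * pcon m)) *\<^sub>R ndiv \<psi> i x I)"
    by (intro HOL.ext) (simp add: Tminus_dvg[OF assms(2)] ndiv_def)
  then have "L2_herm M \<mu> m \<phi> (Tminus M (Suc m) \<psi>) = (- (2 * pcon m)) *\<^sub>R L2_herm M \<mu> m \<phi> (ndiv \<psi>)"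
    by (simp only: L2_herm_scaleR_right)
  moreover have "L2_herm M \<mu> (Suc m) (Tplus M m \<phi>) \<psi> = (2 * pcon m) *\<^sub>R L2_herm M \<mu> (Suc m) (nabla M \<phi>) \<psi>"
    unfolding L2_herm_def pt_herm_Tplus[OF assms(1,2)] by (rule integral_scaleR_right)
  moreover have "L2_herm M \<mu> (Suc m) (nabla M \<phi>) \<psi> = - L2_herm M \<mu> m \<phi> (ndiv \<psi>)"
    using ibp[OF Gam_tensors[OF assms(1)] Gam_tensors[OF assms(2)] assms(3)] by (simp add: ibp_def)
  ultimately show ?thesis by simp
qed

lemma Tplus_adj_eq: "\<psi> \<in> Gam M (Suc j) \<Longrightarrow> Tplus_adj M \<mu> j \<psi> = Tminus M (Suc j) \<psi>"
  unfolding Tplus_adj_def by (intro formal_adjoint_eqI Tminus_Gam L2_herm_Tplus) simp_all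

lemma Tminus_adj_eq:
  assumes "\<phi> \<in> Gam M m"
  shows "Tminus_adj M \<mu> (Suc m) \<phi> = Tplus M m \<phi>"
  unfolding Tminus_adj_def
proof (rule formal_adjoint_eqI[OF Tplus_Gam[OF assms]])
  fix \<eta> assume "\<eta> \<in> Gam M (Suc m)" "compact_support \<eta>"
  \<comment> \<open>The compactly supported test section stands in the second argument here;
    conjugate symmetry moves it to the first, as the formal adjoint requires.\<close>
  then have "cnj (L2_herm M \<mu> m \<phi> (Tminus M (Suc m) \<eta>)) = cnj (L2_herm M \<mu> (Suc m) (Tplus M m \<phi>) \<eta>)"
    using L2_herm_Tplus[OF assms] by simp
  then show "L2_herm M \<mu> (Suc m - 1) (Tminus M (Suc m) \<eta>) \<phi> = L2_herm M \<mu> (Suc m) \<eta> (Tplus M m \<phi>)"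
    by (simp add: L2_herm_cnj)
qed

text \<open>Covers \<open>j = 0\<close>, where the target degree \<open>j - 1\<close> truncates to
  \<open>0\<close> and the operator itself is zero.\<close>

lemma Tminus_adj_Zero: "Tminus_adj M \<mu> 0 (Tminus M 0 \<psi>) = (\<lambda>i x I. 0)"
  unfolding Tminus_adj_def
proof (rule formal_adjoint_eqI)
  show "(\<lambda>i x I. 0) \<in> Gam M 0"
    unfolding Gam_def by (rule sectionsI) (auto intro: Wfib_0 smcI sm_const simp: rho_def matvec_0)
  show "L2_herm M \<mu> (0 - 1) (Tminus M 0 \<eta>) (Tminus M 0 \<psi>) = L2_herm M \<mu> 0 \<eta> (\<lambda>i x I. 0)" for \<eta>
    by (simp add: L2_herm_def pt_herm_0 Tminus_def)
qed

end

locale cc3_vol = cc3_mfd M c + spin3_vol M \<mu>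
  for M :: "('i, 'm::{t2_space, second_countable_topology}, 'n::finite, 's::finite) spin_manifold"
    and c :: real and \<mu> :: "'m measure"
begin

lemma rough: "\<psi> \<in> Gam M j \<Longrightarrow> rough_laplacian M \<mu> j \<psi> = bochner \<psi>"
  by (rule rough_laplacian_eq[OF _ bochner_Gam])

lemma std_laplacian_eq: "\<psi> \<in> Gam M j \<Longrightarrow> std_laplacian M \<mu> j \<psi> = Lap j \<psi>"
  by (simp add: std_laplacian_def rough Lap_def curv_endo_eq)

lemma std_laplacian_down:
  assumes "\<psi> \<in> Gam M j"
  shows "std_laplacian M \<mu> j \<psi> i x I = Dj M j (Dj M j \<psi>) i x I + Tminus_adj M \<mu> j (Tminus M j \<psi>) i x I + lapc j *\<^sub>R \<psi> i x I"
proof (cases j)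
  case 0
  then show ?thesis
    using assms by (simp add: std_laplacian_eq Lap_Zero Tminus_adj_Zero)
next
  case (Suc m)
  note a = assms[unfolded Suc]
  show ?thesis
    unfolding Suc std_laplacian_eq[OF a] Lap_Suc[OF a] Tminus_adj_eq[OF Tminus_Gam[OF a]] by simp
qed

lemma std_laplacian_up:
  assumes "\<psi> \<in> Gam M j"
  shows "std_laplacian M \<mu> j \<psi> i x I = Tplus_adj M \<mu> j (Tplus M j \<psi>) i x I + (kap j)\<^sup>2 *\<^sub>R Dj M j (Dj M j \<psi>) i x I
    + lapc (Suc j) *\<^sub>R \<psi> i x I"
  unfolding std_laplacian_eq[OF assms] Lap_up[OF assms] Tplus_adj_eq[OF Tplus_Gam[OF assms]] ..

end

theorem corollary4:
  fixes M :: "('i, 'm::{t2_space, second_countable_topology}, 'n::finite, 's::finite) spin_manifold"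
    and \<mu> :: "'m measure" and c :: real and n j :: nat
  assumes n: "n = CARD('n)" "n \<ge> 3"
    and M: "riemannian_spin_manifold M" "constant_curvature M c"
    and \<mu>: "riemannian_volume M \<mu>"
  shows
    "(\<forall>\<psi>\<in>Gam M j. \<forall>i x I.
        std_laplacian M \<mu> j \<psi> i x I =
          rough_laplacian M \<mu> j \<psi> i x I + (1 / 2) *\<^sub>R curv_endo M \<psi> i x I \<and>
        std_laplacian M \<mu> j \<psi> i x I =
          rough_laplacian M \<mu> j \<psi> i x I
          + ((real j * (real n + real j - 1) + real n * (real n - 1) / 8) * c) *\<^sub>R \<psi> i x I \<and>
        std_laplacian M \<mu> j \<psi> i x I =
          Dj M j (Dj M j \<psi>) i x I + Tminus_adj M \<mu> j (Tminus M j \<psi>) i x I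
          + ((real j * (real n + real j - 2) - real n * (real n - 1) / 8) * c) *\<^sub>R \<psi> i x I \<and>
        std_laplacian M \<mu> j \<psi> i x I =
          Tplus_adj M \<mu> j (Tplus M j \<psi>) i x I
          + ((real n + 2 * real j - 2)\<^sup>2 / (real n + 2 * real j)\<^sup>2) *\<^sub>R Dj M j (Dj M j \<psi>) i x I
          + (((real j + 1) * (real n + real j - 1) - real n * (real n - 1) / 8) * c) *\<^sub>R \<psi> i x I) \<and>
     (j \<ge> 1 \<longrightarrow>
        (\<forall>\<psi>\<in>Gam M j. \<forall>i x I.
           Tminus M j (Dj M j \<psi>) i x I =
             ((real n + 2 * real j - 4) / (real n + 2 * real j - 2)) *\<^sub>R Dj M (j - 1) (Tminus M j \<psi>) i x I) \<and>
        (\<forall>\<phi>\<in>Gam M (j - 1). \<forall>i x I.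
           Dj M j (Tplus M (j - 1) \<phi>) i x I =
             ((real n + 2 * real j - 4) / (real n + 2 * real j - 2)) *\<^sub>R Tplus M (j - 1) (Dj M (j - 1) \<phi>) i x I) \<and>
        (\<forall>\<phi>\<in>Gam M (j - 1). Tplus M (j - 1) \<phi> = Tminus_adj M \<mu> j \<phi>)) \<and>
     (\<forall>\<psi>\<in>Gam M j. Dj M j (std_laplacian M \<mu> j \<psi>) = std_laplacian M \<mu> j (Dj M j \<psi>)) \<and>
     (j \<ge> 1 \<longrightarrow>
        (\<forall>\<psi>\<in>Gam M j.
           Tminus M j (std_laplacian M \<mu> j \<psi>) = std_laplacian M \<mu> (j - 1) (Tminus M j \<psi>)) \<and>
        (\<forall>\<phi>\<in>Gam M (j - 1).
           Tplus M (j - 1) (std_laplacian M \<mu> (j - 1) \<phi>) = std_laplacian M \<mu> j (Tplus M (j - 1) \<phi>)))"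
proof -
  interpret cc3_vol M c \<mu>
    by unfold_locales (use n M \<mu> in simp_all)
  have N: "real n = real CARD('n)"
    by (simp add: n)
  have c1: "std_laplacian M \<mu> j \<psi> i x I = rough_laplacian M \<mu> j \<psi> i x I
      + ((real j * (real n + real j - 1) + real n * (real n - 1) / 8) * c) *\<^sub>R \<psi> i x I" if "\<psi> \<in> Gam M j" for \<psi> i x I
    by (simp add: std_laplacian_eq[OF that] rough[OF that] Lap_def N)
  have c2: "std_laplacian M \<mu> j \<psi> i x I = Dj M j (Dj M j \<psi>) i x I + Tminus_adj M \<mu> j (Tminus M j \<psi>) i x I
      + ((real j * (real n + real j - 2) - real n * (real n - 1) / 8) * c) *\<^sub>R \<psi> i x I" if "\<psi> \<in> Gam M j" for \<psi> i x I
    unfolding std_laplacian_down[OF that] lapc_def N ..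
  have c3: "std_laplacian M \<mu> j \<psi> i x I = Tplus_adj M \<mu> j (Tplus M j \<psi>) i x I
      + ((real n + 2 * real j - 2)\<^sup>2 / (real n + 2 * real j)\<^sup>2) *\<^sub>R Dj M j (Dj M j \<psi>) i x I
      + (((real j + 1) * (real n + real j - 1) - real n * (real n - 1) / 8) * c) *\<^sub>R \<psi> i x I" if "\<psi> \<in> Gam M j" for \<psi> i x I
  proof -
    \<comment> \<open>The index is raised by one because the formula through \<open>T_j^+\<close>
      stems from the Dirac operator of degree \<open>j + 1\<close>.\<close>
    have "lapc (Suc j) = ((real j + 1) * (real n + real j - 1) - real n * (real n - 1) / 8) * c"
      by (simp add: lapc_def N add.commute)
    then show ?thesis
      unfolding std_laplacian_up[OF that] N power_divide by simp
  qed
  \<comment> \<open>With \<open>j = m + 1\<close>, lowering \<open>n + 2 j\<close> by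
    \<open>4\<close> and by \<open>2\<close> gives numerator and denominator of
    \<open>kap m\<close>.\<close>
  have k: "(real n + 2 * real (Suc m) - 4) / (real n + 2 * real (Suc m) - 2) = kap m" for m
    by (simp add: N)
  have c0: "std_laplacian M \<mu> j \<psi> i x I = rough_laplacian M \<mu> j \<psi> i x I + (1 / 2) *\<^sub>R curv_endo M \<psi> i x I" for \<psi> i x I
    by (simp add: std_laplacian_def)
  note L = std_laplacian_eq
  show ?thesis
  proof (intro conjI impI)
    show "\<forall>\<psi>\<in>Gam M j. \<forall>i x I.
        std_laplacian M \<mu> j \<psi> i x I =
          rough_laplacian M \<mu> j \<psi> i x I + (1 / 2) *\<^sub>R curv_endo M \<psi> i x I \<and>
        std_laplacian M \<mu> j \<psi> i x I =
          rough_laplacian M \<mu> j \<psi> i x I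
          + ((real j * (real n + real j - 1) + real n * (real n - 1) / 8) * c) *\<^sub>R \<psi> i x I \<and>
        std_laplacian M \<mu> j \<psi> i x I =
          Dj M j (Dj M j \<psi>) i x I + Tminus_adj M \<mu> j (Tminus M j \<psi>) i x I
          + ((real j * (real n + real j - 2) - real n * (real n - 1) / 8) * c) *\<^sub>R \<psi> i x I \<and>
        std_laplacian M \<mu> j \<psi> i x I =
          Tplus_adj M \<mu> j (Tplus M j \<psi>) i x I
          + ((real n + 2 * real j - 2)\<^sup>2 / (real n + 2 * real j)\<^sup>2) *\<^sub>R Dj M j (Dj M j \<psi>) i x I
          + (((real j + 1) * (real n + real j - 1) - real n * (real n - 1) / 8) * c) *\<^sub>R \<psi> i x I"
      by (intro ballI allI conjI c0 c1 c2 c3)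
    show "\<forall>\<psi>\<in>Gam M j. Dj M j (std_laplacian M \<mu> j \<psi>) = std_laplacian M \<mu> j (Dj M j \<psi>)"
      by (simp add: L Dj_Gam Dj_Lap)
  next
    assume "1 \<le> j"
    then obtain m where j: "j = Suc m"
      by (cases j) auto
    show "\<forall>\<psi>\<in>Gam M j. \<forall>i x I. Tminus M j (Dj M j \<psi>) i x I =
        ((real n + 2 * real j - 4) / (real n + 2 * real j - 2)) *\<^sub>R Dj M (j - 1) (Tminus M j \<psi>) i x I"
      unfolding j k by (simp add: dirac_blocks(2))
    show "\<forall>\<phi>\<in>Gam M (j - 1). \<forall>i x I. Dj M j (Tplus M (j - 1) \<phi>) i x I =
        ((real n + 2 * real j - 4) / (real n + 2 * real j - 2)) *\<^sub>R Tplus M (j - 1) (Dj M (j - 1) \<phi>) i x I"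
      unfolding j k by (simp add: dirac_blocks_emb(2))
    show "\<forall>\<phi>\<in>Gam M (j - 1). Tplus M (j - 1) \<phi> = Tminus_adj M \<mu> j \<phi>"
      unfolding j by (simp add: Tminus_adj_eq)
    show "\<forall>\<psi>\<in>Gam M j. Tminus M j (std_laplacian M \<mu> j \<psi>) = std_laplacian M \<mu> (j - 1) (Tminus M j \<psi>)"
      unfolding j by (simp add: L Tminus_Gam Tminus_Lap)
    show "\<forall>\<phi>\<in>Gam M (j - 1). Tplus M (j - 1) (std_laplacian M \<mu> (j - 1) \<phi>) = std_laplacian M \<mu> j (Tplus M (j - 1) \<phi>)"
      unfolding j by (simp add: L Tplus_Gam Tplus_Lap)
  qed
qed

end
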